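(* Let $A$ be a unital $C^*$-algebra, let $\alpha\colon\mathbb{T}\to\mathrm{Aut}(A)$ be a continuous action, and let $\beta\in\mathrm{Aut}(A)$ be an automorphism. (1) The action $\alpha$ has the continuous Rokhlin property if and only if the dual automorphism $\widehat{\alpha}\in\mathrm{Aut}(A\rtimes_\alpha\mathbb{T})$ is asymptotically representable. (2) The automorphism $\beta$ is asymptotically representable if and only if the dual action $\widehat{\beta}\colon\mathbb{T}\to\mathrm{Aut}(A\rtimes_\beta\mathbb{Z})$ has the continuous Rokhlin property.
   Context: Continuous Rokhlin property (for circle actions). A continuous action $\alpha\colon\mathbb{T}\to\mathrm{Aut}(A)$ on a unital $C^*$-algebra has the continuous Rokhlin property if there exists a norm-continuous path $(u_t)_{t\in[0,\infty)}$ of unitaries in $A$ with $\lim_{t\to\infty}\sup_{\zeta\in\mathbb{T}}\|\alpha_\zeta(u_t)-\zeta u_t\|=0$ and $\lim_{t\to\infty}\|u_ta-au_t\|=0$ for all $a\in A$. Asymptotic representability. An automorphism $\beta$ of a (not necessarily unital) $C^*$-algebra $B$ is asymptotically representable if there exists a norm-continuous path $(v_t)_{t\in[0,\infty)}$ of contractions in $B$ such that: $\lim_{t\to\infty}\|v_t^*v_tb-b\|=0$ for all $b\in B$; $\lim_{t\to\infty}\|v_t^*v_t-v_tv_t^*\|=0$; $\lim_{t\to\infty}\|\beta(v_t)-v_t\|=0$; and $\lim_{t\to\infty}\|\beta(b)-v_tbv_t^*\|=0$ for all $b\in B$. Dual actions. $\widehat{\alpha}\in\mathrm{Aut}(A\rtimes_\alpha\mathbb{T})$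 is determined on the dense subalgebra $L^1(\mathbb{T},A)$ by $\widehat{\alpha}(\xi)(\zeta)=\zeta\,\xi(\zeta)$, where the product and involution on $L^1(\mathbb{T},A)$ are $(\xi*\eta)(\zeta)=\int_{\mathbb{T}}\xi(\omega)\alpha_\omega(\eta(\omega^{-1}\zeta))\,d\omega$ and $\xi^*(\zeta)=\alpha_\zeta(\xi(\overline{\zeta})^* )$. If $w\in A\rtimes_\beta\mathbb{Z}$ is the canonical unitary with $waw^*=\beta(a)$, then $\widehat{\beta}_\zeta(aw^k)=\zeta^kaw^k$ for $a\in A$, $k\in\mathbb{Z}$, $\zeta\in\mathbb{T}$. *)

theory Defs
  imports "HOL-Analysis.Analysis"
begin

section \<open>C*-algebras\<close>

class cstar_algebra = real_normed_algebra + banach +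
  fixes scaleC :: "complex \<Rightarrow> 'a \<Rightarrow> 'a"
    and star :: "'a \<Rightarrow> 'a"
  assumes scaleR_scaleC: "r *\<^sub>R x = scaleC (complex_of_real r) x"
    and scaleC_add_right: "scaleC c (x + y) = scaleC c x + scaleC c y"
    and scaleC_add_left: "scaleC (c + d) x = scaleC c x + scaleC d x"
    and scaleC_scaleC: "scaleC c (scaleC d x) = scaleC (c * d) x"
    and mult_scaleC_left: "scaleC c x * y = scaleC c (x * y)"
    and mult_scaleC_right: "x * scaleC c y = scaleC c (x * y)"
    and norm_scaleC: "norm (scaleC c x) = cmod c * norm x"
    and star_add: "star (x + y) = star x + star y"
    and star_scaleC: "star (scaleC c x) = scaleC (cnj c) (star x)"
    and star_mult: "star (x * y) = star y * star x"
    and star_star: "star (star x) = x"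
    and norm_star_mult: "norm (star x * x) = (norm x)\<^sup>2"

text \<open>The zero algebra, in which \<open>1 = 0\<close>, is a unital C*-algebra here; this is why the class
  is not based on \<^class>\<open>ring_1\<close>.\<close>

class unital_cstar_algebra = cstar_algebra + monoid_mult

instantiation complex :: unital_cstar_algebra
begin
definition scaleC_complex :: "complex \<Rightarrow> complex \<Rightarrow> complex" where "scaleC_complex = (*)"
definition star_complex :: "complex \<Rightarrow> complex" where "star_complex = cnj"
instance
proof
  fix x :: complex
  show "norm (star x * x) = (norm x)\<^sup>2"
    by (simp add: star_complex_def norm_mult power2_eq_square)
qed (simp_all add: scaleC_complex_def star_complex_def algebra_simps scaleR_conv_of_real norm_mult)
end

text \<open>A crossed product depends on the action and is therefore not a type.  It is given as a
  record with an explicit carrier, and the notions that are needed both for \<open>A\<close> and for its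
  crossed products are formulated for such records.  The record is also used for the
  (semi)normed *-algebras that crossed products are completions of.\<close>

record 'b star_alg =
  carr :: "'b set"
  zer :: "'b" ("\<zero>\<index>")
  plu :: "'b \<Rightarrow> 'b \<Rightarrow> 'b" (infixl "\<boxplus>\<index>" 65)
  scal :: "complex \<Rightarrow> 'b \<Rightarrow> 'b" (infixr "\<cdot>\<index>" 75)
  mul :: "'b \<Rightarrow> 'b \<Rightarrow> 'b" (infixl "\<boxtimes>\<index>" 70)
  adj :: "'b \<Rightarrow> 'b"
  nrm :: "'b \<Rightarrow> real"

definition alg_minus :: "('b, 'm) star_alg_scheme \<Rightarrow> 'b \<Rightarrow> 'b \<Rightarrow> 'b" (infixl "\<boxminus>\<index>" 65) where
  "x \<boxminus>\<^bsub>B\<^esub> y = x \<boxplus>\<^bsub>B\<^esub> ((-1) \<cdot>\<^bsub>B\<^esub> y)"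

definition cstar_univ :: "'a::cstar_algebra star_alg" where
  "cstar_univ = \<lparr>carr = UNIV, zer = 0, plu = (+), scal = scaleC, mul = (*), adj = star, nrm = norm\<rparr>"

definition unit_of :: "'b star_alg \<Rightarrow> 'b" where
  "unit_of B = (THE e. e \<in> carr B \<and> (\<forall>x\<in>carr B. e \<boxtimes>\<^bsub>B\<^esub> x = x \<and> x \<boxtimes>\<^bsub>B\<^esub> e = x))"

definition unitary :: "'b star_alg \<Rightarrow> 'b \<Rightarrow> bool" where
  "unitary B u \<longleftrightarrow> u \<in> carr B \<and> adj B u \<boxtimes>\<^bsub>B\<^esub> u = unit_of B \<and> u \<boxtimes>\<^bsub>B\<^esub> adj B u = unit_of B"

definition star_automorphism :: "'b star_alg \<Rightarrow> ('b \<Rightarrow> 'b) \<Rightarrow> bool" where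
  "star_automorphism B \<phi> \<longleftrightarrow> bij_betw \<phi> (carr B) (carr B) \<and>
     (\<forall>x\<in>carr B. \<forall>y\<in>carr B. \<phi> (x \<boxplus>\<^bsub>B\<^esub> y) = \<phi> x \<boxplus>\<^bsub>B\<^esub> \<phi> y) \<and>
     (\<forall>c. \<forall>x\<in>carr B. \<phi> (c \<cdot>\<^bsub>B\<^esub> x) = c \<cdot>\<^bsub>B\<^esub> \<phi> x) \<and>
     (\<forall>x\<in>carr B. \<forall>y\<in>carr B. \<phi> (x \<boxtimes>\<^bsub>B\<^esub> y) = \<phi> x \<boxtimes>\<^bsub>B\<^esub> \<phi> y) \<and>
     (\<forall>x\<in>carr B. \<phi> (adj B x) = adj B (\<phi> x))"

text \<open>The group of complex numbers of modulus 1.  Functions on it are functions on \<^typ>\<open>complex\<close>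
  whose values elsewhere are irrelevant.\<close>

abbreviation circle :: "complex set" ("\<TT>") where
  "\<TT> \<equiv> sphere 0 1"

definition circle_action :: "'b star_alg \<Rightarrow> (complex \<Rightarrow> 'b \<Rightarrow> 'b) \<Rightarrow> bool" where
  "circle_action B \<alpha> \<longleftrightarrow>
     (\<forall>\<zeta>\<in>\<TT>. star_automorphism B (\<alpha> \<zeta>)) \<and>
     (\<forall>\<zeta>\<in>\<TT>. \<forall>\<omega>\<in>\<TT>. \<forall>b\<in>carr B. \<alpha> (\<zeta> * \<omega>) b = \<alpha> \<zeta> (\<alpha> \<omega> b)) \<and>
     (\<forall>b\<in>carr B. \<forall>\<zeta>\<in>\<TT>. ((\<lambda>\<omega>. nrm B (\<alpha> \<omega> b \<boxminus>\<^bsub>B\<^esub> \<alpha> \<zeta> b)) \<longlongrightarrow> 0) (at \<zeta> within \<TT>))"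

section \<open>Continuous Rokhlin property and asymptotic representability\<close>

definition norm_continuous_path :: "'b star_alg \<Rightarrow> (real \<Rightarrow> 'b) \<Rightarrow> bool" where
  "norm_continuous_path B v \<longleftrightarrow> (\<forall>t\<ge>0. v t \<in> carr B) \<and>
     (\<forall>t\<ge>0. ((\<lambda>s. nrm B (v s \<boxminus>\<^bsub>B\<^esub> v t)) \<longlongrightarrow> 0) (at t within {0..}))"

definition continuous_rokhlin_property :: "'b star_alg \<Rightarrow> (complex \<Rightarrow> 'b \<Rightarrow> 'b) \<Rightarrow> bool" where
  "continuous_rokhlin_property B \<alpha> \<longleftrightarrow> (\<exists>u. norm_continuous_path B u \<and> (\<forall>t\<ge>0. unitary B (u t)) \<and>
     ((\<lambda>t. SUP \<zeta>\<in>\<TT>. nrm B (\<alpha> \<zeta> (u t) \<boxminus>\<^bsub>B\<^esub> \<zeta> \<cdot>\<^bsub>B\<^esub> u t)) \<longlongrightarrow> 0) at_top \<and>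
     (\<forall>a\<in>carr B. ((\<lambda>t. nrm B (u t \<boxtimes>\<^bsub>B\<^esub> a \<boxminus>\<^bsub>B\<^esub> a \<boxtimes>\<^bsub>B\<^esub> u t)) \<longlongrightarrow> 0) at_top))"

definition asymptotically_representable :: "'b star_alg \<Rightarrow> ('b \<Rightarrow> 'b) \<Rightarrow> bool" where
  "asymptotically_representable B \<beta> \<longleftrightarrow> (\<exists>v. norm_continuous_path B v \<and> (\<forall>t\<ge>0. nrm B (v t) \<le> 1) \<and>
     (\<forall>b\<in>carr B. ((\<lambda>t. nrm B (adj B (v t) \<boxtimes>\<^bsub>B\<^esub> v t \<boxtimes>\<^bsub>B\<^esub> b \<boxminus>\<^bsub>B\<^esub> b)) \<longlongrightarrow> 0) at_top) \<and>
     ((\<lambda>t. nrm B (adj B (v t) \<boxtimes>\<^bsub>B\<^esub> v t \<boxminus>\<^bsub>B\<^esub> v t \<boxtimes>\<^bsub>B\<^esub> adj B (v t))) \<longlongrightarrow> 0) at_top \<and>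
     ((\<lambda>t. nrm B (\<beta> (v t) \<boxminus>\<^bsub>B\<^esub> v t)) \<longlongrightarrow> 0) at_top \<and>
     (\<forall>b\<in>carr B. ((\<lambda>t. nrm B (\<beta> b \<boxminus>\<^bsub>B\<^esub> v t \<boxtimes>\<^bsub>B\<^esub> b \<boxtimes>\<^bsub>B\<^esub> adj B (v t))) \<longlongrightarrow> 0) at_top))"

section \<open>Enveloping C*-algebra of a normed *-algebra\<close>

definition cstar_seminorm :: "'d star_alg \<Rightarrow> ('d \<Rightarrow> real) \<Rightarrow> bool" where
  "cstar_seminorm D p \<longleftrightarrow>
     (\<forall>x\<in>carr D. 0 \<le> p x) \<and>
     (\<forall>x\<in>carr D. \<forall>y\<in>carr D. p (x \<boxplus>\<^bsub>D\<^esub> y) \<le> p x + p y) \<and>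
     (\<forall>c. \<forall>x\<in>carr D. p (c \<cdot>\<^bsub>D\<^esub> x) = cmod c * p x) \<and>
     (\<forall>x\<in>carr D. \<forall>y\<in>carr D. p (x \<boxtimes>\<^bsub>D\<^esub> y) \<le> p x * p y) \<and>
     (\<forall>x\<in>carr D. p (adj D x \<boxtimes>\<^bsub>D\<^esub> x) = (p x)\<^sup>2)"

text \<open>The supremum of the seminorms \<open>x \<mapsto> \<parallel>\<pi> x\<parallel>\<close> over all contractive *-representations \<open>\<pi>\<close> of
  \<open>D\<close>.  These seminorms are exactly the C*-seminorms dominated by the given norm; quantifying over
  the latter avoids a quantification over Hilbert spaces of all types.\<close>

definition universal_norm :: "'d star_alg \<Rightarrow> 'd \<Rightarrow> real" where
  "universal_norm D x = (SUP p\<in>{p. cstar_seminorm D p \<and> (\<forall>y\<in>carr D. p y \<le> nrm D y)}. p x)"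

definition cauchy_seqs :: "'d star_alg \<Rightarrow> (nat \<Rightarrow> 'd) set" where
  "cauchy_seqs D = {f. (\<forall>n. f n \<in> carr D) \<and>
     (\<forall>\<epsilon>>0. \<exists>N. \<forall>m\<ge>N. \<forall>n\<ge>N. nrm D (f m \<boxminus>\<^bsub>D\<^esub> f n) < \<epsilon>)}"

definition null_rel :: "'d star_alg \<Rightarrow> (nat \<Rightarrow> 'd) rel" where
  "null_rel D = {(f, g). f \<in> cauchy_seqs D \<and> g \<in> cauchy_seqs D \<and>
     (\<lambda>n. nrm D (f n \<boxminus>\<^bsub>D\<^esub> g n)) \<longlonglongrightarrow> 0}"

text \<open>Hausdorff completion for the seminorm \<^const>\<open>nrm\<close>: Cauchy sequences modulo null sequences,
  with the operations defined on representatives.  All representatives \<open>f\<close> of a class have the same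
  value of \<open>lim \<parallel>f n\<parallel>\<close>.\<close>

definition completion :: "'d star_alg \<Rightarrow> (nat \<Rightarrow> 'd) set star_alg" where
  "completion D = \<lparr>
     carr = cauchy_seqs D // null_rel D,
     zer = null_rel D `` {\<lambda>n. \<zero>\<^bsub>D\<^esub>},
     plu = (\<lambda>X Y. \<Union>f\<in>X. \<Union>g\<in>Y. null_rel D `` {\<lambda>n. f n \<boxplus>\<^bsub>D\<^esub> g n}),
     scal = (\<lambda>c X. \<Union>f\<in>X. null_rel D `` {\<lambda>n. c \<cdot>\<^bsub>D\<^esub> f n}),
     mul = (\<lambda>X Y. \<Union>f\<in>X. \<Union>g\<in>Y. null_rel D `` {\<lambda>n. f n \<boxtimes>\<^bsub>D\<^esub> g n}),
     adj = (\<lambda>X. \<Union>f\<in>X. null_rel D `` {\<lambda>n. adj D (f n)}),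
     nrm = (\<lambda>X. the_elem ((\<lambda>f. lim (\<lambda>n. nrm D (f n))) ` X))\<rparr>"

definition with_universal_norm :: "'d star_alg \<Rightarrow> 'd star_alg" where
  "with_universal_norm D = D\<lparr>nrm := universal_norm D\<rparr>"

definition enveloping_cstar :: "'d star_alg \<Rightarrow> (nat \<Rightarrow> 'd) set star_alg" where
  "enveloping_cstar D = completion (with_universal_norm D)"

text \<open>Extension by continuity of a map on \<open>D\<close> to the enveloping C*-algebra.\<close>

definition enveloping_map :: "'d star_alg \<Rightarrow> ('d \<Rightarrow> 'd) \<Rightarrow> (nat \<Rightarrow> 'd) set \<Rightarrow> (nat \<Rightarrow> 'd) set" where
  "enveloping_map D \<phi> X = (\<Union>f\<in>X. null_rel (with_universal_norm D) `` {\<lambda>n. \<phi> (f n)})"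

section \<open>Crossed products by the circle and by the integers\<close>

text \<open>Integration against normalised Haar measure, for continuous functions.\<close>

definition circle_integral :: "(complex \<Rightarrow> 'v::real_normed_vector) \<Rightarrow> 'v" where
  "circle_integral f = integral {0..1} (\<lambda>t. f (cis (2 * pi * t)))"

text \<open>The convolution *-algebra \<open>C(\<TT>, A)\<close> with the \<open>L\<^sup>1\<close>-norm.  It is a dense *-subalgebra of
  \<open>L\<^sup>1(\<TT>, A)\<close>, and C*-seminorms dominated by the \<open>L\<^sup>1\<close>-norm extend uniquely to \<open>L\<^sup>1(\<TT>, A)\<close>, so both
  have the same enveloping C*-algebra.  (The library's Bochner integral is not available for
  functions with values in a nonseparable \<open>A\<close>.)  Functions that agree on \<open>\<TT>\<close> are at distance 0 and
  hence are identified in the completion.\<close>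

definition circle_conv_alg ::
    "(complex \<Rightarrow> 'a::cstar_algebra \<Rightarrow> 'a) \<Rightarrow> (complex \<Rightarrow> 'a) star_alg" where
  "circle_conv_alg \<alpha> = \<lparr>
     carr = {\<xi>. continuous_on \<TT> \<xi>},
     zer = (\<lambda>\<zeta>. 0),
     plu = (\<lambda>\<xi> \<eta> \<zeta>. \<xi> \<zeta> + \<eta> \<zeta>),
     scal = (\<lambda>c \<xi> \<zeta>. scaleC c (\<xi> \<zeta>)),
     mul = (\<lambda>\<xi> \<eta> \<zeta>. circle_integral (\<lambda>\<omega>. \<xi> \<omega> * \<alpha> \<omega> (\<eta> (inverse \<omega> * \<zeta>)))),
     adj = (\<lambda>\<xi> \<zeta>. \<alpha> \<zeta> (star (\<xi> (cnj \<zeta>)))),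
     nrm = (\<lambda>\<xi>. circle_integral (\<lambda>\<zeta>. norm (\<xi> \<zeta>)))\<rparr>"

definition crossed_product_circle ::
    "(complex \<Rightarrow> 'a::cstar_algebra \<Rightarrow> 'a) \<Rightarrow> (nat \<Rightarrow> complex \<Rightarrow> 'a) set star_alg" where
  "crossed_product_circle \<alpha> = enveloping_cstar (circle_conv_alg \<alpha>)"

definition dual_automorphism :: "(complex \<Rightarrow> 'a::cstar_algebra \<Rightarrow> 'a) \<Rightarrow>
    (nat \<Rightarrow> complex \<Rightarrow> 'a) set \<Rightarrow> (nat \<Rightarrow> complex \<Rightarrow> 'a) set" where
  "dual_automorphism \<alpha> = enveloping_map (circle_conv_alg \<alpha>) (\<lambda>\<xi> \<zeta>. scaleC \<zeta> (\<xi> \<zeta>))"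

definition int_iterate :: "('a \<Rightarrow> 'a) \<Rightarrow> int \<Rightarrow> 'a \<Rightarrow> 'a" where
  "int_iterate \<beta> k = (if 0 \<le> k then \<beta> ^^ nat k else inv \<beta> ^^ nat (- k))"

text \<open>The finitely supported function \<open>\<xi>\<close> stands for \<open>\<Sum>k. \<xi> k w\<^sup>k\<close>, where \<open>w\<close> is a unitary with
  \<open>w a w\<^sup>* = \<beta> a\<close>; the norm is the \<open>\<ell>\<^sup>1\<close>-norm.\<close>

definition int_conv_alg :: "('a::cstar_algebra \<Rightarrow> 'a) \<Rightarrow> (int \<Rightarrow> 'a) star_alg" where
  "int_conv_alg \<beta> = \<lparr>
     carr = {\<xi>. finite {k. \<xi> k \<noteq> 0}},
     zer = (\<lambda>k. 0),
     plu = (\<lambda>\<xi> \<eta> k. \<xi> k + \<eta> k),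
     scal = (\<lambda>c \<xi> k. scaleC c (\<xi> k)),
     mul = (\<lambda>\<xi> \<eta> n. \<Sum>k | \<xi> k \<noteq> 0. \<xi> k * int_iterate \<beta> k (\<eta> (n - k))),
     adj = (\<lambda>\<xi> k. int_iterate \<beta> k (star (\<xi> (- k)))),
     nrm = (\<lambda>\<xi>. \<Sum>k | \<xi> k \<noteq> 0. norm (\<xi> k))\<rparr>"

definition crossed_product_int ::
    "('a::cstar_algebra \<Rightarrow> 'a) \<Rightarrow> (nat \<Rightarrow> int \<Rightarrow> 'a) set star_alg" where
  "crossed_product_int \<beta> = enveloping_cstar (int_conv_alg \<beta>)"

definition dual_action :: "('a::cstar_algebra \<Rightarrow> 'a) \<Rightarrow> complex \<Rightarrow>
    (nat \<Rightarrow> int \<Rightarrow> 'a) set \<Rightarrow> (nat \<Rightarrow> int \<Rightarrow> 'a) set" where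
  "dual_action \<beta> \<zeta> = enveloping_map (int_conv_alg \<beta>) (\<lambda>\<xi> k. scaleC (\<zeta> powi k) (\<xi> k))"

end

theory Submission
  imports Defs
begin

text \<open>Approximately unitary paths are transported between an algebra and its crossed product.

  If \<open>v\<^sub>t \<in> A\<close> asymptotically implements \<open>\<beta>\<close>, then \<open>v\<^sub>t\<close> may be replaced by its unitary polar part, and
  \<open>u\<^sub>t = v\<^sub>t\<^sup>* w\<close> is a path of unitaries of degree 1 for the dual action that asymptotically commutes
  with \<open>A\<close> and \<open>w\<close>.  Conversely, averaging over roots of unity shows that a Rokhlin path \<open>u\<^sub>t\<close> is close to
  \<open>y\<^sub>t w\<close>, where \<open>y\<^sub>t\<close> is its coefficient at 1, and \<open>v\<^sub>t = y\<^sub>t\<^sup>*\<close> asymptotically represents \<open>\<beta>\<close>.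

  If \<open>u\<^sub>t \<in> A\<close> is a Rokhlin path for \<open>\<alpha>\<close>, then \<open>v\<^sub>t = u\<^sub>t\<^sup>* f\<^sub>t\<close> with bump functions \<open>f\<^sub>t\<close> on the circle
  concentrating at 1 asymptotically represents the dual automorphism.  Conversely, let \<open>p\<^sub>k\<close> be the
  spectral projections of the canonical unitaries of the crossed product.  As the dual automorphism
  maps \<open>p\<^sub>k\<close> to \<open>p\<^sub>k\<^sub>-\<^sub>1\<close>, a representing path satisfies \<open>v\<^sub>t p\<^sub>k \<approx> p\<^sub>k\<^sub>-\<^sub>1 v\<^sub>t p\<^sub>k = x\<^sub>t p\<^sub>k\<close> with \<open>x\<^sub>t\<close> in the
  spectral subspace of degree \<open>-1\<close>.  Because \<open>v\<^sub>t\<close> is almost fixed by the dual automorphism, \<open>x\<^sub>t\<close> is almost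
  independent of \<open>k\<close>, and hence asymptotically commutes with all spectral subspaces of \<open>A\<close>.  The adjoint
  of its unitary polar part is the required path.

  Returning from the crossed product to \<open>A\<close> requires that the universal norm does not collapse
  coefficients, which follows from the seminorm of the regular representation on a Hilbert module.  The
  positivity theory that this needs is derived from the power series of \<open>\<surd>(1 - z)\<close>, without spectra.\<close>

section \<open>Elementary C*-algebra theory\<close>

text \<open>The implication from the circle crossed product back to A shapes the proof. That algebra
  need not be unital, so a representing path is nearly unitary only on each fixed element and need
  not be close to any path in A. Cutting by p_k yields a corner with a unit, but one corner does not
  suffice: if a has degree m, then a p_0 = p_m a p_0, so commuting x_t with a compares the corners
  at 0 and at m. Hence only homogeneous a can be treated directly, and density of the spectral
  subspaces covers the rest. Over the integers the crossed product is unital and a single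
  coefficient is enough. Positivity enters twice: Cauchy-Schwarz for an A-valued inner product needs
  an order respected by the norm, and bounding left multiplication needs
  \<open>star c * a * c\<close> below \<open>norm a\<close> times \<open>star c * c\<close>. The
  polar correction makes an almost unitary path exactly unitary after an initial interval of time is
  discarded. It keeps continuity because the inverse root is Lipschitz near 1, and it keeps the
  degree because automorphisms commute with power series.\<close>

lemma scaleC_one [simp]: "scaleC 1 (x::'a::cstar_algebra) = x"
  by (metis of_real_1 scaleR_one scaleR_scaleC)

lemma scaleC_zero_left [simp]: "scaleC 0 (x::'a::cstar_algebra) = 0"
  by (metis of_real_0 scaleR_scaleC scaleR_zero_left)

lemma bounded_linear_scaleC: "bounded_linear (scaleC c :: 'a::cstar_algebra \<Rightarrow> 'a)"
  by (rule bounded_linear_intro[where K="cmod c"])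
    (auto simp: scaleC_add_right scaleR_scaleC scaleC_scaleC norm_scaleC mult.commute)

lemma scaleC_minus1 [simp]: "scaleC (-1) (x::'a::cstar_algebra) = - x"
  by (metis of_real_1 of_real_minus scaleR_minus1_left scaleR_scaleC)

lemma scaleC_zero_right [simp]: "scaleC c (0::'a::cstar_algebra) = 0"
  by (rule linear_0[OF bounded_linear.linear[OF bounded_linear_scaleC]])

lemma scaleC_diff_right: "scaleC c (x - y::'a::cstar_algebra) = scaleC c x - scaleC c y"
  by (rule linear_diff[OF bounded_linear.linear[OF bounded_linear_scaleC]])

lemma scaleC_sum_right: "scaleC c (sum f A) = (\<Sum>i\<in>A. scaleC c (f i :: 'a::cstar_algebra))"
  by (rule linear_sum[OF bounded_linear.linear[OF bounded_linear_scaleC]])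

lemma scaleC_minus_left: "scaleC (- c) (x::'a::cstar_algebra) = - scaleC c x"
  by (metis mult_minus1 scaleC_minus1 scaleC_scaleC)

lemma scaleC_diff_left: "scaleC (c - d) (x::'a::cstar_algebra) = scaleC c x - scaleC d x"
  using scaleC_add_left[of c "- d" x] by (simp add: scaleC_minus_left)

lemma scaleC_sum_left: "scaleC (sum f A) (x::'a::cstar_algebra) = (\<Sum>i\<in>A. scaleC (f i) x)"
  by (induction A rule: infinite_finite_induct) (auto simp: scaleC_add_left)

lemma norm_star [simp]: "norm (star (x::'a::cstar_algebra)) = norm x"
proof -
  have le: "norm y \<le> norm (star y)" for y :: 'a
  proof (cases "y = 0")
    case False
    have "norm y * norm y \<le> norm (star y) * norm y"
      using norm_star_mult[of y] norm_mult_ineq[of "star y" y] by (simp add: power2_eq_square)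
    then show ?thesis using False by simp
  qed simp
  show ?thesis using le[of x] le[of "star x"] by (simp add: star_star)
qed

lemma bounded_linear_star: "bounded_linear (star :: 'a::cstar_algebra \<Rightarrow> 'a)"
  by (rule bounded_linear_intro[where K=1]) (auto simp: star_add scaleR_scaleC star_scaleC)

lemma star_zero [simp]: "star (0::'a::cstar_algebra) = 0"
  by (rule linear_0[OF bounded_linear.linear[OF bounded_linear_star]])

lemma star_diff: "star (x - y::'a::cstar_algebra) = star x - star y"
  by (rule linear_diff[OF bounded_linear.linear[OF bounded_linear_star]])

lemma star_sum: "star (sum f A) = (\<Sum>i\<in>A. star (f i :: 'a::cstar_algebra))"
  by (rule linear_sum[OF bounded_linear.linear[OF bounded_linear_star]])

lemma star_scaleR: "star (r *\<^sub>R x::'a::cstar_algebra) = r *\<^sub>R star x"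
  by (simp add: scaleR_scaleC star_scaleC)

lemma star_one [simp]: "star (1::'a::unital_cstar_algebra) = 1"
  by (metis mult.right_neutral star_mult star_star)

lemma norm_one_le: "norm (1::'a::unital_cstar_algebra) \<le> 1"
  using norm_star_mult[of "1::'a"] by (auto simp: power2_eq_square)

lemma norm_power_Suc: "norm ((z::'a::unital_cstar_algebra) ^ Suc n) \<le> norm z ^ Suc n"
proof (induction n)
  case (Suc n)
  have "norm (z ^ Suc (Suc n)) \<le> norm z * norm (z ^ Suc n)"
    using norm_mult_ineq[of z "z ^ Suc n"] by simp
  also have "\<dots> \<le> norm z * norm z ^ Suc n"
    using Suc by (intro mult_left_mono) auto
  finally show ?case by simp
qed simp

lemma star_power: "star ((z::'a::unital_cstar_algebra) ^ n) = star z ^ n"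
  by (induction n) (auto simp: star_mult power_commutes)

lemma commute_power:
  "c * (z::'a::unital_cstar_algebra) = z * c \<Longrightarrow> c * z ^ n = z ^ n * c"
  by (induction n) (simp_all, metis mult.assoc)

lemma norm_square_le_iff:
  "norm (star x * (x::'a::cstar_algebra)) \<le> 1 \<longleftrightarrow> norm x \<le> 1"
  by (simp add: norm_star_mult power2_eq_square)
    (metis abs_norm_cancel abs_square_le_1 power2_eq_square)

subsection \<open>The square root of \<open>1 - z\<close>\<close>

text \<open>Taylor coefficients of 1 - sqrt (1 - z). The recursion is the coefficient form of w * w
  = 2 w - z for w = 1 - sqrt (1 - z); in this form nonnegativity and summability follow by
  induction, without binomial coefficients.\<close>

fun sqrt_coeff :: "nat \<Rightarrow> real" where
  "sqrt_coeff n = (if n = 0 then 0 else if n = 1 then 1/2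
     else (\<Sum>i\<in>{1..<n}. sqrt_coeff i * sqrt_coeff (n - i)) / 2)"

declare sqrt_coeff.simps [simp del]

lemma sqrt_coeff_0 [simp]: "sqrt_coeff 0 = 0"
  by (simp add: sqrt_coeff.simps)

lemma sqrt_coeff_convolution:
  "(\<Sum>i\<le>n. sqrt_coeff i * sqrt_coeff (n - i)) = 2 * sqrt_coeff n - (if n = 1 then 1 else 0)"
proof (cases "n \<le> 1")
  case True
  then have "n = 0 \<or> n = 1" by auto
  then show ?thesis by (auto simp: sqrt_coeff.simps[of 1] sqrt_coeff.simps[of "Suc 0"])
next
  case False
  have "(\<Sum>i\<le>n. sqrt_coeff i * sqrt_coeff (n - i)) = (\<Sum>i\<in>{1..<n}. sqrt_coeff i * sqrt_coeff (n - i))"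
    by (rule sum.mono_neutral_right) (auto simp: not_less_eq_eq not_less le_Suc_eq dest!: le_antisym)
  then show ?thesis using False by (subst (3) sqrt_coeff.simps) auto
qed

lemma sqrt_coeff_nonneg: "0 \<le> sqrt_coeff n"
proof (induction n rule: less_induct)
  case (less n)
  then show ?case by (subst sqrt_coeff.simps) (auto intro!: sum_nonneg mult_nonneg_nonneg)
qed

text \<open>The partial sums S(N) satisfy 2 S(N + 1) - 1 \<le> S(N)^2: a product of two coefficients
  with index sum at most N + 1 vanishes unless both indices are at most N, because coefficient 0 is
  0. So the bound 1 is inherited.\<close>

lemma sum_sqrt_coeff_le: "(\<Sum>n\<le>N. sqrt_coeff n) \<le> 1"
proof (induction N)
  case (Suc N)
  let ?d = sqrt_coeff
  let ?T = "{(i, j). i + j \<le> Suc N}"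
  have fin: "finite ?T" by (rule finite_subset[of _ "{..Suc N} \<times> {..Suc N}"]) auto
  have "2 * (\<Sum>n\<le>Suc N. ?d n) - 1 = (\<Sum>n\<le>Suc N. 2 * ?d n - (if n = 1 then 1 else 0))"
    by (simp add: sum_subtractf sum_distrib_left)
  also have "\<dots> = (\<Sum>n\<le>Suc N. \<Sum>i\<le>n. ?d i * ?d (n - i))"
    by (simp only: sqrt_coeff_convolution)
  also have "\<dots> = (\<Sum>(i, j)\<in>?T. ?d i * ?d j)"
    by (rule sum.triangle_reindex_eq[symmetric])
  also have "\<dots> = (\<Sum>(i, j)\<in>?T \<inter> {..N} \<times> {..N}. ?d i * ?d j)"
  proof (rule sum.mono_neutral_right)
    have "i = 0 \<or> j = 0" if "i + j \<le> Suc N" "\<not> (i \<le> N \<and> j \<le> N)" for i j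
      using that by arith
    then show "\<forall>p\<in>?T - ?T \<inter> {..N} \<times> {..N}. (case p of (i, j) \<Rightarrow> ?d i * ?d j) = 0"
      by fastforce
  qed (use fin in auto)
  also have "\<dots> \<le> (\<Sum>(i, j)\<in>{..N} \<times> {..N}. ?d i * ?d j)"
    by (rule sum_mono2) (auto intro!: mult_nonneg_nonneg sqrt_coeff_nonneg)
  also have "\<dots> = (\<Sum>i\<le>N. ?d i) * (\<Sum>i\<le>N. ?d i)"
    by (simp add: sum_product sum.cartesian_product)
  also have "\<dots> \<le> 1 * 1"
    using Suc by (intro mult_mono) (auto intro!: sum_nonneg sqrt_coeff_nonneg)
  finally show ?case by simp
qed simp

lemma sum_lessThan_sqrt_coeff_le: "(\<Sum>n<N. sqrt_coeff n) \<le> 1"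
  by (rule order_trans[OF sum_mono2 sum_sqrt_coeff_le[of N]]) (auto simp: sqrt_coeff_nonneg)

lemma summable_sqrt_coeff: "summable sqrt_coeff"
  by (rule summableI_nonneg_bounded[where x=1])
    (simp_all add: sqrt_coeff_nonneg sum_lessThan_sqrt_coeff_le)

lemma suminf_sqrt_coeff_le: "suminf sqrt_coeff \<le> 1"
  by (rule suminf_le_const[OF summable_sqrt_coeff sum_lessThan_sqrt_coeff_le])

text \<open>For norm z \<le> 1 this is 1 - sqrt (1 - z). Summable coefficients give absolute
  convergence on the whole closed unit ball, boundary included.\<close>

definition sqrt_defect :: "'a::unital_cstar_algebra \<Rightarrow> 'a" where
  "sqrt_defect z = (\<Sum>n. sqrt_coeff n *\<^sub>R z ^ n)"

context
  fixes z :: "'a::unital_cstar_algebra"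
  assumes z: "norm z \<le> 1"
begin

text \<open>The factor \<open>norm z\<close>, available because the constant term is 0, makes the
  defect of a small element small; only then can the Neumann series be applied to the
  defect.\<close>

lemma norm_sqrt_term_le: "norm (sqrt_coeff n *\<^sub>R z ^ n) \<le> sqrt_coeff n * norm z"
proof (cases n)
  case (Suc m)
  have "norm (z ^ n) \<le> norm z ^ n" using norm_power_Suc Suc by blast
  also have "\<dots> \<le> norm z" using z Suc by (simp add: mult_left_le power_le_one)
  finally show ?thesis by (simp add: mult_left_mono sqrt_coeff_nonneg)
qed simp

lemma summable_norm_sqrt_term: "summable (\<lambda>n. norm (sqrt_coeff n *\<^sub>R z ^ n))"
  by (rule summable_comparison_test'[OF summable_mult2[OF summable_sqrt_coeff, of "norm z"], of 0])
    (use norm_sqrt_term_le in auto)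

lemma summable_sqrt_term: "summable (\<lambda>n. sqrt_coeff n *\<^sub>R z ^ n)"
  by (rule summable_norm_cancel[OF summable_norm_sqrt_term])

lemma norm_sqrt_defect_le: "norm (sqrt_defect z) \<le> norm z"
proof -
  have "norm (sqrt_defect z) \<le> (\<Sum>n. norm (sqrt_coeff n *\<^sub>R z ^ n))"
    unfolding sqrt_defect_def by (rule summable_norm[OF summable_norm_sqrt_term])
  also have "\<dots> \<le> (\<Sum>n. sqrt_coeff n * norm z)"
    by (rule suminf_le[OF norm_sqrt_term_le summable_norm_sqrt_term summable_mult2[OF summable_sqrt_coeff]])
  also have "\<dots> = suminf sqrt_coeff * norm z"
    by (rule suminf_mult2[OF summable_sqrt_coeff, symmetric])
  also have "\<dots> \<le> 1 * norm z" using suminf_sqrt_coeff_le by (rule mult_right_mono) simp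
  finally show ?thesis by simp
qed

text \<open>Cauchy product of the series with itself, evaluated by
  \<open>sqrt_coeff_convolution\<close>.\<close>

lemma sqrt_defect_square: "sqrt_defect z * sqrt_defect z = 2 *\<^sub>R sqrt_defect z - z"
proof -
  have "(\<lambda>n. (\<Sum>i\<le>n. (sqrt_coeff i *\<^sub>R z ^ i) * (sqrt_coeff (n - i) *\<^sub>R z ^ (n - i))))
    sums (sqrt_defect z * sqrt_defect z)"
    unfolding sqrt_defect_def by (rule Cauchy_product_sums[OF summable_norm_sqrt_term summable_norm_sqrt_term])
  moreover have "(\<Sum>i\<le>n. (sqrt_coeff i *\<^sub>R z ^ i) * (sqrt_coeff (n - i) *\<^sub>R z ^ (n - i)))
      = 2 *\<^sub>R (sqrt_coeff n *\<^sub>R z ^ n) - (if n = 1 then z else 0)" for n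
  proof -
    have "(\<Sum>i\<le>n. (sqrt_coeff i *\<^sub>R z ^ i) * (sqrt_coeff (n - i) *\<^sub>R z ^ (n - i)))
        = (\<Sum>i\<le>n. (sqrt_coeff i * sqrt_coeff (n - i)) *\<^sub>R z ^ n)"
      by (rule sum.cong) (auto simp: power_add[symmetric])
    also have "\<dots> = (\<Sum>i\<le>n. sqrt_coeff i * sqrt_coeff (n - i)) *\<^sub>R z ^ n"
      by (simp add: scaleR_sum_left)
    finally show ?thesis by (simp add: sqrt_coeff_convolution scaleR_diff_left)
  qed
  ultimately have "(\<lambda>n. 2 *\<^sub>R (sqrt_coeff n *\<^sub>R z ^ n) - (if n = 1 then z else 0))
    sums (sqrt_defect z * sqrt_defect z)" by simp
  moreover have "(\<lambda>n. 2 *\<^sub>R (sqrt_coeff n *\<^sub>R z ^ n) - (if n = 1 then z else 0))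
      sums (2 *\<^sub>R sqrt_defect z - z)"
    unfolding sqrt_defect_def
    by (intro sums_diff sums_scaleR_right summable_sums summable_sqrt_term sums_single)
  ultimately show ?thesis by (rule sums_unique2)
qed

lemma square_one_minus_sqrt_defect: "(1 - sqrt_defect z) * (1 - sqrt_defect z) = 1 - z"
  using sqrt_defect_square by (simp add: algebra_simps scaleR_2)

lemma star_sqrt_defect: "star (sqrt_defect z) = sqrt_defect (star z)"
  unfolding sqrt_defect_def
  by (subst bounded_linear.suminf[OF bounded_linear_star summable_sqrt_term])
    (simp add: star_scaleR star_power)

lemma commute_sqrt_defect: "c * z = z * c \<Longrightarrow> c * sqrt_defect z = sqrt_defect z * c"
  unfolding sqrt_defect_def
  by (simp add: suminf_mult[OF summable_sqrt_term, symmetric] suminf_mult2[OF summable_sqrt_term]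
      commute_power)

end

subsection \<open>Positive elements\<close>

text \<open>Positivity in the form that needs no spectrum. That it is closed under sums and contains
  every \<open>star x * x\<close> becomes a theorem (\<open>cpos_add\<close>,
  \<open>cpos_star_mult\<close>).\<close>

definition cpos :: "'a::unital_cstar_algebra \<Rightarrow> bool" where
  "cpos a \<longleftrightarrow> (\<exists>h. star h = h \<and> a = h * h)"

lemma cpos_self_adjoint: "cpos a \<Longrightarrow> star a = a"
  by (auto simp: cpos_def star_mult)

lemma cpos_square: "star h = h \<Longrightarrow> cpos (h * h)"
  by (auto simp: cpos_def)

lemma cpos_zero [simp]: "cpos 0"
  unfolding cpos_def by (rule exI[of _ 0]) simp

lemma cpos_scaleR: "0 \<le> r \<Longrightarrow> cpos a \<Longrightarrow> cpos (r *\<^sub>R a)"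
  unfolding cpos_def
  by (metis (no_types, lifting) mult_scaleR_left mult_scaleR_right real_sqrt_mult_self abs_of_nonneg
      scaleR_scaleR star_scaleR)

lemma norm_self_adjoint_square: "star h = h \<Longrightarrow> norm (h * h) = (norm (h::'a::cstar_algebra))\<^sup>2"
  by (metis norm_star_mult)

text \<open>The reason is that \<open>h + i s\<close> is unitary.\<close>

lemma norm_le_one_of_squares_sum_one:
  fixes h s :: "'a::unital_cstar_algebra"
  assumes "star h = h" "star s = s" "h * s = s * h" "h * h + s * s = 1"
  shows "norm h \<le> 1"
proof -
  define u where "u = h + scaleC \<i> s"
  have su: "star u = h - scaleC \<i> s"
    by (simp add: u_def star_add star_scaleC assms scaleC_minus_left)
  have "star u * u = h * h + s * s"
    unfolding su by (simp add: u_def algebra_simps mult_scaleC_left mult_scaleC_right scaleC_scaleC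
        scaleC_diff_right scaleC_minus_left assms(3))
  then have "norm (star u * u) \<le> 1" using assms(4) norm_one_le by metis
  then have nu: "norm u \<le> 1" by (simp only: norm_square_le_iff)
  have "2 *\<^sub>R h = u + star u" unfolding su by (simp add: u_def scaleR_2)
  then have "2 * norm h = norm (u + star u)" by (metis abs_numeral norm_scaleR)
  also have "\<dots> \<le> 2" using norm_triangle_ineq[of u "star u"] nu by simp
  finally show ?thesis by simp
qed

text \<open>The series supplies a root y of 1 - h * h that commutes with h. The squares of y and h
  add up to 1, so y is a contraction.\<close>

lemma norm_one_minus_square_le:
  fixes h :: "'a::unital_cstar_algebra"
  assumes "star h = h" "norm h \<le> 1"
  shows "norm (1 - h * h) \<le> 1"
proof -
  have z: "norm (h * h) \<le> 1" using assms by (simp add: norm_self_adjoint_square power_le_one)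
  define y where "y = 1 - sqrt_defect (h * h)"
  have yy: "y * y = 1 - h * h" unfolding y_def by (rule square_one_minus_sqrt_defect[OF z])
  have sy: "star y = y"
    unfolding y_def by (simp add: star_diff star_sqrt_defect[OF z] star_mult assms)
  have "h * y = y * h"
    unfolding y_def using commute_sqrt_defect[OF z, of h] by (simp add: algebra_simps mult.assoc)
  then have "norm y \<le> 1"
    using norm_le_one_of_squares_sum_one[of y h] assms sy yy by (simp add: algebra_simps)
  then show ?thesis using norm_self_adjoint_square[OF sy] yy by (simp add: power_le_one)
qed

lemma sqrt_exists:
  fixes a :: "'a::unital_cstar_algebra"
  assumes "star a = a" "norm (1 - a) \<le> 1"
  obtains h where "star h = h" "h * h = a" "norm (1 - h) \<le> 1" "\<And>c. c * a = a * c \<Longrightarrow> c * h = h * c"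
proof
  show "star (1 - sqrt_defect (1 - a)) = 1 - sqrt_defect (1 - a)"
    by (simp add: star_diff star_sqrt_defect[OF assms(2)] assms(1))
  show "(1 - sqrt_defect (1 - a)) * (1 - sqrt_defect (1 - a)) = a"
    by (simp add: square_one_minus_sqrt_defect[OF assms(2)])
  show "norm (1 - (1 - sqrt_defect (1 - a))) \<le> 1"
    using norm_sqrt_defect_le[OF assms(2)] assms(2) by simp
  show "c * (1 - sqrt_defect (1 - a)) = (1 - sqrt_defect (1 - a)) * c" if "c * a = a * c" for c
    using commute_sqrt_defect[OF assms(2), of c] that by (simp add: algebra_simps)
qed

lemma norm_scaled_one_minus:
  "0 < K \<Longrightarrow> norm (K *\<^sub>R 1 - a) = K * norm (1 - (1/K) *\<^sub>R a)"
  for a :: "'a::unital_cstar_algebra"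
proof -
  assume "0 < K"
  then have "K *\<^sub>R 1 - a = K *\<^sub>R (1 - (1/K) *\<^sub>R a)" by (simp add: scaleR_diff_right)
  then show ?thesis using \<open>0 < K\<close> by simp
qed

text \<open>After scaling by 1/K this is \<open>norm_one_minus_square_le\<close>. Together with the
  converse \<open>cpos_if_norm_le\<close> it gives a metric criterion for positivity, under which
  sums and integrals of positive elements are handled by the triangle inequality.\<close>

lemma cpos_norm_le:
  assumes "cpos a" "norm a \<le> K" "0 < K"
  shows "norm (K *\<^sub>R 1 - a) \<le> K"
proof -
  have "cpos ((1/K) *\<^sub>R a)" using assms by (intro cpos_scaleR) auto
  then obtain h where h: "star h = h" "(1/K) *\<^sub>R a = h * h" by (auto simp: cpos_def)
  have "norm ((1/K) *\<^sub>R a) \<le> 1" using assms by simp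
  then have "norm (star h * h) \<le> 1" using h by simp
  then have "norm h \<le> 1" by (simp only: norm_square_le_iff)
  then have "norm (1 - (1/K) *\<^sub>R a) \<le> 1" using norm_one_minus_square_le[OF h(1)] h(2) by simp
  then show ?thesis using norm_scaled_one_minus[of K a] assms by simp
qed

text \<open>Scaling by K reduces to \<open>sqrt_exists\<close>. The norm estimate for h is recorded
  because, by the metric criterion, it certifies that h is positive again.\<close>

lemma scaled_sqrt_exists:
  fixes a :: "'a::unital_cstar_algebra"
  assumes "star a = a" "norm (K *\<^sub>R 1 - a) \<le> K" "0 < K"
  obtains h where "star h = h" "h * h = a" "norm (sqrt K *\<^sub>R 1 - h) \<le> sqrt K"
    "\<And>c. c * a = a * c \<Longrightarrow> c * h = h * c"
proof -
  have n: "norm (1 - (1/K) *\<^sub>R a) \<le> 1" using norm_scaled_one_minus[of K a] assms by simp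
  have sa: "star ((1/K) *\<^sub>R a) = (1/K) *\<^sub>R a" using assms by (simp add: star_scaleR)
  obtain h where h: "star h = h" "h * h = (1/K) *\<^sub>R a" "norm (1 - h) \<le> 1"
     "\<And>c. c * ((1/K) *\<^sub>R a) = ((1/K) *\<^sub>R a) * c \<Longrightarrow> c * h = h * c"
    by (rule sqrt_exists[OF sa n]) blast
  show thesis
  proof
    show "star (sqrt K *\<^sub>R h) = sqrt K *\<^sub>R h" by (simp add: star_scaleR h)
    show "(sqrt K *\<^sub>R h) * (sqrt K *\<^sub>R h) = a" using assms h(2) by simp
    have "sqrt K *\<^sub>R 1 - sqrt K *\<^sub>R h = sqrt K *\<^sub>R (1 - h)" by (simp add: scaleR_diff_right)
    then show "norm (sqrt K *\<^sub>R 1 - sqrt K *\<^sub>R h) \<le> sqrt K" using h(3) assms by simp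
    show "c * (sqrt K *\<^sub>R h) = (sqrt K *\<^sub>R h) * c" if "c * a = a * c" for c
      using h(4)[of c] that by simp
  qed
qed

lemma cpos_if_norm_le:
  fixes a :: "'a::unital_cstar_algebra"
  assumes "star a = a" "norm (K *\<^sub>R 1 - a) \<le> K" "0 < K"
  shows "cpos a"
proof -
  obtain h where "star h = h" "h * h = a" by (rule scaled_sqrt_exists[OF assms]) blast
  then show ?thesis by (auto simp: cpos_def)
qed

lemma cpos_bound_minus:
  assumes "star a = a" "norm a \<le> K" "0 < K"
  shows "cpos (K *\<^sub>R 1 - a)"
  by (rule cpos_if_norm_le[of _ K]) (use assms in \<open>auto simp: star_diff star_scaleR\<close>)

lemma cpos_add:
  assumes "cpos a" "cpos b"
  shows "cpos (a + b)"
proof -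
  define K where "K = norm a + norm b + 1"
  have K: "norm a \<le> K" "norm b \<le> K" "0 < K" by (auto simp: K_def add_nonneg_pos)
  have n: "norm (K *\<^sub>R 1 - a) \<le> K" "norm (K *\<^sub>R 1 - b) \<le> K"
    using assms cpos_norm_le K by blast+
  have "(2 * K) *\<^sub>R 1 - (a + b) = (K *\<^sub>R 1 - a) + (K *\<^sub>R 1 - b)"
    by (simp add: scaleR_2 flip: scaleR_scaleR)
  then have "norm ((2 * K) *\<^sub>R 1 - (a + b)) \<le> K + K"
    using norm_triangle_mono[OF n] by metis
  then show ?thesis
    using cpos_if_norm_le[of "a + b" "2 * K"] K assms by (simp add: star_add cpos_self_adjoint)
qed

lemma cpos_sum: "(\<And>i. i \<in> I \<Longrightarrow> cpos (f i)) \<Longrightarrow> cpos (sum f I)"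
  by (induction I rule: infinite_finite_induct) (auto intro: cpos_add)

lemma cpos_sqrt:
  assumes "cpos a"
  obtains h where "cpos h" "h * h = a" "\<And>c. c * a = a * c \<Longrightarrow> c * h = h * c"
proof -
  define K where "K = norm a + 1"
  have K: "norm a \<le> K" "0 < K" by (auto simp: K_def add_nonneg_pos)
  obtain h where h: "star h = h" "h * h = a" "norm (sqrt K *\<^sub>R 1 - h) \<le> sqrt K"
    "\<And>c. c * a = a * c \<Longrightarrow> c * h = h * c"
    by (rule scaled_sqrt_exists[OF cpos_self_adjoint[OF assms] cpos_norm_le[OF assms K] K(2)]) blast
  moreover have "cpos h" using cpos_if_norm_le[OF h(1) h(3)] K by simp
  ultimately show thesis using that by blast
qed

text \<open>A positive root h of a commutes with a root s of 1 - a, and h * h + s * s = 1, so h is a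
  contraction.\<close>

lemma cpos_complement_le_one:
  fixes a :: "'a::unital_cstar_algebra"
  assumes "cpos a" "cpos (1 - a)"
  shows "norm a \<le> 1"
proof -
  obtain h where h: "cpos h" "h * h = a" "\<And>c. c * a = a * c \<Longrightarrow> c * h = h * c"
    using cpos_sqrt[OF assms(1)] by blast
  obtain s where s: "star s = s" "1 - a = s * s" using assms(2) by (auto simp: cpos_def)
  have "s * (1 - a) = (1 - a) * s" by (simp add: s(2) mult.assoc)
  then have "s * a = a * s" by (simp add: algebra_simps)
  then have "h * s = s * h" using h(3) by metis
  moreover have "h * h + s * s = 1" using h(2) s(2) by (simp flip: s(2))
  ultimately have "norm h \<le> 1"
    using norm_le_one_of_squares_sum_one h(1) s(1) cpos_self_adjoint by blast
  then show ?thesis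
    using norm_self_adjoint_square[OF cpos_self_adjoint[OF h(1)]] h(2) by (simp add: power_le_one)
qed

text \<open>For K slightly above \<open>norm b\<close>, both a / K and 1 - a / K are positive, so a
  / K has norm at most 1. The slack e keeps K positive when b = 0.\<close>

lemma cpos_norm_mono:
  fixes a b :: "'a::unital_cstar_algebra"
  assumes "cpos a" "cpos (b - a)"
  shows "norm a \<le> norm b"
proof (rule field_le_epsilon)
  fix e :: real assume e: "0 < e"
  define K where "K = norm b + e"
  have K: "norm b \<le> K" "0 < K" using e by (auto simp: K_def add_nonneg_pos)
  have pb: "cpos b" using cpos_add[OF assms] by simp
  have "cpos (K *\<^sub>R 1 - b)" using cpos_bound_minus[of b K] K pb by (simp add: cpos_self_adjoint)
  from cpos_add[OF this assms(2)] have "cpos (K *\<^sub>R 1 - a)" by simp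
  then have "cpos ((1/K) *\<^sub>R (K *\<^sub>R 1 - a))" using K by (intro cpos_scaleR) auto
  then have "cpos (1 - (1/K) *\<^sub>R a)" using K by (simp add: scaleR_diff_right)
  moreover have "cpos ((1/K) *\<^sub>R a)" using K assms by (intro cpos_scaleR) auto
  ultimately have "norm ((1/K) *\<^sub>R a) \<le> 1" by (rule cpos_complement_le_one[rotated])
  then show "norm a \<le> norm b + e" using K by (simp add: K_def)
qed


text \<open>Commuting elements have commuting positive roots, and the product of these roots is a
  self-adjoint root of the product.\<close>

lemma cpos_mult:
  assumes "cpos a" "cpos b" "a * b = b * a"
  shows "cpos (a * b)"
proof -
  obtain h where h: "cpos h" "h * h = a" "\<And>c. c * a = a * c \<Longrightarrow> c * h = h * c"
    using cpos_sqrt[OF assms(1)] by blast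
  obtain l where l: "cpos l" "l * l = b" "\<And>c. c * b = b * c \<Longrightarrow> c * l = l * c"
    using cpos_sqrt[OF assms(2)] by blast
  have hl: "h * l = l * h" using h(3)[of b] l(3)[of h] assms(3) by simp
  have "a * b = h * (h * l) * l" by (simp add: mult.assoc flip: h(2) l(2))
  also have "\<dots> = (h * l) * (h * l)" by (subst hl) (simp add: mult.assoc)
  finally have "a * b = (h * l) * (h * l)" .
  moreover have "star (h * l) = h * l"
    using hl by (simp add: star_mult cpos_self_adjoint[OF l(1)] cpos_self_adjoint[OF h(1)])
  ultimately show ?thesis by (metis cpos_square)
qed

lemma cpos_one [simp]: "cpos 1"
  using cpos_square[of "1::'a"] by simp

text \<open>Bernoulli's inequality in the operator order. With r the difference for n, the
  difference for n + 1 is (1 + p) * r + n p * p, a sum of products of commuting positive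
  elements.\<close>

lemma cpos_Bernoulli:
  fixes p :: "'a::unital_cstar_algebra"
  assumes "cpos p"
  shows "cpos ((1 + p) ^ n - (1 + real n *\<^sub>R p))"
proof (induction n)
  case (Suc n)
  define r where "r = (1 + p) ^ n - (1 + real n *\<^sub>R p)"
  have comm: "p * (1 + p) ^ n = (1 + p) ^ n * p"
    by (rule commute_power) (simp add: algebra_simps)
  have pr: "(1 + p) * r = r * (1 + p)" by (simp add: r_def algebra_simps comm)
  have "(1 + p) ^ Suc n - (1 + real (Suc n) *\<^sub>R p) = (1 + p) * r + real n *\<^sub>R (p * p)"
    by (simp add: r_def algebra_simps scaleR_left_distrib)
  moreover have "cpos ((1 + p) * r)"
    using Suc assms by (intro cpos_mult cpos_add pr) (auto simp: r_def)
  moreover have "cpos (real n *\<^sub>R (p * p))"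
    using assms by (intro cpos_scaleR cpos_mult) auto
  ultimately show ?case using cpos_add by metis
qed simp

text \<open>If \<open>y\<^sup>*y = -p\<close> with \<open>p \<ge> 0\<close>, then \<open>yy\<^sup>* \<ge> 0\<close>, and intertwining by \<open>y\<close> bounds
  \<open>p (1 + p)^(2 n)\<close>, which dominates \<open>2 n p\<^sup>2\<close>.\<close>

lemma zero_if_square_negative_aux:
  fixes y :: "'a::unital_cstar_algebra"
  assumes pp: "cpos (- (star y * y))" and ny: "norm y \<le> 1"
  shows "y = 0"
proof -
  define p q where "p = - (star y * y)" and "q = y * star y"
  define a b where "a = (1/2) *\<^sub>R (y + star y)" and "b = scaleC (- \<i> / 2) (y - star y)"
  have sab: "star a = a" "star b = b"
    by (simp_all add: a_def b_def star_scaleR star_scaleC star_add star_diff star_star add.commute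
        scaleC_diff_right scaleC_minus_left)
  have y: "y = a + scaleC \<i> b" and sy: "star y = a - scaleC \<i> b"
    by (simp_all add: a_def b_def scaleC_scaleC scaleR_scaleC scaleC_add_right scaleC_diff_right
        flip: scaleC_add_left scaleC_diff_left)
  \<comment> \<open>For the real and imaginary parts a, b of y one has star y * y + y * star y = 2
    (a * a + b * b), so q is a sum of squares plus p.\<close>
  have "q = 2 *\<^sub>R (a * a) + 2 *\<^sub>R (b * b) + p"
    unfolding p_def q_def sy unfolding y
    by (simp add: algebra_simps scaleR_2 mult_scaleC_left mult_scaleC_right scaleC_scaleC
        scaleC_add_right scaleC_diff_right scaleC_minus_left)
  then have "cpos q"
    using pp sab by (simp only: p_def) (intro cpos_add cpos_scaleR cpos_square, auto)
  moreover have "norm q \<le> 1"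
    using norm_star_mult[of "star y"] ny by (simp add: q_def star_star power_le_one)
  ultimately have nq: "norm (1 - q) \<le> 1" using cpos_norm_le[of q 1] by simp
  \<comment> \<open>Since y * p = - q * y, multiplying y by 1 + p on the right amounts to
    multiplying it by the contraction 1 - q on the left.\<close>
  have bound: "norm (y * (1 + p) ^ n) \<le> 1" for n
  proof (induction n)
    case (Suc n)
    have "y * (1 + p) ^ Suc n = (1 - q) * (y * (1 + p) ^ n)"
      by (simp add: p_def q_def algebra_simps)
    then have "norm (y * (1 + p) ^ Suc n) \<le> norm (1 - q) * norm (y * (1 + p) ^ n)"
      using norm_mult_ineq by metis
    also have "\<dots> \<le> 1 * 1" using nq Suc by (intro mult_mono) auto
    finally show ?case by simp
  qed (use ny in simp)
  have p: "cpos p" using pp by (simp add: p_def)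
  have bound2: "2 * real n * norm (p * p) \<le> 1" for n
  proof -
    define Y where "Y = y * (1 + p) ^ n"
    have "star Y = (1 + p) ^ n * star y"
      by (simp add: Y_def star_mult star_power star_add cpos_self_adjoint[OF p])
    then have "star Y * Y = (1 + p) ^ n * (- p) * (1 + p) ^ n" by (simp add: Y_def p_def mult.assoc)
    also have "\<dots> = - (p * (1 + p) ^ n * (1 + p) ^ n)"
      using commute_power[of p "1 + p" n] by (simp add: algebra_simps)
    also have "\<dots> = - (p * (1 + p) ^ (2 * n))" by (simp add: mult_2 power_add mult.assoc)
    finally have "norm (p * (1 + p) ^ (2 * n)) = norm (star Y * Y)" by simp
    also have "\<dots> \<le> 1" using bound[of n] by (simp only: norm_square_le_iff Y_def)
    finally have le1: "norm (p * (1 + p) ^ (2 * n)) \<le> 1" .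
    have comm: "p * (1 + p) ^ (2*n) = (1 + p) ^ (2*n) * p"
      by (rule commute_power) (simp add: algebra_simps)
    have "cpos (p * ((1 + p) ^ (2 * n) - (1 + real (2 * n) *\<^sub>R p)))"
      by (intro cpos_mult p cpos_Bernoulli) (simp only: right_diff_distrib left_diff_distrib comm, simp add: distrib_left distrib_right)
    then have "cpos (p * (1 + p) ^ (2 * n) - real (2 * n) *\<^sub>R (p * p) - p)"
      by (simp add: algebra_simps)
    from cpos_add[OF this p] have "cpos (p * (1 + p) ^ (2 * n) - real (2 * n) *\<^sub>R (p * p))"
      by simp
    then have "norm (real (2 * n) *\<^sub>R (p * p)) \<le> norm (p * (1 + p) ^ (2 * n))"
      by (intro cpos_norm_mono cpos_scaleR cpos_mult p) auto
    then show ?thesis using le1 by simp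
  qed
  have "norm (p * p) = 0"
  proof (rule ccontr)
    assume "norm (p * p) \<noteq> 0"
    then have "0 < norm (p * p)" by simp
    then obtain n where "1 < real n * norm (p * p)" using reals_Archimedean3 by blast
    then show False using bound2[of n] by linarith
  qed
  then have "p = 0" using norm_self_adjoint_square[OF cpos_self_adjoint[OF p]] by simp
  then show "y = 0" using norm_star_mult[of y] by (simp add: p_def)
qed

lemma zero_if_square_negative:
  fixes y :: "'a::unital_cstar_algebra"
  assumes "cpos (- (star y * y))"
  shows "y = 0"
proof -
  define K where "K = norm y + 1"
  have K: "norm y \<le> K" "0 < K" by (auto simp: K_def add_nonneg_pos)
  have "cpos (((1/K) * (1/K)) *\<^sub>R (- (star y * y)))" using assms K by (intro cpos_scaleR) auto
  then have "cpos (- (star ((1/K) *\<^sub>R y) * ((1/K) *\<^sub>R y)))" by (simp add: star_scaleR)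
  moreover have "norm ((1/K) *\<^sub>R y) \<le> 1" using K by simp
  ultimately have "(1/K) *\<^sub>R y = 0" by (rule zero_if_square_negative_aux)
  then show ?thesis using K by simp
qed

text \<open>Here m is the absolute value of b, and n = m - b is twice the negative part of b. From b
  * n = - n * m the element x * n has square - n * n * m, so it vanishes by
  \<open>zero_if_square_negative\<close>. This makes n nilpotent and, n being self-adjoint, zero; so
  b = m.\<close>

lemma cpos_star_mult: "cpos (star x * x)"
proof -
  define b where "b = star x * x"
  have sb: "star b = b" by (simp add: b_def star_mult star_star)
  obtain m where m: "cpos m" "m * m = b * b" "\<And>c. c * (b * b) = b * b * c \<Longrightarrow> c * m = m * c"
    using cpos_sqrt[OF cpos_square[OF sb]] by blast
  have bm: "b * m = m * b" by (rule m(3)) (simp add: mult.assoc)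
  define n where "n = m - b"
  have sn: "star n = n" by (simp add: n_def star_diff sb cpos_self_adjoint[OF m(1)])
  have nm: "n * m = m * n" by (simp add: n_def algebra_simps bm)
  have bn: "b * n = - (n * m)" by (simp add: n_def algebra_simps m(2) bm)
  have "star (x * n) * (x * n) = n * (b * n)" by (simp add: star_mult sn b_def mult.assoc)
  also have "\<dots> = - (n * n * m)" by (simp add: bn mult.assoc)
  finally have eq: "star (x * n) * (x * n) = - (n * n * m)" .
  have "n * n * m = m * (n * n)" using nm by (metis mult.assoc)
  then have "cpos (n * n * m)" by (intro cpos_mult cpos_square sn m(1))
  then have "x * n = 0" using eq by (intro zero_if_square_negative) simp
  then have nnm: "n * n * m = 0" using eq by simp
  have "n * (b * n) = - (n * (n * m))" by (simp add: bn)
  also have "\<dots> = 0" using nnm by (simp add: mult.assoc)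
  finally have "n * (b * n) = 0" .
  have "n * n * n = n * (m - b) * n" by (simp add: n_def)
  also have "\<dots> = n * (m * n) - n * (b * n)" by (simp only: right_diff_distrib left_diff_distrib mult.assoc)
  also have "\<dots> = 0" using nnm \<open>n * (b * n) = 0\<close> by (simp add: mult.assoc flip: nm)
  finally have "n * n * n = 0" .
  then have "norm ((n * n) * (n * n)) = 0" by (simp add: mult.assoc[symmetric])
  moreover have "norm ((n * n) * (n * n)) = (norm (n * n))\<^sup>2"
    by (rule norm_self_adjoint_square) (simp add: star_mult sn)
  ultimately have "n * n = 0" by simp
  then have "n = 0" using norm_self_adjoint_square[OF sn] by simp
  then show ?thesis using m(1) by (simp add: n_def b_def)
qed

lemma cpos_conjugate: "cpos a \<Longrightarrow> cpos (star c * a * c)"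
proof -
  assume "cpos a"
  then obtain h where h: "star h = h" "a = h * h" by (auto simp: cpos_def)
  then have "star c * a * c = star (h * c) * (h * c)" by (simp add: star_mult mult.assoc)
  then show ?thesis by (metis cpos_star_mult)
qed

text \<open>Conjugation of K - a \<ge> 0 by c. With a = star x * x this is the estimate that bounds
  left multiplication by x on the Hilbert module.\<close>

lemma cpos_conjugate_bound:
  assumes "star a = a" "norm a \<le> K"
  shows "cpos (K *\<^sub>R (star c * c) - star c * a * c)"
proof (cases "K = 0")
  case False
  then have "0 < K" using assms(2) norm_ge_zero[of a] by linarith
  have "star c * (K *\<^sub>R 1 - a) * c = K *\<^sub>R (star c * c) - star c * a * c" by (simp add: algebra_simps)
  then show ?thesis using cpos_conjugate[OF cpos_bound_minus[OF assms \<open>0 < K\<close>], of c] by simp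
qed (use assms in simp)

subsection \<open>Automorphisms\<close>

text \<open>That a self-adjoint h is a contraction is witnessed by a commuting self-adjoint y with h
  * h + y * y = 1. This certificate is algebraic, so a unital *-homomorphism preserves it; no
  spectrum is involved.\<close>

lemma unital_star_hom_contractive:
  fixes \<phi> :: "'a::unital_cstar_algebra \<Rightarrow> 'b::unital_cstar_algebra"
  assumes add: "\<And>x y. \<phi> (x + y) = \<phi> x + \<phi> y" and scal: "\<And>c x. \<phi> (scaleC c x) = scaleC c (\<phi> x)"
    and mult: "\<And>x y. \<phi> (x * y) = \<phi> x * \<phi> y" and star: "\<And>x. \<phi> (star x) = star (\<phi> x)"
    and one: "\<phi> 1 = 1"
  shows "norm (\<phi> x) \<le> norm x"
proof -
  have diff: "\<phi> (x - y) = \<phi> x - \<phi> y" for x y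
    using add[of "x - y" y] by (simp add: algebra_simps)
  have scalR: "\<phi> (r *\<^sub>R x) = r *\<^sub>R \<phi> x" for r x by (simp add: scaleR_scaleC scal)
  have unit_ball: "norm (\<phi> h) \<le> 1" if h: "star h = h" "norm h \<le> 1" for h
  proof -
    have z: "norm (h * h) \<le> 1" using h by (simp add: norm_self_adjoint_square power_le_one)
    define y where "y = 1 - sqrt_defect (h * h)"
    have yy: "y * y = 1 - h * h" unfolding y_def by (rule square_one_minus_sqrt_defect[OF z])
    have sy: "star y = y"
      unfolding y_def by (simp add: star_diff star_sqrt_defect[OF z] star_mult h)
    have hy: "h * y = y * h"
      unfolding y_def using commute_sqrt_defect[OF z, of h] by (simp add: algebra_simps mult.assoc)
    show ?thesis
    proof (rule norm_le_one_of_squares_sum_one)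
      show "star (\<phi> h) = \<phi> h" "star (\<phi> y) = \<phi> y" using star h sy by metis+
      show "\<phi> h * \<phi> y = \<phi> y * \<phi> h" using hy mult by metis
      have "h * h + y * y = 1" by (simp add: yy)
      then show "\<phi> h * \<phi> h + \<phi> y * \<phi> y = 1" using mult add one by metis
    qed
  qed
  have sa: "norm (\<phi> h) \<le> norm h" if h: "star h = h" for h
  proof (cases "h = 0")
    case True
    then show ?thesis using scalR[of 0 h] by simp
  next
    case False
    have "norm (\<phi> ((1 / norm h) *\<^sub>R h)) \<le> 1"
      by (rule unit_ball) (use False h in \<open>auto simp: star_scaleR\<close>)
    then show ?thesis using False by (simp add: scalR divide_simps)
  qed
  have "(norm (\<phi> x))\<^sup>2 = norm (\<phi> (star x * x))" by (simp add: norm_star_mult mult star)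
  also have "\<dots> \<le> norm (star x * x)" by (rule sa) (simp add: star_mult star_star)
  also have "\<dots> = (norm x)\<^sup>2" by (rule norm_star_mult)
  finally show ?thesis by (rule power2_le_imp_le) simp
qed

definition star_auto :: "('a::unital_cstar_algebra \<Rightarrow> 'a) \<Rightarrow> bool" where
  "star_auto \<phi> \<longleftrightarrow> star_automorphism cstar_univ \<phi>"

lemma star_auto_iff:
  "star_auto \<phi> \<longleftrightarrow> bij \<phi> \<and> (\<forall>x y. \<phi> (x + y) = \<phi> x + \<phi> y) \<and> (\<forall>c x. \<phi> (scaleC c x) = scaleC c (\<phi> x)) \<and>
    (\<forall>x y. \<phi> (x * y) = \<phi> x * \<phi> y) \<and> (\<forall>x. \<phi> (star x) = star (\<phi> x))"
  by (simp add: star_auto_def star_automorphism_def cstar_univ_def)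

lemma star_auto_id: "star_auto (\<lambda>x. x)"
  by (simp add: star_auto_iff bij_id[unfolded id_def])

lemma star_auto_comp: "star_auto \<phi> \<Longrightarrow> star_auto \<psi> \<Longrightarrow> star_auto (\<phi> \<circ> \<psi>)"
  by (simp add: star_auto_iff bij_comp)

lemma star_auto_inv:
  assumes "star_auto \<phi>" shows "star_auto (inv \<phi>)"
proof -
  have b: "bij \<phi>" using assms by (simp add: star_auto_iff)
  have r: "\<phi> (inv \<phi> x) = x" "inv \<phi> (\<phi> x) = x" for x
    using b by (simp_all add: bij_is_surj surj_f_inv_f bij_is_inj)
  have e: "inv \<phi> y = x" if "y = \<phi> x" for x y using that r by simp
  show ?thesis
    unfolding star_auto_iff
    by (intro conjI allI bij_imp_bij_inv b e) (use assms r in \<open>simp_all add: star_auto_iff\<close>)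
qed

locale star_aut =
  fixes \<phi> :: "'a::unital_cstar_algebra \<Rightarrow> 'a"
  assumes star_auto: "star_auto \<phi>"
begin

lemma bij: "bij \<phi>" and add: "\<phi> (x + y) = \<phi> x + \<phi> y" and scaleC: "\<phi> (scaleC c x) = scaleC c (\<phi> x)"
  and mult: "\<phi> (x * y) = \<phi> x * \<phi> y" and star: "\<phi> (star x) = star (\<phi> x)"
  using star_auto by (simp_all add: star_auto_iff)

lemma one [simp]: "\<phi> 1 = 1"
proof -
  obtain e where "\<phi> e = 1" using bij by (metis bij_pointE)
  then have "1 = \<phi> (1 * e)" by simp
  also have "\<dots> = \<phi> 1 * 1" using \<open>\<phi> e = 1\<close> by (simp only: mult)
  finally show ?thesis by simp
qed

lemma norm_le: "norm (\<phi> x) \<le> norm x"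
  by (rule unital_star_hom_contractive) (simp_all add: add scaleC mult star)

lemma scaleR: "\<phi> (r *\<^sub>R x) = r *\<^sub>R \<phi> x"
  by (simp add: scaleR_scaleC scaleC)

lemma bounded_linear: "bounded_linear \<phi>"
  by (rule bounded_linear_intro[where K=1]) (auto simp: add scaleR norm_le)

lemma zero [simp]: "\<phi> 0 = 0"
  by (rule linear_0[OF bounded_linear.linear[OF bounded_linear]])

lemma diff: "\<phi> (x - y) = \<phi> x - \<phi> y"
  by (rule linear_diff[OF bounded_linear.linear[OF bounded_linear]])

lemma sum: "\<phi> (sum f A) = (\<Sum>i\<in>A. \<phi> (f i))"
  by (rule linear_sum[OF bounded_linear.linear[OF bounded_linear]])

lemma cpos: "cpos a \<Longrightarrow> cpos (\<phi> a)"
  by (auto simp: cpos_def mult) (metis star)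

end

lemma (in star_aut) norm [simp]: "norm (\<phi> x) = norm x"
proof -
  interpret i: star_aut "inv \<phi>" by standard (rule star_auto_inv[OF star_auto])
  have "norm x = norm (inv \<phi> (\<phi> x))" using bij by (simp add: bij_is_inj)
  also have "\<dots> \<le> norm (\<phi> x)" by (rule i.norm_le)
  finally show ?thesis using norm_le[of x] by simp
qed

subsection \<open>Unitaries near approximate unitaries\<close>

definition neumann :: "'a::unital_cstar_algebra \<Rightarrow> 'a" where
  "neumann w = (\<Sum>n. w ^ n)"

context
  fixes w :: "'a::unital_cstar_algebra"
  assumes w: "norm w \<le> 1/2"
begin

lemma norm_neumann_term: "norm (w ^ n) \<le> (1/2) ^ n"
proof (cases n)
  case (Suc m)
  then have "norm (w ^ n) \<le> norm w ^ n" using norm_power_Suc by blast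
  also have "\<dots> \<le> (1/2) ^ n" using w by (intro power_mono) auto
  finally show ?thesis .
qed (simp add: norm_one_le)

lemma summable_neumann: "summable (\<lambda>n. w ^ n)"
  by (rule summable_comparison_test'[OF summable_geometric[of "1/2 :: real"], of 0])
    (use norm_neumann_term in auto)

lemma norm_neumann_le: "norm (neumann w) \<le> 2"
proof -
  have s: "summable (\<lambda>n. norm (w ^ n))"
    by (rule summable_comparison_test'[OF summable_geometric[of "1/2 :: real"], of 0])
      (use norm_neumann_term in auto)
  have "norm (neumann w) \<le> (\<Sum>n. norm (w ^ n))"
    unfolding neumann_def by (rule summable_norm[OF s])
  also have "\<dots> \<le> (\<Sum>n. (1/2) ^ n)"
    by (rule suminf_le[OF norm_neumann_term s]) (simp add: summable_geometric)
  also have "\<dots> = 2" by (simp add: suminf_geometric)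
  finally show ?thesis .
qed

lemma neumann_split: "neumann w = 1 + (\<Sum>n. w ^ Suc n)"
  unfolding neumann_def using suminf_split_head[OF summable_neumann] by simp

lemma neumann_left: "(1 - w) * neumann w = 1"
  using neumann_split suminf_mult[OF summable_neumann, of w] by (simp add: algebra_simps neumann_def)

lemma neumann_right: "neumann w * (1 - w) = 1"
  using neumann_split suminf_mult2[OF summable_neumann, of w]
  by (simp add: algebra_simps neumann_def power_commutes)

lemma star_neumann: "star (neumann w) = neumann (star w)"
  unfolding neumann_def
  by (subst bounded_linear.suminf[OF bounded_linear_star summable_neumann]) (simp add: star_power)

end

lemma (in star_aut) neumann:
  fixes w :: 'a
  assumes "norm w \<le> 1/2"
  shows "\<phi> (neumann w) = neumann (\<phi> w)"
proof -
  have "norm (\<phi> w) \<le> 1/2" using assms by simp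
  have "\<phi> (neumann w) * (1 - \<phi> w) = 1"
    by (metis neumann_right[OF assms] mult diff one)
  then have "\<phi> (neumann w) * ((1 - \<phi> w) * neumann (\<phi> w)) = neumann (\<phi> w)"
    by (simp flip: mult.assoc)
  then show ?thesis by (simp add: neumann_left[OF \<open>norm (\<phi> w) \<le> 1/2\<close>])
qed

text \<open>Resolvent identity; the constant 4 is the product of the bounds 2 for the two Neumann
  series.\<close>

lemma neumann_lipschitz:
  fixes w w' :: "'a::unital_cstar_algebra"
  assumes "norm w \<le> 1/2" "norm w' \<le> 1/2"
  shows "norm (neumann w - neumann w') \<le> 4 * norm (w - w')"
proof -
  have "neumann w * ((1 - w') - (1 - w)) * neumann w'
      = neumann w * ((1 - w') * neumann w') - (neumann w * (1 - w)) * neumann w'"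
    by (simp only: left_diff_distrib right_diff_distrib mult.assoc)
  also have "\<dots> = neumann w - neumann w'"
    by (simp only: neumann_left[OF assms(2)] neumann_right[OF assms(1)] mult_1_left mult_1_right)
  finally have eq: "neumann w - neumann w' = neumann w * (w - w') * neumann w'" by simp
  have "norm (neumann w * (w - w') * neumann w') \<le> norm (neumann w * (w - w')) * norm (neumann w')"
    by (rule norm_mult_ineq)
  also have "\<dots> \<le> norm (neumann w) * norm (w - w') * norm (neumann w')"
    by (intro mult_right_mono norm_mult_ineq) auto
  also have "\<dots> \<le> 2 * norm (w - w') * 2"
    using assms by (intro mult_mono norm_neumann_le) auto
  finally show ?thesis unfolding eq by simp
qed

text \<open>Subtracting the equations w * w = 2 w - z for the two arguments gives 2 (w - w') = (z -
  z') + (w * w - w' * w'). As w and w' have norm at most 1/2, the last term is at most norm (w - w')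
  and is absorbed on the left.\<close>

lemma sqrt_defect_lipschitz:
  fixes z z' :: "'a::unital_cstar_algebra"
  assumes "norm z \<le> 1/2" "norm z' \<le> 1/2"
  shows "norm (sqrt_defect z - sqrt_defect z') \<le> norm (z - z')"
proof -
  have z: "norm z \<le> 1" "norm z' \<le> 1" using assms by auto
  define w w' where "w = sqrt_defect z" and "w' = sqrt_defect z'"
  have n: "norm w \<le> 1/2" "norm w' \<le> 1/2"
    unfolding w_def w'_def using norm_sqrt_defect_le[OF z(1)] norm_sqrt_defect_le[OF z(2)] assms by auto
  have "2 *\<^sub>R (w - w') = (z - z') + (w * w - w' * w')"
    unfolding w_def w'_def sqrt_defect_square[OF z(1)] sqrt_defect_square[OF z(2)]
    by (simp add: algebra_simps)
  also have "w * w - w' * w' = w * (w - w') + (w - w') * w'" by (simp add: algebra_simps)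
  finally have "2 * norm (w - w') = norm ((z - z') + (w * (w - w') + (w - w') * w'))"
    by (metis abs_numeral norm_scaleR)
  also have "\<dots> \<le> norm (z - z') + (norm w * norm (w - w') + norm (w - w') * norm w')"
    by (intro norm_triangle_mono norm_mult_ineq order_refl)
  also have "\<dots> \<le> norm (z - z') + (1/2 * norm (w - w') + norm (w - w') * (1/2))"
    by (intro add_mono mult_mono n order_refl) auto
  finally show ?thesis by (simp add: w_def w'_def)
qed

text \<open>The inverse of 1 - \<open>sqrt_defect (1 - a)\<close>, which is the square root of a; it
  is meaningful for a within 1/2 of 1, where the Neumann series is controlled.\<close>

definition inv_sqrt :: "'a::unital_cstar_algebra \<Rightarrow> 'a" where
  "inv_sqrt a = neumann (sqrt_defect (1 - a))"

definition polar :: "'a::unital_cstar_algebra \<Rightarrow> 'a" where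
  "polar x = x * inv_sqrt (star x * x)"

lemma inv_sqrt_lipschitz:
  assumes "norm (1 - a) \<le> 1/2" "norm (1 - b) \<le> 1/2"
  shows "norm (inv_sqrt a - inv_sqrt b) \<le> 4 * norm (a - b)"
proof -
  have n: "norm (sqrt_defect (1 - a)) \<le> 1/2" "norm (sqrt_defect (1 - b)) \<le> 1/2"
    using assms norm_sqrt_defect_le[of "1 - a"] norm_sqrt_defect_le[of "1 - b"] by auto
  show ?thesis
    unfolding inv_sqrt_def
    using neumann_lipschitz[OF n] sqrt_defect_lipschitz[OF assms] by (simp add: norm_minus_commute)
qed

lemma inv_sqrt_one [simp]: "inv_sqrt 1 = 1"
proof -
  have "sqrt_defect (0::'a) = 0" using norm_sqrt_defect_le[of "0::'a"] by simp
  then show ?thesis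
    unfolding inv_sqrt_def using neumann_left[of "0::'a"] by simp
qed

lemma polar_isometry:
  assumes "norm (1 - star x * x) \<le> 1/2"
  shows "star (polar x) * polar x = 1"
proof -
  define z w g where "z = 1 - star x * x" and "w = sqrt_defect z" and "g = neumann w"
  have z: "norm z \<le> 1" using assms by (simp add: z_def)
  have sz: "star z = z" by (simp add: z_def star_diff star_mult star_star)
  have n: "norm w \<le> 1/2" using assms norm_sqrt_defect_le[OF z] by (simp add: w_def z_def)
  have sw: "star w = w" by (simp add: w_def star_sqrt_defect[OF z] sz)
  have sg: "star g = g" by (simp add: g_def star_neumann[OF n] sw)
  have "star x * x = (1 - w) * (1 - w)"
    unfolding w_def square_one_minus_sqrt_defect[OF z] by (simp add: z_def)
  then have "star (x * g) * (x * g) = (g * (1 - w)) * ((1 - w) * g)"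
    by (simp add: star_mult sg mult.assoc) (metis mult.assoc)
  also have "\<dots> = 1" by (simp add: g_def neumann_left[OF n] neumann_right[OF n])
  finally show ?thesis by (simp add: polar_def inv_sqrt_def g_def w_def z_def)
qed

text \<open>The defect r = 1 - u * star u of u = \<open>polar x\<close> kills u, hence also x = u *
  (1 - w). Therefore r = r * (1 - x * star x) has norm at most half its own norm.\<close>

lemma polar_coisometry:
  assumes "norm (1 - star x * x) \<le> 1/2" "norm (1 - x * star x) \<le> 1/2"
  shows "polar x * star (polar x) = 1"
proof -
  define z w g where "z = 1 - star x * x" and "w = sqrt_defect z" and "g = neumann w"
  have z: "norm z \<le> 1" using assms by (simp add: z_def)
  have n: "norm w \<le> 1/2" using assms norm_sqrt_defect_le[OF z] by (simp add: w_def z_def)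
  define u where "u = polar x"
  have u: "u = x * g" by (simp add: u_def polar_def inv_sqrt_def g_def w_def z_def)
  have x: "x = u * (1 - w)" unfolding u mult.assoc g_def neumann_right[OF n] by simp
  define r where "r = 1 - u * star u"
  have "r * u = 0"
    unfolding r_def using polar_isometry[OF assms(1)] by (simp add: left_diff_distrib mult.assoc flip: u_def)
  then have "r * x = 0" by (subst x) (simp flip: mult.assoc)
  then have "r = r * (1 - x * star x)" by (simp add: right_diff_distrib flip: mult.assoc)
  then have "norm r \<le> norm r * norm (1 - x * star x)" by (metis norm_mult_ineq)
  also have "\<dots> \<le> norm r * (1/2)" using assms(2) by (intro mult_left_mono) auto
  finally have "r = 0" by simp
  then show ?thesis by (simp add: r_def u_def)
qed

lemma norm_polar_diff_le:
  assumes "norm (1 - star x * x) \<le> 1/2"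
  shows "norm (polar x - x) \<le> 4 * norm x * norm (1 - star x * x)"
proof -
  have "polar x - x = x * (inv_sqrt (star x * x) - inv_sqrt 1)"
    by (simp add: polar_def right_diff_distrib)
  then have "norm (polar x - x) \<le> norm x * norm (inv_sqrt (star x * x) - inv_sqrt 1)"
    by (metis norm_mult_ineq)
  also have "\<dots> \<le> norm x * (4 * norm (star x * x - 1))"
    using assms by (intro mult_left_mono inv_sqrt_lipschitz) auto
  finally show ?thesis by (simp add: norm_minus_commute)
qed

lemma continuous_on_polar:
  fixes f :: "'b::topological_space \<Rightarrow> 'a::unital_cstar_algebra"
  assumes f: "continuous_on S f" and n: "\<And>s. s \<in> S \<Longrightarrow> norm (1 - star (f s) * f s) \<le> 1/2"
  shows "continuous_on S (\<lambda>s. polar (f s))"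
proof -
  have "(4::real)-lipschitz_on {a. norm (1 - a) \<le> 1/2} inv_sqrt"
    by (rule lipschitz_onI) (auto simp: dist_norm inv_sqrt_lipschitz)
  then have "continuous_on {a::'a. norm (1 - a) \<le> 1/2} inv_sqrt"
    by (rule lipschitz_on_continuous_on)
  moreover have "continuous_on S (\<lambda>s. star (f s) * f s)"
    by (intro continuous_intros f bounded_linear.continuous_on[OF bounded_linear_star])
  ultimately have "continuous_on S (\<lambda>s. inv_sqrt (star (f s) * f s))"
    by (rule continuous_on_compose2) (use n in auto)
  then show ?thesis unfolding polar_def by (intro continuous_intros f)
qed

lemma (in star_aut) sqrt_defect:
  fixes z :: 'a
  assumes "norm z \<le> 1"
  shows "\<phi> (sqrt_defect z) = sqrt_defect (\<phi> z)"
proof -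
  have power: "\<phi> (z ^ n) = \<phi> z ^ n" for n by (induction n) (auto simp: mult)
  show ?thesis
    unfolding sqrt_defect_def
    by (subst bounded_linear.suminf[OF bounded_linear summable_sqrt_term[OF assms]])
      (simp add: scaleR power)
qed

lemma (in star_aut) inv_sqrt:
  assumes "norm (1 - a) \<le> 1/2"
  shows "\<phi> (inv_sqrt a) = inv_sqrt (\<phi> a)"
proof -
  have n: "norm (1 - a) \<le> 1" using assms by simp
  show ?thesis
    unfolding inv_sqrt_def
    using neumann[of "sqrt_defect (1 - a)"] norm_sqrt_defect_le[OF n] assms
    by (simp add: sqrt_defect[OF n] diff)
qed

section \<open>Seminormed *-algebras given by records\<close>

text \<open>In a convolution algebra over the circle, values off the circle are junk; therefore the laws that
  involve products and adjoints are only required up to elements of norm 0.\<close>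

locale star_prealgebra =
  fixes B :: "'b star_alg" (structure)
  assumes zer_closed [simp, intro]: "\<zero> \<in> carr B"
    and plu_closed [simp, intro]: "\<And>x y. x \<in> carr B \<Longrightarrow> y \<in> carr B \<Longrightarrow> x \<boxplus> y \<in> carr B"
    and scal_closed [simp, intro]: "\<And>c x. x \<in> carr B \<Longrightarrow> c \<cdot> x \<in> carr B"
    and mul_closed [simp, intro]: "\<And>x y. x \<in> carr B \<Longrightarrow> y \<in> carr B \<Longrightarrow> x \<boxtimes> y \<in> carr B"
    and adj_closed [simp, intro]: "\<And>x. x \<in> carr B \<Longrightarrow> adj B x \<in> carr B"
    and plu_assoc: "\<And>x y z. x \<in> carr B \<Longrightarrow> y \<in> carr B \<Longrightarrow> z \<in> carr B \<Longrightarrow> (x \<boxplus> y) \<boxplus> z = x \<boxplus> (y \<boxplus> z)"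
    and plu_comm: "\<And>x y. x \<in> carr B \<Longrightarrow> y \<in> carr B \<Longrightarrow> x \<boxplus> y = y \<boxplus> x"
    and plu_zero: "\<And>x. x \<in> carr B \<Longrightarrow> x \<boxplus> \<zero> = x"
    and scal_plu: "\<And>c x y. x \<in> carr B \<Longrightarrow> y \<in> carr B \<Longrightarrow> c \<cdot> (x \<boxplus> y) = c \<cdot> x \<boxplus> c \<cdot> y"
    and plu_scal: "\<And>c d x. x \<in> carr B \<Longrightarrow> (c + d) \<cdot> x = c \<cdot> x \<boxplus> d \<cdot> x"
    and scal_scal: "\<And>c d x. x \<in> carr B \<Longrightarrow> c \<cdot> (d \<cdot> x) = (c * d) \<cdot> x"
    and scal_one: "\<And>x. x \<in> carr B \<Longrightarrow> 1 \<cdot> x = x"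
    and scal_zero: "\<And>x. x \<in> carr B \<Longrightarrow> 0 \<cdot> x = \<zero>"
    and nrm_nonneg [simp]: "\<And>x. x \<in> carr B \<Longrightarrow> 0 \<le> nrm B x"
    and nrm_triangle: "\<And>x y. x \<in> carr B \<Longrightarrow> y \<in> carr B \<Longrightarrow> nrm B (x \<boxplus> y) \<le> nrm B x + nrm B y"
    and nrm_scal: "\<And>c x. x \<in> carr B \<Longrightarrow> nrm B (c \<cdot> x) = cmod c * nrm B x"
    and mul_plu_left: "\<And>x y z. x \<in> carr B \<Longrightarrow> y \<in> carr B \<Longrightarrow> z \<in> carr B \<Longrightarrow>
      nrm B ((x \<boxplus> y) \<boxtimes> z \<boxminus> (x \<boxtimes> z \<boxplus> y \<boxtimes> z)) = 0"
    and mul_plu_right: "\<And>x y z. x \<in> carr B \<Longrightarrow> y \<in> carr B \<Longrightarrow> z \<in> carr B \<Longrightarrow>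
      nrm B (z \<boxtimes> (x \<boxplus> y) \<boxminus> (z \<boxtimes> x \<boxplus> z \<boxtimes> y)) = 0"
    and mul_scal_left: "\<And>c x y. x \<in> carr B \<Longrightarrow> y \<in> carr B \<Longrightarrow> nrm B ((c \<cdot> x) \<boxtimes> y \<boxminus> c \<cdot> (x \<boxtimes> y)) = 0"
    and mul_scal_right: "\<And>c x y. x \<in> carr B \<Longrightarrow> y \<in> carr B \<Longrightarrow> nrm B (x \<boxtimes> (c \<cdot> y) \<boxminus> c \<cdot> (x \<boxtimes> y)) = 0"
    and mul_assoc: "\<And>x y z. x \<in> carr B \<Longrightarrow> y \<in> carr B \<Longrightarrow> z \<in> carr B \<Longrightarrow>
      nrm B ((x \<boxtimes> y) \<boxtimes> z \<boxminus> x \<boxtimes> (y \<boxtimes> z)) = 0"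
    and adj_plu: "\<And>x y. x \<in> carr B \<Longrightarrow> y \<in> carr B \<Longrightarrow> nrm B (adj B (x \<boxplus> y) \<boxminus> (adj B x \<boxplus> adj B y)) = 0"
    and adj_scal: "\<And>c x. x \<in> carr B \<Longrightarrow> nrm B (adj B (c \<cdot> x) \<boxminus> cnj c \<cdot> adj B x) = 0"
    and adj_mul: "\<And>x y. x \<in> carr B \<Longrightarrow> y \<in> carr B \<Longrightarrow> nrm B (adj B (x \<boxtimes> y) \<boxminus> adj B y \<boxtimes> adj B x) = 0"
    and adj_adj: "\<And>x. x \<in> carr B \<Longrightarrow> nrm B (adj B (adj B x) \<boxminus> x) = 0"
begin

lemma minus_closed [simp, intro]: "x \<in> carr B \<Longrightarrow> y \<in> carr B \<Longrightarrow> x \<boxminus> y \<in> carr B"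
  by (simp add: alg_minus_def)

lemma plu_left_comm:
  "x \<in> carr B \<Longrightarrow> y \<in> carr B \<Longrightarrow> z \<in> carr B \<Longrightarrow> x \<boxplus> (y \<boxplus> z) = y \<boxplus> (x \<boxplus> z)"
  by (metis plu_assoc plu_comm)

lemmas plu_ac = plu_assoc plu_comm plu_left_comm

lemma minus_self: "x \<in> carr B \<Longrightarrow> x \<boxminus> x = \<zero>"
  using plu_scal[of x 1 "-1"] by (simp add: alg_minus_def scal_one scal_zero)

lemma nrm_zer [simp]: "nrm B \<zero> = 0"
  using nrm_scal[of \<zero> 0] by (simp add: scal_zero)

lemma nrm_minus_self [simp]: "x \<in> carr B \<Longrightarrow> nrm B (x \<boxminus> x) = 0"
  by (simp add: minus_self)

lemma cancel_middle:
  assumes "x \<in> carr B" "y \<in> carr B" "z \<in> carr B"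
  shows "(x \<boxminus> y) \<boxplus> (y \<boxminus> z) = x \<boxminus> z"
proof -
  have "(x \<boxminus> y) \<boxplus> (y \<boxminus> z) = x \<boxplus> ((y \<boxminus> y) \<boxplus> (-1) \<cdot> z)"
    using assms by (simp add: alg_minus_def plu_ac)
  also have "\<dots> = x \<boxminus> z"
    using assms minus_self[of y] plu_comm[of \<zero> "(-1) \<cdot> z"] by (simp only: plu_zero scal_closed zer_closed alg_minus_def)
  finally show ?thesis .
qed

lemma dist_triangle:
  assumes "x \<in> carr B" "y \<in> carr B" "z \<in> carr B"
  shows "nrm B (x \<boxminus> z) \<le> nrm B (x \<boxminus> y) + nrm B (y \<boxminus> z)"
  using nrm_triangle[of "x \<boxminus> y" "y \<boxminus> z"] assms by (simp add: cancel_middle)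

lemma scal_minus:
  assumes "x \<in> carr B" "y \<in> carr B"
  shows "c \<cdot> (x \<boxminus> y) = c \<cdot> x \<boxminus> c \<cdot> y"
  using assms by (simp add: alg_minus_def scal_plu scal_scal mult.commute)

lemma dist_scal:
  "x \<in> carr B \<Longrightarrow> y \<in> carr B \<Longrightarrow> nrm B (c \<cdot> x \<boxminus> c \<cdot> y) = cmod c * nrm B (x \<boxminus> y)"
  by (simp add: nrm_scal flip: scal_minus)

lemma dist_commute:
  assumes "x \<in> carr B" "y \<in> carr B"
  shows "nrm B (x \<boxminus> y) = nrm B (y \<boxminus> x)"
proof -
  have "y \<boxminus> x = (-1) \<cdot> (x \<boxminus> y)"
    using assms by (simp add: alg_minus_def scal_plu scal_scal scal_one plu_comm)
  then show ?thesis using nrm_scal[of "x \<boxminus> y" "-1"] assms by simp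
qed

lemma plu_minus_plu:
  assumes "x \<in> carr B" "y \<in> carr B" "x' \<in> carr B" "y' \<in> carr B"
  shows "(x \<boxplus> y) \<boxminus> (x' \<boxplus> y') = (x \<boxminus> x') \<boxplus> (y \<boxminus> y')"
  using assms by (simp add: alg_minus_def scal_plu plu_ac)

lemma dist_plu:
  assumes "x \<in> carr B" "y \<in> carr B" "x' \<in> carr B" "y' \<in> carr B"
  shows "nrm B ((x \<boxplus> y) \<boxminus> (x' \<boxplus> y')) \<le> nrm B (x \<boxminus> x') + nrm B (y \<boxminus> y')"
  using assms nrm_triangle[of "x \<boxminus> x'" "y \<boxminus> y'"] by (simp add: plu_minus_plu)

lemma dist_minus:
  assumes "x \<in> carr B" "y \<in> carr B" "x' \<in> carr B" "y' \<in> carr B"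
  shows "nrm B ((x \<boxminus> y) \<boxminus> (x' \<boxminus> y')) \<le> nrm B (x \<boxminus> x') + nrm B (y \<boxminus> y')"
  using dist_plu[of x "(-1) \<cdot> y" x' "(-1) \<cdot> y'"] assms dist_scal[of y y' "-1"] by (simp add: alg_minus_def)

lemma minus_plu_cancel: "x \<in> carr B \<Longrightarrow> y \<in> carr B \<Longrightarrow> (x \<boxminus> y) \<boxplus> y = x"
  using plu_minus_plu[of x \<zero> y y] cancel_middle[of x y \<zero>]
  by (metis alg_minus_def plu_zero scal_zero scal_scal mult_zero_right zer_closed scal_closed)

lemma nrm_le_dist: "x \<in> carr B \<Longrightarrow> y \<in> carr B \<Longrightarrow> nrm B x \<le> nrm B (x \<boxminus> y) + nrm B y"
  using nrm_triangle[of "x \<boxminus> y" y] by (simp add: minus_plu_cancel)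

lemma nrm_minus_le: "x \<in> carr B \<Longrightarrow> y \<in> carr B \<Longrightarrow> nrm B (x \<boxminus> y) \<le> nrm B x + nrm B y"
  using nrm_triangle[of x "(-1) \<cdot> y"] by (simp add: alg_minus_def nrm_scal)

lemma abs_nrm_diff_le:
  "x \<in> carr B \<Longrightarrow> y \<in> carr B \<Longrightarrow> \<bar>nrm B x - nrm B y\<bar> \<le> nrm B (x \<boxminus> y)"
  using nrm_le_dist[of x y] nrm_le_dist[of y x] dist_commute[of x y] by simp

lemma dist_zero_trans:
  assumes "x \<in> carr B" "y \<in> carr B" "z \<in> carr B" "nrm B (x \<boxminus> y) = 0" "nrm B (y \<boxminus> z) = 0"
  shows "nrm B (x \<boxminus> z) = 0"
  using dist_triangle[of x y z] nrm_nonneg[of "x \<boxminus> z"] assms minus_closed by (metis add_0 antisym)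

lemma nrm_eq_of_dist_zero:
  assumes "x \<in> carr B" "y \<in> carr B" "nrm B (x \<boxminus> y) = 0"
  shows "nrm B x = nrm B y"
  using abs_nrm_diff_le[of x y] assms by simp

lemma dist_mul_minus_right:
  assumes "x \<in> carr B" "y \<in> carr B" "z \<in> carr B"
  shows "nrm B ((x \<boxtimes> y \<boxminus> x \<boxtimes> z) \<boxminus> x \<boxtimes> (y \<boxminus> z)) = 0"
proof -
  have a: "nrm B (x \<boxtimes> (y \<boxminus> z) \<boxminus> (x \<boxtimes> y \<boxplus> x \<boxtimes> ((-1) \<cdot> z))) = 0"
    unfolding alg_minus_def[of B y z] by (rule mul_plu_right) (use assms in auto)
  have b: "nrm B ((x \<boxtimes> y \<boxplus> x \<boxtimes> ((-1) \<cdot> z)) \<boxminus> (x \<boxtimes> y \<boxminus> x \<boxtimes> z)) = 0"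
    unfolding alg_minus_def[of B "x \<boxtimes> y" "x \<boxtimes> z"]
    using dist_plu[of "x \<boxtimes> y" "x \<boxtimes> ((-1) \<cdot> z)" "x \<boxtimes> y" "(-1) \<cdot> (x \<boxtimes> z)"] assms mul_scal_right[of x z "-1"]
    by (auto intro!: antisym)
  show ?thesis using dist_zero_trans[OF _ _ _ a b] assms by (subst dist_commute) auto
qed

lemma dist_mul_minus_left:
  assumes "x \<in> carr B" "y \<in> carr B" "z \<in> carr B"
  shows "nrm B ((y \<boxtimes> x \<boxminus> z \<boxtimes> x) \<boxminus> (y \<boxminus> z) \<boxtimes> x) = 0"
proof -
  have a: "nrm B ((y \<boxminus> z) \<boxtimes> x \<boxminus> (y \<boxtimes> x \<boxplus> ((-1) \<cdot> z) \<boxtimes> x)) = 0"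
    unfolding alg_minus_def[of B y z] by (rule mul_plu_left) (use assms in auto)
  have b: "nrm B ((y \<boxtimes> x \<boxplus> ((-1) \<cdot> z) \<boxtimes> x) \<boxminus> (y \<boxtimes> x \<boxminus> z \<boxtimes> x)) = 0"
    unfolding alg_minus_def[of B "y \<boxtimes> x" "z \<boxtimes> x"]
    using dist_plu[of "y \<boxtimes> x" "((-1) \<cdot> z) \<boxtimes> x" "y \<boxtimes> x" "(-1) \<cdot> (z \<boxtimes> x)"] assms mul_scal_left[of z x "-1"]
    by (auto intro!: antisym)
  show ?thesis using dist_zero_trans[OF _ _ _ a b] assms by (subst dist_commute) auto
qed

lemma dist_adj_minus:
  assumes "x \<in> carr B" "y \<in> carr B"
  shows "nrm B ((adj B x \<boxminus> adj B y) \<boxminus> adj B (x \<boxminus> y)) = 0"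
proof -
  have a: "nrm B (adj B (x \<boxminus> y) \<boxminus> (adj B x \<boxplus> adj B ((-1) \<cdot> y))) = 0"
    unfolding alg_minus_def[of B x y] by (rule adj_plu) (use assms in auto)
  have b: "nrm B ((adj B x \<boxplus> adj B ((-1) \<cdot> y)) \<boxminus> (adj B x \<boxminus> adj B y)) = 0"
    unfolding alg_minus_def[of B "adj B x" "adj B y"]
    using dist_plu[of "adj B x" "adj B ((-1) \<cdot> y)" "adj B x" "(-1) \<cdot> adj B y"] assms adj_scal[of y "-1"]
    by (auto intro!: antisym)
  show ?thesis using dist_zero_trans[OF _ _ _ a b] assms by (subst dist_commute) auto
qed

end

locale cstar_prealgebra = star_prealgebra B for B :: "'b star_alg" (structure) +
  assumes nrm_mul: "\<And>x y. x \<in> carr B \<Longrightarrow> y \<in> carr B \<Longrightarrow> nrm B (x \<boxtimes> y) \<le> nrm B x * nrm B y"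
    and nrm_cstar: "\<And>x. x \<in> carr B \<Longrightarrow> nrm B (adj B x \<boxtimes> x) = (nrm B x)\<^sup>2"
begin

lemma nrm_adj [simp]: "x \<in> carr B \<Longrightarrow> nrm B (adj B x) = nrm B x"
proof -
  have le: "nrm B y \<le> nrm B (adj B y)" if "y \<in> carr B" for y
  proof (cases "nrm B y = 0")
    case False
    then have "0 < nrm B y" using that nrm_nonneg[of y] by linarith
    moreover have "nrm B y * nrm B y \<le> nrm B (adj B y) * nrm B y"
      using nrm_cstar[of y] nrm_mul[of "adj B y" y] that by (simp add: power2_eq_square)
    ultimately show ?thesis by simp
  qed (use that in simp)
  assume x: "x \<in> carr B"
  then have "nrm B (adj B (adj B x)) = nrm B x" by (intro nrm_eq_of_dist_zero adj_adj) auto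
  then show ?thesis using le[of x] le[of "adj B x"] x by simp
qed

lemma dist_mul_left:
  assumes "x \<in> carr B" "y \<in> carr B" "z \<in> carr B"
  shows "nrm B (x \<boxtimes> y \<boxminus> x \<boxtimes> z) \<le> nrm B x * nrm B (y \<boxminus> z)"
  using nrm_eq_of_dist_zero[OF _ _ dist_mul_minus_right[OF assms]] nrm_mul[of x "y \<boxminus> z"] assms by simp

lemma dist_mul_right:
  assumes "x \<in> carr B" "y \<in> carr B" "z \<in> carr B"
  shows "nrm B (y \<boxtimes> x \<boxminus> z \<boxtimes> x) \<le> nrm B (y \<boxminus> z) * nrm B x"
  using nrm_eq_of_dist_zero[OF _ _ dist_mul_minus_left[OF assms]] nrm_mul[of "y \<boxminus> z" x] assms by simp

lemma dist_mul:
  assumes "x \<in> carr B" "y \<in> carr B" "x' \<in> carr B" "y' \<in> carr B"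
  shows "nrm B (x \<boxtimes> y \<boxminus> x' \<boxtimes> y') \<le> nrm B x * nrm B (y \<boxminus> y') + nrm B (x \<boxminus> x') * nrm B y'"
  using dist_triangle[of "x \<boxtimes> y" "x \<boxtimes> y'" "x' \<boxtimes> y'"] dist_mul_left[of x y y'] dist_mul_right[of y' x x'] assms
  by auto

lemma dist_adj:
  assumes "x \<in> carr B" "y \<in> carr B"
  shows "nrm B (adj B x \<boxminus> adj B y) = nrm B (x \<boxminus> y)"
  using nrm_eq_of_dist_zero[OF _ _ dist_adj_minus[OF assms]] assms by simp

end

locale cstar_normed = cstar_prealgebra B for B :: "'b star_alg" (structure) +
  assumes separated: "\<And>x y. x \<in> carr B \<Longrightarrow> y \<in> carr B \<Longrightarrow> nrm B (x \<boxminus> y) = 0 \<Longrightarrow> x = y"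
begin

lemma mul_assoc_eq:
  "x \<in> carr B \<Longrightarrow> y \<in> carr B \<Longrightarrow> z \<in> carr B \<Longrightarrow> (x \<boxtimes> y) \<boxtimes> z = x \<boxtimes> (y \<boxtimes> z)"
  by (rule separated[OF _ _ mul_assoc]) auto

lemma adj_mul_eq: "x \<in> carr B \<Longrightarrow> y \<in> carr B \<Longrightarrow> adj B (x \<boxtimes> y) = adj B y \<boxtimes> adj B x"
  by (rule separated[OF _ _ adj_mul]) auto

lemma adj_adj_eq [simp]: "x \<in> carr B \<Longrightarrow> adj B (adj B x) = x"
  by (rule separated[OF _ _ adj_adj]) auto

lemma unit_of_eqI:
  assumes "e \<in> carr B" "\<And>x. x \<in> carr B \<Longrightarrow> e \<boxtimes> x = x" "\<And>x. x \<in> carr B \<Longrightarrow> x \<boxtimes> e = x"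
  shows "unit_of B = e"
  unfolding unit_of_def
proof (rule the_equality)
  fix e' assume "e' \<in> carr B \<and> (\<forall>x\<in>carr B. e' \<boxtimes> x = x \<and> x \<boxtimes> e' = x)"
  then show "e' = e" using assms by metis
qed (use assms in auto)

text \<open>Turning limits of norms into a transitive relation that respects products and adjoints
  allows asymptotic identities to be chained. Membership in the carrier is demanded from time 0 on,
  as paths are arbitrary elsewhere.\<close>

definition asymptotic :: "(real \<Rightarrow> 'b) \<Rightarrow> (real \<Rightarrow> 'b) \<Rightarrow> bool" (infix "\<doteq>" 50) where
  "f \<doteq> g \<longleftrightarrow> (\<forall>t\<ge>0. f t \<in> carr B \<and> g t \<in> carr B) \<and> ((\<lambda>t. nrm B (f t \<boxminus> g t)) \<longlongrightarrow> 0) at_top"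

definition bounded_path :: "(real \<Rightarrow> 'b) \<Rightarrow> bool" where
  "bounded_path f \<longleftrightarrow> (\<exists>K. \<forall>t\<ge>0. f t \<in> carr B \<and> nrm B (f t) \<le> K)"

lemma eventually_at_top_nonneg: "(\<And>t::real. 0 \<le> t \<Longrightarrow> P t) \<Longrightarrow> eventually P at_top"
  using eventually_ge_at_top[of "0::real"] by (rule eventually_mono)

lemma asymptoticI:
  assumes "\<And>t. 0 \<le> t \<Longrightarrow> f t \<in> carr B" "\<And>t. 0 \<le> t \<Longrightarrow> g t \<in> carr B"
    "\<And>t. 0 \<le> t \<Longrightarrow> nrm B (f t \<boxminus> g t) \<le> r t" "(r \<longlongrightarrow> 0) at_top"
  shows "f \<doteq> g"
  unfolding asymptotic_def
proof (intro conjI)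
  show "((\<lambda>t. nrm B (f t \<boxminus> g t)) \<longlongrightarrow> 0) at_top"
    by (rule tendsto_sandwich[OF _ _ tendsto_const assms(4)]) (auto intro!: eventually_at_top_nonneg simp: assms)
qed (use assms in auto)

lemma asymptotic_sym: "f \<doteq> g \<Longrightarrow> g \<doteq> f"
  by (rule asymptoticI[where r="\<lambda>t. nrm B (f t \<boxminus> g t)"]) (auto simp: asymptotic_def dist_commute)

lemma asymptotic_trans [trans]:
  assumes "f \<doteq> g" "g \<doteq> h" shows "f \<doteq> h"
  by (rule asymptoticI[where r="\<lambda>t. nrm B (f t \<boxminus> g t) + nrm B (g t \<boxminus> h t)"])
    (use assms in \<open>auto simp: asymptotic_def intro!: dist_triangle tendsto_add_zero\<close>)

lemma asymptotic_cong:
  assumes "f \<doteq> g" "\<And>t. 0 \<le> t \<Longrightarrow> f t = f' t" "\<And>t. 0 \<le> t \<Longrightarrow> g t = g' t" shows "f' \<doteq> g'"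
  by (rule asymptoticI[where r="\<lambda>t. nrm B (f t \<boxminus> g t)"])
    (use assms in \<open>auto simp: asymptotic_def\<close>)

lemma asymptotic_carr: "f \<doteq> g \<Longrightarrow> 0 \<le> t \<Longrightarrow> f t \<in> carr B" "f \<doteq> g \<Longrightarrow> 0 \<le> t \<Longrightarrow> g t \<in> carr B"
  by (auto simp: asymptotic_def)

lemma asymptotic_tendsto: "f \<doteq> g \<Longrightarrow> ((\<lambda>t. nrm B (f t \<boxminus> g t)) \<longlongrightarrow> 0) at_top"
  by (simp add: asymptotic_def)

lemma bounded_pathI: "(\<And>t. 0 \<le> t \<Longrightarrow> f t \<in> carr B) \<Longrightarrow> (\<And>t. 0 \<le> t \<Longrightarrow> nrm B (f t) \<le> K) \<Longrightarrow> bounded_path f"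
  by (auto simp: bounded_path_def)

lemma bounded_path_const [simp]: "x \<in> carr B \<Longrightarrow> bounded_path (\<lambda>_. x)"
  by (rule bounded_pathI) auto

lemma bounded_path_mul: "bounded_path f \<Longrightarrow> bounded_path g \<Longrightarrow> bounded_path (\<lambda>t. f t \<boxtimes> g t)"
proof -
  assume "bounded_path f" "bounded_path g"
  then obtain K L where KL: "\<And>t. 0 \<le> t \<Longrightarrow> f t \<in> carr B \<and> nrm B (f t) \<le> K"
     "\<And>t. 0 \<le> t \<Longrightarrow> g t \<in> carr B \<and> nrm B (g t) \<le> L" unfolding bounded_path_def by metis
  show ?thesis
  proof (rule bounded_pathI)
    fix t :: real assume t: "0 \<le> t"
    have "nrm B (f t \<boxtimes> g t) \<le> nrm B (f t) * nrm B (g t)" using KL t by (intro nrm_mul) auto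
    also have "\<dots> \<le> K * L" using KL[OF t] order_trans[OF nrm_nonneg[of "f t"]]
      by (intro mult_mono) auto
    finally show "nrm B (f t \<boxtimes> g t) \<le> K * L" .
  qed (use KL in auto)
qed

lemma bounded_path_adj: "bounded_path f \<Longrightarrow> bounded_path (\<lambda>t. adj B (f t))"
  unfolding bounded_path_def using nrm_adj adj_closed by metis

lemma asymptotic_mul:
  assumes "f \<doteq> f'" "g \<doteq> g'" "bounded_path f" "bounded_path g'"
  shows "(\<lambda>t. f t \<boxtimes> g t) \<doteq> (\<lambda>t. f' t \<boxtimes> g' t)"
proof -
  obtain K L where KL: "\<And>t. 0 \<le> t \<Longrightarrow> f t \<in> carr B \<and> nrm B (f t) \<le> K"
     "\<And>t. 0 \<le> t \<Longrightarrow> g' t \<in> carr B \<and> nrm B (g' t) \<le> L" using assms(3,4) unfolding bounded_path_def by metis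
  show ?thesis
  proof (rule asymptoticI)
    fix t :: real assume t: "0 \<le> t"
    have c: "f t \<in> carr B" "f' t \<in> carr B" "g t \<in> carr B" "g' t \<in> carr B"
      using asymptotic_carr[OF assms(1) t] asymptotic_carr[OF assms(2) t] by auto
    then show "f t \<boxtimes> g t \<in> carr B" "f' t \<boxtimes> g' t \<in> carr B" by auto
    have "nrm B (f t) * nrm B (g t \<boxminus> g' t) \<le> K * nrm B (g t \<boxminus> g' t)"
      using KL t c by (intro mult_right_mono) auto
    moreover have "nrm B (f t \<boxminus> f' t) * nrm B (g' t) \<le> nrm B (f t \<boxminus> f' t) * L"
      using KL t c by (intro mult_left_mono) auto
    ultimately show "nrm B (f t \<boxtimes> g t \<boxminus> f' t \<boxtimes> g' t) \<le> K * nrm B (g t \<boxminus> g' t) + nrm B (f t \<boxminus> f' t) * L"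
      using dist_mul[of "f t" "g t" "f' t" "g' t"] c by linarith
  next
    show "((\<lambda>t. K * nrm B (g t \<boxminus> g' t) + nrm B (f t \<boxminus> f' t) * L) \<longlongrightarrow> 0) at_top"
      by (intro tendsto_add_zero tendsto_mult_right_zero tendsto_mult_left_zero asymptotic_tendsto assms)
  qed
qed

lemma asymptotic_mul_left:
  assumes "g \<doteq> g'" "bounded_path f"
  shows "(\<lambda>t. f t \<boxtimes> g t) \<doteq> (\<lambda>t. f t \<boxtimes> g' t)"
proof -
  obtain K where K: "\<And>t. 0 \<le> t \<Longrightarrow> f t \<in> carr B \<and> nrm B (f t) \<le> K"
    using assms(2) unfolding bounded_path_def by metis
  show ?thesis
  proof (rule asymptoticI)
    fix t :: real assume t: "0 \<le> t"
    have c: "f t \<in> carr B" "g t \<in> carr B" "g' t \<in> carr B"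
      using asymptotic_carr[OF assms(1) t] K t by auto
    then show "f t \<boxtimes> g t \<in> carr B" "f t \<boxtimes> g' t \<in> carr B" by auto
    have "nrm B (f t) * nrm B (g t \<boxminus> g' t) \<le> K * nrm B (g t \<boxminus> g' t)"
      using K t c by (intro mult_right_mono) auto
    then show "nrm B (f t \<boxtimes> g t \<boxminus> f t \<boxtimes> g' t) \<le> K * nrm B (g t \<boxminus> g' t)"
      using dist_mul_left[of "f t" "g t" "g' t"] c by linarith
  qed (intro tendsto_mult_right_zero asymptotic_tendsto assms)
qed

lemma asymptotic_adj: "f \<doteq> g \<Longrightarrow> (\<lambda>t. adj B (f t)) \<doteq> (\<lambda>t. adj B (g t))"
  by (rule asymptoticI[where r="\<lambda>t. nrm B (f t \<boxminus> g t)"]) (auto simp: asymptotic_def dist_adj)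

text \<open>Adjoints exchange multiplication on the right with multiplication on the left.\<close>

lemma asymptotic_mul_right:
  assumes "g \<doteq> g'" "bounded_path f"
  shows "(\<lambda>t. g t \<boxtimes> f t) \<doteq> (\<lambda>t. g' t \<boxtimes> f t)"
proof -
  have f: "f t \<in> carr B" if "0 \<le> t" for t using assms(2) that by (auto simp: bounded_path_def)
  have g: "g t \<in> carr B" "g' t \<in> carr B" if "0 \<le> t" for t using assms(1) that by (auto simp: asymptotic_def)
  have "(\<lambda>t. adj B (adj B (f t) \<boxtimes> adj B (g t))) \<doteq> (\<lambda>t. adj B (adj B (f t) \<boxtimes> adj B (g' t)))"
    by (intro asymptotic_adj asymptotic_mul_left bounded_path_adj assms)
  then show ?thesis by (rule asymptotic_cong) (use f g in \<open>auto simp: adj_mul_eq\<close>)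
qed

end

section \<open>The universal norm\<close>

lemma cstar_seminormD:
  assumes "cstar_seminorm D p"
  shows "x \<in> carr D \<Longrightarrow> 0 \<le> p x"
    and "x \<in> carr D \<Longrightarrow> y \<in> carr D \<Longrightarrow> p (x \<boxplus>\<^bsub>D\<^esub> y) \<le> p x + p y"
    and "x \<in> carr D \<Longrightarrow> p (c \<cdot>\<^bsub>D\<^esub> x) = cmod c * p x"
    and "x \<in> carr D \<Longrightarrow> y \<in> carr D \<Longrightarrow> p (x \<boxtimes>\<^bsub>D\<^esub> y) \<le> p x * p y"
    and "x \<in> carr D \<Longrightarrow> p (adj D x \<boxtimes>\<^bsub>D\<^esub> x) = (p x)\<^sup>2"
  using assms by (auto simp: cstar_seminorm_def)

lemma with_universal_norm_simps [simp]:
  "carr (with_universal_norm D) = carr D" "zer (with_universal_norm D) = zer D"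
  "plu (with_universal_norm D) = plu D" "scal (with_universal_norm D) = scal D"
  "mul (with_universal_norm D) = mul D" "adj (with_universal_norm D) = adj D"
  "nrm (with_universal_norm D) = universal_norm D" "alg_minus (with_universal_norm D) = alg_minus D"
  by (simp_all add: with_universal_norm_def alg_minus_def fun_eq_iff)

context star_prealgebra
begin

abbreviation dominated :: "('b \<Rightarrow> real) set" where
  "dominated \<equiv> {p. cstar_seminorm B p \<and> (\<forall>y\<in>carr B. p y \<le> nrm B y)}"

lemma dominated_nonempty: "dominated \<noteq> {}"
proof -
  have "(\<lambda>_. 0) \<in> dominated" by (auto simp: cstar_seminorm_def)
  then show ?thesis by blast
qed

lemma bdd_above_dominated: "x \<in> carr B \<Longrightarrow> bdd_above ((\<lambda>p. p x) ` dominated)"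
  by (rule bdd_aboveI[of _ "nrm B x"]) auto

lemma dominated_le_universal: "p \<in> dominated \<Longrightarrow> x \<in> carr B \<Longrightarrow> p x \<le> universal_norm B x"
  unfolding universal_norm_def by (rule cSUP_upper[OF _ bdd_above_dominated])

lemma universal_le:
  "(\<And>p. p \<in> dominated \<Longrightarrow> p x \<le> c) \<Longrightarrow> universal_norm B x \<le> c"
  unfolding universal_norm_def by (rule cSUP_least[OF dominated_nonempty]) blast

lemma universal_le_nrm: "x \<in> carr B \<Longrightarrow> universal_norm B x \<le> nrm B x"
  by (rule universal_le) auto

lemma universal_nonneg: "x \<in> carr B \<Longrightarrow> 0 \<le> universal_norm B x"
proof -
  assume x: "x \<in> carr B"
  obtain p where p: "p \<in> dominated" using dominated_nonempty by blast
  then have "cstar_seminorm B p" by simp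
  then have "0 \<le> p x" using x by (rule cstar_seminormD(1))
  then show ?thesis using dominated_le_universal[OF p x] by simp
qed

lemma universal_zero_if: "x \<in> carr B \<Longrightarrow> nrm B x = 0 \<Longrightarrow> universal_norm B x = 0"
  using universal_le_nrm[of x] universal_nonneg[of x] by simp

text \<open>Precomposition with \<phi> sends each seminorm competing in the supremum to another
  competitor. This is how the dual maps turn out to be contractive for the universal norm.\<close>

lemma universal_invariant:
  assumes \<phi>: "\<And>x. x \<in> carr B \<Longrightarrow> \<phi> x \<in> carr B" and "\<And>p. p \<in> dominated \<Longrightarrow> (\<lambda>x. p (\<phi> x)) \<in> dominated"
    and x: "x \<in> carr B"
  shows "universal_norm B (\<phi> x) \<le> universal_norm B x"
  by (rule universal_le) (use dominated_le_universal[OF assms(2) x] in auto)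

lemma dominated_dist_zero:
  assumes p: "p \<in> dominated" and "x \<in> carr B" "y \<in> carr B" "nrm B (x \<boxminus> y) = 0"
  shows "p x = p y"
proof -
  have s: "cstar_seminorm B p" using p by simp
  have le: "p x \<le> p y" if "x \<in> carr B" "y \<in> carr B" "nrm B (x \<boxminus> y) = 0" for x y
  proof -
    have "p (x \<boxminus> y) \<le> nrm B (x \<boxminus> y)" using p that by blast
    then have "p (x \<boxminus> y) \<le> 0" using that by simp
    then show ?thesis
      using cstar_seminormD(2)[OF s, of "x \<boxminus> y" y] that by (simp add: minus_plu_cancel)
  qed
  show ?thesis using le[of x y] le[of y x] assms dist_commute[of x y] by auto
qed

text \<open>A supremum of C*-seminorms is one again. Each law yields an inequality for the supremum;
  homogeneity is reversed by scaling back with \<open>inverse c\<close>, and the C*-identity by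
  taking square roots before the supremum.\<close>

theorem cstar_prealgebra_universal: "cstar_prealgebra (with_universal_norm B)"
proof (intro cstar_prealgebra.intro cstar_prealgebra_axioms.intro star_prealgebra.intro; simp)
  show "universal_norm B (x \<boxplus> y) \<le> universal_norm B x + universal_norm B y"
    if "x \<in> carr B" "y \<in> carr B" for x y
  proof (rule universal_le)
    fix p assume p: "p \<in> dominated"
    then have "p (x \<boxplus> y) \<le> p x + p y" using cstar_seminormD(2) that by auto
    then show "p (x \<boxplus> y) \<le> universal_norm B x + universal_norm B y"
      using dominated_le_universal[OF p that(1)] dominated_le_universal[OF p that(2)] by linarith
  qed
  show "universal_norm B (c \<cdot> x) = cmod c * universal_norm B x" if x: "x \<in> carr B" for c x
  proof (cases "c = 0")
    case True
    then show ?thesis using x by (simp add: scal_zero universal_zero_if)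
  next
    case False
    have le: "universal_norm B (c \<cdot> x) \<le> cmod c * universal_norm B x" if "x \<in> carr B" for c x
    proof (rule universal_le)
      fix p assume p: "p \<in> dominated"
      then have "p (c \<cdot> x) = cmod c * p x" using cstar_seminormD(3) that by auto
      then show "p (c \<cdot> x) \<le> cmod c * universal_norm B x"
        using dominated_le_universal[OF p that] by (simp add: mult_left_mono)
    qed
    have "universal_norm B x = universal_norm B (inverse c \<cdot> c \<cdot> x)"
      using False x by (simp add: scal_scal scal_one)
    also have "\<dots> \<le> cmod (inverse c) * universal_norm B (c \<cdot> x)" using x by (intro le) auto
    finally have "cmod c * universal_norm B x \<le> universal_norm B (c \<cdot> x)"
      using False by (simp add: norm_inverse norm_divide field_simps)
    then show ?thesis using le[OF x, of c] by simp
  qed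
  show "universal_norm B (x \<boxtimes> y) \<le> universal_norm B x * universal_norm B y"
    if "x \<in> carr B" "y \<in> carr B" for x y
  proof (rule universal_le)
    fix p assume p: "p \<in> dominated"
    then have s: "cstar_seminorm B p" by simp
    have "p (x \<boxtimes> y) \<le> p x * p y" by (rule cstar_seminormD(4)[OF s that])
    also have "\<dots> \<le> universal_norm B x * universal_norm B y"
      by (intro mult_mono dominated_le_universal[OF p] that universal_nonneg cstar_seminormD(1)[OF s])
    finally show "p (x \<boxtimes> y) \<le> universal_norm B x * universal_norm B y" .
  qed
  show "universal_norm B (adj B x \<boxtimes> x) = (universal_norm B x)\<^sup>2" if x: "x \<in> carr B" for x
  proof (rule antisym)
    show "universal_norm B (adj B x \<boxtimes> x) \<le> (universal_norm B x)\<^sup>2"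
    proof (rule universal_le)
      fix p assume p: "p \<in> dominated"
      then have "p (adj B x \<boxtimes> x) = (p x)\<^sup>2" "0 \<le> p x" using cstar_seminormD(1,5) x by auto
      then show "p (adj B x \<boxtimes> x) \<le> (universal_norm B x)\<^sup>2"
        using dominated_le_universal[OF p x] by (simp add: power_mono)
    qed
    have "universal_norm B x \<le> sqrt (universal_norm B (adj B x \<boxtimes> x))"
    proof (rule universal_le)
      fix p assume p: "p \<in> dominated"
      then have "cstar_seminorm B p" by simp
      then have "(p x)\<^sup>2 = p (adj B x \<boxtimes> x)" using cstar_seminormD(5)[of B p x] x by simp
      also have "\<dots> \<le> universal_norm B (adj B x \<boxtimes> x)"
        using dominated_le_universal[OF p] x by auto
      finally show "p x \<le> sqrt (universal_norm B (adj B x \<boxtimes> x))" by (rule real_le_rsqrt)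
    qed
    then have "(universal_norm B x)\<^sup>2 \<le> (sqrt (universal_norm B (adj B x \<boxtimes> x)))\<^sup>2"
      using universal_nonneg[OF x] by (rule power_mono)
    then show "(universal_norm B x)\<^sup>2 \<le> universal_norm B (adj B x \<boxtimes> x)"
      using universal_nonneg x by simp
  qed
qed (auto intro: plu_comm simp: plu_assoc plu_zero scal_plu plu_scal scal_scal scal_one scal_zero universal_nonneg
    universal_zero_if mul_plu_left mul_plu_right mul_scal_left mul_scal_right mul_assoc adj_plu adj_scal
    adj_mul adj_adj)

end

section \<open>The completion\<close>

context cstar_prealgebra
begin

abbreviation cls :: "(nat \<Rightarrow> 'b) \<Rightarrow> (nat \<Rightarrow> 'b) set" where
  "cls f \<equiv> null_rel B `` {f}"

abbreviation const_cls :: "'b \<Rightarrow> (nat \<Rightarrow> 'b) set" where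
  "const_cls x \<equiv> cls (\<lambda>_. x)"

lemma cauchy_carr: "f \<in> cauchy_seqs B \<Longrightarrow> f n \<in> carr B"
  by (simp add: cauchy_seqs_def)

lemma cauchy_dist:
  "f \<in> cauchy_seqs B \<Longrightarrow> 0 < \<epsilon> \<Longrightarrow> \<exists>N. \<forall>m\<ge>N. \<forall>n\<ge>N. nrm B (f m \<boxminus> f n) < \<epsilon>"
  by (simp add: cauchy_seqs_def)

lemma cauchyI_le:
  assumes f: "f \<in> cauchy_seqs B" and "\<And>n. g n \<in> carr B"
    and le: "\<And>m n. nrm B (g m \<boxminus> g n) \<le> K * nrm B (f m \<boxminus> f n)"
  shows "g \<in> cauchy_seqs B"
  unfolding cauchy_seqs_def
proof (intro CollectI conjI allI impI)
  fix \<epsilon> :: real assume "0 < \<epsilon>"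
  \<comment> \<open>K is an arbitrary real, so the divisor is \<bar>K\<bar> + 1.\<close>
  then obtain N where N: "\<forall>m\<ge>N. \<forall>n\<ge>N. nrm B (f m \<boxminus> f n) < \<epsilon> / (\<bar>K\<bar> + 1)"
    using cauchy_dist[OF f, of "\<epsilon> / (\<bar>K\<bar> + 1)"] by (auto simp: add_nonneg_pos)
  show "\<exists>N. \<forall>m\<ge>N. \<forall>n\<ge>N. nrm B (g m \<boxminus> g n) < \<epsilon>"
  proof (intro exI allI impI)
    fix m n assume mn: "N \<le> m" "N \<le> n"
    have nn: "0 \<le> nrm B (f m \<boxminus> f n)" using cauchy_carr[OF f] by simp
    have "K * nrm B (f m \<boxminus> f n) \<le> (\<bar>K\<bar> + 1) * nrm B (f m \<boxminus> f n)"
      using nn by (intro mult_right_mono) auto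
    also have "\<dots> < (\<bar>K\<bar> + 1) * (\<epsilon> / (\<bar>K\<bar> + 1))"
      using N mn by (intro mult_strict_left_mono) (auto simp: add_nonneg_pos)
    also have "\<dots> = \<epsilon>" by (simp add: add_nonneg_pos pos_add_strict) 
    finally show "nrm B (g m \<boxminus> g n) < \<epsilon>" using le[of m n] by simp
  qed
qed (rule assms)

lemma cauchy_const [simp]: "x \<in> carr B \<Longrightarrow> (\<lambda>_. x) \<in> cauchy_seqs B"
  by (simp add: cauchy_seqs_def)

lemma cauchy_plu:
  assumes f: "f \<in> cauchy_seqs B" and g: "g \<in> cauchy_seqs B"
  shows "(\<lambda>n. f n \<boxplus> g n) \<in> cauchy_seqs B"
  unfolding cauchy_seqs_def
proof (intro CollectI conjI allI impI)
  fix \<epsilon> :: real assume "0 < \<epsilon>"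
  then obtain N M where N: "\<forall>m\<ge>N. \<forall>n\<ge>N. nrm B (f m \<boxminus> f n) < \<epsilon> / 2"
    and M: "\<forall>m\<ge>M. \<forall>n\<ge>M. nrm B (g m \<boxminus> g n) < \<epsilon> / 2"
    using cauchy_dist[OF f, of "\<epsilon> / 2"] cauchy_dist[OF g, of "\<epsilon> / 2"] by auto
  show "\<exists>N. \<forall>m\<ge>N. \<forall>n\<ge>N. nrm B ((f m \<boxplus> g m) \<boxminus> (f n \<boxplus> g n)) < \<epsilon>"
  proof (intro exI[of _ "max N M"] allI impI)
    fix m n assume "max N M \<le> m" "max N M \<le> n"
    then have "nrm B (f m \<boxminus> f n) < \<epsilon> / 2" "nrm B (g m \<boxminus> g n) < \<epsilon> / 2" using N M by auto
    then show "nrm B ((f m \<boxplus> g m) \<boxminus> (f n \<boxplus> g n)) < \<epsilon>"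
      using dist_plu[of "f m" "g m" "f n" "g n"] cauchy_carr[OF f] cauchy_carr[OF g] by auto
  qed
qed (simp add: cauchy_carr[OF f] cauchy_carr[OF g])

lemma cauchy_scal:
  assumes f: "f \<in> cauchy_seqs B"
  shows "(\<lambda>n. c \<cdot> f n) \<in> cauchy_seqs B"
  by (rule cauchyI_le[OF f, of _ "cmod c"]) (simp_all add: cauchy_carr[OF f] dist_scal)

lemma cauchy_minus:
  assumes f: "f \<in> cauchy_seqs B" and g: "g \<in> cauchy_seqs B"
  shows "(\<lambda>n. f n \<boxminus> g n) \<in> cauchy_seqs B"
  unfolding alg_minus_def by (intro cauchy_plu cauchy_scal f g)

lemma cauchy_adj:
  assumes f: "f \<in> cauchy_seqs B"
  shows "(\<lambda>n. adj B (f n)) \<in> cauchy_seqs B"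
  by (rule cauchyI_le[OF f, of _ 1]) (simp_all add: cauchy_carr[OF f] dist_adj)

lemma convergent_nrm:
  assumes f: "f \<in> cauchy_seqs B"
  shows "convergent (\<lambda>n. nrm B (f n))"
proof (rule real_Cauchy_convergent, rule metric_CauchyI)
  fix \<epsilon> :: real assume "0 < \<epsilon>"
  then obtain N where N: "\<forall>m\<ge>N. \<forall>n\<ge>N. nrm B (f m \<boxminus> f n) < \<epsilon>" using cauchy_dist[OF f] by blast
  show "\<exists>M. \<forall>m\<ge>M. \<forall>n\<ge>M. dist (nrm B (f m)) (nrm B (f n)) < \<epsilon>"
  proof (intro exI allI impI)
    fix m n assume "N \<le> m" "N \<le> n"
    then have "nrm B (f m \<boxminus> f n) < \<epsilon>" using N by blast
    then show "dist (nrm B (f m)) (nrm B (f n)) < \<epsilon>"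
      using abs_nrm_diff_le[of "f m" "f n"] cauchy_carr[OF f] by (simp add: dist_real_def)
  qed
qed

lemma cauchy_bounded:
  assumes f: "f \<in> cauchy_seqs B"
  obtains K where "0 < K" "\<And>n. nrm B (f n) \<le> K"
proof -
  have "Bseq (\<lambda>n. nrm B (f n))" using convergent_nrm[OF f] by (rule convergent_imp_Bseq)
  then show thesis using that by (metis Bseq_def abs_le_D1 real_norm_def)
qed

lemma cauchy_mul:
  assumes f: "f \<in> cauchy_seqs B" and g: "g \<in> cauchy_seqs B"
  shows "(\<lambda>n. f n \<boxtimes> g n) \<in> cauchy_seqs B"
  unfolding cauchy_seqs_def
proof (intro CollectI conjI allI impI)
  fix \<epsilon> :: real assume e: "0 < \<epsilon>"
  obtain K where K: "0 < K" "\<And>n. nrm B (f n) \<le> K" using cauchy_bounded[OF f] by blast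
  obtain L where L: "0 < L" "\<And>n. nrm B (g n) \<le> L" using cauchy_bounded[OF g] by blast
  obtain N M where N: "\<forall>m\<ge>N. \<forall>n\<ge>N. nrm B (f m \<boxminus> f n) < \<epsilon> / (2 * L)"
    and M: "\<forall>m\<ge>M. \<forall>n\<ge>M. nrm B (g m \<boxminus> g n) < \<epsilon> / (2 * K)"
    using cauchy_dist[OF f, of "\<epsilon> / (2 * L)"] cauchy_dist[OF g, of "\<epsilon> / (2 * K)"] e K(1) L(1) by auto
  note c = cauchy_carr[OF f] cauchy_carr[OF g]
  show "\<exists>N. \<forall>m\<ge>N. \<forall>n\<ge>N. nrm B ((f m \<boxtimes> g m) \<boxminus> (f n \<boxtimes> g n)) < \<epsilon>"
  proof (intro exI[of _ "max N M"] allI impI)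
    fix m n assume "max N M \<le> m" "max N M \<le> n"
    then have d: "nrm B (f m \<boxminus> f n) < \<epsilon> / (2 * L)" "nrm B (g m \<boxminus> g n) < \<epsilon> / (2 * K)" using N M by auto
    have "nrm B (f m) * nrm B (g m \<boxminus> g n) \<le> K * nrm B (g m \<boxminus> g n)"
      using K c by (intro mult_right_mono) auto
    also have "\<dots> < K * (\<epsilon> / (2 * K))" using d K by (intro mult_strict_left_mono) auto
    finally have 1: "nrm B (f m) * nrm B (g m \<boxminus> g n) < \<epsilon> / 2" using K by simp
    have "nrm B (f m \<boxminus> f n) * nrm B (g n) \<le> nrm B (f m \<boxminus> f n) * L"
      using L c by (intro mult_left_mono) auto
    also have "\<dots> < \<epsilon> / (2 * L) * L" using d L by (intro mult_strict_right_mono) auto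
    finally have 2: "nrm B (f m \<boxminus> f n) * nrm B (g n) < \<epsilon> / 2" using L by simp
    show "nrm B ((f m \<boxtimes> g m) \<boxminus> (f n \<boxtimes> g n)) < \<epsilon>"
      using 1 2 dist_mul[of "f m" "g m" "f n" "g n"] c by auto
  qed
qed (simp add: cauchy_carr[OF f] cauchy_carr[OF g])

lemma null_relI:
  "f \<in> cauchy_seqs B \<Longrightarrow> g \<in> cauchy_seqs B \<Longrightarrow> (\<lambda>n. nrm B (f n \<boxminus> g n)) \<longlonglongrightarrow> 0 \<Longrightarrow> (f, g) \<in> null_rel B"
  by (simp add: null_rel_def)

lemma null_relD:
  assumes "(f, g) \<in> null_rel B"
  shows "f \<in> cauchy_seqs B" "g \<in> cauchy_seqs B" "(\<lambda>n. nrm B (f n \<boxminus> g n)) \<longlonglongrightarrow> 0"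
  using assms by (simp_all add: null_rel_def)

lemma equiv_null_rel: "equiv (cauchy_seqs B) (null_rel B)"
proof (rule equivI)
  show "null_rel B \<subseteq> cauchy_seqs B \<times> cauchy_seqs B" by (auto simp: null_rel_def)
  show "refl_on (cauchy_seqs B) (null_rel B)"
    by (rule refl_onI) (auto simp: null_rel_def cauchy_carr)
  show "sym (null_rel B)"
    by (rule symI) (auto simp: null_rel_def dist_commute cauchy_carr)
  show "trans (null_rel B)"
  proof (rule transI)
    fix f g h assume "(f, g) \<in> null_rel B" "(g, h) \<in> null_rel B"
    note a = null_relD[OF this(1)] and b = null_relD[OF this(2)]
    have "(\<lambda>n. nrm B (f n \<boxminus> h n)) \<longlonglongrightarrow> 0"
    proof (rule tendsto_sandwich[OF _ _ tendsto_const])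
      show "(\<lambda>n. nrm B (f n \<boxminus> g n) + nrm B (g n \<boxminus> h n)) \<longlonglongrightarrow> 0"
        by (intro tendsto_add_zero a b)
    qed (use a b cauchy_carr in \<open>auto intro!: always_eventually dist_triangle\<close>)
    then show "(f, h) \<in> null_rel B" using a b by (intro null_relI)
  qed
qed

lemma cls_eqI:
  "f \<in> cauchy_seqs B \<Longrightarrow> g \<in> cauchy_seqs B \<Longrightarrow> (\<And>n. nrm B (f n \<boxminus> g n) = 0) \<Longrightarrow> cls f = cls g"
  by (intro equiv_class_eq[OF equiv_null_rel] null_relI) auto

text \<open>The operations of the completion are unions over representatives. Compatibility with
  \<open>null_rel\<close> makes all members of the union equal, so it collapses to a single
  class.\<close>

lemma UN_cls:
  assumes "f \<in> cauchy_seqs B" and "\<And>g h. (g, h) \<in> null_rel B \<Longrightarrow> (F g, F h) \<in> null_rel B"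
  shows "(\<Union>g\<in>cls f. cls (F g)) = cls (F f)"
  by (rule UN_equiv_class[OF equiv_null_rel _ assms(1)])
    (auto simp: congruent_def intro!: equiv_class_eq[OF equiv_null_rel] assms)

lemma UN_cls2:
  assumes "f \<in> cauchy_seqs B" "g \<in> cauchy_seqs B"
    and "\<And>f f' g g'. (f, f') \<in> null_rel B \<Longrightarrow> (g, g') \<in> null_rel B \<Longrightarrow> (F f g, F f' g') \<in> null_rel B"
  shows "(\<Union>f\<in>cls f. \<Union>g\<in>cls g. cls (F f g)) = cls (F f g)"
  by (rule UN_equiv_class2[OF equiv_null_rel equiv_null_rel _ assms(1,2)])
    (auto simp: congruent2_def intro!: equiv_class_eq[OF equiv_null_rel] assms)

abbreviation "C \<equiv> completion B"

lemma carr_completion: "X \<in> carr C \<longleftrightarrow> (\<exists>f\<in>cauchy_seqs B. X = cls f)"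
  by (auto simp: completion_def quotient_def)

lemma cls_closed [simp, intro]: "f \<in> cauchy_seqs B \<Longrightarrow> cls f \<in> carr C"
  by (auto simp: carr_completion)

lemma zer_completion: "zer C = const_cls \<zero>"
  by (simp add: completion_def)

lemma plu_completion:
  assumes "f \<in> cauchy_seqs B" "g \<in> cauchy_seqs B"
  shows "cls f \<boxplus>\<^bsub>C\<^esub> cls g = cls (\<lambda>n. f n \<boxplus> g n)"
proof -
  have "(\<Union>f\<in>cls f. \<Union>g\<in>cls g. cls (\<lambda>n. f n \<boxplus> g n)) = cls (\<lambda>n. f n \<boxplus> g n)"
  proof (rule UN_cls2[OF assms])
    fix f f' g g' assume "(f, f') \<in> null_rel B" "(g, g') \<in> null_rel B"
    note a = null_relD[OF this(1)] and b = null_relD[OF this(2)]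
    show "(\<lambda>n. f n \<boxplus> g n, \<lambda>n. f' n \<boxplus> g' n) \<in> null_rel B"
    proof (rule null_relI)
      show "(\<lambda>n. nrm B ((f n \<boxplus> g n) \<boxminus> (f' n \<boxplus> g' n))) \<longlonglongrightarrow> 0"
      proof (rule tendsto_sandwich[OF _ _ tendsto_const])
        show "(\<lambda>n. nrm B (f n \<boxminus> f' n) + nrm B (g n \<boxminus> g' n)) \<longlonglongrightarrow> 0"
          by (intro tendsto_add_zero a b)
      qed (use a b cauchy_carr in \<open>auto intro!: always_eventually dist_plu\<close>)
    qed (use a b in \<open>auto intro!: cauchy_plu\<close>)
  qed
  then show ?thesis by (simp add: completion_def)
qed

lemma scal_completion:
  assumes "f \<in> cauchy_seqs B"
  shows "c \<cdot>\<^bsub>C\<^esub> cls f = cls (\<lambda>n. c \<cdot> f n)"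
proof -
  have "(\<Union>f\<in>cls f. cls (\<lambda>n. c \<cdot> f n)) = cls (\<lambda>n. c \<cdot> f n)"
  proof (rule UN_cls[OF assms])
    fix f f' assume "(f, f') \<in> null_rel B"
    note a = null_relD[OF this(1)]
    have "(\<lambda>n. nrm B (c \<cdot> f n \<boxminus> c \<cdot> f' n)) = (\<lambda>n. cmod c * nrm B (f n \<boxminus> f' n))"
      using a cauchy_carr by (auto simp: dist_scal)
    then show "(\<lambda>n. c \<cdot> f n, \<lambda>n. c \<cdot> f' n) \<in> null_rel B"
      using a by (auto intro!: null_relI cauchy_scal tendsto_mult_right_zero)
  qed
  then show ?thesis by (simp add: completion_def)
qed

lemma adj_completion:
  assumes "f \<in> cauchy_seqs B"
  shows "adj C (cls f) = cls (\<lambda>n. adj B (f n))"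
proof -
  have "(\<Union>f\<in>cls f. cls (\<lambda>n. adj B (f n))) = cls (\<lambda>n. adj B (f n))"
  proof (rule UN_cls[OF assms])
    fix f f' assume "(f, f') \<in> null_rel B"
    note a = null_relD[OF this(1)]
    have "(\<lambda>n. nrm B (adj B (f n) \<boxminus> adj B (f' n))) = (\<lambda>n. nrm B (f n \<boxminus> f' n))"
      using a cauchy_carr by (auto simp: dist_adj)
    then show "(\<lambda>n. adj B (f n), \<lambda>n. adj B (f' n)) \<in> null_rel B"
      using a by (auto intro!: null_relI cauchy_adj)
  qed
  then show ?thesis by (simp add: completion_def)
qed

lemma mul_completion:
  assumes "f \<in> cauchy_seqs B" "g \<in> cauchy_seqs B"
  shows "cls f \<boxtimes>\<^bsub>C\<^esub> cls g = cls (\<lambda>n. f n \<boxtimes> g n)"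
proof -
  have "(\<Union>f\<in>cls f. \<Union>g\<in>cls g. cls (\<lambda>n. f n \<boxtimes> g n)) = cls (\<lambda>n. f n \<boxtimes> g n)"
  proof (rule UN_cls2[OF assms])
    fix f f' g g' assume "(f, f') \<in> null_rel B" "(g, g') \<in> null_rel B"
    note a = null_relD[OF this(1)] and b = null_relD[OF this(2)]
    obtain K where K: "0 < K" "\<And>n. nrm B (f n) \<le> K" using cauchy_bounded[OF a(1)] by blast
    obtain L where L: "0 < L" "\<And>n. nrm B (g' n) \<le> L" using cauchy_bounded[OF b(2)] by blast
    note c = cauchy_carr[OF a(1)] cauchy_carr[OF a(2)] cauchy_carr[OF b(1)] cauchy_carr[OF b(2)]
    show "(\<lambda>n. f n \<boxtimes> g n, \<lambda>n. f' n \<boxtimes> g' n) \<in> null_rel B"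
    proof (rule null_relI)
      show "(\<lambda>n. nrm B ((f n \<boxtimes> g n) \<boxminus> (f' n \<boxtimes> g' n))) \<longlonglongrightarrow> 0"
      proof (rule tendsto_sandwich[OF _ _ tendsto_const])
        show "(\<lambda>n. K * nrm B (g n \<boxminus> g' n) + nrm B (f n \<boxminus> f' n) * L) \<longlonglongrightarrow> 0"
          by (intro tendsto_add_zero tendsto_mult_right_zero tendsto_mult_left_zero a b)
        have "nrm B ((f n \<boxtimes> g n) \<boxminus> (f' n \<boxtimes> g' n)) \<le> K * nrm B (g n \<boxminus> g' n) + nrm B (f n \<boxminus> f' n) * L" for n
        proof -
          have "nrm B (f n) * nrm B (g n \<boxminus> g' n) \<le> K * nrm B (g n \<boxminus> g' n)"
            using K c by (intro mult_right_mono) auto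
          moreover have "nrm B (f n \<boxminus> f' n) * nrm B (g' n) \<le> nrm B (f n \<boxminus> f' n) * L"
            using L c by (intro mult_left_mono) auto
          ultimately show ?thesis using dist_mul[of "f n" "g n" "f' n" "g' n"] c by auto
        qed
        then show "\<forall>\<^sub>F n in sequentially. nrm B ((f n \<boxtimes> g n) \<boxminus> (f' n \<boxtimes> g' n))
            \<le> K * nrm B (g n \<boxminus> g' n) + nrm B (f n \<boxminus> f' n) * L" by simp
      qed (use c in auto)
    qed (use a b in \<open>auto intro!: cauchy_mul\<close>)
  qed
  then show ?thesis by (simp add: completion_def)
qed

text \<open>Equivalent sequences have norms with the same limit, so the set in the definition of the
  norm is a singleton and \<open>the_elem\<close> is meaningful. As a limit statement it carries
  norm inequalities over to the completion.\<close>

lemma nrm_completion_tendsto: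
  assumes "f \<in> cauchy_seqs B"
  shows "(\<lambda>n. nrm B (f n)) \<longlonglongrightarrow> nrm C (cls f)"
proof -
  have "lim (\<lambda>n. nrm B (g n)) = lim (\<lambda>n. nrm B (f n))" if "g \<in> cls f" for g
  proof -
    have "(f, g) \<in> null_rel B" using that by simp
    note a = null_relD[OF this]
    have "(\<lambda>n. nrm B (g n) - nrm B (f n)) \<longlonglongrightarrow> 0"
    proof (rule tendsto_rabs_zero_cancel, rule tendsto_sandwich[OF _ _ tendsto_const a(3)])
      show "\<forall>\<^sub>F n in sequentially. \<bar>nrm B (g n) - nrm B (f n)\<bar> \<le> nrm B (f n \<boxminus> g n)"
        using abs_nrm_diff_le a cauchy_carr by (auto intro!: always_eventually simp: abs_minus_commute)
    qed simp
    from tendsto_add[OF this, of "\<lambda>n. nrm B (f n)" "lim (\<lambda>n. nrm B (f n))"]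
    have "(\<lambda>n. nrm B (g n)) \<longlonglongrightarrow> lim (\<lambda>n. nrm B (f n))"
      using convergent_nrm[OF assms] by (simp add: convergent_LIMSEQ_iff)
    then show ?thesis by (rule limI)
  qed
  moreover have "f \<in> cls f" using equiv_class_self[OF equiv_null_rel assms] .
  ultimately have "(\<lambda>g. lim (\<lambda>n. nrm B (g n))) ` cls f = {lim (\<lambda>n. nrm B (f n))}" by blast
  then have "nrm C (cls f) = lim (\<lambda>n. nrm B (f n))" by (simp add: completion_def)
  then show ?thesis using convergent_nrm[OF assms] by (simp add: convergent_LIMSEQ_iff)
qed

lemma minus_completion:
  assumes "f \<in> cauchy_seqs B" "g \<in> cauchy_seqs B"
  shows "cls f \<boxminus>\<^bsub>C\<^esub> cls g = cls (\<lambda>n. f n \<boxminus> g n)"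
  using assms by (simp add: alg_minus_def plu_completion scal_completion cauchy_scal)

lemmas completion_simps = zer_completion plu_completion scal_completion adj_completion mul_completion minus_completion
lemmas cauchy_intros = cauchy_plu cauchy_scal cauchy_adj cauchy_mul cauchy_minus cauchy_const

lemma dist_completion_zeroI:
  assumes "f \<in> cauchy_seqs B" "g \<in> cauchy_seqs B" "\<And>n. nrm B (f n \<boxminus> g n) = 0"
  shows "nrm C (cls f \<boxminus>\<^bsub>C\<^esub> cls g) = 0"
  using nrm_completion_tendsto[OF cauchy_minus[OF assms(1,2)]] assms
  by (simp add: minus_completion LIMSEQ_const_iff)

text \<open>Laws valid up to norm 0 hold termwise on representatives, norm laws pass to the limit,
  and classes at distance 0 coincide by the definition of \<open>null_rel\<close>.\<close>

theorem cstar_normed_completion: "cstar_normed C"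
proof (intro cstar_normed.intro cstar_prealgebra.intro star_prealgebra.intro
    cstar_normed_axioms.intro cstar_prealgebra_axioms.intro)
  fix X Y Z c d
  assume "X \<in> carr C" "Y \<in> carr C"
  then obtain f g where fg: "f \<in> cauchy_seqs B" "g \<in> cauchy_seqs B" "X = cls f" "Y = cls g"
    by (auto simp: carr_completion)
  note c [simp] = cauchy_carr[OF fg(1)] cauchy_carr[OF fg(2)]
  show "X \<boxplus>\<^bsub>C\<^esub> Y \<in> carr C" "X \<boxtimes>\<^bsub>C\<^esub> Y \<in> carr C"
    using fg by (auto simp: completion_simps intro!: cauchy_intros)
  show "X \<boxplus>\<^bsub>C\<^esub> Y = Y \<boxplus>\<^bsub>C\<^esub> X"
    using fg by (simp add: completion_simps plu_comm)
  show "c \<cdot>\<^bsub>C\<^esub> (X \<boxplus>\<^bsub>C\<^esub> Y) = c \<cdot>\<^bsub>C\<^esub> X \<boxplus>\<^bsub>C\<^esub> c \<cdot>\<^bsub>C\<^esub> Y"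
    using fg by (simp add: completion_simps cauchy_intros scal_plu)
  show "nrm C (X \<boxplus>\<^bsub>C\<^esub> Y) \<le> nrm C X + nrm C Y"
  proof (rule LIMSEQ_le)
    show "(\<lambda>n. nrm B (f n \<boxplus> g n)) \<longlonglongrightarrow> nrm C (X \<boxplus>\<^bsub>C\<^esub> Y)"
      using nrm_completion_tendsto[of "\<lambda>n. f n \<boxplus> g n"] fg by (simp add: completion_simps cauchy_intros)
    show "(\<lambda>n. nrm B (f n) + nrm B (g n)) \<longlonglongrightarrow> nrm C X + nrm C Y"
      using fg by (auto intro!: tendsto_add nrm_completion_tendsto)
  qed (auto simp: nrm_triangle)
  show "nrm C ((c \<cdot>\<^bsub>C\<^esub> X) \<boxtimes>\<^bsub>C\<^esub> Y \<boxminus>\<^bsub>C\<^esub> c \<cdot>\<^bsub>C\<^esub> (X \<boxtimes>\<^bsub>C\<^esub> Y)) = 0"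
    using dist_completion_zeroI[of "\<lambda>n. (c \<cdot> f n) \<boxtimes> g n" "\<lambda>n. c \<cdot> (f n \<boxtimes> g n)"] fg
    by (simp add: completion_simps cauchy_intros mul_scal_left)
  show "nrm C (X \<boxtimes>\<^bsub>C\<^esub> (c \<cdot>\<^bsub>C\<^esub> Y) \<boxminus>\<^bsub>C\<^esub> c \<cdot>\<^bsub>C\<^esub> (X \<boxtimes>\<^bsub>C\<^esub> Y)) = 0"
    using dist_completion_zeroI[of "\<lambda>n. f n \<boxtimes> (c \<cdot> g n)" "\<lambda>n. c \<cdot> (f n \<boxtimes> g n)"] fg
    by (simp add: completion_simps cauchy_intros mul_scal_right)
  show "nrm C (adj C (X \<boxplus>\<^bsub>C\<^esub> Y) \<boxminus>\<^bsub>C\<^esub> (adj C X \<boxplus>\<^bsub>C\<^esub> adj C Y)) = 0"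
    using dist_completion_zeroI[of "\<lambda>n. adj B (f n \<boxplus> g n)" "\<lambda>n. adj B (f n) \<boxplus> adj B (g n)"] fg
    by (simp add: completion_simps cauchy_intros adj_plu)
  show "nrm C (adj C (X \<boxtimes>\<^bsub>C\<^esub> Y) \<boxminus>\<^bsub>C\<^esub> adj C Y \<boxtimes>\<^bsub>C\<^esub> adj C X) = 0"
    using dist_completion_zeroI[of "\<lambda>n. adj B (f n \<boxtimes> g n)" "\<lambda>n. adj B (g n) \<boxtimes> adj B (f n)"] fg
    by (simp add: completion_simps cauchy_intros adj_mul)
  show "nrm C (X \<boxtimes>\<^bsub>C\<^esub> Y) \<le> nrm C X * nrm C Y"
  proof (rule LIMSEQ_le)
    show "(\<lambda>n. nrm B (f n \<boxtimes> g n)) \<longlonglongrightarrow> nrm C (X \<boxtimes>\<^bsub>C\<^esub> Y)"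
      using nrm_completion_tendsto[of "\<lambda>n. f n \<boxtimes> g n"] fg by (simp add: completion_simps cauchy_intros)
    show "(\<lambda>n. nrm B (f n) * nrm B (g n)) \<longlonglongrightarrow> nrm C X * nrm C Y"
      using fg by (auto intro!: tendsto_mult nrm_completion_tendsto)
  qed (auto simp: nrm_mul)
  show "X = Y" if "nrm C (X \<boxminus>\<^bsub>C\<^esub> Y) = 0"
    using nrm_completion_tendsto[OF cauchy_minus[OF fg(1,2)]] that fg
    by (simp add: completion_simps equiv_class_eq[OF equiv_null_rel] null_relI)
  assume "Z \<in> carr C"
  then obtain h where h: "h \<in> cauchy_seqs B" "Z = cls h" by (auto simp: carr_completion)
  note ch [simp] = cauchy_carr[OF h(1)]
  show "X \<boxplus>\<^bsub>C\<^esub> Y \<boxplus>\<^bsub>C\<^esub> Z = X \<boxplus>\<^bsub>C\<^esub> (Y \<boxplus>\<^bsub>C\<^esub> Z)"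
    using fg h by (simp add: completion_simps cauchy_intros plu_assoc)
  show "nrm C ((X \<boxplus>\<^bsub>C\<^esub> Y) \<boxtimes>\<^bsub>C\<^esub> Z \<boxminus>\<^bsub>C\<^esub> (X \<boxtimes>\<^bsub>C\<^esub> Z \<boxplus>\<^bsub>C\<^esub> Y \<boxtimes>\<^bsub>C\<^esub> Z)) = 0"
    using dist_completion_zeroI[of "\<lambda>n. (f n \<boxplus> g n) \<boxtimes> h n" "\<lambda>n. f n \<boxtimes> h n \<boxplus> g n \<boxtimes> h n"] fg h
    by (simp add: completion_simps cauchy_intros mul_plu_left)
  show "nrm C (Z \<boxtimes>\<^bsub>C\<^esub> (X \<boxplus>\<^bsub>C\<^esub> Y) \<boxminus>\<^bsub>C\<^esub> (Z \<boxtimes>\<^bsub>C\<^esub> X \<boxplus>\<^bsub>C\<^esub> Z \<boxtimes>\<^bsub>C\<^esub> Y)) = 0"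
    using dist_completion_zeroI[of "\<lambda>n. h n \<boxtimes> (f n \<boxplus> g n)" "\<lambda>n. h n \<boxtimes> f n \<boxplus> h n \<boxtimes> g n"] fg h
    by (simp add: completion_simps cauchy_intros mul_plu_right)
  show "nrm C ((X \<boxtimes>\<^bsub>C\<^esub> Y) \<boxtimes>\<^bsub>C\<^esub> Z \<boxminus>\<^bsub>C\<^esub> X \<boxtimes>\<^bsub>C\<^esub> (Y \<boxtimes>\<^bsub>C\<^esub> Z)) = 0"
    using dist_completion_zeroI[of "\<lambda>n. (f n \<boxtimes> g n) \<boxtimes> h n" "\<lambda>n. f n \<boxtimes> (g n \<boxtimes> h n)"] fg h
    by (simp add: completion_simps cauchy_intros mul_assoc)
next
  fix X c d
  assume "X \<in> carr C"
  then obtain f where f: "f \<in> cauchy_seqs B" "X = cls f"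
    by (auto simp: carr_completion)
  note c [simp] = cauchy_carr[OF f(1)]
  show "c \<cdot>\<^bsub>C\<^esub> X \<in> carr C" "adj C X \<in> carr C"
    using f by (auto simp: completion_simps intro!: cauchy_intros)
  show "X \<boxplus>\<^bsub>C\<^esub> \<zero>\<^bsub>C\<^esub> = X"
    using f by (simp add: completion_simps cauchy_intros plu_zero)
  show "(c + d) \<cdot>\<^bsub>C\<^esub> X = c \<cdot>\<^bsub>C\<^esub> X \<boxplus>\<^bsub>C\<^esub> d \<cdot>\<^bsub>C\<^esub> X"
    using f by (simp add: completion_simps cauchy_intros plu_scal)
  show "c \<cdot>\<^bsub>C\<^esub> d \<cdot>\<^bsub>C\<^esub> X = (c * d) \<cdot>\<^bsub>C\<^esub> X"
    using f by (simp add: completion_simps cauchy_intros scal_scal)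
  show "1 \<cdot>\<^bsub>C\<^esub> X = X" "0 \<cdot>\<^bsub>C\<^esub> X = \<zero>\<^bsub>C\<^esub>"
    using f by (simp_all add: completion_simps cauchy_intros scal_one scal_zero)
  show "0 \<le> nrm C X"
    using LIMSEQ_le_const[OF nrm_completion_tendsto[OF f(1)], of 0] f by auto
  show "nrm C (c \<cdot>\<^bsub>C\<^esub> X) = cmod c * nrm C X"
  proof (rule LIMSEQ_unique)
    show "(\<lambda>n. nrm B (c \<cdot> f n)) \<longlonglongrightarrow> nrm C (c \<cdot>\<^bsub>C\<^esub> X)"
      using nrm_completion_tendsto[of "\<lambda>n. c \<cdot> f n"] f by (simp add: completion_simps cauchy_intros)
    show "(\<lambda>n. nrm B (c \<cdot> f n)) \<longlonglongrightarrow> cmod c * nrm C X"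
      using f by (auto simp: nrm_scal intro!: tendsto_mult_left nrm_completion_tendsto)
  qed
  show "nrm C (adj C (c \<cdot>\<^bsub>C\<^esub> X) \<boxminus>\<^bsub>C\<^esub> cnj c \<cdot>\<^bsub>C\<^esub> adj C X) = 0"
    using dist_completion_zeroI[of "\<lambda>n. adj B (c \<cdot> f n)" "\<lambda>n. cnj c \<cdot> adj B (f n)"] f
    by (simp add: completion_simps cauchy_intros adj_scal)
  show "nrm C (adj C (adj C X) \<boxminus>\<^bsub>C\<^esub> X) = 0"
    using dist_completion_zeroI[of "\<lambda>n. adj B (adj B (f n))" f] f
    by (simp add: completion_simps cauchy_intros adj_adj)
  show "nrm C (adj C X \<boxtimes>\<^bsub>C\<^esub> X) = (nrm C X)\<^sup>2"
  proof (rule LIMSEQ_unique)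
    show "(\<lambda>n. nrm B (adj B (f n) \<boxtimes> f n)) \<longlonglongrightarrow> nrm C (adj C X \<boxtimes>\<^bsub>C\<^esub> X)"
      using nrm_completion_tendsto[of "\<lambda>n. adj B (f n) \<boxtimes> f n"] f by (simp add: completion_simps cauchy_intros)
    show "(\<lambda>n. nrm B (adj B (f n) \<boxtimes> f n)) \<longlonglongrightarrow> (nrm C X)\<^sup>2"
      using f by (auto simp: nrm_cstar intro!: tendsto_power nrm_completion_tendsto)
  qed
qed (auto simp: zer_completion)

interpretation C: cstar_normed "completion B"
  by (rule cstar_normed_completion)

lemma nrm_const_cls [simp]: "x \<in> carr B \<Longrightarrow> nrm C (const_cls x) = nrm B x"
  using nrm_completion_tendsto[of "\<lambda>_. x"] by (simp add: LIMSEQ_const_iff)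

lemma const_cls_ops:
  assumes "x \<in> carr B"
  shows "c \<cdot>\<^bsub>C\<^esub> const_cls x = const_cls (c \<cdot> x)" "adj C (const_cls x) = const_cls (adj B x)"
    and "y \<in> carr B \<Longrightarrow> const_cls x \<boxplus>\<^bsub>C\<^esub> const_cls y = const_cls (x \<boxplus> y)"
    and "y \<in> carr B \<Longrightarrow> const_cls x \<boxtimes>\<^bsub>C\<^esub> const_cls y = const_cls (x \<boxtimes> y)"
    and "y \<in> carr B \<Longrightarrow> const_cls x \<boxminus>\<^bsub>C\<^esub> const_cls y = const_cls (x \<boxminus> y)"
  using assms by (simp_all add: completion_simps)

lemma const_cls_closed [simp, intro]: "x \<in> carr B \<Longrightarrow> const_cls x \<in> carr C"
  by (intro cls_closed cauchy_const)

lemma const_cls_eqI: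
  "x \<in> carr B \<Longrightarrow> y \<in> carr B \<Longrightarrow> nrm B (x \<boxminus> y) = 0 \<Longrightarrow> const_cls x = const_cls y"
  by (rule cls_eqI) auto

lemma const_cls_dense:
  assumes "X \<in> carr C" "0 < \<epsilon>"
  obtains x where "x \<in> carr B" "nrm C (X \<boxminus>\<^bsub>C\<^esub> const_cls x) < \<epsilon>"
proof -
  obtain f where f: "f \<in> cauchy_seqs B" "X = cls f" using assms by (auto simp: carr_completion)
  obtain N where N: "\<forall>m\<ge>N. \<forall>n\<ge>N. nrm B (f m \<boxminus> f n) < \<epsilon> / 2"
    using cauchy_dist[OF f(1), of "\<epsilon> / 2"] assms by auto
  have c: "f N \<in> carr B" using cauchy_carr[OF f(1)] .
  have "nrm C (X \<boxminus>\<^bsub>C\<^esub> const_cls (f N)) \<le> \<epsilon> / 2"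
  proof (rule LIMSEQ_le_const2)
    show "(\<lambda>n. nrm B (f n \<boxminus> f N)) \<longlonglongrightarrow> nrm C (X \<boxminus>\<^bsub>C\<^esub> const_cls (f N))"
      using nrm_completion_tendsto[of "\<lambda>n. f n \<boxminus> f N"] f c by (simp add: completion_simps cauchy_intros)
    show "\<exists>M. \<forall>n\<ge>M. nrm B (f n \<boxminus> f N) \<le> \<epsilon> / 2" using N by (meson less_imp_le order_refl)
  qed
  then show thesis using that[OF c] assms by simp
qed

text \<open>Since K does not depend on t, one approximation of X by a constant class serves for all
  times at once.\<close>

lemma asymptotic_dense:
  fixes F G :: "real \<Rightarrow> (nat \<Rightarrow> 'b) set \<Rightarrow> (nat \<Rightarrow> 'b) set"
  assumes lip: "\<And>t X Y. 0 \<le> t \<Longrightarrow> X \<in> carr C \<Longrightarrow> Y \<in> carr C \<Longrightarrow>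
      nrm C (F t X \<boxminus>\<^bsub>C\<^esub> G t X) \<le> K * nrm C (X \<boxminus>\<^bsub>C\<^esub> Y) + nrm C (F t Y \<boxminus>\<^bsub>C\<^esub> G t Y)"
    and K: "0 < K"
    and conv: "\<And>x. x \<in> carr B \<Longrightarrow> ((\<lambda>t. nrm C (F t (const_cls x) \<boxminus>\<^bsub>C\<^esub> G t (const_cls x))) \<longlongrightarrow> 0) at_top"
    and nonneg: "\<And>t. 0 \<le> t \<Longrightarrow> 0 \<le> nrm C (F t X \<boxminus>\<^bsub>C\<^esub> G t X)"
    and X: "X \<in> carr C"
  shows "((\<lambda>t. nrm C (F t X \<boxminus>\<^bsub>C\<^esub> G t X)) \<longlongrightarrow> 0) at_top"
proof (rule tendstoI)
  fix \<epsilon> :: real assume e: "0 < \<epsilon>"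
  obtain x where x: "x \<in> carr B" "nrm C (X \<boxminus>\<^bsub>C\<^esub> const_cls x) < \<epsilon> / (2 * K)"
    using const_cls_dense[OF X, of "\<epsilon> / (2 * K)"] e K by auto
  have "K * nrm C (X \<boxminus>\<^bsub>C\<^esub> const_cls x) < K * (\<epsilon> / (2 * K))"
    using x(2) K by (rule mult_strict_left_mono)
  then have 1: "K * nrm C (X \<boxminus>\<^bsub>C\<^esub> const_cls x) < \<epsilon> / 2" using K by simp
  have "\<forall>\<^sub>F t in at_top. dist (nrm C (F t (const_cls x) \<boxminus>\<^bsub>C\<^esub> G t (const_cls x))) 0 < \<epsilon> / 2"
    using e by (intro tendstoD[OF conv] x) auto
  from eventually_conj[OF eventually_ge_at_top[of 0] this]
  show "\<forall>\<^sub>F t in at_top. dist (nrm C (F t X \<boxminus>\<^bsub>C\<^esub> G t X)) 0 < \<epsilon>"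
  proof (rule eventually_mono)
    fix t assume "0 \<le> t \<and> dist (nrm C (F t (const_cls x) \<boxminus>\<^bsub>C\<^esub> G t (const_cls x))) 0 < \<epsilon> / 2"
    then show "dist (nrm C (F t X \<boxminus>\<^bsub>C\<^esub> G t X)) 0 < \<epsilon>"
      using lip[of t X "const_cls x"] 1 X x nonneg[of t] by (auto simp: dist_real_def)
  qed
qed

subsection \<open>Extension of maps\<close>

text \<open>The choice of representative is immaterial for contractive additive T: by
  \<open>extend_tendsto\<close> every representative of the class has the same limit.\<close>

definition extend :: "('b \<Rightarrow> 'v::banach) \<Rightarrow> (nat \<Rightarrow> 'b) set \<Rightarrow> 'v" where
  "extend T X = lim (\<lambda>n. T ((SOME f. f \<in> X) n))"

context
  fixes T :: "'b \<Rightarrow> 'v::banach"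
  assumes T_minus: "\<And>x y. x \<in> carr B \<Longrightarrow> y \<in> carr B \<Longrightarrow> T (x \<boxminus> y) = T x - T y"
    and T_le: "\<And>x. x \<in> carr B \<Longrightarrow> norm (T x) \<le> nrm B x"
begin

lemma extend_tendsto:
  assumes f: "f \<in> cauchy_seqs B"
  shows "(\<lambda>n. T (f n)) \<longlonglongrightarrow> extend T (cls f)"
proof -
  define g where "g = (SOME g. g \<in> cls f)"
  have "f \<in> cls f" using equiv_class_self[OF equiv_null_rel f] .
  then have "g \<in> cls f" unfolding g_def by (rule someI[of "\<lambda>g. g \<in> cls f"])
  then have "(f, g) \<in> null_rel B" by simp
  note a = null_relD[OF this]
  have "Cauchy (\<lambda>n. T (f n))"
  proof (rule CauchyI)
    fix \<epsilon> :: real assume "0 < \<epsilon>"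
    then obtain N where N: "\<forall>m\<ge>N. \<forall>n\<ge>N. nrm B (f m \<boxminus> f n) < \<epsilon>" using cauchy_dist[OF f] by blast
    show "\<exists>M. \<forall>m\<ge>M. \<forall>n\<ge>M. norm (T (f m) - T (f n)) < \<epsilon>"
    proof (intro exI allI impI)
      fix m n assume "N \<le> m" "N \<le> n"
      then have "nrm B (f m \<boxminus> f n) < \<epsilon>" using N by blast
      then show "norm (T (f m) - T (f n)) < \<epsilon>"
        using T_le[of "f m \<boxminus> f n"] cauchy_carr[OF f] by (simp add: T_minus)
    qed
  qed
  then obtain l where l: "(\<lambda>n. T (f n)) \<longlonglongrightarrow> l" by (auto simp: Cauchy_convergent_iff convergent_def)
  have "(\<lambda>n. T (f n) - T (g n)) \<longlonglongrightarrow> 0"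
  proof (rule Lim_null_comparison[OF _ a(3)])
    show "\<forall>\<^sub>F n in sequentially. norm (T (f n) - T (g n)) \<le> nrm B (f n \<boxminus> g n)"
      using T_le a cauchy_carr by (auto intro!: always_eventually simp flip: T_minus)
  qed
  from tendsto_diff[OF l this] have "(\<lambda>n. T (g n)) \<longlonglongrightarrow> l" by simp
  then have "extend T (cls f) = l" unfolding extend_def g_def by (rule limI)
  then show ?thesis using l by simp
qed

lemma extend_const_cls: "x \<in> carr B \<Longrightarrow> extend T (const_cls x) = T x"
  using extend_tendsto[of "\<lambda>_. x"] by (simp add: LIMSEQ_const_iff)

lemma extend_minus:
  assumes "X \<in> carr C" "Y \<in> carr C"
  shows "extend T (X \<boxminus>\<^bsub>C\<^esub> Y) = extend T X - extend T Y"
proof -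
  obtain f g where fg: "f \<in> cauchy_seqs B" "g \<in> cauchy_seqs B" "X = cls f" "Y = cls g"
    using assms by (auto simp: carr_completion)
  have "(\<lambda>n. T (f n) - T (g n)) \<longlonglongrightarrow> extend T (X \<boxminus>\<^bsub>C\<^esub> Y)"
    using extend_tendsto[OF cauchy_minus[OF fg(1,2)]] fg cauchy_carr by (simp add: completion_simps T_minus)
  moreover have "(\<lambda>n. T (f n) - T (g n)) \<longlonglongrightarrow> extend T X - extend T Y"
    using fg by (auto intro!: tendsto_diff extend_tendsto)
  ultimately show ?thesis by (rule LIMSEQ_unique)
qed

lemma norm_extend_le:
  assumes "X \<in> carr C" shows "norm (extend T X) \<le> nrm C X"
proof -
  obtain f where f: "f \<in> cauchy_seqs B" "X = cls f" using assms by (auto simp: carr_completion)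
  show ?thesis
    unfolding f(2) by (rule LIMSEQ_le[OF tendsto_norm[OF extend_tendsto] nrm_completion_tendsto])
      (use f cauchy_carr T_le in auto)
qed

lemma extend_dist_le:
  assumes "X \<in> carr C" "Y \<in> carr C"
  shows "norm (extend T X - extend T Y) \<le> nrm C (X \<boxminus>\<^bsub>C\<^esub> Y)"
  using norm_extend_le[of "X \<boxminus>\<^bsub>C\<^esub> Y"] assms by (simp add: extend_minus)

lemma extend_path_continuous:
  assumes "norm_continuous_path C v"
  shows "continuous_on {0..} (\<lambda>t. extend T (v t))"
  unfolding continuous_on_def
proof
  fix t :: real assume t: "t \<in> {0..}"
  have "((\<lambda>s. nrm C (v s \<boxminus>\<^bsub>C\<^esub> v t)) \<longlongrightarrow> 0) (at t within {0..})"
    using assms t by (simp add: norm_continuous_path_def)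
  then have "((\<lambda>s. extend T (v s) - extend T (v t)) \<longlongrightarrow> 0) (at t within {0..})"
  proof (rule Lim_null_comparison[rotated])
    show "\<forall>\<^sub>F s in at t within {0..}. norm (extend T (v s) - extend T (v t)) \<le> nrm C (v s \<boxminus>\<^bsub>C\<^esub> v t)"
      unfolding eventually_at_filter
      using assms t by (auto intro!: always_eventually extend_dist_le simp: norm_continuous_path_def)
  qed
  then show "((\<lambda>s. extend T (v s)) \<longlongrightarrow> extend T (v t)) (at t within {0..})"
    by (simp add: LIM_zero_iff)
qed

end

definition map_completion :: "('b \<Rightarrow> 'b) \<Rightarrow> (nat \<Rightarrow> 'b) set \<Rightarrow> (nat \<Rightarrow> 'b) set" where
  "map_completion \<phi> X = (\<Union>f\<in>X. cls (\<lambda>n. \<phi> (f n)))"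

context
  fixes \<phi> :: "'b \<Rightarrow> 'b"
  assumes phi_closed: "\<And>x. x \<in> carr B \<Longrightarrow> \<phi> x \<in> carr B"
    and phi_dist: "\<And>x y. x \<in> carr B \<Longrightarrow> y \<in> carr B \<Longrightarrow> nrm B (\<phi> x \<boxminus> \<phi> y) \<le> nrm B (x \<boxminus> y)"
begin

lemma cauchy_map: "f \<in> cauchy_seqs B \<Longrightarrow> (\<lambda>n. \<phi> (f n)) \<in> cauchy_seqs B"
  by (rule cauchyI_le[of f _ 1]) (auto simp: cauchy_carr phi_closed phi_dist)

lemma map_completion_cls:
  assumes "f \<in> cauchy_seqs B"
  shows "map_completion \<phi> (cls f) = cls (\<lambda>n. \<phi> (f n))"
  unfolding map_completion_def
proof (rule UN_cls[OF assms])
  fix f g assume "(f, g) \<in> null_rel B"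
  note a = null_relD[OF this]
  show "(\<lambda>n. \<phi> (f n), \<lambda>n. \<phi> (g n)) \<in> null_rel B"
  proof (rule null_relI)
    show "(\<lambda>n. nrm B (\<phi> (f n) \<boxminus> \<phi> (g n))) \<longlonglongrightarrow> 0"
      by (rule tendsto_sandwich[OF _ _ tendsto_const a(3)])
        (use a cauchy_carr in \<open>auto intro!: always_eventually simp: phi_closed phi_dist\<close>)
  qed (use a cauchy_map in auto)
qed

lemma map_completion_const_cls: "x \<in> carr B \<Longrightarrow> map_completion \<phi> (const_cls x) = const_cls (\<phi> x)"
  by (simp add: map_completion_cls)

lemma map_completion_closed: "X \<in> carr C \<Longrightarrow> map_completion \<phi> X \<in> carr C"
  by (auto simp: carr_completion map_completion_cls cauchy_map)

lemma map_completion_dist: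
  assumes "X \<in> carr C" "Y \<in> carr C"
  shows "nrm C (map_completion \<phi> X \<boxminus>\<^bsub>C\<^esub> map_completion \<phi> Y) \<le> nrm C (X \<boxminus>\<^bsub>C\<^esub> Y)"
proof -
  obtain f g where fg: "f \<in> cauchy_seqs B" "g \<in> cauchy_seqs B" "X = cls f" "Y = cls g"
    using assms by (auto simp: carr_completion)
  have "(\<lambda>n. nrm B (\<phi> (f n) \<boxminus> \<phi> (g n))) \<longlonglongrightarrow> nrm C (map_completion \<phi> X \<boxminus>\<^bsub>C\<^esub> map_completion \<phi> Y)"
    using nrm_completion_tendsto[OF cauchy_minus[OF cauchy_map cauchy_map, OF fg(1,2)]] fg
    by (simp add: map_completion_cls minus_completion cauchy_map)
  moreover have "(\<lambda>n. nrm B (f n \<boxminus> g n)) \<longlonglongrightarrow> nrm C (X \<boxminus>\<^bsub>C\<^esub> Y)"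
    using nrm_completion_tendsto[OF cauchy_minus[OF fg(1,2)]] fg by (simp add: minus_completion)
  ultimately show ?thesis
    by (rule LIMSEQ_le) (use fg cauchy_carr phi_dist in auto)
qed

end

end

lemma (in star_prealgebra) enveloping_map_eq:
  "enveloping_map B \<phi> = cstar_prealgebra.map_completion (with_universal_norm B) \<phi>"
proof -
  interpret U: cstar_prealgebra "with_universal_norm B" by (rule cstar_prealgebra_universal)
  show ?thesis by (auto simp: enveloping_map_def U.map_completion_def fun_eq_iff)
qed

section \<open>The seminorm of the regular representation\<close>

text \<open>With \<open>E\<close> the evaluation at the neutral element of the group, \<open>E (y\<^sup>* x)\<close> is the inner product of
  the Hilbert module of square-integrable functions, on which the convolution algebra acts from the left.\<close>

locale expectation = star_prealgebra D for D :: "'d star_alg" (structure) +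
  fixes E :: "'d \<Rightarrow> 'a::unital_cstar_algebra"
  assumes E_plu: "\<And>x y. x \<in> carr D \<Longrightarrow> y \<in> carr D \<Longrightarrow> E (x \<boxplus> y) = E x + E y"
    and E_scal: "\<And>c x. x \<in> carr D \<Longrightarrow> E (c \<cdot> x) = scaleC c (E x)"
    and E_adj: "\<And>x. x \<in> carr D \<Longrightarrow> E (adj D x) = star (E x)"
    and E_null: "\<And>x. x \<in> carr D \<Longrightarrow> nrm D x = 0 \<Longrightarrow> E x = 0"
    and E_pos: "\<And>x. x \<in> carr D \<Longrightarrow> cpos (E (adj D x \<boxtimes> x))"
    and E_module: "\<And>x c. x \<in> carr D \<Longrightarrow> \<exists>x'\<in>carr D. \<forall>y\<in>carr D. E (adj D y \<boxtimes> x') = E (adj D y \<boxtimes> x) * c"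
    and null_mul_left: "\<And>x y. x \<in> carr D \<Longrightarrow> y \<in> carr D \<Longrightarrow> nrm D x = 0 \<Longrightarrow> nrm D (x \<boxtimes> y) = 0"
    and null_mul_right: "\<And>x y. x \<in> carr D \<Longrightarrow> y \<in> carr D \<Longrightarrow> nrm D x = 0 \<Longrightarrow> nrm D (y \<boxtimes> x) = 0"
begin

definition ip :: "'d \<Rightarrow> 'd \<Rightarrow> 'a" where
  "ip x y = E (adj D x \<boxtimes> y)"

definition mnorm :: "'d \<Rightarrow> real" where
  "mnorm x = sqrt (norm (ip x x))"

lemma E_minus: "x \<in> carr D \<Longrightarrow> y \<in> carr D \<Longrightarrow> E (x \<boxminus> y) = E x - E y"
  by (simp add: alg_minus_def E_plu E_scal)

lemma E_cong: "x \<in> carr D \<Longrightarrow> y \<in> carr D \<Longrightarrow> nrm D (x \<boxminus> y) = 0 \<Longrightarrow> E x = E y"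
  using E_null[of "x \<boxminus> y"] by (simp add: E_minus)

lemma ip_plu_right:
  "x \<in> carr D \<Longrightarrow> y \<in> carr D \<Longrightarrow> z \<in> carr D \<Longrightarrow> ip z (x \<boxplus> y) = ip z x + ip z y"
  using E_cong[OF _ _ mul_plu_right[of x y "adj D z"]] by (simp add: ip_def E_plu)

lemma ip_scal_right: "x \<in> carr D \<Longrightarrow> z \<in> carr D \<Longrightarrow> ip z (c \<cdot> x) = scaleC c (ip z x)"
  using E_cong[OF _ _ mul_scal_right[of "adj D z" x c]] by (simp add: ip_def E_scal)

lemma mul_cong_left:
  assumes "x \<in> carr D" "y \<in> carr D" "z \<in> carr D" "nrm D (x \<boxminus> y) = 0"
  shows "nrm D (x \<boxtimes> z \<boxminus> y \<boxtimes> z) = 0"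
proof -
  have "nrm D (x \<boxtimes> z \<boxminus> y \<boxtimes> z) = nrm D ((x \<boxminus> y) \<boxtimes> z)"
    by (rule nrm_eq_of_dist_zero[OF _ _ dist_mul_minus_left]) (use assms in auto)
  then show ?thesis using null_mul_left[of "x \<boxminus> y" z] assms by simp
qed

lemma ip_commute: "x \<in> carr D \<Longrightarrow> y \<in> carr D \<Longrightarrow> ip y x = star (ip x y)"
proof -
  assume c: "x \<in> carr D" "y \<in> carr D"
  have "star (ip x y) = E (adj D (adj D x \<boxtimes> y))" using c by (simp add: ip_def E_adj)
  also have "\<dots> = E (adj D y \<boxtimes> adj D (adj D x))" using c by (intro E_cong adj_mul) auto
  also have "\<dots> = E (adj D y \<boxtimes> x)"
  proof (rule E_cong)
    have "nrm D (adj D y \<boxtimes> adj D (adj D x) \<boxminus> adj D y \<boxtimes> x) = nrm D (adj D y \<boxtimes> (adj D (adj D x) \<boxminus> x))"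
      by (rule nrm_eq_of_dist_zero[OF _ _ dist_mul_minus_right]) (use c in auto)
    then show "nrm D (adj D y \<boxtimes> adj D (adj D x) \<boxminus> adj D y \<boxtimes> x) = 0"
      using null_mul_right[of "adj D (adj D x) \<boxminus> x" "adj D y"] c adj_adj by simp
  qed (use c in auto)
  finally show ?thesis by (simp add: ip_def)
qed

lemma ip_plu_left:
  "x \<in> carr D \<Longrightarrow> y \<in> carr D \<Longrightarrow> z \<in> carr D \<Longrightarrow> ip (x \<boxplus> y) z = ip x z + ip y z"
  using ip_commute[of z "x \<boxplus> y"] ip_commute[of z x] ip_commute[of z y]
  by (simp add: ip_plu_right star_add)

lemma ip_scal_left: "x \<in> carr D \<Longrightarrow> z \<in> carr D \<Longrightarrow> ip (c \<cdot> x) z = scaleC (cnj c) (ip x z)"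
  using ip_commute[of z "c \<cdot> x"] ip_commute[of z x] by (simp add: ip_scal_right star_scaleC)

lemma ip_pos: "x \<in> carr D \<Longrightarrow> cpos (ip x x)"
  by (simp add: ip_def E_pos)

lemma ip_mul_left:
  assumes "x \<in> carr D" "y \<in> carr D" "z \<in> carr D"
  shows "ip (x \<boxtimes> y) z = ip y (adj D x \<boxtimes> z)"
proof -
  have "E (adj D (x \<boxtimes> y) \<boxtimes> z) = E ((adj D y \<boxtimes> adj D x) \<boxtimes> z)"
    by (intro E_cong mul_cong_left adj_mul) (use assms in auto)
  also have "\<dots> = E (adj D y \<boxtimes> (adj D x \<boxtimes> z))"
    by (intro E_cong mul_assoc) (use assms in auto)
  finally show ?thesis by (simp add: ip_def)
qed

lemma ip_mul_adj_left:
  assumes "x \<in> carr D" "y \<in> carr D" "z \<in> carr D"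
  shows "ip (adj D x \<boxtimes> y) z = ip y (x \<boxtimes> z)"
  using ip_commute[of "adj D x \<boxtimes> y" z] ip_commute[of z "adj D x \<boxtimes> y"] ip_mul_left[of x z y]
    ip_commute[of "x \<boxtimes> z" y] assms by simp

text \<open>With c = \<open>ip x y\<close>, the element x' supplied by \<open>E_module\<close> plays
  the role of x c. Expanding the positive element \<open>ip z z\<close> for z = y - r x' gives the
  claim at r = 1 / R, where R exceeds \<open>norm (ip x x)\<close> by e; the excess keeps R positive
  and is sent to 0 at the end.\<close>

lemma Cauchy_Schwarz_square:
  assumes x: "x \<in> carr D" and y: "y \<in> carr D"
  shows "(norm (ip x y))\<^sup>2 \<le> norm (ip x x) * norm (ip y y)"
proof -
  define c where "c = ip x y"
  have le: "(norm c)\<^sup>2 \<le> (norm (ip x x) + e) * norm (ip y y)" if e: "0 < e" for e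
  proof -
    define R where "R = norm (ip x x) + e"
    define r where "r = 1 / R"
    have R: "0 < R" "norm (ip x x) \<le> R" using e by (auto simp: R_def add_nonneg_pos)
    have r: "0 < r" "r * R = 1" using R by (auto simp: r_def)
    obtain x' where x': "x' \<in> carr D" "\<And>z. z \<in> carr D \<Longrightarrow> ip z x' = ip z x * c"
      using E_module[OF x, of c] by (auto simp: ip_def)
    have yx': "ip y x' = star c * c" using x'(2)[OF y] ip_commute[OF x y] by (simp add: c_def)
    have x'y: "ip x' y = star c * c" using ip_commute[OF y x'(1)] yx' by (simp add: star_mult star_star)
    have x'x': "ip x' x' = star c * ip x x * c"
      using x'(2)[OF x'(1)] ip_commute[OF x x'(1)] x'(2)[OF x] ip_commute[OF x x]
      by (simp add: star_mult star_star)
    define z where "z = y \<boxplus> complex_of_real (- r) \<cdot> x'"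
    have zz: "ip z z = ip y y - r *\<^sub>R (star c * c) - r *\<^sub>R (star c * c) + r *\<^sub>R r *\<^sub>R (star c * ip x x * c)"
      using x'(1) y
      by (simp add: z_def ip_plu_left ip_plu_right ip_scal_left ip_scal_right yx' x'y
          x'x' scaleR_scaleC scaleC_scaleC scaleC_minus_left scaleC_diff_right)
    have "cpos (ip z z)" using x'(1) y by (intro ip_pos) (auto simp: z_def)
    \<comment> \<open>As r * R = 1, adding this positive element turns the quadratic term of
      \<open>ip z z\<close> into r times \<open>star c * c\<close>, which cancels one of the two
      mixed terms.\<close>
    moreover have "cpos (r *\<^sub>R r *\<^sub>R (R *\<^sub>R (star c * c) - star c * ip x x * c))"
      using r R ip_commute[OF x x] by (intro cpos_scaleR cpos_conjugate_bound) auto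
    ultimately have "cpos (ip z z + r *\<^sub>R r *\<^sub>R (R *\<^sub>R (star c * c) - star c * ip x x * c))"
      using cpos_add by blast
    moreover have "ip z z + r *\<^sub>R r *\<^sub>R (R *\<^sub>R (star c * c) - star c * ip x x * c)
        = ip y y - r *\<^sub>R (star c * c)"
      unfolding zz using r(2) by (simp add: scaleR_diff_right)
    ultimately have "cpos (ip y y - r *\<^sub>R (star c * c))" by simp
    then have "norm (r *\<^sub>R (star c * c)) \<le> norm (ip y y)"
      using r by (intro cpos_norm_mono cpos_scaleR cpos_star_mult) auto
    then have "r * (norm c)\<^sup>2 \<le> norm (ip y y)" using r by (simp add: norm_star_mult)
    then have "R * (r * (norm c)\<^sup>2) \<le> R * norm (ip y y)" using R by (intro mult_left_mono) auto
    moreover have "R * (r * (norm c)\<^sup>2) = (norm c)\<^sup>2" using r(2) by (metis mult.assoc mult.commute mult_1)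
    ultimately show ?thesis by (simp only: R_def)
  qed
  have "((\<lambda>e. (norm (ip x x) + e) * norm (ip y y)) \<longlongrightarrow> (norm (ip x x) + 0) * norm (ip y y)) (at_right 0)"
    by (intro tendsto_intros)
  then have "(norm c)\<^sup>2 \<le> (norm (ip x x) + 0) * norm (ip y y)"
    by (rule tendsto_lowerbound) (auto simp: eventually_at_right_less le eventually_at_filter)
  then show ?thesis by (simp add: c_def)
qed

lemma mnorm_nonneg [simp]: "0 \<le> mnorm x"
  by (simp add: mnorm_def)

lemma mnorm_square: "(mnorm x)\<^sup>2 = norm (ip x x)"
  by (simp add: mnorm_def)

lemma Cauchy_Schwarz:
  assumes "x \<in> carr D" "y \<in> carr D"
  shows "norm (ip x y) \<le> mnorm x * mnorm y"
  by (rule power2_le_imp_le) (simp_all add: power_mult_distrib mnorm_square Cauchy_Schwarz_square assms)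

lemma mnorm_triangle:
  assumes "x \<in> carr D" "y \<in> carr D"
  shows "mnorm (x \<boxplus> y) \<le> mnorm x + mnorm y"
proof (rule power2_le_imp_le)
  have "(mnorm (x \<boxplus> y))\<^sup>2 = norm ((ip x x + ip y x) + (ip x y + ip y y))"
    using assms by (simp add: mnorm_square ip_plu_left ip_plu_right)
  also have "\<dots> \<le> (norm (ip x x) + norm (ip y x)) + (norm (ip x y) + norm (ip y y))"
    by (intro norm_triangle_mono norm_triangle_ineq)
  also have "\<dots> \<le> (mnorm x * mnorm x + mnorm y * mnorm x) + (mnorm x * mnorm y + mnorm y * mnorm y)"
    using assms by (intro add_mono Cauchy_Schwarz)
  finally show "(mnorm (x \<boxplus> y))\<^sup>2 \<le> (mnorm x + mnorm y)\<^sup>2"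
    by (simp add: power2_eq_square algebra_simps)
qed simp

lemma mnorm_scal: "x \<in> carr D \<Longrightarrow> mnorm (c \<cdot> x) = cmod c * mnorm x"
  by (simp add: mnorm_def ip_scal_left ip_scal_right scaleC_scaleC norm_scaleC norm_mult
      real_sqrt_mult)

lemma mnorm_null: "x \<in> carr D \<Longrightarrow> nrm D x = 0 \<Longrightarrow> mnorm x = 0"
  using E_null[of "adj D x \<boxtimes> x"] null_mul_right[of x "adj D x"] by (simp add: mnorm_def ip_def)

lemma mnorm_cong:
  assumes "x \<in> carr D" "y \<in> carr D" "nrm D (x \<boxminus> y) = 0"
  shows "mnorm x = mnorm y"
proof -
  have le: "mnorm x \<le> mnorm y" if "x \<in> carr D" "y \<in> carr D" "nrm D (x \<boxminus> y) = 0" for x y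
    using mnorm_triangle[of "x \<boxminus> y" y] mnorm_null[of "x \<boxminus> y"] that by (simp add: minus_plu_cancel)
  show ?thesis using le[of x y] le[of y x] assms dist_commute[of x y] by simp
qed

end

lemma divide_le_if_le_mult: "(a::real) \<le> c * b \<Longrightarrow> 0 \<le> c \<Longrightarrow> 0 \<le> b \<Longrightarrow> a / b \<le> c"
  by (cases "b = 0") (auto simp: divide_le_eq)

locale regular = expectation +
  assumes mnorm_mul_le: "\<And>x y. x \<in> carr D \<Longrightarrow> y \<in> carr D \<Longrightarrow> mnorm (x \<boxtimes> y) \<le> nrm D x * mnorm y"
begin

text \<open>Operator norm of left multiplication by x on the Hilbert module. A vector y with
  \<open>mnorm y = 0\<close> contributes the quotient 0, so it does not disturb the
  supremum.\<close>

definition reg :: "'a \<Rightarrow> real" where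
  "reg x = (SUP y\<in>carr D. mnorm (x \<boxtimes> y) / mnorm y)"

lemma bdd_above_reg: "x \<in> carr D \<Longrightarrow> bdd_above ((\<lambda>y. mnorm (x \<boxtimes> y) / mnorm y) ` carr D)"
  by (rule bdd_aboveI[of _ "nrm D x"]) (auto intro!: divide_le_if_le_mult mnorm_mul_le)

lemma reg_leI:
  assumes "0 \<le> c" "\<And>y. y \<in> carr D \<Longrightarrow> mnorm (x \<boxtimes> y) \<le> c * mnorm y"
  shows "reg x \<le> c"
  unfolding reg_def
proof (rule cSUP_least)
  fix y assume "y \<in> carr D"
  then show "mnorm (x \<boxtimes> y) / mnorm y \<le> c"
    using assms(2) by (intro divide_le_if_le_mult assms(1) mnorm_nonneg)
qed (use zer_closed in blast)

lemma mnorm_le_reg: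
  assumes "x \<in> carr D" "y \<in> carr D"
  shows "mnorm (x \<boxtimes> y) \<le> reg x * mnorm y"
proof (cases "mnorm y = 0")
  case True
  then show ?thesis using mnorm_mul_le[OF assms] by simp
next
  case False
  then have "0 < mnorm y" using mnorm_nonneg[of y] by linarith
  moreover have "mnorm (x \<boxtimes> y) / mnorm y \<le> reg x"
    unfolding reg_def by (rule cSUP_upper[OF assms(2) bdd_above_reg[OF assms(1)]])
  ultimately show ?thesis by (simp add: divide_le_eq)
qed

lemma reg_nonneg: "x \<in> carr D \<Longrightarrow> 0 \<le> reg x"
proof -
  assume x: "x \<in> carr D"
  have "0 \<le> mnorm (x \<boxtimes> \<zero>) / mnorm \<zero>" by simp
  also have "\<dots> \<le> reg x" unfolding reg_def by (rule cSUP_upper[OF zer_closed bdd_above_reg[OF x]])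
  finally show ?thesis .
qed

lemma reg_mul_le:
  assumes "x \<in> carr D" "y \<in> carr D"
  shows "reg (x \<boxtimes> y) \<le> reg x * reg y"
proof (rule reg_leI)
  fix z assume z: "z \<in> carr D"
  have "mnorm ((x \<boxtimes> y) \<boxtimes> z) = mnorm (x \<boxtimes> (y \<boxtimes> z))"
    by (rule mnorm_cong[OF _ _ mul_assoc]) (use assms z in auto)
  also have "\<dots> \<le> reg x * mnorm (y \<boxtimes> z)" using assms z by (intro mnorm_le_reg) auto
  also have "\<dots> \<le> reg x * (reg y * mnorm z)"
    using assms z by (intro mult_left_mono mnorm_le_reg reg_nonneg) auto
  finally show "mnorm ((x \<boxtimes> y) \<boxtimes> z) \<le> reg x * reg y * mnorm z" by (simp add: mult.assoc)
qed (use assms reg_nonneg in auto)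

text \<open>Left multiplications are adjointable: for w = \<open>adj D x \<boxtimes> y\<close>, the
  square of \<open>mnorm w\<close> is the norm of \<open>ip y (x \<boxtimes> w)\<close>.
  Cauchy-Schwarz bounds it by \<open>mnorm y\<close> * \<open>reg x\<close> *
  \<open>mnorm w\<close>, and one factor cancels.\<close>

lemma reg_adj_le:
  assumes "x \<in> carr D"
  shows "reg (adj D x) \<le> reg x"
proof (rule reg_leI[OF reg_nonneg[OF assms]])
  fix y assume y: "y \<in> carr D"
  let ?w = "adj D x \<boxtimes> y"
  show "mnorm ?w \<le> reg x * mnorm y"
  proof (cases "mnorm ?w = 0")
    case True
    then show ?thesis using reg_nonneg[OF assms] by simp
  next
    case False
    have "mnorm ?w * mnorm ?w = norm (ip y (x \<boxtimes> ?w))"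
      using ip_mul_adj_left[of x y ?w] mnorm_square[of ?w] assms y by (simp add: power2_eq_square)
    also have "\<dots> \<le> mnorm y * mnorm (x \<boxtimes> ?w)" using assms y by (intro Cauchy_Schwarz) auto
    also have "\<dots> \<le> mnorm y * (reg x * mnorm ?w)"
      using assms y by (intro mult_left_mono mnorm_le_reg) auto
    finally have "mnorm ?w * mnorm ?w \<le> (reg x * mnorm y) * mnorm ?w" by (simp add: ac_simps)
    then show ?thesis using False mnorm_nonneg[of ?w] by (metis mult_right_le_imp_le order.not_eq_order_implies_strict)
  qed
qed

text \<open>The C*-identity comes from writing the square of \<open>mnorm (x \<boxtimes> y)\<close>
  as the norm of \<open>ip y (adj D x \<boxtimes> (x \<boxtimes> y))\<close> and applying
  Cauchy-Schwarz.\<close>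

lemma cstar_seminorm_reg: "cstar_seminorm D reg"
  unfolding cstar_seminorm_def
proof (intro conjI ballI allI)
  fix x y assume x: "x \<in> carr D" and y: "y \<in> carr D"
  show "reg (x \<boxplus> y) \<le> reg x + reg y"
  proof (rule reg_leI)
    fix z assume z: "z \<in> carr D"
    have "mnorm ((x \<boxplus> y) \<boxtimes> z) = mnorm (x \<boxtimes> z \<boxplus> y \<boxtimes> z)"
      by (rule mnorm_cong[OF _ _ mul_plu_left]) (use x y z in auto)
    also have "\<dots> \<le> mnorm (x \<boxtimes> z) + mnorm (y \<boxtimes> z)" using x y z by (intro mnorm_triangle) auto
    also have "\<dots> \<le> reg x * mnorm z + reg y * mnorm z"
      using x y z by (intro add_mono mnorm_le_reg) auto
    finally show "mnorm ((x \<boxplus> y) \<boxtimes> z) \<le> (reg x + reg y) * mnorm z" by (simp add: algebra_simps)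
  qed (use x y reg_nonneg in auto)
  show "reg (x \<boxtimes> y) \<le> reg x * reg y" by (rule reg_mul_le[OF x y])
next
  fix x assume x: "x \<in> carr D"
  show "reg (adj D x \<boxtimes> x) = (reg x)\<^sup>2"
  proof (rule antisym)
    have "reg (adj D x \<boxtimes> x) \<le> reg (adj D x) * reg x" using x by (intro reg_mul_le) auto
    also have "\<dots> \<le> reg x * reg x" using x by (intro mult_right_mono reg_adj_le reg_nonneg)
    finally show "reg (adj D x \<boxtimes> x) \<le> (reg x)\<^sup>2" by (simp add: power2_eq_square)
    have "reg x \<le> sqrt (reg (adj D x \<boxtimes> x))"
    proof (rule reg_leI)
      fix y assume y: "y \<in> carr D"
      have "(mnorm (x \<boxtimes> y))\<^sup>2 = norm (ip y (adj D x \<boxtimes> (x \<boxtimes> y)))"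
        using ip_mul_left[of x y "x \<boxtimes> y"] x y by (simp add: mnorm_square)
      also have "\<dots> \<le> mnorm y * mnorm (adj D x \<boxtimes> (x \<boxtimes> y))"
        using x y by (intro Cauchy_Schwarz) auto
      also have "mnorm (adj D x \<boxtimes> (x \<boxtimes> y)) = mnorm ((adj D x \<boxtimes> x) \<boxtimes> y)"
        by (rule mnorm_cong[OF _ _ mul_assoc, symmetric]) (use x y in auto)
      also have "mnorm y * \<dots> \<le> mnorm y * (reg (adj D x \<boxtimes> x) * mnorm y)"
        using x y by (intro mult_left_mono mnorm_le_reg) auto
      also have "\<dots> = (sqrt (reg (adj D x \<boxtimes> x)) * mnorm y)\<^sup>2"
        using x reg_nonneg[of "adj D x \<boxtimes> x"] by (simp add: power_mult_distrib power2_eq_square)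
      finally show "mnorm (x \<boxtimes> y) \<le> sqrt (reg (adj D x \<boxtimes> x)) * mnorm y"
        by (rule power2_le_imp_le) (use x reg_nonneg[of "adj D x \<boxtimes> x"] in simp)
    qed (use x reg_nonneg in auto)
    then have "(reg x)\<^sup>2 \<le> (sqrt (reg (adj D x \<boxtimes> x)))\<^sup>2"
      using reg_nonneg[OF x] by (rule power_mono)
    then show "(reg x)\<^sup>2 \<le> reg (adj D x \<boxtimes> x)"
      using reg_nonneg[of "adj D x \<boxtimes> x"] x by simp
  qed
  fix c
  have le: "reg (c \<cdot> x) \<le> cmod c * reg x" if x: "x \<in> carr D" for c x
  proof (rule reg_leI)
    fix z assume z: "z \<in> carr D"
    have "mnorm ((c \<cdot> x) \<boxtimes> z) = mnorm (c \<cdot> (x \<boxtimes> z))"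
      by (rule mnorm_cong[OF _ _ mul_scal_left]) (use x z in auto)
    also have "\<dots> = cmod c * mnorm (x \<boxtimes> z)" using x z by (simp add: mnorm_scal)
    also have "\<dots> \<le> cmod c * (reg x * mnorm z)"
      using x z by (intro mult_left_mono mnorm_le_reg) auto
    finally show "mnorm ((c \<cdot> x) \<boxtimes> z) \<le> cmod c * reg x * mnorm z" by (simp add: mult.assoc)
  qed (use x reg_nonneg in auto)
  show "reg (c \<cdot> x) = cmod c * reg x"
  proof (cases "c = 0")
    case True
    then show ?thesis using le[OF x, of 0] reg_nonneg[of "0 \<cdot> x"] x by simp
  next
    case False
    have "reg x = reg (inverse c \<cdot> c \<cdot> x)"
      using False x by (simp add: scal_scal scal_one)
    also have "\<dots> \<le> cmod (inverse c) * reg (c \<cdot> x)" using x by (intro le) auto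
    finally have "cmod c * reg x \<le> reg (c \<cdot> x)"
      using False by (simp add: norm_inverse norm_divide field_simps)
    then show ?thesis using le[OF x, of c] by simp
  qed
qed (rule reg_nonneg)

text \<open>\<open>reg\<close> is one of the seminorms in the supremum. This is the lower bound on
  the universal norm from which coefficients of elements of the crossed product are
  recovered.\<close>

lemma mnorm_le_universal:
  assumes "x \<in> carr D" "y \<in> carr D"
  shows "mnorm (x \<boxtimes> y) \<le> universal_norm D x * mnorm y"
proof -
  have "reg \<in> dominated"
    using cstar_seminorm_reg mnorm_mul_le by (auto intro!: reg_leI)
  then have "reg x \<le> universal_norm D x" using assms by (intro dominated_le_universal)
  then show ?thesis using mnorm_le_reg[OF assms] by (meson mult_right_mono mnorm_nonneg order_trans)
qed

end

section \<open>The two properties for a unital C*-algebra\<close>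

lemma cstar_univ_simps [simp]:
  "carr cstar_univ = UNIV" "plu cstar_univ = (+)" "scal cstar_univ = scaleC" "mul cstar_univ = (*)"
  "adj cstar_univ = star" "nrm cstar_univ = norm" "x \<boxminus>\<^bsub>cstar_univ\<^esub> y = x - y"
  by (simp_all add: cstar_univ_def alg_minus_def)

lemma unit_of_cstar_univ [simp]: "unit_of cstar_univ = (1::'a::unital_cstar_algebra)"
  unfolding unit_of_def
proof (rule the_equality)
  fix e :: 'a assume "e \<in> carr cstar_univ \<and> (\<forall>x\<in>carr cstar_univ. e \<boxtimes>\<^bsub>cstar_univ\<^esub> x = x \<and> x \<boxtimes>\<^bsub>cstar_univ\<^esub> e = x)"
  then show "e = 1" by (metis UNIV_I cstar_univ_simps(1,4) mult_1_right)
qed simp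

lemma norm_continuous_path_cstar_univ [simp]:
  "norm_continuous_path cstar_univ v \<longleftrightarrow> continuous_on {0..} v"
  by (simp add: norm_continuous_path_def continuous_on_def tendsto_norm_zero_iff LIM_zero_iff Ball_def)

lemma continuous_rokhlin_property_cstar_univ:
  "continuous_rokhlin_property (cstar_univ :: 'a::unital_cstar_algebra star_alg) \<alpha> \<longleftrightarrow>
    (\<exists>u :: real \<Rightarrow> 'a. continuous_on {0..} u \<and> (\<forall>t\<ge>0. star (u t) * u t = 1 \<and> u t * star (u t) = 1) \<and>
     ((\<lambda>t. SUP \<zeta>\<in>\<TT>. norm (\<alpha> \<zeta> (u t) - scaleC \<zeta> (u t))) \<longlongrightarrow> 0) at_top \<and>
     (\<forall>a. ((\<lambda>t. u t * a - a * u t) \<longlongrightarrow> 0) at_top))"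
  by (simp add: continuous_rokhlin_property_def unitary_def tendsto_norm_zero_iff)

lemma asymptotically_representable_cstar_univ:
  "asymptotically_representable (cstar_univ :: 'a::unital_cstar_algebra star_alg) \<beta> \<longleftrightarrow>
    (\<exists>v :: real \<Rightarrow> 'a. continuous_on {0..} v \<and> (\<forall>t\<ge>0. norm (v t) \<le> 1) \<and>
     (\<forall>b. ((\<lambda>t. star (v t) * v t * b - b) \<longlongrightarrow> 0) at_top) \<and>
     ((\<lambda>t. star (v t) * v t - v t * star (v t)) \<longlongrightarrow> 0) at_top \<and>
     ((\<lambda>t. \<beta> (v t) - v t) \<longlongrightarrow> 0) at_top \<and>
     (\<forall>b. ((\<lambda>t. \<beta> b - v t * b * star (v t)) \<longlongrightarrow> 0) at_top))"
  by (simp add: asymptotically_representable_def tendsto_norm_zero_iff)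

lemma norm_le_one_if_isometry: "star u * u = 1 \<Longrightarrow> norm (u::'a::unital_cstar_algebra) \<le> 1"
  using norm_square_le_iff[of u] norm_one_le[where 'a='a] by simp

lemma tendsto_zero_mult_bounded:
  fixes f g :: "real \<Rightarrow> 'a::real_normed_algebra"
  assumes "(f \<longlongrightarrow> 0) at_top" "\<And>t. 0 \<le> t \<Longrightarrow> norm (g t) \<le> K"
  shows "((\<lambda>t. f t * g t) \<longlongrightarrow> 0) at_top" "((\<lambda>t. g t * f t) \<longlongrightarrow> 0) at_top"
proof -
  have ev: "\<forall>\<^sub>F t in at_top. norm (g t) \<le> K"
    using eventually_ge_at_top[of "0::real"] by (rule eventually_mono) (rule assms)
  have lim: "((\<lambda>t. norm (f t) * K) \<longlongrightarrow> 0) at_top"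
    by (intro tendsto_mult_left_zero tendsto_norm_zero assms)
  show "((\<lambda>t. f t * g t) \<longlongrightarrow> 0) at_top"
    by (rule Lim_null_comparison[OF eventually_mono[OF ev] lim])
      (meson norm_mult_ineq mult_left_mono norm_ge_zero order_trans)
  show "((\<lambda>t. g t * f t) \<longlongrightarrow> 0) at_top"
    by (rule Lim_null_comparison[OF eventually_mono[OF ev] lim])
      (metis norm_mult_ineq mult_right_mono norm_ge_zero order_trans mult.commute)
qed

text \<open>From some time on both products are within 1/2 of 1, where polar parts are unitary. The
  shift by s discards the time before; later properties concern only limits at infinity.\<close>

lemma unitary_path_near:
  fixes x :: "real \<Rightarrow> 'a::unital_cstar_algebra"
  assumes x: "continuous_on {0..} x" and l: "((\<lambda>t. star (x t) * x t) \<longlongrightarrow> 1) at_top"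
    and r: "((\<lambda>t. x t * star (x t)) \<longlongrightarrow> 1) at_top"
  obtains s where "0 \<le> s" "continuous_on {0..} (\<lambda>t. polar (x (t + s)))"
    "\<And>t. 0 \<le> t \<Longrightarrow> norm (1 - star (x (t + s)) * x (t + s)) \<le> 1/2"
    "\<And>t. 0 \<le> t \<Longrightarrow> star (polar (x (t + s))) * polar (x (t + s)) = 1"
    "\<And>t. 0 \<le> t \<Longrightarrow> polar (x (t + s)) * star (polar (x (t + s))) = 1"
    "((\<lambda>t. polar (x (t + s)) - x (t + s)) \<longlongrightarrow> 0) at_top"
proof -
  have "\<forall>\<^sub>F t in at_top. dist (star (x t) * x t) 1 < 1/2 \<and> dist (x t * star (x t)) 1 < 1/2"
    by (intro eventually_conj tendstoD l r) auto
  then obtain s0 where "\<And>t. s0 \<le> t \<Longrightarrow> dist (star (x t) * x t) 1 < 1/2 \<and> dist (x t * star (x t)) 1 < 1/2"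
    by (auto simp: eventually_at_top_linorder)
  then have s0: "norm (1 - star (x t) * x t) \<le> 1/2" "norm (1 - x t * star (x t)) \<le> 1/2" if "s0 \<le> t" for t
    using that by (auto simp: dist_norm norm_minus_commute intro: less_imp_le)
  define s where "s = max 0 s0"
  have s: "0 \<le> s" "s0 \<le> t + s" if "0 \<le> t" for t using that by (auto simp: s_def)
  have nx: "norm (x t) \<le> 2" if "norm (1 - star (x t) * x t) \<le> 1/2" for t
  proof -
    have "(norm (x t))\<^sup>2 = norm (1 - (1 - star (x t) * x t))" by (simp add: norm_star_mult)
    also have "\<dots> \<le> norm (1::'a) + norm (1 - star (x t) * x t)" by (rule norm_triangle_ineq4)
    also have "\<dots> \<le> 1 + 1/2" using that norm_one_le by (intro add_mono) auto
    also have "\<dots> \<le> 2\<^sup>2" by simp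
    finally show ?thesis by (rule power2_le_imp_le) simp
  qed
  have filt: "filterlim (\<lambda>t. t + s) at_top at_top"
    using filterlim_tendsto_add_at_top[OF tendsto_const filterlim_ident, of s] by (simp add: add.commute)
  show thesis
  proof (rule that[of s])
    show "continuous_on {0..} (\<lambda>t. polar (x (t + s)))"
      by (rule continuous_on_polar, rule continuous_on_compose2[OF x])
        (use s s0 in \<open>auto intro!: continuous_intros\<close>)
    show "((\<lambda>t. polar (x (t + s)) - x (t + s)) \<longlongrightarrow> 0) at_top"
    proof (rule Lim_null_comparison)
      have "((\<lambda>t. 1 - star (x t) * x t) \<longlongrightarrow> 1 - 1) at_top" by (intro tendsto_intros l)
      from filterlim_compose[OF this filt]
      have "((\<lambda>t. 1 - star (x (t + s)) * x (t + s)) \<longlongrightarrow> 0) at_top" by simp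
      \<comment> \<open>8 = 4 * 2, the constant of \<open>norm_polar_diff_le\<close> times the bound
        2 on the norm of x from \<open>nx\<close>.\<close>
      then show "((\<lambda>t. 8 * norm (1 - star (x (t + s)) * x (t + s))) \<longlongrightarrow> 0) at_top"
        by (intro tendsto_mult_right_zero tendsto_norm_zero)
      show "\<forall>\<^sub>F t in at_top. norm (polar (x (t + s)) - x (t + s)) \<le> 8 * norm (1 - star (x (t + s)) * x (t + s))"
        using eventually_ge_at_top[of "0::real"]
      proof eventually_elim
        case (elim t)
        let ?z = "norm (1 - star (x (t + s)) * x (t + s))"
        have "norm (polar (x (t + s)) - x (t + s)) \<le> 4 * norm (x (t + s)) * ?z"
          using s0 s elim by (intro norm_polar_diff_le) auto
        also have "\<dots> \<le> 4 * 2 * ?z"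
          using s0 s elim by (intro mult_right_mono mult_left_mono nx) auto
        finally show ?case by simp
      qed
    qed
  qed (use s s0 in \<open>auto intro!: polar_isometry polar_coisometry\<close>)
qed

section \<open>Crossed products by the integers\<close>

locale int_system =
  fixes \<beta> :: "'a::unital_cstar_algebra \<Rightarrow> 'a"
  assumes beta: "star_auto \<beta>"
begin

abbreviation iter :: "int \<Rightarrow> 'a \<Rightarrow> 'a" where
  "iter \<equiv> int_iterate \<beta>"

lemma star_auto_funpow: "star_auto \<phi> \<Longrightarrow> star_auto (\<phi> ^^ n)"
  by (induction n) (auto simp: star_auto_comp star_auto_id[folded id_def])

lemma star_auto_iter: "star_auto (iter k)"
  by (auto simp: int_iterate_def intro!: star_auto_funpow star_auto_inv beta)

lemma bij_beta: "bij \<beta>"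
  using beta by (simp add: star_auto_iff)

sublocale iter: star_aut "iter k" for k
  by standard (rule star_auto_iter)

sublocale beta: star_aut \<beta>
  by standard (rule beta)

lemma iter_0 [simp]: "iter 0 = (\<lambda>x. x)"
  by (auto simp: int_iterate_def)

lemma iter_1 [simp]: "iter 1 = \<beta>"
  by (auto simp: int_iterate_def)

lemma iter_plus_one: "iter (k + 1) x = \<beta> (iter k x)"
proof (cases "0 \<le> k")
  case True
  then show ?thesis by (simp add: int_iterate_def nat_add_distrib)
next
  case False
  then obtain n where n: "k = - int (Suc n)"
    using negD[of k] by auto
  have "\<beta> ((inv \<beta> ^^ Suc n) x) = (inv \<beta> ^^ n) x"
    using bij_beta by (simp add: bij_is_surj surj_f_inv_f)
  moreover have "nat (- k) = Suc n" by (simp add: n)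
  then have "iter k x = (inv \<beta> ^^ Suc n) x" using False by (simp only: int_iterate_def if_False)
  moreover have "iter (k + 1) x = (inv \<beta> ^^ n) x" by (simp add: n int_iterate_def)
  ultimately show ?thesis by simp
qed

lemma iter_minus_one: "iter (k - 1) x = inv \<beta> (iter k x)"
  using iter_plus_one[of "k - 1" x] bij_beta by (simp add: bij_is_inj)

lemma iter_add: "iter (k + l) x = iter k (iter l x)"
proof (induction k rule: int_induct[of _ 0])
  case (step1 i)
  then show ?case using iter_plus_one[of "i + l" x] iter_plus_one[of i] by (simp add: algebra_simps)
next
  case (step2 i)
  then show ?case using iter_minus_one[of "i + l" x] iter_minus_one[of i] by (simp add: algebra_simps)
qed simp

section \<open>The convolution algebra over the integers\<close>

abbreviation "D \<equiv> int_conv_alg \<beta>"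

lemma D_simps:
  "carr D = {\<xi>. finite {k. \<xi> k \<noteq> 0}}" "zer D = (\<lambda>k. 0)" "plu D = (\<lambda>\<xi> \<eta> k. \<xi> k + \<eta> k)"
  "scal D = (\<lambda>c \<xi> k. scaleC c (\<xi> k))" "adj D = (\<lambda>\<xi> k. iter k (star (\<xi> (- k))))"
  "alg_minus D = (\<lambda>\<xi> \<eta> k. \<xi> k - \<eta> k)"
  by (auto simp: int_conv_alg_def alg_minus_def fun_eq_iff)

text \<open>The definition sums over the exact support, which changes under every operation. With an
  arbitrary finite superset S, several functions can be expanded over one common index set.\<close>

lemma mul_eq:
  assumes "finite S" "\<forall>k. k \<notin> S \<longrightarrow> \<xi> k = 0"
  shows "mul D \<xi> \<eta> n = (\<Sum>k\<in>S. \<xi> k * iter k (\<eta> (n - k)))"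
proof -
  have "mul D \<xi> \<eta> n = (\<Sum>k | \<xi> k \<noteq> 0. \<xi> k * iter k (\<eta> (n - k)))" by (simp add: int_conv_alg_def)
  also have "\<dots> = (\<Sum>k\<in>S. \<xi> k * iter k (\<eta> (n - k)))"
    by (rule sum.mono_neutral_left) (use assms in auto)
  finally show ?thesis .
qed

lemma nrm_eq:
  assumes "finite S" "\<forall>k. k \<notin> S \<longrightarrow> \<xi> k = 0"
  shows "nrm D \<xi> = (\<Sum>k\<in>S. norm (\<xi> k))"
proof -
  have "nrm D \<xi> = (\<Sum>k | \<xi> k \<noteq> 0. norm (\<xi> k))" by (simp add: int_conv_alg_def)
  also have "\<dots> = (\<Sum>k\<in>S. norm (\<xi> k))"
    by (rule sum.mono_neutral_left) (use assms in auto)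
  finally show ?thesis .
qed

lemma carrI: "finite S \<Longrightarrow> \<forall>k. k \<notin> S \<longrightarrow> \<xi> k = 0 \<Longrightarrow> \<xi> \<in> carr D"
  unfolding D_simps by (auto intro: finite_subset[of _ S])

lemma carrE:
  assumes "\<xi> \<in> carr D"
  obtains S where "finite S" "\<forall>k. k \<notin> S \<longrightarrow> \<xi> k = 0"
proof
  show "finite {k. \<xi> k \<noteq> 0}" using assms by (simp add: D_simps)
qed simp

lemma carrE2:
  assumes "\<xi> \<in> carr D" "\<eta> \<in> carr D"
  obtains S where "finite S" "\<forall>k. k \<notin> S \<longrightarrow> \<xi> k = 0" "\<forall>k. k \<notin> S \<longrightarrow> \<eta> k = 0"
proof
  show "finite ({k. \<xi> k \<noteq> 0} \<union> {k. \<eta> k \<noteq> 0})" using assms by (simp add: D_simps)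
qed simp_all

lemma mul_zero_outside:
  assumes "finite S" "\<forall>k. k \<notin> S \<longrightarrow> \<xi> k = 0" "\<forall>k. k \<notin> T \<longrightarrow> \<eta> k = 0"
    "n \<notin> (\<lambda>(k, l). k + l) ` (S \<times> T)"
  shows "mul D \<xi> \<eta> n = 0"
proof -
  have "\<eta> (n - k) = 0" if "k \<in> S" for k
  proof -
    have "n - k \<notin> T" using assms(4) that by (auto intro!: rev_image_eqI[of "(k, n - k)"])
    then show ?thesis using assms(3) by blast
  qed
  then show ?thesis unfolding mul_eq[OF assms(1,2)] by (intro sum.neutral) auto
qed

lemma mul_closed:
  assumes "\<xi> \<in> carr D" "\<eta> \<in> carr D"
  shows "mul D \<xi> \<eta> \<in> carr D"
proof -
  obtain S where S: "finite S" "\<forall>k. k \<notin> S \<longrightarrow> \<xi> k = 0" using assms(1) by (rule carrE)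
  obtain T where T: "finite T" "\<forall>k. k \<notin> T \<longrightarrow> \<eta> k = 0" using assms(2) by (rule carrE)
  show ?thesis
    by (rule carrI[of "(\<lambda>(k, l). k + l) ` (S \<times> T)"])
      (use S T mul_zero_outside[OF S T(2)] in auto)
qed

lemma adj_closed:
  assumes "\<xi> \<in> carr D" shows "adj D \<xi> \<in> carr D"
proof -
  obtain S where S: "finite S" "\<forall>k. k \<notin> S \<longrightarrow> \<xi> k = 0" using assms by (rule carrE)
  have "adj D \<xi> k = 0" if "k \<notin> uminus ` S" for k
  proof -
    have "- k \<notin> S" using that by (metis image_eqI minus_minus)
    then show ?thesis using S(2) by (simp add: D_simps)
  qed
  then show ?thesis using S(1) by (intro carrI[of "uminus ` S"]) auto
qed

lemma mul_assoc_D: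
  assumes "\<xi> \<in> carr D" "\<eta> \<in> carr D"
  shows "mul D (mul D \<xi> \<eta>) \<zeta> = mul D \<xi> (mul D \<eta> \<zeta>)"
proof
  fix n
  obtain S where S: "finite S" "\<forall>k. k \<notin> S \<longrightarrow> \<xi> k = 0" using assms(1) by (rule carrE)
  obtain T where T: "finite T" "\<forall>k. k \<notin> T \<longrightarrow> \<eta> k = 0" using assms(2) by (rule carrE)
  define R where "R = (\<lambda>(k, l). k + l) ` (S \<times> T)"
  have R: "finite R" using S T by (simp add: R_def)
  have out: "\<forall>k. k \<notin> R \<longrightarrow> mul D \<xi> \<eta> k = 0"
    using mul_zero_outside[OF S T(2)] by (auto simp: R_def)
  have "mul D (mul D \<xi> \<eta>) \<zeta> n = (\<Sum>m\<in>R. \<Sum>k\<in>S. \<xi> k * iter k (\<eta> (m - k)) * iter m (\<zeta> (n - m)))"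
    unfolding mul_eq[OF R out] mul_eq[OF S] by (simp add: sum_distrib_right)
  also have "\<dots> = (\<Sum>k\<in>S. \<Sum>m\<in>R. \<xi> k * iter k (\<eta> (m - k)) * iter m (\<zeta> (n - m)))"
    by (rule sum.swap)
  \<comment> \<open>Substitution m = k + l; for m in R outside k + T the factor \<eta> (m - k) is
    0.\<close>
  also have "\<dots> = (\<Sum>k\<in>S. \<Sum>l\<in>T. \<xi> k * iter k (\<eta> l) * iter (k + l) (\<zeta> (n - (k + l))))"
  proof (rule sum.cong[OF refl])
    fix k assume k: "k \<in> S"
    have "(\<Sum>l\<in>T. \<xi> k * iter k (\<eta> l) * iter (k + l) (\<zeta> (n - (k + l))))
        = (\<Sum>m\<in>(+) k ` T. \<xi> k * iter k (\<eta> (m - k)) * iter m (\<zeta> (n - m)))"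
      by (subst sum.reindex) (auto simp: inj_on_def)
    also have "\<dots> = (\<Sum>m\<in>R. \<xi> k * iter k (\<eta> (m - k)) * iter m (\<zeta> (n - m)))"
    proof (rule sum.mono_neutral_left[OF R])
      show "(+) k ` T \<subseteq> R" using k by (auto simp: R_def)
      show "\<forall>m\<in>R - (+) k ` T. \<xi> k * iter k (\<eta> (m - k)) * iter m (\<zeta> (n - m)) = 0"
      proof
        fix m assume "m \<in> R - (+) k ` T"
        then have "m - k \<notin> T" by (auto intro!: rev_image_eqI[of "m - k"])
        then show "\<xi> k * iter k (\<eta> (m - k)) * iter m (\<zeta> (n - m)) = 0" using T(2) by simp
      qed
    qed
    finally show "(\<Sum>m\<in>R. \<xi> k * iter k (\<eta> (m - k)) * iter m (\<zeta> (n - m)))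
        = (\<Sum>l\<in>T. \<xi> k * iter k (\<eta> l) * iter (k + l) (\<zeta> (n - (k + l))))" by simp
  qed
  also have "\<dots> = mul D \<xi> (mul D \<eta> \<zeta>) n"
    unfolding mul_eq[OF S] mul_eq[OF T]
    by (simp add: iter.sum iter.mult iter_add sum_distrib_left mult.assoc diff_diff_eq)
  finally show "mul D (mul D \<xi> \<eta>) \<zeta> n = mul D \<xi> (mul D \<eta> \<zeta>) n" .
qed

lemma adj_mul_D:
  assumes "\<xi> \<in> carr D" "\<eta> \<in> carr D"
  shows "adj D (mul D \<xi> \<eta>) = mul D (adj D \<eta>) (adj D \<xi>)"
proof
  fix n
  obtain S where S: "finite S" "\<forall>k. k \<notin> S \<longrightarrow> \<xi> k = 0" using assms(1) by (rule carrE)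
  obtain T where T: "finite T" "\<forall>k. k \<notin> T \<longrightarrow> adj D \<eta> k = 0" using adj_closed[OF assms(2)] by (rule carrE)
  \<comment> \<open>T makes \<open>mul_eq\<close> applicable to the product of the adjoints, and the
    translate n + S is where the second factor can be nonzero.\<close>
  define R where "R = T \<union> (+) n ` S"
  have R: "finite R" "\<forall>k. k \<notin> R \<longrightarrow> adj D \<eta> k = 0" using S T by (auto simp: R_def)
  have "mul D (adj D \<eta>) (adj D \<xi>) n
      = (\<Sum>m\<in>R. iter m (star (\<eta> (- m))) * iter n (star (\<xi> (m - n))))"
    unfolding mul_eq[OF R] by (simp add: D_simps(5) flip: iter_add)
  also have "\<dots> = (\<Sum>m\<in>(+) n ` S. iter m (star (\<eta> (- m))) * iter n (star (\<xi> (m - n))))"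
  proof (rule sum.mono_neutral_right[OF R(1)])
    show "\<forall>m\<in>R - (+) n ` S. iter m (star (\<eta> (- m))) * iter n (star (\<xi> (m - n))) = 0"
    proof
      fix m assume "m \<in> R - (+) n ` S"
      then have "m - n \<notin> S" by (auto intro!: rev_image_eqI[of "m - n"])
      then show "iter m (star (\<eta> (- m))) * iter n (star (\<xi> (m - n))) = 0" using S(2) by simp
    qed
  qed (simp add: R_def)
  also have "\<dots> = (\<Sum>k\<in>S. iter (n + k) (star (\<eta> (- (n + k)))) * iter n (star (\<xi> k)))"
    by (subst sum.reindex) (auto simp: inj_on_def)
  also have "\<dots> = adj D (mul D \<xi> \<eta>) n"
  proof -
    have "adj D (mul D \<xi> \<eta>) n = iter n (star (mul D \<xi> \<eta> (- n)))" by (simp add: D_simps)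
    then show ?thesis
      unfolding mul_eq[OF S] by (simp add: star_sum iter.sum star_mult iter.mult iter.star iter_add)
  qed
  finally show "adj D (mul D \<xi> \<eta>) n = mul D (adj D \<eta>) (adj D \<xi>) n" by simp
qed

lemma star_prealgebra_D: "star_prealgebra D"
proof (intro star_prealgebra.intro)
  have null: "nrm D (alg_minus D x x) = 0" for x by (simp add: D_simps nrm_eq[of "{}"])
  fix x y z c d assume x: "x \<in> carr D"
  then obtain S where S: "finite S" "\<forall>k. k \<notin> S \<longrightarrow> x k = 0" by (rule carrE)
  show "scal D c x \<in> carr D" using S by (intro carrI[of S]) (auto simp: D_simps)
  show "adj D x \<in> carr D" using x by (rule adj_closed)
  show "0 \<le> nrm D x" by (simp add: nrm_eq[OF S] sum_nonneg)
  show "nrm D (scal D c x) = cmod c * nrm D x"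
    using S nrm_eq[OF S] nrm_eq[of S "scal D c x"] by (simp add: D_simps norm_scaleC sum_distrib_left)
  have "adj D (scal D c x) = scal D (cnj c) (adj D x)" by (simp add: D_simps star_scaleC iter.scaleC)
  then show "nrm D (alg_minus D (adj D (scal D c x)) (scal D (cnj c) (adj D x))) = 0" by (simp add: null)
  have "adj D (adj D x) = x" by (auto simp: D_simps iter.star star_star simp flip: iter_add)
  then show "nrm D (alg_minus D (adj D (adj D x)) x) = 0" by (simp add: null)
  assume y: "y \<in> carr D"
  obtain S where S: "finite S" "\<forall>k. k \<notin> S \<longrightarrow> x k = 0" "\<forall>k. k \<notin> S \<longrightarrow> y k = 0"
    using x y by (rule carrE2)
  show "plu D x y \<in> carr D" using S by (intro carrI[of S]) (auto simp: D_simps)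
  show "mul D x y \<in> carr D" using x y by (rule mul_closed)
  show "nrm D (plu D x y) \<le> nrm D x + nrm D y"
    using nrm_eq[OF S(1,2)] nrm_eq[OF S(1,3)] nrm_eq[of S "plu D x y"] S
    by (simp add: D_simps norm_triangle_ineq sum_mono flip: sum.distrib)
  have "mul D (scal D c x) y = scal D c (mul D x y)" "mul D x (scal D c y) = scal D c (mul D x y)"
    using S mul_eq[of S] by (auto simp: D_simps fun_eq_iff scaleC_sum_right mult_scaleC_left mult_scaleC_right iter.scaleC)
  then show "nrm D (alg_minus D (mul D (scal D c x) y) (scal D c (mul D x y))) = 0"
    "nrm D (alg_minus D (mul D x (scal D c y)) (scal D c (mul D x y))) = 0" by (simp_all add: null)
  have "adj D (plu D x y) = plu D (adj D x) (adj D y)" by (simp add: D_simps star_add iter.add)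
  then show "nrm D (alg_minus D (adj D (plu D x y)) (plu D (adj D x) (adj D y))) = 0" by (simp add: null)
  show "nrm D (alg_minus D (adj D (mul D x y)) (mul D (adj D y) (adj D x))) = 0"
    using adj_mul_D[OF x y] by (simp add: null)
  assume z: "z \<in> carr D"
  obtain T where T: "finite T" "\<forall>k. k \<notin> T \<longrightarrow> z k = 0" using z by (rule carrE)
  have "mul D (plu D x y) z = plu D (mul D x z) (mul D y z)"
    using S mul_eq[of S] by (auto simp: D_simps fun_eq_iff distrib_right sum.distrib)
  then show "nrm D (alg_minus D (mul D (plu D x y) z) (plu D (mul D x z) (mul D y z))) = 0" by (simp add: null)
  have "mul D z (plu D x y) = plu D (mul D z x) (mul D z y)"
    using T mul_eq[of T] by (auto simp: D_simps fun_eq_iff distrib_left sum.distrib iter.add)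
  then show "nrm D (alg_minus D (mul D z (plu D x y)) (plu D (mul D z x) (mul D z y))) = 0" by (simp add: null)
  show "nrm D (alg_minus D (mul D (mul D x y) z) (mul D x (mul D y z))) = 0"
    using mul_assoc_D[OF x y] by (simp add: null)
qed (auto simp: D_simps algebra_simps scaleC_add_left scaleC_add_right scaleC_scaleC)

text \<open>Writing x as the sum of the x k w^k, the coefficient of the adjoint of y times x at 0 is
  the sum of w^(-k) \<open>star (y k) * x k\<close> w^k; conjugation by w^(-k) accounts for the
  twist.\<close>

lemma E_ip:
  assumes "finite S" "\<forall>k. k \<notin> S \<longrightarrow> y k = 0"
  shows "mul D (adj D y) x 0 = (\<Sum>k\<in>S. iter (- k) (star (y k) * x k))"
proof -
  have "mul D (adj D y) x 0 = (\<Sum>k\<in>uminus ` S. adj D y k * iter k (x (0 - k)))"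
  proof (rule mul_eq)
    have "adj D y k = 0" if "k \<notin> uminus ` S" for k
    proof -
      have "- k \<notin> S" using that by (metis image_eqI minus_minus)
      then show ?thesis using assms(2) by (simp add: D_simps)
    qed
    then show "\<forall>k. k \<notin> uminus ` S \<longrightarrow> adj D y k = 0" by blast
  qed (use assms in simp)
  also have "\<dots> = (\<Sum>k\<in>S. iter (- k) (star (y k) * x k))"
    by (subst sum.reindex) (auto simp: D_simps iter.mult)
  finally show ?thesis .
qed

lemma nrm_zero_imp: "x \<in> carr D \<Longrightarrow> nrm D x = 0 \<Longrightarrow> x = (\<lambda>_. 0)"
  by (auto simp: int_conv_alg_def sum_nonneg_eq_0_iff)

lemma expectation_D: "expectation D (\<lambda>x. x 0)"
proof (intro expectation.intro star_prealgebra_D expectation_axioms.intro)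
  fix x c assume x: "x \<in> carr D"
  obtain S where S: "finite S" "\<forall>k. k \<notin> S \<longrightarrow> x k = 0" using x by (rule carrE)
  show "cpos (mul D (adj D x) x 0)"
    unfolding E_ip[OF S] by (intro cpos_sum iter.cpos cpos_star_mult)
  show "\<exists>x'\<in>carr D. \<forall>y\<in>carr D. mul D (adj D y) x' 0 = mul D (adj D y) x 0 * c"
  proof (intro bexI ballI)
    \<comment> \<open>Right multiplication by c: moving c to the left past w^k turns it into
      \<beta>^k (c).\<close>
    show "(\<lambda>k. x k * iter k c) \<in> carr D" using S by (intro carrI[of S]) auto
    fix y assume "y \<in> carr D"
    then obtain T where T: "finite T" "\<forall>k. k \<notin> T \<longrightarrow> y k = 0" by (rule carrE)
    show "mul D (adj D y) (\<lambda>k. x k * iter k c) 0 = mul D (adj D y) x 0 * c"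
      unfolding E_ip[OF T] by (simp add: sum_distrib_right iter.mult mult.assoc flip: iter_add)
  qed
  assume n: "nrm D x = 0"
  have x0: "x = (\<lambda>_. 0)" using nrm_zero_imp x n by simp
  show "x 0 = 0" by (simp add: x0)
  fix y assume "y \<in> carr D"
  then obtain T where T: "finite T" "\<forall>k. k \<notin> T \<longrightarrow> y k = 0" by (rule carrE)
  have "mul D x y = x" "mul D y x = x" using mul_eq[of "{}" x y] mul_eq[OF T] by (auto simp: x0)
  then show "nrm D (mul D x y) = 0" "nrm D (mul D y x) = 0" using n by simp_all
qed (auto simp: D_simps)

sublocale exp: expectation D "\<lambda>x. x 0"
  by (rule expectation_D)

text \<open>x y is the sum of the z k = x k w^k y. Each z k is bounded by \<open>norm (x k)\<close>
  times the size of y through \<open>cpos_conjugate_bound\<close>; pairing the sum with w = x y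
  itself and applying Cauchy-Schwarz termwise leaves the l1 norm of x after one factor
  \<open>mnorm w\<close> is cancelled.\<close>

lemma regular_D: "regular D (\<lambda>x. x 0)"
proof (intro regular.intro expectation_D regular_axioms.intro)
  fix x y assume x: "x \<in> carr D" and y: "y \<in> carr D"
  obtain S where S: "finite S" "\<forall>k. k \<notin> S \<longrightarrow> x k = 0" using x by (rule carrE)
  obtain T where T: "finite T" "\<forall>k. k \<notin> T \<longrightarrow> y k = 0" using y by (rule carrE)
  define z where "z k n = x k * iter k (y (n - k))" for k n
  have zT: "z k n = 0" if "n \<notin> (+) k ` T" for k n
  proof -
    have "n - k \<notin> T" using that by (auto intro!: rev_image_eqI[of "n - k"])
    then show ?thesis using T(2) by (simp add: z_def)
  qed
  have z: "z k \<in> carr D" for k by (rule carrI[of "(+) k ` T"]) (use T zT in auto)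
  have mz: "exp.mnorm (z k) \<le> norm (x k) * exp.mnorm y" for k
  proof (rule power2_le_imp_le)
    define a where "a = star (x k) * x k"
    have na: "norm a = (norm (x k))\<^sup>2" by (simp add: a_def norm_star_mult)
    have "exp.ip (z k) (z k) = (\<Sum>n\<in>(+) k ` T. iter (- n) (star (z k n) * z k n))"
      unfolding exp.ip_def by (rule E_ip) (use T zT in auto)
    also have "\<dots> = (\<Sum>l\<in>T. iter (- (k + l)) (star (iter k (y l)) * a * iter k (y l)))"
      by (subst sum.reindex) (auto simp: inj_on_def z_def a_def star_mult mult.assoc)
    finally have zz: "exp.ip (z k) (z k) = (\<Sum>l\<in>T. iter (- (k + l)) (star (iter k (y l)) * a * iter k (y l)))" .
    have yy: "exp.ip y y = (\<Sum>l\<in>T. iter (- (k + l)) (star (iter k (y l)) * iter k (y l)))"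
      unfolding exp.ip_def E_ip[OF T] by (simp flip: iter.star iter.mult iter_add)
    have "norm a *\<^sub>R exp.ip y y - exp.ip (z k) (z k) = (\<Sum>l\<in>T. iter (- (k + l))
       (norm a *\<^sub>R (star (iter k (y l)) * iter k (y l)) - star (iter k (y l)) * a * iter k (y l)))"
      unfolding zz yy by (simp add: scaleR_sum_right sum_subtractf iter.diff iter.scaleR)
    also have "cpos \<dots>"
      by (intro cpos_sum iter.cpos cpos_conjugate_bound) (auto simp: a_def star_mult star_star)
    finally have "norm (exp.ip (z k) (z k)) \<le> norm (norm a *\<^sub>R exp.ip y y)"
      using z by (intro cpos_norm_mono exp.ip_pos)
    then show "(exp.mnorm (z k))\<^sup>2 \<le> (norm (x k) * exp.mnorm y)\<^sup>2"
      by (simp add: exp.mnorm_square power_mult_distrib na)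
  qed (simp add: exp.mnorm_nonneg)
  define w where "w = mul D x y"
  have w: "w \<in> carr D" unfolding w_def using x y by (rule mul_closed)
  obtain R where R: "finite R" "\<forall>k. k \<notin> R \<longrightarrow> w k = 0" using w by (rule carrE)
  have "exp.ip w w = (\<Sum>m\<in>R. iter (- m) (star (w m) * (\<Sum>k\<in>S. z k m)))"
    unfolding exp.ip_def E_ip[OF R] by (simp add: w_def mul_eq[OF S] z_def)
  also have "\<dots> = (\<Sum>k\<in>S. \<Sum>m\<in>R. iter (- m) (star (w m) * z k m))"
    by (subst sum.swap) (simp add: sum_distrib_left iter.sum)
  also have "\<dots> = (\<Sum>k\<in>S. exp.ip w (z k))" unfolding exp.ip_def E_ip[OF R] ..
  finally have "norm (exp.ip w w) = norm (\<Sum>k\<in>S. exp.ip w (z k))" by simp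
  also have "\<dots> \<le> (\<Sum>k\<in>S. norm (exp.ip w (z k)))" by (rule norm_sum)
  also have "\<dots> \<le> (\<Sum>k\<in>S. exp.mnorm w * (norm (x k) * exp.mnorm y))"
  proof (rule sum_mono)
    fix k
    have "norm (exp.ip w (z k)) \<le> exp.mnorm w * exp.mnorm (z k)" by (rule exp.Cauchy_Schwarz[OF w z])
    also have "\<dots> \<le> exp.mnorm w * (norm (x k) * exp.mnorm y)"
      by (rule mult_left_mono[OF mz]) simp
    finally show "norm (exp.ip w (z k)) \<le> exp.mnorm w * (norm (x k) * exp.mnorm y)" .
  qed
  also have "\<dots> = exp.mnorm w * (nrm D x * exp.mnorm y)"
    unfolding nrm_eq[OF S] by (simp add: sum_distrib_left sum_distrib_right)
  finally have "exp.mnorm w * exp.mnorm w \<le> exp.mnorm w * (nrm D x * exp.mnorm y)"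
    by (simp add: power2_eq_square flip: exp.mnorm_square)
  moreover have "0 \<le> nrm D x * exp.mnorm y" by (simp add: nrm_eq[OF S] sum_nonneg)
  ultimately show "exp.mnorm (mul D x y) \<le> nrm D x * exp.mnorm y"
    using exp.mnorm_nonneg[of w] by (cases "exp.mnorm w = 0") (auto simp: w_def mult_le_cancel_left)
qed

sublocale reg: regular D "\<lambda>x. x 0"
  by (rule regular_D)

sublocale U: cstar_prealgebra "with_universal_norm D"
  by (rule exp.cstar_prealgebra_universal)

end

section \<open>Roots of unity on the circle\<close>

lemma cnj_circle: "\<zeta> \<in> \<TT> \<Longrightarrow> cnj \<zeta> = inverse \<zeta>"
  by (simp add: inverse_complex_def complex_eq_iff cmod_def)

lemma circle_nonzero: "\<zeta> \<in> \<TT> \<Longrightarrow> \<zeta> \<noteq> 0"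
  by auto

lemma norm_circle_powi: "\<zeta> \<in> \<TT> \<Longrightarrow> cmod (\<zeta> powi k) = 1"
  by (simp add: norm_power_int)

lemma cnj_circle_powi: "\<zeta> \<in> \<TT> \<Longrightarrow> cnj \<zeta> powi k = \<zeta> powi (- k)"
  by (simp add: cnj_circle power_int_minus power_int_inverse)

text \<open>For 0 < \<bar>m\<bar> < N the ratio z of the geometric sum is an N-th root of unity
  different from 1.\<close>

lemma sum_roots_of_unity:
  assumes "0 < N" and m: "\<bar>m\<bar> < int N"
  shows "(\<Sum>j<N. cis (2 * pi * real j / real N) powi m) = (if m = 0 then of_nat N else 0)"
proof (cases "m = 0")
  case False
  define z where "z = cis (2 * pi * of_int m / real N)"
  have "z \<noteq> 1"
  proof
    assume "z = 1"
    then have "cos (2 * pi * of_int m / real N) = 1" by (simp add: z_def complex_eq_iff)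
    then obtain n :: int where "2 * pi * of_int m / real N = of_int n * (2 * pi)"
      by (auto simp: cos_one_2pi_int)
    then have "of_int m = of_int n * real N" using assms(1) by (simp add: field_simps)
    then have "m = n * int N" by (metis of_int_eq_iff of_int_mult of_int_of_nat_eq)
    then have "\<bar>m\<bar> = \<bar>n\<bar> * int N" "n \<noteq> 0" using False by (auto simp: abs_mult)
    moreover from \<open>n \<noteq> 0\<close> have "1 \<le> \<bar>n\<bar>" by simp
    then have "1 * int N \<le> \<bar>n\<bar> * int N" by (rule mult_right_mono) simp
    ultimately show False using m by simp
  qed
  have "cis (2 * pi * real j / real N) powi m = z ^ j" for j
    by (simp add: z_def cis_power_int Complex.DeMoivre mult_ac)
  then have "(\<Sum>j<N. cis (2 * pi * real j / real N) powi m) = (\<Sum>j<N. z ^ j)" by simp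
  also have "\<dots> = (z ^ N - 1) / (z - 1)" using \<open>z \<noteq> 1\<close> by (rule geometric_sum)
  also have "z ^ N = cis (2 * pi * of_int m)" using assms(1) by (simp add: z_def Complex.DeMoivre)
  also have "\<dots> = 1" by (simp add: cis_multiple_2pi)
  finally show ?thesis using False by simp
qed simp

lemma cSUP_circle_le:
  fixes f :: "complex \<Rightarrow> real"
  assumes "\<And>\<zeta>. \<zeta> \<in> \<TT> \<Longrightarrow> f \<zeta> \<le> K" "\<zeta> \<in> \<TT>"
  shows "f \<zeta> \<le> (SUP \<zeta>\<in>\<TT>. f \<zeta>)"
  by (rule cSUP_upper[OF assms(2)]) (auto intro!: bdd_aboveI[of _ K] assms)

context int_system
begin

section \<open>The crossed product by the integers, its dual action and its coefficient of degree
  1\<close>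

abbreviation "CC \<equiv> completion (with_universal_norm D)"

abbreviation mulC (infixl "\<odot>" 70) where "X \<odot> Y \<equiv> mul CC X Y"
abbreviation minusC (infixl "\<ominus>" 65) where "X \<ominus> Y \<equiv> alg_minus CC X Y"

interpretation CC: cstar_normed CC
  by (rule U.cstar_normed_completion)

text \<open>The monomial a w^k.\<close>

definition single :: "int \<Rightarrow> 'a \<Rightarrow> int \<Rightarrow> 'a" where
  "single k a = (\<lambda>j. if j = k then a else 0)"

lemma single_carr [simp]: "single k a \<in> carr D"
  by (rule carrI[of "{k}"]) (auto simp: single_def)

lemma mul_single_left: "mul D (single k a) x n = a * iter k (x (n - k))"
  using mul_eq[of "{k}" "single k a" x n] by (simp add: single_def)

lemma mul_single_right: "x \<in> carr D \<Longrightarrow> mul D x (single k a) n = x (n - k) * iter (n - k) a"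
proof -
  assume "x \<in> carr D"
  then obtain S where S: "finite S" "\<forall>k. k \<notin> S \<longrightarrow> x k = 0" by (rule carrE)
  then have "mul D x (single k a) n = (\<Sum>j\<in>insert (n - k) S. x j * iter j (single k a (n - j)))"
    by (intro mul_eq) auto
  also have "\<dots> = (\<Sum>j\<in>{n - k}. x j * iter j (single k a (n - j)))"
    by (rule sum.mono_neutral_right) (use S in \<open>auto simp: single_def\<close>)
  finally show ?thesis by (simp add: single_def)
qed

lemma mul_single_single: "mul D (single k a) (single l b) = single (k + l) (a * iter k b)"
  by (rule ext, simp only: mul_single_left) (auto simp: single_def)

lemma adj_single: "adj D (single k a) = single (- k) (iter (- k) (star a))"
  by (auto simp: D_simps single_def fun_eq_iff)

lemma minus_single: "alg_minus D (single k a) (single k b) = single k (a - b)"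
  by (auto simp: D_simps single_def fun_eq_iff)

lemma nrm_single: "nrm D (single k a) = norm a"
  using nrm_eq[of "{k}" "single k a"] by (simp add: single_def)

text \<open>The l1 norm is an upper bound. The lower bound comes from letting the monomial act on
  the vector 1 of the regular representation.\<close>

lemma universal_single: "universal_norm D (single k a) = norm a"
proof (rule antisym)
  show "universal_norm D (single k a) \<le> norm a"
    using exp.universal_le_nrm[of "single k a"] by (simp add: nrm_single)
  have "exp.ip (single k b) (single k b) = iter (- k) (star b * b)" for k b
    unfolding exp.ip_def by (subst E_ip[of "{k}"]) (auto simp: single_def)
  then have m: "exp.mnorm (single k b) = norm b" for k b
    by (simp add: exp.mnorm_def norm_star_mult)
  have "norm a = exp.mnorm (mul D (single k a) (single 0 1))" by (simp add: mul_single_single m)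
  also have "\<dots> \<le> universal_norm D (single k a) * norm (1::'a)"
    using reg.mnorm_le_universal[of "single k a" "single 0 1"] by (simp add: m)
  \<comment> \<open>Only norm 1 \<le> 1 is available here, as the zero algebra counts as
    unital.\<close>
  also have "\<dots> \<le> universal_norm D (single k a) * 1"
    by (intro mult_left_mono norm_one_le exp.universal_nonneg single_carr)
  finally show "norm a \<le> universal_norm D (single k a)" by simp
qed

abbreviation dual :: "complex \<Rightarrow> (int \<Rightarrow> 'a) \<Rightarrow> int \<Rightarrow> 'a" where
  "dual \<zeta> \<xi> \<equiv> \<lambda>k. scaleC (\<zeta> powi k) (\<xi> k)"

lemma dual_carr [simp]: "\<xi> \<in> carr D \<Longrightarrow> dual \<zeta> \<xi> \<in> carr D"
  by (elim carrE, rename_tac S, rule_tac S=S in carrI) auto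

lemma dual_minus: "dual \<zeta> (alg_minus D x y) = alg_minus D (dual \<zeta> x) (dual \<zeta> y)"
  by (simp add: D_simps scaleC_diff_right)

text \<open>\<open>dual \<zeta>\<close> is multiplicative, respects adjoints and is isometric for
  the l1 norm.\<close>

lemma dual_dominated:
  assumes z: "\<zeta> \<in> \<TT>" and p: "p \<in> exp.dominated"
  shows "(\<lambda>x. p (dual \<zeta> x)) \<in> exp.dominated"
proof -
  have s: "cstar_seminorm D p" using p by simp
  have nz: "\<zeta> \<noteq> 0" using z by (rule circle_nonzero)
  have "cstar_seminorm D (\<lambda>x. p (dual \<zeta> x))"
    unfolding cstar_seminorm_def
  proof (intro conjI ballI allI)
    fix x y c assume x: "x \<in> carr D" and y: "y \<in> carr D"
    show "0 \<le> p (dual \<zeta> x)" using cstar_seminormD(1)[OF s, of "dual \<zeta> x"] x by simp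
    have "dual \<zeta> (plu D x y) = plu D (dual \<zeta> x) (dual \<zeta> y)" by (simp add: D_simps scaleC_add_right)
    then show "p (dual \<zeta> (plu D x y)) \<le> p (dual \<zeta> x) + p (dual \<zeta> y)"
      using cstar_seminormD(2)[OF s, of "dual \<zeta> x" "dual \<zeta> y"] x y by simp
    have "dual \<zeta> (scal D c x) = scal D c (dual \<zeta> x)" by (simp add: D_simps scaleC_scaleC mult.commute)
    then show "p (dual \<zeta> (scal D c x)) = cmod c * p (dual \<zeta> x)"
      using cstar_seminormD(3)[OF s, of "dual \<zeta> x" c] x by simp
    have mul: "dual \<zeta> (mul D x y) = mul D (dual \<zeta> x) (dual \<zeta> y)" if x: "x \<in> carr D" for x y
    proof
      fix n
      obtain S where S: "finite S" "\<forall>k. k \<notin> S \<longrightarrow> x k = 0" using x by (rule carrE)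
      have S': "\<forall>k. k \<notin> S \<longrightarrow> dual \<zeta> x k = 0" using S by simp
      show "dual \<zeta> (mul D x y) n = mul D (dual \<zeta> x) (dual \<zeta> y) n"
        unfolding mul_eq[OF S] mul_eq[OF S(1) S']
        by (simp add: scaleC_sum_right iter.scaleC mult_scaleC_left mult_scaleC_right scaleC_scaleC
            power_int_diff nz)
    qed
    show "p (dual \<zeta> (mul D x y)) \<le> p (dual \<zeta> x) * p (dual \<zeta> y)"
      unfolding mul[OF x] by (rule cstar_seminormD(4)[OF s]) (use x y in auto)
    have "dual \<zeta> (adj D x) = adj D (dual \<zeta> x)"
      using z by (simp add: D_simps star_scaleC iter.scaleC cnj_circle_powi)
    then show "p (dual \<zeta> (mul D (adj D x) x)) = (p (dual \<zeta> x))\<^sup>2"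
      unfolding mul[OF adj_closed[OF x]]
      using cstar_seminormD(5)[OF s, of "dual \<zeta> x"] x by simp
  qed
  moreover have "p (dual \<zeta> x) \<le> nrm D x" if x: "x \<in> carr D" for x
  proof -
    obtain S where S: "finite S" "\<forall>k. k \<notin> S \<longrightarrow> x k = 0" using x by (rule carrE)
    have "p (dual \<zeta> x) \<le> nrm D (dual \<zeta> x)" using p x by auto
    also have "\<dots> = nrm D x"
      using S nrm_eq[of S "dual \<zeta> x"] nrm_eq[OF S] z by (simp add: norm_scaleC norm_circle_powi)
    finally show ?thesis .
  qed
  ultimately show ?thesis by simp
qed

lemma universal_dual_le: "\<zeta> \<in> \<TT> \<Longrightarrow> x \<in> carr D \<Longrightarrow> universal_norm D (dual \<zeta> x) \<le> universal_norm D x"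
  by (rule exp.universal_invariant) (auto simp: dual_dominated[simplified])

lemma universal_sum_le:
  fixes N :: nat and f :: "nat \<Rightarrow> int \<Rightarrow> 'a"
  assumes "\<And>j. j < N \<Longrightarrow> f j \<in> carr D"
  shows "(\<lambda>k. \<Sum>j<N. f j k) \<in> carr D \<and> universal_norm D (\<lambda>k. \<Sum>j<N. f j k) \<le> (\<Sum>j<N. universal_norm D (f j))"
  using assms
proof (induction N)
  case 0
  have "(\<lambda>k. 0) = single 0 0" by (auto simp: single_def)
  then show ?case using universal_single[of 0 0] by (simp add: carrI[of "{}"])
next
  case (Suc N)
  have eq: "(\<lambda>k. \<Sum>j<Suc N. f j k) = plu D (\<lambda>k. \<Sum>j<N. f j k) (f N)" by (simp add: D_simps)
  have IH: "(\<lambda>k. \<Sum>j<N. f j k) \<in> carr D"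
    "universal_norm D (\<lambda>k. \<Sum>j<N. f j k) \<le> (\<Sum>j<N. universal_norm D (f j))"
    using Suc by auto
  show ?case
    unfolding eq using U.nrm_triangle[of "\<lambda>k. \<Sum>j<N. f j k" "f N"] IH Suc(2)[of N]
      exp.plu_closed[of "\<lambda>k. \<Sum>j<N. f j k" "f N"] by auto
qed

text \<open>N exceeds the distance of every degree in the support from 1, so the N-th roots of unity
  separate degree 1 from the others. A finite average thus replaces integration over the circle and
  stays inside the algebra of finitely supported functions.\<close>

lemma averaging:
  assumes "x \<in> carr D"
  obtains N where "0 < N" "\<And>k. (\<Sum>j<N. scaleC (1 / of_nat N) (scaleC (inverse (cis (2 * pi * real j / real N)))
     (dual (cis (2 * pi * real j / real N)) x k))) = single 1 (x 1) k"
proof -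
  obtain S where S: "finite S" "\<forall>k. k \<notin> S \<longrightarrow> x k = 0" using assms by (rule carrE)
  \<comment> \<open>Inserting 1 makes the maximum run over a nonempty set; the final + 1 gives the
    strict inequality required of N.\<close>
  define N where "N = nat (Max ((\<lambda>k. \<bar>k - 1\<bar>) ` insert 1 S)) + 1"
  have N: "\<bar>k - 1\<bar> < int N" if "k \<in> S" for k
  proof -
    have "\<bar>k - 1\<bar> \<le> Max ((\<lambda>k. \<bar>k - 1\<bar>) ` insert 1 S)" using S that by (intro Max_ge) auto
    moreover from order_trans[OF abs_ge_zero this]
    have "0 \<le> Max ((\<lambda>k. \<bar>k - 1\<bar>) ` insert 1 S)" .
    ultimately show ?thesis unfolding N_def by linarith
  qed
  show thesis
  proof (rule that[of N])
    show "0 < N" by (simp add: N_def)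
    fix k
    let ?z = "\<lambda>j. cis (2 * pi * real j / real N)"
    have e: "inverse (?z j) * (?z j powi k) = ?z j powi (k - 1)" for j
      by (simp add: power_int_diff field_simps)
    have "(\<Sum>j<N. scaleC (1 / of_nat N) (scaleC (inverse (?z j)) (dual (?z j) x k)))
      = scaleC ((1 / of_nat N) * (\<Sum>j<N. ?z j powi (k - 1))) (x k)"
      by (simp only: scaleC_scaleC e scaleC_sum_left sum_distrib_left)
    also have "\<dots> = single 1 (x 1) k"
    proof (cases "k \<in> S")
      case True
      show ?thesis
        using sum_roots_of_unity[OF \<open>0 < N\<close> N[OF True]] \<open>0 < N\<close> by (auto simp: single_def)
    qed (use S in \<open>auto simp: single_def\<close>)
    finally show "(\<Sum>j<N. scaleC (1 / of_nat N) (scaleC (inverse (?z j)) (dual (?z j) x k))) = single 1 (x 1) k" .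
  qed
qed

text \<open>The monomial of degree 1 is an average of unimodular multiples of the elements
  \<open>dual \<zeta> x\<close>, none of which has larger norm than x.\<close>

lemma norm_coefficient_le:
  assumes x: "x \<in> carr D"
  shows "norm (x 1) \<le> universal_norm D x"
proof -
  obtain N where N: "0 < N" "\<And>k. (\<Sum>j<N. scaleC (1 / of_nat N) (scaleC (inverse (cis (2 * pi * real j / real N)))
     (dual (cis (2 * pi * real j / real N)) x k))) = single 1 (x 1) k"
    using averaging[OF x] by blast
  let ?z = "\<lambda>j. cis (2 * pi * real j / real N)"
  define f where "f j = scal D (1 / of_nat N) (scal D (inverse (?z j)) (dual (?z j) x))" for j
  have f: "f j \<in> carr D" for j using x by (simp add: f_def)
  have "norm (x 1) = universal_norm D (\<lambda>k. \<Sum>j<N. f j k)"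
    using N(2) by (simp add: f_def D_simps universal_single)
  also have "\<dots> \<le> (\<Sum>j<N. universal_norm D (f j))" using universal_sum_le[of N f] f by blast
  also have "\<dots> \<le> (\<Sum>j<N. (1 / of_nat N) * universal_norm D x)"
  proof (rule sum_mono)
    fix j
    have "universal_norm D (f j) = (1 / of_nat N) * universal_norm D (dual (?z j) x)"
      using x U.nrm_scal by (simp add: f_def norm_divide norm_inverse)
    also have "\<dots> \<le> (1 / of_nat N) * universal_norm D x"
      using x by (intro mult_left_mono universal_dual_le) auto
    finally show "universal_norm D (f j) \<le> (1 / of_nat N) * universal_norm D x" .
  qed
  also have "\<dots> = universal_norm D x" using N(1) by simp
  finally show ?thesis .
qed

text \<open>The difference is the average of x - \<zeta>^(-1) \<open>dual \<zeta> x\<close> over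
  roots of unity, and each of these has the norm of \<open>dual \<zeta> x\<close> - \<zeta>
  x.\<close>

lemma dist_single_le:
  assumes x: "x \<in> carr D" and s: "\<And>\<zeta>. \<zeta> \<in> \<TT> \<Longrightarrow> universal_norm D (alg_minus D (dual \<zeta> x) (scal D \<zeta> x)) \<le> s"
  shows "universal_norm D (alg_minus D x (single 1 (x 1))) \<le> s"
proof -
  obtain N where N: "0 < N" "\<And>k. (\<Sum>j<N. scaleC (1 / of_nat N) (scaleC (inverse (cis (2 * pi * real j / real N)))
     (dual (cis (2 * pi * real j / real N)) x k))) = single 1 (x 1) k"
    using averaging[OF x] by blast
  let ?z = "\<lambda>j. cis (2 * pi * real j / real N)"
  define f where "f j = scal D (1 / of_nat N) (scal D (- inverse (?z j)) (alg_minus D (dual (?z j) x) (scal D (?z j) x)))" for j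
  have f: "f j \<in> carr D" for j using x by (simp add: f_def)
  have "f j k = scaleC (1 / of_nat N) (x k) -
      scaleC (1 / of_nat N) (scaleC (inverse (?z j)) (dual (?z j) x k))" for j k
    by (simp add: f_def D_simps scaleC_diff_right scaleC_minus_left scaleC_scaleC cis_mult)
  then have "(\<Sum>j<N. f j k) = scaleC (of_nat N * (1 / of_nat N)) (x k) - single 1 (x 1) k" for k
    by (simp only: sum_subtractf N(2)) (simp flip: scaleC_sum_left)
  then have "alg_minus D x (single 1 (x 1)) = (\<lambda>k. \<Sum>j<N. f j k)" using N(1) by (simp add: D_simps)
  then have "universal_norm D (alg_minus D x (single 1 (x 1))) \<le> (\<Sum>j<N. universal_norm D (f j))"
    using universal_sum_le[of N f] f by simp
  also have "\<dots> \<le> (\<Sum>j<N. (1 / of_nat N) * s)"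
  proof (rule sum_mono)
    fix j
    have "universal_norm D (f j) = (1 / of_nat N) * universal_norm D (alg_minus D (dual (?z j) x) (scal D (?z j) x))"
      using x U.nrm_scal by (simp add: f_def norm_divide norm_inverse)
    also have "\<dots> \<le> (1 / of_nat N) * s"
      by (intro mult_left_mono s) auto
    finally show "universal_norm D (f j) \<le> (1 / of_nat N) * s" .
  qed
  also have "\<dots> = s" using N(1) by simp
  finally show ?thesis .
qed

text \<open>\<open>J a\<close> is a w and \<open>I a\<close> is a, both as elements of the crossed
  product.\<close>

abbreviation J :: "'a \<Rightarrow> (nat \<Rightarrow> int \<Rightarrow> 'a) set" where "J a \<equiv> U.const_cls (single 1 a)"
abbreviation I :: "'a \<Rightarrow> (nat \<Rightarrow> int \<Rightarrow> 'a) set" where "I a \<equiv> U.const_cls (single 0 a)"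

lemma J_closed: "J a \<in> carr CC" "I a \<in> carr CC"
  by (auto intro!: U.const_cls_closed)

lemma beta_iter [simp]: "\<beta> (iter (- 1) x) = x"
  using iter_plus_one[of "- 1" x] by simp

lemma J_ops:
  "adj CC (J a) \<odot> J b = I (iter (- 1) (star a * b))"
  "J a \<odot> adj CC (J b) = I (a * star b)"
  "J a \<odot> I b = J (a * \<beta> b)" "I b \<odot> J a = J (b * a)"
  "J a \<ominus> J b = J (a - b)" "I a \<ominus> I b = I (a - b)"
  by (simp_all add: U.const_cls_ops[simplified] mul_single_single adj_single minus_single iter.mult flip: iter_add)

lemma nrm_J: "nrm CC (J a) = norm a" "nrm CC (I a) = norm a"
  using U.nrm_const_cls[of "single 1 a"] U.nrm_const_cls[of "single 0 a"] by (simp_all add: universal_single)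

lemma unit_CC: "unit_of CC = I 1"
proof (rule CC.unit_of_eqI)
  fix X assume "X \<in> carr CC"
  then obtain f where f: "f \<in> cauchy_seqs (with_universal_norm D)" "X = U.cls f" by (auto simp: U.carr_completion)
  have c: "f n \<in> carr D" for n using U.cauchy_carr[OF f(1), of n] by simp
  have u: "(\<lambda>_. single 0 1) \<in> cauchy_seqs (with_universal_norm D)" by (intro U.cauchy_const) simp
  have "mul D (single 0 1) x = x" "x \<in> carr D \<Longrightarrow> mul D x (single 0 1) = x" for x
    by (auto simp: fun_eq_iff mul_single_left mul_single_right)
  then show "I 1 \<odot> X = X" "X \<odot> I 1 = X"
    unfolding f(2) U.mul_completion[OF u f(1)] U.mul_completion[OF f(1) u] using c by simp_all
qed (rule J_closed)

lemma dual_action_eq: "dual_action \<beta> \<zeta> = U.map_completion (dual \<zeta>)"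
  by (simp add: dual_action_def exp.enveloping_map_eq)

lemma crossed_product_int_eq: "crossed_product_int \<beta> = CC"
  by (simp add: crossed_product_int_def enveloping_cstar_def)

lemma dual_dist:
  assumes "\<zeta> \<in> \<TT>" "x \<in> carr D" "y \<in> carr D"
  shows "universal_norm D (alg_minus D (dual \<zeta> x) (dual \<zeta> y)) \<le> universal_norm D (alg_minus D x y)"
  using universal_dual_le[of \<zeta> "alg_minus D x y"] assms by (simp flip: dual_minus)

lemma dual_action_props:
  assumes z: "\<zeta> \<in> \<TT>"
  shows "x \<in> carr D \<Longrightarrow> dual_action \<beta> \<zeta> (U.const_cls x) = U.const_cls (dual \<zeta> x)"
    and "X \<in> carr CC \<Longrightarrow> dual_action \<beta> \<zeta> X \<in> carr CC"
    and "X \<in> carr CC \<Longrightarrow> Y \<in> carr CC \<Longrightarrow>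
      nrm CC (dual_action \<beta> \<zeta> X \<ominus> dual_action \<beta> \<zeta> Y) \<le> nrm CC (X \<ominus> Y)"
  unfolding dual_action_eq
  using U.map_completion_const_cls[of "dual \<zeta>" x] U.map_completion_closed[of "dual \<zeta>" X]
    U.map_completion_dist[of "dual \<zeta>" X Y] dual_dist[OF z] by simp_all

abbreviation coeff1 :: "(nat \<Rightarrow> int \<Rightarrow> 'a) set \<Rightarrow> 'a" where
  "coeff1 \<equiv> U.extend (\<lambda>x. x 1)"

lemma coeff1_props:
  "X \<in> carr CC \<Longrightarrow> norm (coeff1 X) \<le> nrm CC X"
  "X \<in> carr CC \<Longrightarrow> Y \<in> carr CC \<Longrightarrow> norm (coeff1 X - coeff1 Y) \<le> nrm CC (X \<ominus> Y)"
  "x \<in> carr D \<Longrightarrow> coeff1 (U.const_cls x) = x 1"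
  "norm_continuous_path CC v \<Longrightarrow> continuous_on {0..} (\<lambda>t. coeff1 (v t))"
proof -
  have a: "\<And>x y. x \<in> carr (with_universal_norm D) \<Longrightarrow> y \<in> carr (with_universal_norm D) \<Longrightarrow>
      alg_minus (with_universal_norm D) x y 1 = x 1 - y 1" by (simp add: D_simps)
  have b: "\<And>x. x \<in> carr (with_universal_norm D) \<Longrightarrow> norm (x 1) \<le> nrm (with_universal_norm D) x"
    using norm_coefficient_le by simp
  show "X \<in> carr CC \<Longrightarrow> norm (coeff1 X) \<le> nrm CC X" by (rule U.norm_extend_le[OF a b])
  show "X \<in> carr CC \<Longrightarrow> Y \<in> carr CC \<Longrightarrow> norm (coeff1 X - coeff1 Y) \<le> nrm CC (X \<ominus> Y)"
    by (rule U.extend_dist_le[OF a b])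
  show "x \<in> carr D \<Longrightarrow> coeff1 (U.const_cls x) = x 1"
    by (rule U.extend_const_cls[OF a b]) simp_all
  show "norm_continuous_path CC v \<Longrightarrow> continuous_on {0..} (\<lambda>t. coeff1 (v t))"
    by (rule U.extend_path_continuous[OF a b])
qed

text \<open>\<open>dist_single_le\<close> extended by density. The approximation x of X is used four
  times, twice to pass the hypothesis to x and once each for X and its coefficient; hence e /
  4.\<close>

lemma dist_J_coeff1_le:
  assumes X: "X \<in> carr CC" and s: "\<And>\<zeta>. \<zeta> \<in> \<TT> \<Longrightarrow> nrm CC (dual_action \<beta> \<zeta> X \<ominus> \<zeta> \<cdot>\<^bsub>CC\<^esub> X) \<le> s"
  shows "nrm CC (X \<ominus> J (coeff1 X)) \<le> s"
proof (rule field_le_epsilon)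
  fix e :: real assume "0 < e"
  then obtain x where "x \<in> carr (with_universal_norm D)" and d: "nrm CC (X \<ominus> U.const_cls x) < e / 4"
    using U.const_cls_dense[OF X, of "e / 4"] by auto
  then have x: "x \<in> carr D" by simp
  let ?x = "U.const_cls x"
  have xc: "?x \<in> carr CC" using x by (intro U.const_cls_closed) simp
  have d': "nrm CC (?x \<ominus> X) < e / 4" using d CC.dist_commute[OF X xc] by simp
  have "universal_norm D (alg_minus D x (single 1 (x 1))) \<le> s + e / 2"
  proof (rule dist_single_le[OF x])
    fix \<zeta> assume z: "\<zeta> \<in> \<TT>"
    have "universal_norm D (alg_minus D (dual \<zeta> x) (scal D \<zeta> x)) = nrm CC (dual_action \<beta> \<zeta> ?x \<ominus> \<zeta> \<cdot>\<^bsub>CC\<^esub> ?x)"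
      using x U.nrm_const_cls[of "alg_minus D (dual \<zeta> x) (scal D \<zeta> x)"]
      by (simp add: dual_action_props(1)[OF z] U.const_cls_ops[simplified])
    also have "\<dots> \<le> nrm CC (dual_action \<beta> \<zeta> ?x \<ominus> dual_action \<beta> \<zeta> X) +
        nrm CC (dual_action \<beta> \<zeta> X \<ominus> \<zeta> \<cdot>\<^bsub>CC\<^esub> ?x)"
      using X xc dual_action_props(2)[OF z] by (intro CC.dist_triangle) auto
    also have "nrm CC (dual_action \<beta> \<zeta> X \<ominus> \<zeta> \<cdot>\<^bsub>CC\<^esub> ?x) \<le>
        nrm CC (dual_action \<beta> \<zeta> X \<ominus> \<zeta> \<cdot>\<^bsub>CC\<^esub> X) + nrm CC (\<zeta> \<cdot>\<^bsub>CC\<^esub> X \<ominus> \<zeta> \<cdot>\<^bsub>CC\<^esub> ?x)"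
      using X xc dual_action_props(2)[OF z] by (intro CC.dist_triangle) auto
    also have "nrm CC (\<zeta> \<cdot>\<^bsub>CC\<^esub> X \<ominus> \<zeta> \<cdot>\<^bsub>CC\<^esub> ?x) = nrm CC (X \<ominus> ?x)"
      using z X xc by (simp add: CC.dist_scal)
    finally show "universal_norm D (alg_minus D (dual \<zeta> x) (scal D \<zeta> x)) \<le> s + e / 2"
      using dual_action_props(3)[OF z xc X] s[OF z] d d' by linarith
  qed
  then have 1: "nrm CC (?x \<ominus> J (x 1)) \<le> s + e / 2"
    using x U.nrm_const_cls[of "alg_minus D x (single 1 (x 1))"] by (simp add: U.const_cls_ops[simplified])
  have "nrm CC (J (x 1) \<ominus> J (coeff1 X)) = norm (coeff1 ?x - coeff1 X)"
    by (simp add: J_ops nrm_J coeff1_props(3)[OF x])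
  also have "\<dots> < e / 4" using coeff1_props(2)[OF xc X] d' by simp
  finally have 2: "nrm CC (J (x 1) \<ominus> J (coeff1 X)) < e / 4" .
  show "nrm CC (X \<ominus> J (coeff1 X)) \<le> s + e"
    using 1 2 d CC.dist_triangle[of X ?x "J (coeff1 X)"] CC.dist_triangle[of ?x "J (x 1)" "J (coeff1 X)"]
      X xc J_closed(1)[of "x 1"] J_closed(1)[of "coeff1 X"] by linarith
qed

section \<open>From the crossed product by the integers to A\<close>

theorem asymptotically_representable_if_dual_rokhlin:
  assumes "continuous_rokhlin_property (crossed_product_int \<beta>) (dual_action \<beta>)"
  shows "asymptotically_representable (cstar_univ :: 'a star_alg) \<beta>"
proof -
  obtain u where u: "norm_continuous_path CC u" "\<And>t. 0 \<le> t \<Longrightarrow> unitary CC (u t)"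
    and sup: "((\<lambda>t. SUP \<zeta>\<in>\<TT>. nrm CC (dual_action \<beta> \<zeta> (u t) \<ominus> \<zeta> \<cdot>\<^bsub>CC\<^esub> u t)) \<longlongrightarrow> 0) at_top"
    and comm: "\<And>a. a \<in> carr CC \<Longrightarrow> ((\<lambda>t. nrm CC (u t \<odot> a \<ominus> a \<odot> u t)) \<longlongrightarrow> 0) at_top"
    using assms unfolding continuous_rokhlin_property_def crossed_product_int_eq by blast
  define y where "y t = coeff1 (u t)" for t
  have uc: "u t \<in> carr CC" if "0 \<le> t" for t using u(2)[OF that] by (simp add: unitary_def)
  have uu: "adj CC (u t) \<odot> u t = I 1" "u t \<odot> adj CC (u t) = I 1" if "0 \<le> t" for t
    using u(2)[OF that] by (simp_all add: unitary_def unit_CC)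
  have nu: "nrm CC (u t) \<le> 1" if "0 \<le> t" for t
  proof -
    have "(nrm CC (u t))\<^sup>2 = norm (1::'a)" using CC.nrm_cstar[OF uc[OF that]] uu[OF that] nrm_J by simp
    then have "(nrm CC (u t))\<^sup>2 \<le> 1\<^sup>2" using norm_one_le by simp
    then show ?thesis by (rule power2_le_imp_le) simp
  qed
  have ny: "norm (y t) \<le> 1" if "0 \<le> t" for t
    unfolding y_def using coeff1_props(1)[OF uc[OF that]] nu[OF that] by simp
  have uJ: "CC.asymptotic u (\<lambda>t. J (y t))"
  proof (rule CC.asymptoticI[OF _ _ _ sup])
    fix t :: real assume t: "0 \<le> t"
    show "u t \<in> carr CC" "J (y t) \<in> carr CC" using uc[OF t] J_closed by auto
    show "nrm CC (u t \<ominus> J (y t)) \<le> (SUP \<zeta>\<in>\<TT>. nrm CC (dual_action \<beta> \<zeta> (u t) \<ominus> \<zeta> \<cdot>\<^bsub>CC\<^esub> u t))"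
      unfolding y_def
    \<comment> \<open>Each term lies below the supremum because the family is bounded, namely by
      twice the norm of u t.\<close>
    proof (rule dist_J_coeff1_le[OF uc[OF t]], rule cSUP_circle_le)
      fix \<zeta> assume z: "\<zeta> \<in> \<TT>"
      \<comment> \<open>\<open>dual_action_props\<close> controls distances; comparison with the
        image of zero turns this into a norm bound.\<close>
      have zero: "dual_action \<beta> \<zeta> \<zero>\<^bsub>CC\<^esub> = \<zero>\<^bsub>CC\<^esub>"
        using dual_action_props(1)[OF z, of "zer D"] by (simp add: U.zer_completion) (simp add: D_simps carrI[of "{}"])
      have "nrm CC (dual_action \<beta> \<zeta> (u t)) \<le> nrm CC (u t)"
        using dual_action_props(3)[OF z uc[OF t] CC.zer_closed] CC.nrm_le_dist[of "dual_action \<beta> \<zeta> (u t)" "\<zero>\<^bsub>CC\<^esub>"]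
          CC.nrm_minus_le[of "u t" "\<zero>\<^bsub>CC\<^esub>"] uc[OF t] dual_action_props(2)[OF z uc[OF t]] unfolding zero by simp
      then show "nrm CC (dual_action \<beta> \<zeta> (u t) \<ominus> \<zeta> \<cdot>\<^bsub>CC\<^esub> u t) \<le> 2 * nrm CC (u t)"
        using CC.nrm_minus_le[of "dual_action \<beta> \<zeta> (u t)" "\<zeta> \<cdot>\<^bsub>CC\<^esub> u t"] uc[OF t]
          dual_action_props(2)[OF z uc[OF t]] CC.nrm_scal[OF uc[OF t], of \<zeta>] z by simp
    qed
  qed
  have bu: "CC.bounded_path u" by (rule CC.bounded_pathI[of _ 1]) (auto intro: uc nu)
  have bJ: "CC.bounded_path (\<lambda>t. J (y t))"
    by (rule CC.bounded_pathI[of _ 1]) (auto intro: J_closed simp: nrm_J ny)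
  have limI: "((\<lambda>t. f t - g t) \<longlongrightarrow> 0) at_top" if "CC.asymptotic (\<lambda>t. I (f t)) (\<lambda>t. I (g t))" for f g
    using CC.asymptotic_tendsto[OF that] by (simp add: J_ops nrm_J tendsto_norm_zero_iff)
  have limJ: "((\<lambda>t. f t - g t) \<longlongrightarrow> 0) at_top" if "CC.asymptotic (\<lambda>t. J (f t)) (\<lambda>t. J (g t))" for f g
    using CC.asymptotic_tendsto[OF that] by (simp add: J_ops nrm_J tendsto_norm_zero_iff)
  have "CC.asymptotic (\<lambda>t. adj CC (J (y t)) \<odot> J (y t)) (\<lambda>t. adj CC (u t) \<odot> u t)"
    by (intro CC.asymptotic_mul CC.asymptotic_adj CC.asymptotic_sym[OF uJ] CC.bounded_path_adj bu bJ)
  then have "CC.asymptotic (\<lambda>t. I (iter (- 1) (star (y t) * y t))) (\<lambda>t. I 1)"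
    by (rule CC.asymptotic_cong) (simp_all add: J_ops uu)
  from limI[OF this] have "((\<lambda>t. norm (iter (- 1) (star (y t) * y t) - 1)) \<longlongrightarrow> 0) at_top"
    by (rule tendsto_norm_zero)
  \<comment> \<open>The inverse of \<beta> is isometric and fixes 1, so the twist disappears from
    the estimate.\<close>
  moreover have "norm (iter (- 1) (star (y t) * y t) - 1) = norm (star (y t) * y t - 1)" for t
    using iter.norm[of "- 1" "star (y t) * y t - 1"] by (simp only: iter.diff iter.one)
  ultimately have "((\<lambda>t. norm (star (y t) * y t - 1)) \<longlongrightarrow> 0) at_top" by simp
  then have yy: "((\<lambda>t. star (y t) * y t - 1) \<longlongrightarrow> 0) at_top" by (rule tendsto_norm_zero_cancel)
  have "CC.asymptotic (\<lambda>t. J (y t) \<odot> adj CC (J (y t))) (\<lambda>t. u t \<odot> adj CC (u t))"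
    by (intro CC.asymptotic_mul CC.asymptotic_adj CC.asymptotic_sym[OF uJ] CC.bounded_path_adj bu bJ)
  then have "CC.asymptotic (\<lambda>t. I (y t * star (y t))) (\<lambda>t. I 1)"
    by (rule CC.asymptotic_cong) (simp_all add: J_ops uu)
  from limI[OF this] have yy': "((\<lambda>t. y t * star (y t) - 1) \<longlongrightarrow> 0) at_top" .
  have comm': "CC.asymptotic (\<lambda>t. J (y t) \<odot> X) (\<lambda>t. X \<odot> J (y t))" if X: "X \<in> carr CC" for X
  proof -
    have "CC.asymptotic (\<lambda>t. J (y t) \<odot> X) (\<lambda>t. u t \<odot> X)"
      by (intro CC.asymptotic_mul_right CC.asymptotic_sym[OF uJ] CC.bounded_path_const X)
    also have "CC.asymptotic (\<lambda>t. u t \<odot> X) (\<lambda>t. X \<odot> u t)"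
      unfolding CC.asymptotic_def using comm[OF X] uc X by auto
    also have "CC.asymptotic (\<lambda>t. X \<odot> u t) (\<lambda>t. X \<odot> J (y t))"
      by (intro CC.asymptotic_mul_left uJ CC.bounded_path_const X)
    finally show ?thesis .
  qed
  have yb: "((\<lambda>t. y t * \<beta> b - b * y t) \<longlongrightarrow> 0) at_top" for b
    by (rule limJ) (use comm'[OF J_closed(2)] in \<open>simp add: J_ops\<close>)
  \<comment> \<open>Commutation with w itself: y w * w = y w^2 is compared with w * y w = \<beta>
    (y) w^2, which shows that y is almost fixed by \<beta>.\<close>
  have "CC.asymptotic (\<lambda>t. U.const_cls (single 2 (y t))) (\<lambda>t. U.const_cls (single 2 (\<beta> (y t))))"
    using comm'[OF J_closed(1), of 1] by (simp add: U.const_cls_ops[simplified] mul_single_single)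
  from CC.asymptotic_tendsto[OF this] have "((\<lambda>t. norm (y t - \<beta> (y t))) \<longlongrightarrow> 0) at_top"
    using U.nrm_const_cls by (simp add: U.const_cls_ops[simplified] minus_single universal_single)
  then have ybeta: "((\<lambda>t. y t - \<beta> (y t)) \<longlongrightarrow> 0) at_top" by (rule tendsto_norm_zero_cancel)
  show ?thesis
    unfolding asymptotically_representable_cstar_univ
  proof (intro exI[of _ "\<lambda>t. star (y t)"] conjI allI impI)
    show "continuous_on {0..} (\<lambda>t. star (y t))"
      unfolding y_def
      by (intro bounded_linear.continuous_on[OF bounded_linear_star] coeff1_props(4) u)
    show "norm (star (y t)) \<le> 1" if "0 \<le> t" for t using ny[OF that] by simp
    show "((\<lambda>t. star (star (y t)) * star (y t) * b - b) \<longlongrightarrow> 0) at_top" for b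
      using tendsto_zero_mult_bounded(1)[OF yy', of "\<lambda>_. b" "norm b"] by (simp add: star_star algebra_simps)
    show "((\<lambda>t. star (star (y t)) * star (y t) - star (y t) * star (star (y t))) \<longlongrightarrow> 0) at_top"
      using tendsto_diff[OF yy' yy] by (simp add: star_star)
    show "((\<lambda>t. \<beta> (star (y t)) - star (y t)) \<longlongrightarrow> 0) at_top"
      using tendsto_minus[OF bounded_linear.tendsto_zero[OF bounded_linear_star ybeta]]
      by (simp add: star_diff beta.star)
    fix b
    have "((\<lambda>t. star (y t) * (y t * \<beta> b - b * y t)) \<longlongrightarrow> 0) at_top"
      by (rule tendsto_zero_mult_bounded(2)[OF yb, of _ 1]) (simp add: ny)
    moreover have "((\<lambda>t. (star (y t) * y t - 1) * \<beta> b) \<longlongrightarrow> 0) at_top"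
      by (rule tendsto_zero_mult_bounded(1)[OF yy, of _ "norm (\<beta> b)"]) simp
    \<comment> \<open>The terms with \<open>star (y t) * y t * \<beta> b\<close> cancel, leaving
      \<beta> b - \<open>star (y t) * b * y t\<close>.\<close>
    ultimately have "((\<lambda>t. star (y t) * (y t * \<beta> b - b * y t) - (star (y t) * y t - 1) * \<beta> b) \<longlongrightarrow> 0 - 0) at_top"
      by (rule tendsto_diff)
    then show "((\<lambda>t. \<beta> b - star (y t) * b * star (star (y t))) \<longlongrightarrow> 0) at_top"
      by (simp add: star_star algebra_simps)
  qed
qed

section \<open>From A to the crossed product by the integers\<close>

theorem dual_rokhlin_if_asymptotically_representable:
  assumes "asymptotically_representable (cstar_univ :: 'a star_alg) \<beta>"
  shows "continuous_rokhlin_property (crossed_product_int \<beta>) (dual_action \<beta>)"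
proof -
  obtain v :: "real \<Rightarrow> 'a" where v: "continuous_on {0..} v" "\<And>t. 0 \<le> t \<Longrightarrow> norm (v t) \<le> 1"
    "\<And>b. ((\<lambda>t. star (v t) * v t * b - b) \<longlongrightarrow> 0) at_top"
    "((\<lambda>t. star (v t) * v t - v t * star (v t)) \<longlongrightarrow> 0) at_top"
    "((\<lambda>t. \<beta> (v t) - v t) \<longlongrightarrow> 0) at_top"
    "\<And>b. ((\<lambda>t. \<beta> b - v t * b * star (v t)) \<longlongrightarrow> 0) at_top"
    using assms unfolding asymptotically_representable_cstar_univ by blast
  \<comment> \<open>A is unital, so b = 1 upgrades convergence on each element to convergence in
    norm.\<close>
  have l: "((\<lambda>t. star (v t) * v t) \<longlongrightarrow> 1) at_top"
    using v(3)[of 1] by (simp add: LIM_zero_iff)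
  have r: "((\<lambda>t. v t * star (v t)) \<longlongrightarrow> 1) at_top"
    using tendsto_diff[OF l v(4)] by simp
  obtain s where s: "0 \<le> s" "continuous_on {0..} (\<lambda>t. polar (v (t + s)))"
    "\<And>t. 0 \<le> t \<Longrightarrow> norm (1 - star (v (t + s)) * v (t + s)) \<le> 1/2"
    "\<And>t. 0 \<le> t \<Longrightarrow> star (polar (v (t + s))) * polar (v (t + s)) = 1"
    "\<And>t. 0 \<le> t \<Longrightarrow> polar (v (t + s)) * star (polar (v (t + s))) = 1"
    "((\<lambda>t. polar (v (t + s)) - v (t + s)) \<longlongrightarrow> 0) at_top"
    by (rule unitary_path_near[OF v(1) l r]) blast
  define w where "w t = polar (v (t + s))" for t
  define x where "x t = v (t + s)" for t
  have wx: "((\<lambda>t. w t - x t) \<longlongrightarrow> 0) at_top" using s(6) by (simp add: w_def x_def)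
  have w: "star (w t) * w t = 1" "w t * star (w t) = 1" if "0 \<le> t" for t
    using s that by (simp_all add: w_def)
  have nw: "norm (w t) \<le> 1" if "0 \<le> t" for t
    using norm_le_one_if_isometry[OF w(1)[OF that]] .
  have nx: "norm (x t) \<le> 1" if "0 \<le> t" for t using v(2) s(1) that by (simp add: x_def)
  have filt: "filterlim (\<lambda>t. t + s) at_top at_top"
    using filterlim_tendsto_add_at_top[OF tendsto_const filterlim_ident, of s] by (simp add: add.commute)
  have bx: "((\<lambda>t. \<beta> (x t) - x t) \<longlongrightarrow> 0) at_top"
    using filterlim_compose[OF v(5) filt] by (simp add: x_def)
  have xb: "((\<lambda>t. \<beta> b - x t * b * star (x t)) \<longlongrightarrow> 0) at_top" for b
    using filterlim_compose[OF v(6) filt] by (simp add: x_def)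
  have bw: "((\<lambda>t. \<beta> (w t) - w t) \<longlongrightarrow> 0) at_top"
    using tendsto_add[OF tendsto_diff[OF bounded_linear.tendsto_zero[OF beta.bounded_linear wx] wx] bx]
    by (simp add: beta.diff)
  have wb: "((\<lambda>t. \<beta> b - w t * b * star (w t)) \<longlongrightarrow> 0) at_top" for b
  proof -
    have 1: "((\<lambda>t. (w t - x t) * (b * star (x t))) \<longlongrightarrow> 0) at_top"
    proof (rule tendsto_zero_mult_bounded(1)[OF wx])
      fix t :: real assume "0 \<le> t"
      then show "norm (b * star (x t)) \<le> norm b * 1"
        by (intro order_trans[OF norm_mult_ineq] mult_left_mono) (auto simp: nx)
    qed
    have 2: "((\<lambda>t. (w t * b) * (star (w t) - star (x t))) \<longlongrightarrow> 0) at_top"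
    proof (rule tendsto_zero_mult_bounded(2))
      show "((\<lambda>t. star (w t) - star (x t)) \<longlongrightarrow> 0) at_top"
        using bounded_linear.tendsto_zero[OF bounded_linear_star wx] by (simp add: star_diff)
      fix t :: real assume "0 \<le> t"
      then show "norm (w t * b) \<le> 1 * norm b"
        by (intro order_trans[OF norm_mult_ineq] mult_right_mono) (auto simp: nw)
    qed
    show ?thesis using tendsto_diff[OF xb[of b] tendsto_add[OF 1 2]] by (simp add: algebra_simps)
  qed
  have wb': "((\<lambda>t. star (w t) * \<beta> b - b * star (w t)) \<longlongrightarrow> 0) at_top" for b
  proof (rule Lim_transform_eventually)
    show "((\<lambda>t. star (w t) * (\<beta> b - w t * b * star (w t))) \<longlongrightarrow> 0) at_top"
      by (rule tendsto_zero_mult_bounded(2)[OF wb, of _ 1]) (simp add: nw)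
    show "\<forall>\<^sub>F t in at_top. star (w t) * (\<beta> b - w t * b * star (w t)) = star (w t) * \<beta> b - b * star (w t)"
      by (rule CC.eventually_at_top_nonneg) (simp add: right_diff_distrib w flip: mult.assoc)
  qed
  \<comment> \<open>The Rokhlin path will be \<open>J (y t)\<close>, the adjoint of
    \<open>w t\<close> times the canonical unitary.\<close>
  define y where "y t = star (w t)" for t
  have yb: "((\<lambda>t. y t * \<beta> b - b * y t) \<longlongrightarrow> 0) at_top" for b using wb' by (simp add: y_def)
  have ny: "norm (y t) \<le> 1" if "0 \<le> t" for t using nw[OF that] by (simp add: y_def)
  have b1: "((\<lambda>t. \<beta> (y t) - y t) \<longlongrightarrow> 0) at_top"
    using bounded_linear.tendsto_zero[OF bounded_linear_star bw] by (simp add: star_diff beta.star y_def)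
  have iy: "((\<lambda>t. iter k (y t) - y t) \<longlongrightarrow> 0) at_top" for k
  proof (induction k rule: int_induct[of _ 0])
    case (step1 i)
    have "((\<lambda>t. \<beta> (iter i (y t) - y t) + (\<beta> (y t) - y t)) \<longlongrightarrow> 0) at_top"
      by (intro tendsto_add_zero bounded_linear.tendsto_zero[OF beta.bounded_linear] step1 b1)
    then show ?case by (simp add: beta.diff iter_plus_one)
  next
    case (step2 i)
    have "((\<lambda>t. iter (-1) ((iter i (y t) - y t) - (\<beta> (y t) - y t))) \<longlongrightarrow> 0) at_top"
      using tendsto_diff[OF step2(2) b1]
      by (intro bounded_linear.tendsto_zero[OF iter.bounded_linear]) simp
    moreover have "iter (-1) ((iter i (y t) - y t) - (\<beta> (y t) - y t)) = iter (i - 1) (y t) - y t" for t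
      using iter_add[of "-1" 1 "y t"] iter_add[of "-1" i "y t"] by (simp add: iter.diff)
    ultimately show ?case by simp
  qed simp
  have yc: "continuous_on {0..} y"
    unfolding y_def w_def by (intro bounded_linear.continuous_on[OF bounded_linear_star] s)
  have commD: "((\<lambda>t. nrm CC (J (y t) \<odot> U.const_cls x \<ominus> U.const_cls x \<odot> J (y t))) \<longlongrightarrow> 0) at_top"
    if "x \<in> carr (with_universal_norm D)" for x
  proof -
    have x: "x \<in> carr D" using that by simp
    then obtain S where S: "finite S" "\<forall>k. k \<notin> S \<longrightarrow> x k = 0" by (rule carrE)
    \<comment> \<open>The coefficient at k of the commutator of \<open>J (y t)\<close> with x. It
      vanishes off the support of x shifted by 1, so convergence of each coefficient already gives
      convergence in the l1 norm.\<close>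
    define g where "g t k = y t * \<beta> (x (k - 1)) - x (k - 1) * iter (k - 1) (y t)" for t k
    have ge: "alg_minus D (mul D (single 1 (y t)) x) (mul D x (single 1 (y t))) = g t" for t
      using x by (auto simp: D_simps(6) mul_single_left mul_single_right g_def)
    have gc: "g t \<in> carr D" for t unfolding ge[symmetric] using x by (intro exp.minus_closed exp.mul_closed) auto
    have gl: "((\<lambda>t. g t k) \<longlongrightarrow> 0) at_top" for k
    proof -
      have "((\<lambda>t. x (k - 1) * (iter (k - 1) (y t) - y t)) \<longlongrightarrow> 0) at_top"
        by (rule tendsto_zero_mult_bounded(2)[OF iy, of _ "norm (x (k - 1))"]) simp
      from tendsto_diff[OF yb[of "x (k - 1)"] this] show ?thesis by (simp add: g_def algebra_simps)
    qed
    have nn: "nrm CC (J (y t) \<odot> U.const_cls x \<ominus> U.const_cls x \<odot> J (y t)) = universal_norm D (g t)" for t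
      using x gc U.nrm_const_cls[of "g t"] by (simp add: U.const_cls_ops[simplified] exp.mul_closed ge)
    show ?thesis
      unfolding nn
    proof (rule tendsto_sandwich[OF _ _ tendsto_const])
      show "((\<lambda>t. \<Sum>k\<in>(+) 1 ` S. norm (g t k)) \<longlongrightarrow> 0) at_top"
        by (intro tendsto_null_sum tendsto_norm_zero gl)
      have "universal_norm D (g t) \<le> (\<Sum>k\<in>(+) 1 ` S. norm (g t k))" for t
      proof -
        have "x (k - 1) = 0" if "k \<notin> (+) 1 ` S" for k
        proof -
          have "k - 1 \<notin> S" using that by (auto intro!: rev_image_eqI[of "k - 1"])
          then show ?thesis using S by blast
        qed
        then have "nrm D (g t) = (\<Sum>k\<in>(+) 1 ` S. norm (g t k))"
          using S by (intro nrm_eq) (auto simp: g_def)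
        then show ?thesis using exp.universal_le_nrm[OF gc[of t]] by simp
      qed
      then show "\<forall>\<^sub>F t in at_top. universal_norm D (g t) \<le> (\<Sum>k\<in>(+) 1 ` S. norm (g t k))" by simp
      show "\<forall>\<^sub>F t in at_top. 0 \<le> universal_norm D (g t)" using exp.universal_nonneg[OF gc] by simp
    qed
  qed
  show ?thesis
    unfolding continuous_rokhlin_property_def crossed_product_int_eq
  proof (intro exI[of _ "\<lambda>t. J (y t)"] conjI allI impI ballI)
    show "norm_continuous_path CC (\<lambda>t. J (y t))"
      using yc by (auto simp: norm_continuous_path_def J_closed J_ops nrm_J continuous_on_def
          tendsto_norm_zero_iff LIM_zero_iff)
    show "unitary CC (J (y t))" if "0 \<le> t" for t
      using w[OF that] by (simp add: unitary_def J_closed J_ops unit_CC y_def star_star)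
    have "nrm CC (dual_action \<beta> \<zeta> (J a) \<ominus> \<zeta> \<cdot>\<^bsub>CC\<^esub> J a) = 0" if z: "\<zeta> \<in> \<TT>" for \<zeta> a
    proof -
      have "dual \<zeta> (single 1 a) = scal D \<zeta> (single 1 a)" by (auto simp: D_simps single_def)
      then have "dual_action \<beta> \<zeta> (J a) = \<zeta> \<cdot>\<^bsub>CC\<^esub> J a"
        using dual_action_props(1)[OF z, of "single 1 a"] by (simp add: U.const_cls_ops[simplified])
      then show ?thesis using J_closed by simp
    qed
    then have "(SUP \<zeta>\<in>\<TT>. nrm CC (dual_action \<beta> \<zeta> (J (y t)) \<ominus> \<zeta> \<cdot>\<^bsub>CC\<^esub> J (y t))) = (SUP \<zeta>\<in>\<TT>. 0)" for t
      by (intro SUP_cong) auto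
    then show "((\<lambda>t. SUP \<zeta>\<in>\<TT>. nrm CC (dual_action \<beta> \<zeta> (J (y t)) \<ominus> \<zeta> \<cdot>\<^bsub>CC\<^esub> J (y t))) \<longlongrightarrow> 0) at_top"
      by simp
    fix X assume X: "X \<in> carr CC"
    show "((\<lambda>t. nrm CC (J (y t) \<odot> X \<ominus> X \<odot> J (y t))) \<longlongrightarrow> 0) at_top"
    \<comment> \<open>K = 2 because left and right multiplication by the contraction
      \<open>J (y t)\<close> contribute 1 each.\<close>
    proof (rule U.asymptotic_dense[where K=2 and F="\<lambda>t X. J (y t) \<odot> X" and G="\<lambda>t X. X \<odot> J (y t)", OF _ _ commD _ X])
      fix t :: real and X Y assume t: "0 \<le> t" and X: "X \<in> carr CC" and Y: "Y \<in> carr CC"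
      have "nrm CC (J (y t) \<odot> X \<ominus> J (y t) \<odot> Y) \<le> nrm CC (J (y t)) * nrm CC (X \<ominus> Y)"
        "nrm CC (X \<odot> J (y t) \<ominus> Y \<odot> J (y t)) \<le> nrm CC (X \<ominus> Y) * nrm CC (J (y t))"
        by (intro CC.dist_mul_left CC.dist_mul_right J_closed X Y)+
      moreover have "nrm CC (J (y t)) * nrm CC (X \<ominus> Y) \<le> 1 * nrm CC (X \<ominus> Y)"
        using X Y ny[OF t] by (intro mult_right_mono) (auto simp: nrm_J)
      ultimately show "nrm CC (J (y t) \<odot> X \<ominus> X \<odot> J (y t)) \<le> 2 * nrm CC (X \<ominus> Y) +
          nrm CC (J (y t) \<odot> Y \<ominus> Y \<odot> J (y t))"
        using CC.nrm_le_dist[of "J (y t) \<odot> X \<ominus> X \<odot> J (y t)" "J (y t) \<odot> Y \<ominus> Y \<odot> J (y t)"]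
          CC.dist_minus[of "J (y t) \<odot> X" "X \<odot> J (y t)" "J (y t) \<odot> Y" "Y \<odot> J (y t)"]
          J_closed(1)[of "y t"] X Y by (auto simp: mult.commute)
    qed (use X J_closed(1) in \<open>auto intro!: CC.nrm_nonneg\<close>)
  qed
qed

end

section \<open>Integration over the circle\<close>

lemma circle_cis:
  assumes "\<zeta> \<in> \<TT>"
  obtains s where "s \<in> {0..1}" "\<zeta> = cis (2 * pi * s)"
proof -
  have "\<zeta> \<noteq> 0" "cmod \<zeta> = 1" using assms by auto
  then have "\<zeta> = cis (Arg2pi \<zeta>)" using Arg2pi_eq[of \<zeta>] by (simp add: cis_conv_exp)
  moreover have "0 \<le> Arg2pi \<zeta>" "Arg2pi \<zeta> < 2 * pi" by (simp_all add: Arg2pi_ge_0 Arg2pi_lt_2pi)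
  ultimately show thesis using that[of "Arg2pi \<zeta> / (2 * pi)"] by auto
qed

lemma circle_mult [simp]: "\<zeta> \<in> \<TT> \<Longrightarrow> \<omega> \<in> \<TT> \<Longrightarrow> \<zeta> * \<omega> \<in> \<TT>"
  by (simp add: norm_mult)

lemma circle_inverse [simp]: "\<zeta> \<in> \<TT> \<Longrightarrow> inverse \<zeta> \<in> \<TT>"
  by (simp add: norm_inverse)

lemma circle_cnj [simp]: "\<zeta> \<in> \<TT> \<Longrightarrow> cnj \<zeta> \<in> \<TT>"
  by simp

lemma circle_one [simp]: "1 \<in> \<TT>"
  by simp

lemma compact_circle: "compact \<TT>"
  by simp

lemma continuous_on_cis: "continuous_on S (\<lambda>t. cis (2 * pi * t))"
  by (intro continuous_intros)

context
  fixes f :: "complex \<Rightarrow> 'v::banach"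
  assumes f: "continuous_on \<TT> f"
begin

lemma continuous_on_circle_cis: "continuous_on S (\<lambda>t. f (cis (2 * pi * t)))"
  by (rule continuous_on_compose2[OF f continuous_on_cis]) auto

lemma circle_integrable: "(\<lambda>t. f (cis (2 * pi * t))) integrable_on {a..b}"
  by (rule integrable_continuous_interval[OF continuous_on_circle_cis])

text \<open>In the parameter t a rotation is a translation by s; the part of the interval beyond 1
  is moved back by periodicity.\<close>

lemma circle_integral_rotate:
  assumes "\<omega> \<in> \<TT>"
  shows "circle_integral (\<lambda>\<zeta>. f (\<omega> * \<zeta>)) = circle_integral f"
proof -
  obtain s where s: "s \<in> {0..1}" "\<omega> = cis (2 * pi * s)" using circle_cis[OF assms] .
  define F where "F t = f (cis (2 * pi * t))" for t
  have per: "F (t + 1) = F t" for t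
    by (simp add: F_def distrib_left flip: cis_mult)
  have int: "F integrable_on {a..b}" for a b unfolding F_def by (rule circle_integrable)
  have "circle_integral (\<lambda>\<zeta>. f (\<omega> * \<zeta>)) = integral {0..1} (\<lambda>t. F (t + s))"
    by (simp add: circle_integral_def F_def s(2) cis_mult distrib_left add.commute)
  also have "\<dots> = integral {s..1 + s} F" using integral_shift_real_ivl[of s s "1 + s" F] by simp
  also have "\<dots> = integral {s..1} F + integral {1..1 + s} F"
    using s by (intro Henstock_Kurzweil_Integration.integral_combine[symmetric] int) auto
  also have "integral {1..1 + s} F = integral {0..s} (\<lambda>t. F (t + 1))"
    using integral_shift_real_ivl[of 1 1 "1 + s" F] by simp
  also have "\<dots> = integral {0..s} F" by (simp add: per)
  also have "integral {s..1} F + integral {0..s} F = integral {0..1} F"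
    using s by (subst add.commute) (intro Henstock_Kurzweil_Integration.integral_combine int, auto)
  finally show ?thesis by (simp add: circle_integral_def F_def[abs_def])
qed

lemma circle_integral_cnj: "circle_integral (\<lambda>\<zeta>. f (cnj \<zeta>)) = circle_integral f"
proof -
  define F where "F t = f (cis (2 * pi * t))" for t
  have per: "F (t + 1) = F t" for t
    by (simp add: F_def distrib_left flip: cis_mult)
  have "circle_integral (\<lambda>\<zeta>. f (cnj \<zeta>)) = integral {0..1} (\<lambda>t. F (- t))"
    by (simp add: circle_integral_def F_def cis_cnj)
  also have "\<dots> = integral {-1..0} F" using Henstock_Kurzweil_Integration.integral_reflect_real[where f=F and a="-1" and b=0] by simp
  also have "\<dots> = integral {-1..0} (\<lambda>t. F (t + 1))" by (simp add: per)
  also have "\<dots> = integral {0..1} F" using integral_shift_real_ivl[of 0 1 1 F] by simp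
  finally show ?thesis by (simp add: circle_integral_def F_def[abs_def])
qed

lemma circle_integral_linear:
  assumes "bounded_linear h"
  shows "circle_integral (\<lambda>\<zeta>. h (f \<zeta>)) = h (circle_integral f)"
  using integral_linear[OF circle_integrable[of 0 1] assms] by (simp add: circle_integral_def o_def)

lemma circle_integral_norm_le:
  assumes g: "continuous_on \<TT> g" and "\<And>\<zeta>. \<zeta> \<in> \<TT> \<Longrightarrow> norm (f \<zeta>) \<le> g \<zeta>"
  shows "norm (circle_integral f) \<le> circle_integral g"
  unfolding circle_integral_def
  by (rule integral_norm_bound_integral[OF circle_integrable])
    (use assms in \<open>auto intro!: integrable_continuous_interval continuous_on_compose2[OF g continuous_on_cis]\<close>)

end

lemma circle_integral_cong:
  "(\<And>\<zeta>. \<zeta> \<in> \<TT> \<Longrightarrow> f \<zeta> = g \<zeta>) \<Longrightarrow> circle_integral f = circle_integral g"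
  by (simp add: circle_integral_def)

lemma circle_integral_const [simp]: "circle_integral (\<lambda>_. c) = c"
  by (simp add: circle_integral_def)

lemma circle_integral_add:
  fixes f g :: "complex \<Rightarrow> 'v::banach"
  assumes "continuous_on \<TT> f" "continuous_on \<TT> g"
  shows "circle_integral (\<lambda>\<zeta>. f \<zeta> + g \<zeta>) = circle_integral f + circle_integral g"
  unfolding circle_integral_def using assms by (intro integral_add circle_integrable)

lemma circle_integral_diff:
  fixes f g :: "complex \<Rightarrow> 'v::banach"
  assumes "continuous_on \<TT> f" "continuous_on \<TT> g"
  shows "circle_integral (\<lambda>\<zeta>. f \<zeta> - g \<zeta>) = circle_integral f - circle_integral g"
  unfolding circle_integral_def using assms by (intro integral_diff circle_integrable)

lemma circle_integral_mono:
  fixes f g :: "complex \<Rightarrow> real"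
  assumes "continuous_on \<TT> f" "continuous_on \<TT> g" "\<And>\<zeta>. \<zeta> \<in> \<TT> \<Longrightarrow> f \<zeta> \<le> g \<zeta>"
  shows "circle_integral f \<le> circle_integral g"
  unfolding circle_integral_def using assms by (intro integral_le circle_integrable) auto

lemma circle_integral_nonneg:
  fixes f :: "complex \<Rightarrow> real"
  assumes "continuous_on \<TT> f" "\<And>\<zeta>. \<zeta> \<in> \<TT> \<Longrightarrow> 0 \<le> f \<zeta>"
  shows "0 \<le> circle_integral f"
  using circle_integral_mono[of "\<lambda>_. 0" f] assms by simp

lemma circle_integral_bound:
  fixes f :: "complex \<Rightarrow> 'v::banach"
  assumes "continuous_on \<TT> f" "\<And>\<zeta>. \<zeta> \<in> \<TT> \<Longrightarrow> norm (f \<zeta>) \<le> K"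
  shows "norm (circle_integral f) \<le> K"
  using circle_integral_norm_le[of f "\<lambda>_. K"] assms by simp

lemma circle_integral_zero_imp:
  fixes f :: "complex \<Rightarrow> real"
  assumes "continuous_on \<TT> f" "\<And>\<zeta>. \<zeta> \<in> \<TT> \<Longrightarrow> 0 \<le> f \<zeta>" "circle_integral f = 0" "\<zeta> \<in> \<TT>"
  shows "f \<zeta> = 0"
proof -
  obtain s where s: "s \<in> {0..1}" "\<zeta> = cis (2 * pi * s)" using circle_cis[OF assms(4)] .
  have "\<forall>t\<in>{0..1}. f (cis (2 * pi * t)) = 0"
    using integral_eq_0_iff[OF continuous_on_circle_cis[OF assms(1)], of 0 1] assms
    by (simp add: circle_integral_def)
  then show ?thesis using s by simp
qed

lemma circle_integral_swap:
  fixes f :: "complex \<Rightarrow> complex \<Rightarrow> 'v::banach"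
  assumes "continuous_on (\<TT> \<times> \<TT>) (\<lambda>(x, y). f x y)"
  shows "circle_integral (\<lambda>x. circle_integral (f x)) = circle_integral (\<lambda>y. circle_integral (\<lambda>x. f x y))"
proof -
  have "continuous_on (cbox (0, 0) (1, 1)) (\<lambda>p. (\<lambda>(x, y). f x y) (cis (2 * pi * fst p), cis (2 * pi * snd p)))"
    by (rule continuous_on_compose2[OF assms]) (auto intro!: continuous_intros)
  then show ?thesis
    using integral_swap_continuous[of 0 0 1 1 "\<lambda>s t. f (cis (2 * pi * s)) (cis (2 * pi * t))"]
    by (simp add: circle_integral_def case_prod_beta')
qed

lemma continuous_on_circle_integral:
  fixes f :: "'s::topological_space \<Rightarrow> complex \<Rightarrow> 'v::banach"
  assumes "continuous_on (S \<times> \<TT>) (\<lambda>(s, \<zeta>). f s \<zeta>)"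
  shows "continuous_on S (\<lambda>s. circle_integral (f s))"
proof -
  have "continuous_on (S \<times> cbox 0 1) (\<lambda>p. (\<lambda>(s, \<zeta>). f s \<zeta>) (fst p, cis (2 * pi * snd p)))"
    by (rule continuous_on_compose2[OF assms]) (auto intro!: continuous_intros)
  then show ?thesis
    using integral_continuous_on_param[of S 0 1 "\<lambda>s t. f s (cis (2 * pi * t))"]
    by (simp add: circle_integral_def case_prod_beta')
qed

lemma circle_bounded:
  fixes f :: "complex \<Rightarrow> 'v::real_normed_vector"
  assumes "continuous_on \<TT> f"
  obtains K where "0 < K" "\<And>\<zeta>. \<zeta> \<in> \<TT> \<Longrightarrow> norm (f \<zeta>) \<le> K"
proof -
  have "bounded (f ` \<TT>)" by (intro compact_imp_bounded compact_continuous_image assms compact_circle)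
  then show thesis using that by (auto simp: bounded_pos)
qed

text \<open>The metric criterion is stable under averaging: f is bounded on the compact circle by
  some K, and the integral of K - f again has norm at most K.\<close>

lemma cpos_circle_integral:
  fixes f :: "complex \<Rightarrow> 'a::unital_cstar_algebra"
  assumes f: "continuous_on \<TT> f" and p: "\<And>\<zeta>. \<zeta> \<in> \<TT> \<Longrightarrow> cpos (f \<zeta>)"
  shows "cpos (circle_integral f)"
proof -
  obtain K where K: "0 < K" "\<And>\<zeta>. \<zeta> \<in> \<TT> \<Longrightarrow> norm (f \<zeta>) \<le> K" using circle_bounded[OF f] by blast
  show ?thesis
  proof (rule cpos_if_norm_le[OF _ _ K(1)])
    show "star (circle_integral f) = circle_integral f"
      unfolding circle_integral_linear[OF f bounded_linear_star, symmetric]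
      by (rule circle_integral_cong[OF cpos_self_adjoint[OF p]])
    have "K *\<^sub>R 1 - circle_integral f = circle_integral (\<lambda>\<zeta>. K *\<^sub>R 1 - f \<zeta>)"
      using circle_integral_diff[of "\<lambda>_. K *\<^sub>R 1" f] f by simp
    also have "norm \<dots> \<le> K"
      by (rule circle_integral_bound) (use K p in \<open>auto intro!: continuous_intros f cpos_norm_le\<close>)
    finally show "norm (K *\<^sub>R 1 - circle_integral f) \<le> K" .
  qed
qed

section \<open>Crossed products by the circle\<close>

locale circle_system =
  fixes \<alpha> :: "complex \<Rightarrow> 'a::unital_cstar_algebra \<Rightarrow> 'a"
  assumes action: "circle_action cstar_univ \<alpha>"
begin

lemma star_aut_action: "\<zeta> \<in> \<TT> \<Longrightarrow> star_aut (\<alpha> \<zeta>)"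
  using action by (simp add: circle_action_def star_aut_def star_auto_def)

lemma action_mult: "\<zeta> \<in> \<TT> \<Longrightarrow> \<omega> \<in> \<TT> \<Longrightarrow> \<alpha> (\<zeta> * \<omega>) a = \<alpha> \<zeta> (\<alpha> \<omega> a)"
  using action by (simp add: circle_action_def)

lemma action_hom:
  assumes "\<zeta> \<in> \<TT>"
  shows "\<alpha> \<zeta> (x + y) = \<alpha> \<zeta> x + \<alpha> \<zeta> y" "\<alpha> \<zeta> (x - y) = \<alpha> \<zeta> x - \<alpha> \<zeta> y" "\<alpha> \<zeta> (scaleC c x) = scaleC c (\<alpha> \<zeta> x)"
    "\<alpha> \<zeta> (x * y) = \<alpha> \<zeta> x * \<alpha> \<zeta> y" "\<alpha> \<zeta> (star x) = star (\<alpha> \<zeta> x)" "norm (\<alpha> \<zeta> x) = norm x"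
    "\<alpha> \<zeta> 1 = 1" "\<alpha> \<zeta> 0 = 0" "\<alpha> \<zeta> (r *\<^sub>R x) = r *\<^sub>R \<alpha> \<zeta> x"
proof -
  interpret star_aut "\<alpha> \<zeta>" by (rule star_aut_action[OF assms])
  show "\<alpha> \<zeta> (x + y) = \<alpha> \<zeta> x + \<alpha> \<zeta> y" "\<alpha> \<zeta> (x - y) = \<alpha> \<zeta> x - \<alpha> \<zeta> y" "\<alpha> \<zeta> (scaleC c x) = scaleC c (\<alpha> \<zeta> x)"
    "\<alpha> \<zeta> (x * y) = \<alpha> \<zeta> x * \<alpha> \<zeta> y" "\<alpha> \<zeta> (star x) = star (\<alpha> \<zeta> x)" "norm (\<alpha> \<zeta> x) = norm x"
    "\<alpha> \<zeta> 1 = 1" "\<alpha> \<zeta> 0 = 0" "\<alpha> \<zeta> (r *\<^sub>R x) = r *\<^sub>R \<alpha> \<zeta> x"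
    by (simp_all add: add diff scaleC mult star scaleR)
qed

lemma bounded_linear_action: "\<zeta> \<in> \<TT> \<Longrightarrow> bounded_linear (\<alpha> \<zeta>)"
  by (rule star_aut.bounded_linear[OF star_aut_action])

lemma action_cpos: "\<zeta> \<in> \<TT> \<Longrightarrow> cpos a \<Longrightarrow> cpos (\<alpha> \<zeta> a)"
  by (rule star_aut.cpos[OF star_aut_action])

text \<open>The action law gives that \<alpha> 1 is idempotent; being isometric, it is the
  identity.\<close>

lemma action_one [simp]: "\<alpha> 1 a = a"
proof -
  have "norm (\<alpha> 1 (\<alpha> 1 a - a)) = 0" using action_mult[of 1 1 a] by (simp only: action_hom(2)[OF circle_one]) simp
  then have "norm (\<alpha> 1 a - a) = 0" by (simp only: action_hom(6)[OF circle_one])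
  then show ?thesis by simp
qed

lemma action_inverse [simp]: "\<zeta> \<in> \<TT> \<Longrightarrow> \<alpha> \<zeta> (\<alpha> (inverse \<zeta>) a) = a"
  using action_mult[of \<zeta> "inverse \<zeta>" a] circle_inverse[of \<zeta>] circle_nonzero[of \<zeta>] by auto

lemma action_orbit_tendsto:
  assumes "\<zeta> \<in> \<TT>" shows "((\<lambda>\<omega>. \<alpha> \<omega> b) \<longlongrightarrow> \<alpha> \<zeta> b) (at \<zeta> within \<TT>)"
  using action assms by (simp add: circle_action_def tendsto_norm_zero_iff LIM_zero_iff)

lemma continuous_on_orbit: "continuous_on \<TT> (\<lambda>\<zeta>. \<alpha> \<zeta> b)"
  unfolding continuous_on_def using action_orbit_tendsto by blast

text \<open>Joint continuity from continuity of orbits: a change of the argument is transported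
  isometrically, whatever the group element.\<close>

lemma continuous_on_action [continuous_intros]:
  fixes g :: "'s::topological_space \<Rightarrow> complex" and h :: "'s \<Rightarrow> 'a"
  assumes g: "continuous_on S g" and h: "continuous_on S h" and gS: "\<And>s. s \<in> S \<Longrightarrow> g s \<in> \<TT>"
  shows "continuous_on S (\<lambda>s. \<alpha> (g s) (h s))"
  unfolding continuous_on_def
proof
  have gS': "cmod (g s) = 1" if "s \<in> S" for s using gS[OF that] by simp
  fix s0 assume s0: "s0 \<in> S"
  have "continuous_on S (\<lambda>s. \<alpha> (g s) (h s0))"
    by (rule continuous_on_compose2[OF continuous_on_orbit g]) (use gS in auto)
  then have 1: "((\<lambda>s. \<alpha> (g s) (h s0)) \<longlongrightarrow> \<alpha> (g s0) (h s0)) (at s0 within S)"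
    using s0 by (auto simp: continuous_on_def)
  have "((\<lambda>s. h s - h s0) \<longlongrightarrow> 0) (at s0 within S)"
    using h s0 by (auto simp: continuous_on_def LIM_zero_iff)
  then have "((\<lambda>s. \<alpha> (g s) (h s - h s0)) \<longlongrightarrow> 0) (at s0 within S)"
    by (rule Lim_null_comparison[rotated, OF tendsto_norm_zero])
      (auto simp: eventually_at_filter gS' action_hom(6) intro!: always_eventually)
  from tendsto_add[OF this 1] have "((\<lambda>s. \<alpha> (g s) (h s - h s0) + \<alpha> (g s) (h s0)) \<longlongrightarrow> \<alpha> (g s0) (h s0)) (at s0 within S)"
    by simp
  then show "((\<lambda>s. \<alpha> (g s) (h s)) \<longlongrightarrow> \<alpha> (g s0) (h s0)) (at s0 within S)"
    by (rule Lim_transform_eventually)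
      (auto simp: eventually_at_filter gS' action_hom(2) intro!: always_eventually)
qed

lemmas continuous_on_star [continuous_intros] = bounded_linear.continuous_on[OF bounded_linear_star]

lemma continuous_on_scaleC [continuous_intros]:
  fixes g :: "'s::topological_space \<Rightarrow> complex" and h :: "'s \<Rightarrow> 'a"
  assumes "continuous_on S g" "continuous_on S h"
  shows "continuous_on S (\<lambda>s. scaleC (g s) (h s))"
proof -
  have "scaleC (g s) (h s) = Re (g s) *\<^sub>R h s + Im (g s) *\<^sub>R scaleC \<i> (h s)" for s
    by (simp add: scaleR_scaleC scaleC_scaleC mult.commute complex_eq[symmetric] flip: scaleC_add_left)
  then show ?thesis
    by (simp only:) (intro continuous_intros bounded_linear.continuous_on[OF bounded_linear_scaleC] assms)
qed

section \<open>The convolution algebra over the circle\<close>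

abbreviation "D \<equiv> circle_conv_alg \<alpha>"

lemma D_simps:
  "carr D = {\<xi>. continuous_on \<TT> \<xi>}" "zer D = (\<lambda>k. 0)" "plu D = (\<lambda>\<xi> \<eta> k. \<xi> k + \<eta> k)"
  "scal D = (\<lambda>c \<xi> k. scaleC c (\<xi> k))" "adj D = (\<lambda>\<xi> \<zeta>. \<alpha> \<zeta> (star (\<xi> (cnj \<zeta>))))"
  "alg_minus D = (\<lambda>\<xi> \<eta> k. \<xi> k - \<eta> k)" "nrm D = (\<lambda>\<xi>. circle_integral (\<lambda>\<zeta>. norm (\<xi> \<zeta>)))"
  by (auto simp: circle_conv_alg_def alg_minus_def fun_eq_iff)

lemma mul_eq: "mul D \<xi> \<eta> \<zeta> = circle_integral (\<lambda>\<omega>. \<xi> \<omega> * \<alpha> \<omega> (\<eta> (inverse \<omega> * \<zeta>)))"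
  by (simp add: circle_conv_alg_def)

lemma carr_compose:
  assumes "\<xi> \<in> carr D" "continuous_on S g" "\<And>s. s \<in> S \<Longrightarrow> g s \<in> \<TT>"
  shows "continuous_on S (\<lambda>s. \<xi> (g s))"
  by (rule continuous_on_compose2[of \<TT> \<xi>]) (use assms in \<open>auto simp: D_simps\<close>)

lemma carr_continuous: "\<xi> \<in> carr D \<Longrightarrow> continuous_on \<TT> \<xi>"
  by (simp add: D_simps)

lemma mul_carr:
  assumes "\<xi> \<in> carr D" "\<eta> \<in> carr D"
  shows "mul D \<xi> \<eta> \<in> carr D"
proof -
  have "continuous_on \<TT> (\<lambda>\<zeta>. circle_integral (\<lambda>\<omega>. \<xi> \<omega> * \<alpha> \<omega> (\<eta> (inverse \<omega> * \<zeta>))))"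
    by (rule continuous_on_circle_integral, unfold case_prod_beta',
        intro continuous_intros carr_compose[OF assms(1)] carr_compose[OF assms(2)])
      (auto simp: norm_mult norm_inverse)
  then show ?thesis by (simp add: D_simps mul_eq[abs_def])
qed

lemma adj_carr:
  assumes "\<xi> \<in> carr D" shows "adj D \<xi> \<in> carr D"
proof -
  have "continuous_on \<TT> (\<lambda>\<zeta>. \<alpha> \<zeta> (star (\<xi> (cnj \<zeta>))))"
    by (intro continuous_intros carr_compose[OF assms]) auto
  then show ?thesis by (simp add: D_simps)
qed

text \<open>Products and adjoints are controlled on the circle, so the algebra laws are verified
  pointwise there and enter as distance 0.\<close>

lemma nrm_minus_zero: "(\<And>\<zeta>. \<zeta> \<in> \<TT> \<Longrightarrow> \<xi> \<zeta> = \<eta> \<zeta>) \<Longrightarrow> nrm D (alg_minus D \<xi> \<eta>) = 0"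
  using circle_integral_cong[of "\<lambda>\<zeta>. norm (\<xi> \<zeta> - \<eta> \<zeta>)" "\<lambda>_. 0"] by (simp add: D_simps)

lemma nrm_zero_imp: "\<xi> \<in> carr D \<Longrightarrow> nrm D \<xi> = 0 \<Longrightarrow> \<zeta> \<in> \<TT> \<Longrightarrow> \<xi> \<zeta> = 0"
  using circle_integral_zero_imp[of "\<lambda>\<zeta>. norm (\<xi> \<zeta>)" \<zeta>] by (simp add: D_simps continuous_on_norm)

lemma mul_integrand:
  assumes "\<xi> \<in> carr D" "\<eta> \<in> carr D" "\<zeta> \<in> \<TT>"
  shows "continuous_on \<TT> (\<lambda>\<omega>. \<xi> \<omega> * \<alpha> \<omega> (\<eta> (inverse \<omega> * \<zeta>)))"
  by (intro continuous_intros carr_compose[OF assms(1)] carr_compose[OF assms(2)])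
    (use assms(3) in \<open>auto simp: norm_mult norm_inverse\<close>)

text \<open>Fubini, followed by the rotation replacing \<rho> with \<omega> * \<rho> in the inner
  integral.\<close>

lemma mul_assoc_D:
  assumes x: "x \<in> carr D" and y: "y \<in> carr D" and z: "z \<in> carr D" and \<zeta>: "\<zeta> \<in> \<TT>"
  shows "mul D (mul D x y) z \<zeta> = mul D x (mul D y z) \<zeta>"
proof -
  define g where "g \<omega> \<rho> = x \<omega> * \<alpha> \<omega> (y (inverse \<omega> * \<rho>)) * \<alpha> \<rho> (z (inverse \<rho> * \<zeta>))" for \<omega> \<rho>
  have gc: "continuous_on (\<TT> \<times> \<TT>) (\<lambda>(\<omega>, \<rho>). g \<omega> \<rho>)"
    unfolding g_def case_prod_beta'
    by (intro continuous_intros carr_compose[OF x] carr_compose[OF y] carr_compose[OF z])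
      (use \<zeta> in \<open>auto simp: norm_mult norm_inverse\<close>)
  have "mul D (mul D x y) z \<zeta> = circle_integral (\<lambda>\<rho>. circle_integral (\<lambda>\<omega>. g \<omega> \<rho>))"
    unfolding mul_eq
  proof (rule circle_integral_cong)
    fix \<rho> assume \<rho>: "\<rho> \<in> \<TT>"
    show "circle_integral (\<lambda>\<omega>. x \<omega> * \<alpha> \<omega> (y (inverse \<omega> * \<rho>))) * \<alpha> \<rho> (z (inverse \<rho> * \<zeta>)) = circle_integral (\<lambda>\<omega>. g \<omega> \<rho>)"
      unfolding g_def
      using circle_integral_linear[OF mul_integrand[OF x y \<rho>] bounded_linear_mult_left[of "\<alpha> \<rho> (z (inverse \<rho> * \<zeta>))"]]
      by simp
  qed
  also have "\<dots> = circle_integral (\<lambda>\<omega>. circle_integral (g \<omega>))"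
    by (rule circle_integral_swap[OF gc, symmetric])
  also have "\<dots> = mul D x (mul D y z) \<zeta>"
    unfolding mul_eq[of x "mul D y z"]
  proof (rule circle_integral_cong)
    fix \<omega> assume \<omega>: "\<omega> \<in> \<TT>"
    have g\<omega>: "continuous_on \<TT> (g \<omega>)"
      unfolding g_def
      by (intro continuous_intros carr_compose[OF y] carr_compose[OF z])
        (use \<zeta> \<omega> in \<open>auto simp: norm_mult norm_inverse\<close>)
    have i: "inverse \<omega> * \<zeta> \<in> \<TT>" using \<omega> \<zeta> by (intro circle_mult circle_inverse)
    have "x \<omega> * \<alpha> \<omega> (mul D y z (inverse \<omega> * \<zeta>))
        = circle_integral (\<lambda>\<rho>. x \<omega> * \<alpha> \<omega> (y \<rho> * \<alpha> \<rho> (z (inverse \<rho> * (inverse \<omega> * \<zeta>)))))"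
      unfolding mul_eq
      using circle_integral_linear[OF mul_integrand[OF y z i],
          OF bounded_linear_compose[OF bounded_linear_mult_right[of "x \<omega>"] bounded_linear_action[OF \<omega>]]]
      by simp
    also have "\<dots> = circle_integral (\<lambda>\<rho>. g \<omega> (\<omega> * \<rho>))"
    proof (rule circle_integral_cong)
      fix \<rho> assume \<rho>: "\<rho> \<in> \<TT>"
      have e: "inverse \<omega> * (\<omega> * \<rho>) = \<rho>" "inverse (\<omega> * \<rho>) * \<zeta> = inverse \<rho> * (inverse \<omega> * \<zeta>)"
        using circle_nonzero[OF \<omega>] by (simp_all add: field_simps)
      show "x \<omega> * \<alpha> \<omega> (y \<rho> * \<alpha> \<rho> (z (inverse \<rho> * (inverse \<omega> * \<zeta>)))) = g \<omega> (\<omega> * \<rho>)"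
        unfolding g_def e by (simp add: action_hom[OF \<omega>] action_mult[OF \<omega> \<rho>] mult.assoc)
    qed
    also have "\<dots> = circle_integral (g \<omega>)" by (rule circle_integral_rotate[OF g\<omega> \<omega>])
    finally show "circle_integral (g \<omega>) = x \<omega> * \<alpha> \<omega> (mul D y z (inverse \<omega> * \<zeta>))" by simp
  qed
  finally show ?thesis .
qed

text \<open>The right side is the integral of g; rotating its variable by \<zeta> turns g into the
  adjoint of the integrand on the left.\<close>

lemma adj_mul_D:
  assumes x: "x \<in> carr D" and y: "y \<in> carr D" and \<zeta>: "\<zeta> \<in> \<TT>"
  shows "adj D (mul D x y) \<zeta> = mul D (adj D y) (adj D x) \<zeta>"
proof -
  define g where "g \<rho> = \<alpha> \<rho> (star (y (cnj \<rho>))) * \<alpha> \<zeta> (star (x (inverse \<zeta> * \<rho>)))" for \<rho>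
  have gc: "continuous_on \<TT> g"
    unfolding g_def
    by (intro continuous_intros carr_compose[OF x] carr_compose[OF y])
      (use \<zeta> in \<open>auto simp: norm_mult norm_inverse\<close>)
  have "mul D (adj D y) (adj D x) \<zeta> = circle_integral g"
    unfolding mul_eq
  proof (rule circle_integral_cong)
    fix \<rho> assume \<rho>: "\<rho> \<in> \<TT>"
    have e: "cnj (inverse \<rho> * \<zeta>) = inverse \<zeta> * \<rho>"
      using \<rho> \<zeta> cnj_circle[OF \<rho>] cnj_circle[OF \<zeta>] by (simp add: mult.commute)
    have r: "\<rho> * (inverse \<rho> * \<zeta>) = \<zeta>" using circle_nonzero[OF \<rho>] by simp
    have "\<alpha> \<rho> (\<alpha> (inverse \<rho> * \<zeta>) (star (x (inverse \<zeta> * \<rho>)))) = \<alpha> \<zeta> (star (x (inverse \<zeta> * \<rho>)))"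
      using \<rho> \<zeta> action_mult[of \<rho> "inverse \<rho> * \<zeta>"] by (metis circle_inverse circle_mult r)
    then show "adj D y \<rho> * \<alpha> \<rho> (adj D x (inverse \<rho> * \<zeta>)) = g \<rho>"
      unfolding g_def D_simps e by simp
  qed
  also have "\<dots> = circle_integral (\<lambda>\<omega>. g (\<zeta> * \<omega>))" by (rule circle_integral_rotate[OF gc \<zeta>, symmetric])
  also have "\<dots> = circle_integral (\<lambda>\<omega>. \<alpha> \<zeta> (star (x \<omega> * \<alpha> \<omega> (y (inverse \<omega> * cnj \<zeta>)))))"
  proof (rule circle_integral_cong)
    fix \<omega> assume \<omega>: "\<omega> \<in> \<TT>"
    have e: "inverse \<zeta> * (\<zeta> * \<omega>) = \<omega>" "cnj (\<zeta> * \<omega>) = inverse \<omega> * cnj \<zeta>"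
      using circle_nonzero[OF \<zeta>] by (simp_all add: cnj_circle[OF \<omega>] cnj_circle[OF \<zeta>])
    show "g (\<zeta> * \<omega>) = \<alpha> \<zeta> (star (x \<omega> * \<alpha> \<omega> (y (inverse \<omega> * cnj \<zeta>))))"
      unfolding g_def e using \<omega> \<zeta> by (simp add: action_hom action_mult star_mult)
  qed
  also have "\<dots> = adj D (mul D x y) \<zeta>"
    unfolding D_simps mul_eq
    using circle_integral_linear[OF mul_integrand[OF x y circle_cnj[OF \<zeta>]],
        OF bounded_linear_compose[OF bounded_linear_action[OF \<zeta>] bounded_linear_star]]
    by simp
  finally show ?thesis by simp
qed

lemma star_prealgebra_D: "star_prealgebra D"
proof (intro star_prealgebra.intro)
  fix x y z c d assume x: "x \<in> carr D"
  note xc = carr_continuous[OF x]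
  show "scal D c x \<in> carr D" using xc by (simp add: D_simps continuous_intros)
  show "adj D x \<in> carr D" using x by (rule adj_carr)
  show "0 \<le> nrm D x" using xc by (simp add: D_simps circle_integral_nonneg continuous_on_norm)
  show "nrm D (scal D c x) = cmod c * nrm D x"
    using circle_integral_linear[of "\<lambda>\<zeta>. norm (x \<zeta>)" "\<lambda>r. cmod c * r"] xc
    by (simp add: D_simps norm_scaleC continuous_on_norm bounded_linear_mult_right)
  show "nrm D (alg_minus D (adj D (scal D c x)) (scal D (cnj c) (adj D x))) = 0"
    by (rule nrm_minus_zero) (simp only: D_simps star_scaleC action_hom)
  show "nrm D (alg_minus D (adj D (adj D x)) x) = 0"
  proof (rule nrm_minus_zero)
    fix \<zeta> assume \<zeta>: "\<zeta> \<in> \<TT>"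
    show "adj D (adj D x) \<zeta> = x \<zeta>"
      using action_inverse[OF \<zeta>, of "x \<zeta>"]
      by (simp only: D_simps cnj_circle[OF \<zeta>] inverse_inverse_eq complex_cnj_inverse star_star
          action_hom(5)[OF circle_inverse[OF \<zeta>], symmetric])
  qed
  assume y: "y \<in> carr D"
  note yc = carr_continuous[OF y]
  show "plu D x y \<in> carr D" using xc yc by (simp add: D_simps continuous_intros)
  show "mul D x y \<in> carr D" using x y by (rule mul_carr)
  have "circle_integral (\<lambda>\<zeta>. norm (x \<zeta> + y \<zeta>)) \<le> circle_integral (\<lambda>\<zeta>. norm (x \<zeta>) + norm (y \<zeta>))"
    using xc yc by (intro circle_integral_mono continuous_intros norm_triangle_ineq)
  also have "\<dots> = circle_integral (\<lambda>\<zeta>. norm (x \<zeta>)) + circle_integral (\<lambda>\<zeta>. norm (y \<zeta>))"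
    using xc yc by (intro circle_integral_add continuous_intros)
  finally show "nrm D (plu D x y) \<le> nrm D x + nrm D y" by (simp add: D_simps)
  show "nrm D (alg_minus D (mul D (scal D c x) y) (scal D c (mul D x y))) = 0"
  proof (rule nrm_minus_zero)
    fix \<zeta> assume \<zeta>: "\<zeta> \<in> \<TT>"
    show "mul D (scal D c x) y \<zeta> = scal D c (mul D x y) \<zeta>"
      using circle_integral_linear[OF mul_integrand[OF x y \<zeta>] bounded_linear_scaleC[of c]]
      by (simp add: mul_eq D_simps mult_scaleC_left)
  qed
  show "nrm D (alg_minus D (mul D x (scal D c y)) (scal D c (mul D x y))) = 0"
  proof (rule nrm_minus_zero)
    fix \<zeta> assume \<zeta>: "\<zeta> \<in> \<TT>"
    show "mul D x (scal D c y) \<zeta> = scal D c (mul D x y) \<zeta>"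
      unfolding mul_eq D_simps circle_integral_linear[OF mul_integrand[OF x y \<zeta>] bounded_linear_scaleC[of c], symmetric]
      by (rule circle_integral_cong) (simp only: action_hom mult_scaleC_right)
  qed
  show "nrm D (alg_minus D (adj D (plu D x y)) (plu D (adj D x) (adj D y))) = 0"
    by (rule nrm_minus_zero) (simp only: D_simps star_add action_hom)
  show "nrm D (alg_minus D (adj D (mul D x y)) (mul D (adj D y) (adj D x))) = 0"
    by (rule nrm_minus_zero) (rule adj_mul_D[OF x y])
  assume z: "z \<in> carr D"
  show "nrm D (alg_minus D (mul D (plu D x y) z) (plu D (mul D x z) (mul D y z))) = 0"
  proof (rule nrm_minus_zero)
    fix \<zeta> assume \<zeta>: "\<zeta> \<in> \<TT>"
    show "mul D (plu D x y) z \<zeta> = plu D (mul D x z) (mul D y z) \<zeta>"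
      using circle_integral_add[OF mul_integrand[OF x z \<zeta>] mul_integrand[OF y z \<zeta>]]
      by (simp add: mul_eq D_simps distrib_right)
  qed
  show "nrm D (alg_minus D (mul D z (plu D x y)) (plu D (mul D z x) (mul D z y))) = 0"
  proof (rule nrm_minus_zero)
    fix \<zeta> assume \<zeta>: "\<zeta> \<in> \<TT>"
    show "mul D z (plu D x y) \<zeta> = plu D (mul D z x) (mul D z y) \<zeta>"
      unfolding mul_eq D_simps circle_integral_add[OF mul_integrand[OF z x \<zeta>] mul_integrand[OF z y \<zeta>], symmetric]
      by (rule circle_integral_cong) (simp only: action_hom distrib_left)
  qed
  show "nrm D (alg_minus D (mul D (mul D x y) z) (mul D x (mul D y z))) = 0"
    by (rule nrm_minus_zero) (rule mul_assoc_D[OF x y z])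
qed (auto simp: D_simps algebra_simps scaleC_add_left scaleC_add_right scaleC_scaleC)

section \<open>The regular representation over the circle\<close>

lemma E_ip:
  assumes x: "x \<in> carr D" and y: "y \<in> carr D"
  shows "mul D (adj D y) x 1 = circle_integral (\<lambda>\<omega>. \<alpha> (inverse \<omega>) (star (y \<omega>) * x \<omega>))"
proof -
  have "continuous_on \<TT> (\<lambda>\<omega>. \<alpha> (inverse \<omega>) (star (y \<omega>) * x \<omega>))"
    by (intro continuous_intros carr_continuous x y) (auto simp: norm_inverse)
  from circle_integral_cnj[OF this, symmetric]
  have "circle_integral (\<lambda>\<omega>. \<alpha> (inverse \<omega>) (star (y \<omega>) * x \<omega>))
    = circle_integral (\<lambda>\<omega>. \<alpha> (inverse (cnj \<omega>)) (star (y (cnj \<omega>)) * x (cnj \<omega>)))" .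
  also have "\<dots> = mul D (adj D y) x 1"
    unfolding mul_eq by (rule circle_integral_cong) (simp add: D_simps cnj_circle action_hom)
  finally show ?thesis by simp
qed

lemma ip_integrand:
  assumes x: "x \<in> carr D" and y: "y \<in> carr D"
  shows "continuous_on \<TT> (\<lambda>\<omega>. \<alpha> (inverse \<omega>) (star (y \<omega>) * x \<omega>))"
  by (intro continuous_intros carr_continuous x y) (auto simp: norm_inverse)

lemma expectation_D: "expectation D (\<lambda>x. x 1)"
proof (intro expectation.intro star_prealgebra_D expectation_axioms.intro)
  fix x c assume x: "x \<in> carr D"
  show "cpos (mul D (adj D x) x 1)"
    unfolding E_ip[OF x x]
    by (intro cpos_circle_integral ip_integrand x action_cpos cpos_star_mult circle_inverse)
  show "\<exists>x'\<in>carr D. \<forall>y\<in>carr D. mul D (adj D y) x' 1 = mul D (adj D y) x 1 * c"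
  proof (intro bexI ballI)
    \<comment> \<open>The witness is right multiplication by c, which acquires \<alpha> \<zeta> when
      moved past the canonical unitary at \<zeta>.\<close>
    have "continuous_on \<TT> (\<lambda>\<zeta>. x \<zeta> * \<alpha> \<zeta> c)"
      by (intro continuous_intros carr_continuous x) auto
    then show x': "(\<lambda>\<zeta>. x \<zeta> * \<alpha> \<zeta> c) \<in> carr D" by (simp add: D_simps)
    fix y assume y: "y \<in> carr D"
    have "mul D (adj D y) (\<lambda>\<zeta>. x \<zeta> * \<alpha> \<zeta> c) 1 = circle_integral (\<lambda>\<omega>. \<alpha> (inverse \<omega>) (star (y \<omega>) * x \<omega>) * c)"
      unfolding E_ip[OF x' y]
    proof (rule circle_integral_cong)
      fix \<omega> assume \<omega>: "\<omega> \<in> \<TT>"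
      have "\<alpha> (inverse \<omega>) (\<alpha> \<omega> c) = c" using action_inverse[of "inverse \<omega>" c] \<omega> by (simp add: norm_inverse)
      then show "\<alpha> (inverse \<omega>) (star (y \<omega>) * (x \<omega> * \<alpha> \<omega> c)) = \<alpha> (inverse \<omega>) (star (y \<omega>) * x \<omega>) * c"
        using \<omega> by (simp add: action_hom(4) norm_inverse mult.assoc)
    qed
    also have "\<dots> = mul D (adj D y) x 1 * c"
      unfolding E_ip[OF x y] by (rule circle_integral_linear[OF ip_integrand[OF x y] bounded_linear_mult_left])
    finally show "mul D (adj D y) (\<lambda>\<zeta>. x \<zeta> * \<alpha> \<zeta> c) 1 = mul D (adj D y) x 1 * c" .
  qed
  assume n: "nrm D x = 0"
  note x0 = nrm_zero_imp[OF x n]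
  show "x 1 = 0" by (rule x0) simp
  have null: "nrm D z = 0" if "\<And>\<zeta>. \<zeta> \<in> \<TT> \<Longrightarrow> z \<zeta> = 0" for z
    using nrm_minus_zero[of z "\<lambda>_. 0"] that by (simp add: D_simps)
  fix y
  show "nrm D (mul D x y) = 0"
  proof (rule null)
    fix \<zeta>
    have "mul D x y \<zeta> = circle_integral (\<lambda>_. 0)"
      unfolding mul_eq by (rule circle_integral_cong) (simp only: x0 mult_zero_left)
    then show "mul D x y \<zeta> = 0" by simp
  qed
  show "nrm D (mul D y x) = 0"
  proof (rule null)
    fix \<zeta> assume \<zeta>: "\<zeta> \<in> \<TT>"
    have "mul D y x \<zeta> = circle_integral (\<lambda>_. 0)"
      unfolding mul_eq
    proof (rule circle_integral_cong)
      fix \<omega> assume \<omega>: "\<omega> \<in> \<TT>"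
      then have "x (inverse \<omega> * \<zeta>) = 0" using \<zeta> by (intro x0 circle_mult circle_inverse)
      then show "y \<omega> * \<alpha> \<omega> (x (inverse \<omega> * \<zeta>)) = 0" using action_hom(8)[OF \<omega>] by simp
    qed
    then show "mul D y x \<zeta> = 0" by simp
  qed
qed (auto simp: D_simps cnj_circle)

sublocale exp: expectation D "\<lambda>x. x 1"
  by (rule expectation_D)

text \<open>The argument over the integers with integrals for sums: x y is the integral over
  \<omega> of the functions z \<omega>, each bounded by \<open>norm (x \<omega>)\<close> times the
  size of y, and Fubini exchanges this integral with the inner product.\<close>

lemma regular_D: "regular D (\<lambda>x. x 1)"
proof (intro regular.intro expectation_D regular_axioms.intro)
  fix x y assume x: "x \<in> carr D" and y: "y \<in> carr D"
  define z where "z \<omega> \<zeta> = x \<omega> * \<alpha> \<omega> (y (inverse \<omega> * \<zeta>))" for \<omega> \<zeta>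
  have z: "z \<omega> \<in> carr D" if "\<omega> \<in> \<TT>" for \<omega>
  proof -
    have "continuous_on \<TT> (z \<omega>)"
      unfolding z_def by (intro continuous_intros carr_compose[OF y])
        (use that in \<open>auto simp: norm_mult norm_inverse\<close>)
    then show ?thesis by (simp add: D_simps)
  qed
  have mz: "exp.mnorm (z \<omega>) \<le> norm (x \<omega>) * exp.mnorm y" if \<omega>: "\<omega> \<in> \<TT>" for \<omega>
  proof (rule power2_le_imp_le)
    define a where "a = star (x \<omega>) * x \<omega>"
    have na: "norm a = (norm (x \<omega>))\<^sup>2" by (simp add: a_def norm_star_mult)
    \<comment> \<open>The integrand of \<open>ip y y\<close> after rotation by \<omega>, a form in
      which it can be compared pointwise with the integrand of
      \<open>ip (z \<omega>) (z \<omega>)\<close>.\<close>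
    define k where "k \<zeta> = \<alpha> (inverse \<zeta>) (star (\<alpha> \<omega> (y (inverse \<omega> * \<zeta>))) * \<alpha> \<omega> (y (inverse \<omega> * \<zeta>)))" for \<zeta>
    have kc: "continuous_on \<TT> k"
      unfolding k_def by (intro continuous_intros carr_compose[OF y])
        (use \<omega> in \<open>auto simp: norm_mult norm_inverse\<close>)
    have "exp.ip y y = circle_integral (\<lambda>\<zeta>. \<alpha> (inverse \<zeta>) (star (y \<zeta>) * y \<zeta>))"
      unfolding exp.ip_def by (rule E_ip[OF y y])
    also have "\<dots> = circle_integral (\<lambda>\<zeta>. k (\<omega> * \<zeta>))"
    proof (rule circle_integral_cong)
      fix \<zeta> assume \<zeta>: "\<zeta> \<in> \<TT>"
      have e: "inverse \<omega> * (\<omega> * \<zeta>) = \<zeta>" using circle_nonzero[OF \<omega>] by simp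
      have "k (\<omega> * \<zeta>) = \<alpha> (inverse (\<omega> * \<zeta>)) (\<alpha> \<omega> (star (y \<zeta>) * y \<zeta>))"
        unfolding k_def e using \<omega> by (simp add: action_hom)
      also have "\<dots> = \<alpha> (inverse (\<omega> * \<zeta>) * \<omega>) (star (y \<zeta>) * y \<zeta>)"
        using \<omega> \<zeta> by (intro action_mult[symmetric]) (auto simp: norm_mult norm_inverse)
      also have "inverse (\<omega> * \<zeta>) * \<omega> = inverse \<zeta>" using circle_nonzero[OF \<omega>] by simp
      finally show "\<alpha> (inverse \<zeta>) (star (y \<zeta>) * y \<zeta>) = k (\<omega> * \<zeta>)" by simp
    qed
    also have "\<dots> = circle_integral k" by (rule circle_integral_rotate[OF kc \<omega>])
    finally have yy: "exp.ip y y = circle_integral k" .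
    have zz: "exp.ip (z \<omega>) (z \<omega>) = circle_integral (\<lambda>\<zeta>. \<alpha> (inverse \<zeta>) (star (z \<omega> \<zeta>) * z \<omega> \<zeta>))"
      unfolding exp.ip_def by (rule E_ip[OF z z]) (rule \<omega>)+
    have "norm a *\<^sub>R exp.ip y y - exp.ip (z \<omega>) (z \<omega>)
        = circle_integral (\<lambda>\<zeta>. norm a *\<^sub>R k \<zeta> - \<alpha> (inverse \<zeta>) (star (z \<omega> \<zeta>) * z \<omega> \<zeta>))"
      unfolding yy zz
      using circle_integral_diff[of "\<lambda>\<zeta>. norm a *\<^sub>R k \<zeta>" "\<lambda>\<zeta>. \<alpha> (inverse \<zeta>) (star (z \<omega> \<zeta>) * z \<omega> \<zeta>)"]
        circle_integral_linear[OF kc bounded_linear_scaleR_right[of "norm a"]] kc ip_integrand[OF z z, OF \<omega> \<omega>]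
      by (simp add: continuous_on_scaleR)
    moreover have "cpos \<dots>"
    proof (rule cpos_circle_integral)
      show "continuous_on \<TT> (\<lambda>\<zeta>. norm a *\<^sub>R k \<zeta> - \<alpha> (inverse \<zeta>) (star (z \<omega> \<zeta>) * z \<omega> \<zeta>))"
        by (intro continuous_on_diff continuous_on_scaleR continuous_on_const kc ip_integrand[OF z z, OF \<omega> \<omega>])
      fix \<zeta> assume \<zeta>: "\<zeta> \<in> \<TT>"
      define b where "b = \<alpha> \<omega> (y (inverse \<omega> * \<zeta>))"
      have "norm a *\<^sub>R k \<zeta> - \<alpha> (inverse \<zeta>) (star (z \<omega> \<zeta>) * z \<omega> \<zeta>)
          = \<alpha> (inverse \<zeta>) (norm a *\<^sub>R (star b * b) - star b * a * b)"
        using circle_inverse[OF \<zeta>] by (simp only: k_def z_def a_def b_def star_mult mult.assoc action_hom)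
      then show "cpos (norm a *\<^sub>R k \<zeta> - \<alpha> (inverse \<zeta>) (star (z \<omega> \<zeta>) * z \<omega> \<zeta>))"
        using circle_inverse[OF \<zeta>]
        by (simp only:) (intro action_cpos cpos_conjugate_bound, auto simp: a_def star_mult star_star)
    qed
    ultimately have "norm (exp.ip (z \<omega>) (z \<omega>)) \<le> norm (norm a *\<^sub>R exp.ip y y)"
      using z[OF \<omega>] by (intro cpos_norm_mono exp.ip_pos) auto
    then show "(exp.mnorm (z \<omega>))\<^sup>2 \<le> (norm (x \<omega>) * exp.mnorm y)\<^sup>2"
      by (simp add: exp.mnorm_square power_mult_distrib na)
  qed (simp add: exp.mnorm_nonneg)
  define w where "w = mul D x y"
  have w: "w \<in> carr D" unfolding w_def using x y by (rule mul_carr)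
  define G where "G \<omega> \<zeta> = \<alpha> (inverse \<zeta>) (star (w \<zeta>) * z \<omega> \<zeta>)" for \<omega> \<zeta>
  have G_abs: "G \<omega> = (\<lambda>\<zeta>. \<alpha> (inverse \<zeta>) (star (w \<zeta>) * z \<omega> \<zeta>))" for \<omega> by (simp add: G_def fun_eq_iff)
  have Gc: "continuous_on (\<TT> \<times> \<TT>) (\<lambda>(\<omega>, \<zeta>). G \<omega> \<zeta>)"
    unfolding G_def z_def case_prod_beta'
    by (intro continuous_intros carr_compose[OF x] carr_compose[OF y] carr_compose[OF w])
      (auto simp: norm_mult norm_inverse)
  have "exp.ip w w = circle_integral (\<lambda>\<zeta>. circle_integral (\<lambda>\<omega>. G \<omega> \<zeta>))"
    unfolding exp.ip_def E_ip[OF w w]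
  proof (rule circle_integral_cong)
    fix \<zeta> assume \<zeta>: "\<zeta> \<in> \<TT>"
    show "\<alpha> (inverse \<zeta>) (star (w \<zeta>) * w \<zeta>) = circle_integral (\<lambda>\<omega>. G \<omega> \<zeta>)"
      using circle_integral_linear[OF mul_integrand[OF x y \<zeta>],
          OF bounded_linear_compose[OF bounded_linear_action[OF circle_inverse[OF \<zeta>]] bounded_linear_mult_right[of "star (w \<zeta>)"]]]
      by (simp add: G_def z_def w_def mul_eq)
  qed
  also have "\<dots> = circle_integral (\<lambda>\<omega>. circle_integral (G \<omega>))"
    by (rule circle_integral_swap[OF Gc, symmetric])
  also have "\<dots> = circle_integral (\<lambda>\<omega>. exp.ip w (z \<omega>))"
    by (rule circle_integral_cong) (simp only: exp.ip_def E_ip[OF z w] G_abs)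
  finally have ww: "exp.ip w w = circle_integral (\<lambda>\<omega>. circle_integral (G \<omega>))"
    using \<open>circle_integral (\<lambda>\<omega>. circle_integral (G \<omega>)) = circle_integral (\<lambda>\<omega>. exp.ip w (z \<omega>))\<close> by simp
  have "norm (exp.ip w w) \<le> circle_integral (\<lambda>\<omega>. norm (x \<omega>) * (exp.mnorm w * exp.mnorm y))"
    unfolding ww
  proof (rule circle_integral_norm_le)
    show "continuous_on \<TT> (\<lambda>\<omega>. circle_integral (G \<omega>))" by (rule continuous_on_circle_integral[OF Gc])
    show "continuous_on \<TT> (\<lambda>\<omega>. norm (x \<omega>) * (exp.mnorm w * exp.mnorm y))"
      by (intro continuous_intros carr_continuous x)
    fix \<omega> assume \<omega>: "\<omega> \<in> \<TT>"
    have "norm (circle_integral (G \<omega>)) = norm (exp.ip w (z \<omega>))"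
      using \<omega> by (simp only: exp.ip_def E_ip[OF z w] G_abs)
    also have "\<dots> \<le> exp.mnorm w * exp.mnorm (z \<omega>)" by (rule exp.Cauchy_Schwarz[OF w z[OF \<omega>]])
    also have "\<dots> \<le> exp.mnorm w * (norm (x \<omega>) * exp.mnorm y)"
      by (rule mult_left_mono[OF mz[OF \<omega>]]) simp
    finally show "norm (circle_integral (G \<omega>)) \<le> norm (x \<omega>) * (exp.mnorm w * exp.mnorm y)"
      by (simp add: mult_ac)
  qed
  also have "\<dots> = nrm D x * (exp.mnorm w * exp.mnorm y)"
    using circle_integral_linear[of "\<lambda>\<omega>. norm (x \<omega>)", OF _ bounded_linear_mult_left] carr_continuous[OF x]
    by (simp add: D_simps continuous_on_norm)
  finally have "exp.mnorm w * exp.mnorm w \<le> exp.mnorm w * (nrm D x * exp.mnorm y)"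
    by (simp add: power2_eq_square mult_ac flip: exp.mnorm_square)
  moreover have "0 \<le> nrm D x * exp.mnorm y" using x by simp
  ultimately show "exp.mnorm (mul D x y) \<le> nrm D x * exp.mnorm y"
    using exp.mnorm_nonneg[of w] by (cases "exp.mnorm w = 0") (auto simp: w_def mult_le_cancel_left)
qed

sublocale reg: regular D "\<lambda>x. x 1"
  by (rule regular_D)

sublocale U: cstar_prealgebra "with_universal_norm D"
  by (rule exp.cstar_prealgebra_universal)

end

text \<open>A compact set has a finite e / 4-net. On the net convergence is uniform, and
  contractions u t change the commutator by at most e / 2 when a is replaced by a net point.\<close>

lemma compact_asymptotic_commute:
  fixes u :: "real \<Rightarrow> 'a::real_normed_algebra"
  assumes K: "compact K" and u: "\<And>t. 0 \<le> t \<Longrightarrow> norm (u t) \<le> 1"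
    and comm: "\<And>a. ((\<lambda>t. u t * a - a * u t) \<longlongrightarrow> 0) at_top" and e: "0 < e"
  shows "\<forall>\<^sub>F t in at_top. \<forall>a\<in>K. norm (u t * a - a * u t) \<le> e"
proof -
  obtain N where N: "finite N" "K \<subseteq> (\<Union>x\<in>N. ball x (e / 4))"
    using K e unfolding compact_eq_totally_bounded by (meson zero_less_divide_iff zero_less_numeral)
  have "\<forall>\<^sub>F t in at_top. \<forall>b\<in>N. dist (u t * b - b * u t) 0 < e / 2"
    using N(1) e by (intro eventually_ball_finite ballI tendstoD[OF comm]) auto
  with eventually_ge_at_top[of "0::real"] show ?thesis
  proof eventually_elim
    case (elim t)
    show ?case
    proof
      fix a assume "a \<in> K"
      then obtain b where b: "b \<in> N" "norm (a - b) < e / 4"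
        using N(2) by (auto simp: dist_norm norm_minus_commute)
      have 1: "norm (u t * (a - b)) \<le> 1 * (e / 4)" "norm ((a - b) * u t) \<le> (e / 4) * 1"
        using b u[OF elim(1)] e by (intro order_trans[OF norm_mult_ineq] mult_mono; simp)+
      have "u t * a - a * u t = (u t * b - b * u t) + (u t * (a - b) - (a - b) * u t)"
        by (simp add: algebra_simps)
      also have "norm \<dots> \<le> norm (u t * b - b * u t) + (norm (u t * (a - b)) + norm ((a - b) * u t))"
        by (intro norm_triangle_mono order_refl norm_triangle_ineq4)
      also have "\<dots> \<le> e" using 1 elim(2) b(1) by (auto simp: dist_norm dest!: bspec)
      finally show "norm (u t * a - a * u t) \<le> e" .
    qed
  qed
qed

text \<open>The signs match the four-term error decomposition for the implementation of the dual
  automorphism.\<close>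

lemma norm_four_terms_le:
  fixes a b c d :: "'a::real_normed_vector"
  shows "norm (- a - b - c + d) \<le> norm a + norm b + norm c + norm d"
  using norm_triangle_ineq[of "- a - b - c" d] norm_triangle_ineq4[of "- a - b" c] norm_triangle_ineq4[of "- a" b]
  by simp

section \<open>A continuous family of bump functions on the circle\<close>

text \<open>A tent of height 1 over the point 1 with radius 1 / (t + 1). The explicit dependence on
  t makes the family continuous in t as well; t + 1 makes time 0 admissible.\<close>

definition tent :: "real \<Rightarrow> complex \<Rightarrow> real" where
  "tent t \<zeta> = max 0 (1 - (t + 1) * cmod (\<zeta> - 1))"

text \<open>Normalised to integral 1, so that averaging against it approximates evaluation at
  1.\<close>

definition bump :: "real \<Rightarrow> complex \<Rightarrow> real" where
  "bump t \<zeta> = tent t \<zeta> / circle_integral (tent t)"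

lemma continuous_on_tent_pair: "continuous_on S (\<lambda>(t, \<zeta>). tent t \<zeta>)"
  unfolding tent_def case_prod_beta' by (intro continuous_intros)

lemma continuous_on_tent: "continuous_on S (tent t)"
  unfolding tent_def[abs_def] by (intro continuous_intros)

lemma circle_integral_tent_pos: "0 < circle_integral (tent t)"
proof -
  have "0 \<le> circle_integral (tent t)"
    by (rule circle_integral_nonneg[OF continuous_on_tent]) (simp add: tent_def)
  moreover have "circle_integral (tent t) \<noteq> 0"
    using circle_integral_zero_imp[OF continuous_on_tent, of t 1] by (auto simp: tent_def)
  ultimately show ?thesis by simp
qed

lemma bump_nonneg: "0 \<le> bump t \<zeta>"
  using circle_integral_tent_pos[of t] by (simp add: bump_def tent_def)

lemma bump_support: "0 \<le> t \<Longrightarrow> bump t \<zeta> \<noteq> 0 \<Longrightarrow> cmod (\<zeta> - 1) \<le> 1 / (t + 1)"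
proof -
  assume t: "0 \<le> t" and "bump t \<zeta> \<noteq> 0"
  then have "(t + 1) * cmod (\<zeta> - 1) < 1" by (auto simp: bump_def tent_def max_def split: if_splits)
  then show ?thesis using t by (simp add: field_simps)
qed

lemma bump_cnj: "bump t (cnj \<zeta>) = bump t \<zeta>"
proof -
  have "cmod (cnj \<zeta> - 1) = cmod (cnj (\<zeta> - 1))" by simp
  also have "\<dots> = cmod (\<zeta> - 1)" by (rule complex_mod_cnj)
  finally show ?thesis by (simp add: bump_def tent_def)
qed

lemma continuous_on_bump: "continuous_on S (bump t)"
  unfolding bump_def[abs_def] using circle_integral_tent_pos[of t]
  by (intro continuous_intros continuous_on_tent) auto

lemma continuous_on_bump_pair: "continuous_on (S \<times> \<TT>) (\<lambda>(t, \<zeta>). bump t \<zeta>)"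
proof -
  have "continuous_on S (\<lambda>t. circle_integral (tent t))"
    by (rule continuous_on_circle_integral[OF continuous_on_tent_pair])
  then have "continuous_on (S \<times> \<TT>) (\<lambda>p. circle_integral (tent (fst p)))"
    by (rule continuous_on_compose2) (auto intro!: continuous_intros)
  then show ?thesis
    unfolding bump_def case_prod_beta'
    using continuous_on_tent_pair[of "S \<times> \<TT>"] circle_integral_tent_pos less_imp_neq[symmetric]
    by (intro continuous_on_divide) (auto simp: case_prod_beta' less_imp_neq[symmetric])
qed

lemma circle_integral_bump: "circle_integral (bump t) = 1"
  using circle_integral_linear[OF continuous_on_tent[of _ t], of "\<lambda>r. r / circle_integral (tent t)"]
    circle_integral_tent_pos[of t]
  by (simp add: bump_def[abs_def] bounded_linear_divide)

text \<open>A weighted mean with nonnegative weight of total mass 1 that is supported where F is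
  within e of c.\<close>

lemma bump_average_le:
  fixes F :: "complex \<Rightarrow> 'v::banach"
  assumes F: "continuous_on \<TT> F" and t: "0 \<le> t"
    and le: "\<And>\<zeta>. \<zeta> \<in> \<TT> \<Longrightarrow> cmod (\<zeta> - 1) \<le> 1 / (t + 1) \<Longrightarrow> norm (F \<zeta> - c) \<le> e"
  shows "norm (circle_integral (\<lambda>\<zeta>. bump t \<zeta> *\<^sub>R F \<zeta>) - c) \<le> e"
proof -
  have "circle_integral (\<lambda>\<zeta>. bump t \<zeta> *\<^sub>R c) = c"
    using circle_integral_linear[OF continuous_on_bump[of _ t] bounded_linear_scaleR_left[of c]]
    by (simp add: circle_integral_bump)
  then have "circle_integral (\<lambda>\<zeta>. bump t \<zeta> *\<^sub>R F \<zeta>) - c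
      = circle_integral (\<lambda>\<zeta>. bump t \<zeta> *\<^sub>R F \<zeta> - bump t \<zeta> *\<^sub>R c)"
    by (subst circle_integral_diff) (auto intro!: continuous_intros F continuous_on_bump)
  also have "norm \<dots> \<le> circle_integral (\<lambda>\<zeta>. bump t \<zeta> * e)"
  proof (rule circle_integral_norm_le)
    show "continuous_on \<TT> (\<lambda>\<zeta>. bump t \<zeta> *\<^sub>R F \<zeta> - bump t \<zeta> *\<^sub>R c)"
      by (intro continuous_intros F continuous_on_bump)
    show "continuous_on \<TT> (\<lambda>\<zeta>. bump t \<zeta> * e)" by (intro continuous_intros continuous_on_bump)
    fix \<zeta> assume \<zeta>: "\<zeta> \<in> \<TT>"
    have "norm (bump t \<zeta> *\<^sub>R F \<zeta> - bump t \<zeta> *\<^sub>R c) = bump t \<zeta> * norm (F \<zeta> - c)"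
      using bump_nonneg[of t \<zeta>] by (simp flip: scaleR_diff_right)
    also have "\<dots> \<le> bump t \<zeta> * e"
      using le[OF \<zeta>] bump_support[OF t, of \<zeta>] bump_nonneg[of t \<zeta>]
      by (cases "bump t \<zeta> = 0") (auto intro!: mult_left_mono)
    finally show "norm (bump t \<zeta> *\<^sub>R F \<zeta> - bump t \<zeta> *\<^sub>R c) \<le> bump t \<zeta> * e" .
  qed
  also have "\<dots> = e"
    using circle_integral_linear[OF continuous_on_bump[of _ t] bounded_linear_mult_left[of e]]
    by (simp add: circle_integral_bump)
  finally show ?thesis .
qed

lemma tendsto_inverse_at_top: "((\<lambda>t::real. 1 / (t + 1)) \<longlongrightarrow> 0) at_top"
  by real_asymp

text \<open>F is uniformly continuous on the compact torus, so one radius of the bump serves for all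
  \<zeta>.\<close>

lemma bump_average_uniform:
  fixes F :: "complex \<Rightarrow> complex \<Rightarrow> 'v::banach"
  assumes F: "continuous_on (\<TT> \<times> \<TT>) (\<lambda>(\<omega>, \<zeta>). F \<omega> \<zeta>)" and e: "0 < e"
  shows "\<forall>\<^sub>F t in at_top. \<forall>\<zeta>\<in>\<TT>. norm (circle_integral (\<lambda>\<omega>. bump t \<omega> *\<^sub>R F \<omega> \<zeta>) - F 1 \<zeta>) \<le> e"
proof -
  have "uniformly_continuous_on (\<TT> \<times> \<TT>) (\<lambda>(\<omega>, \<zeta>). F \<omega> \<zeta>)"
    by (rule compact_uniformly_continuous[OF F]) (intro compact_Times compact_circle)
  then obtain d where d: "0 < d" "\<And>p q. p \<in> \<TT> \<times> \<TT> \<Longrightarrow> q \<in> \<TT> \<times> \<TT> \<Longrightarrow> dist q p < d \<Longrightarrow>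
      dist ((\<lambda>(\<omega>, \<zeta>). F \<omega> \<zeta>) q) ((\<lambda>(\<omega>, \<zeta>). F \<omega> \<zeta>) p) < e"
    using e unfolding uniformly_continuous_on_def by metis
  have "\<forall>\<^sub>F t in at_top. dist (1 / (t + 1)) (0::real) < d" by (rule tendstoD[OF tendsto_inverse_at_top d(1)])
  with eventually_ge_at_top[of "0::real"] show ?thesis
  proof eventually_elim
    case (elim t)
    show ?case
    proof
      fix \<zeta> assume \<zeta>: "\<zeta> \<in> \<TT>"
      show "norm (circle_integral (\<lambda>\<omega>. bump t \<omega> *\<^sub>R F \<omega> \<zeta>) - F 1 \<zeta>) \<le> e"
      proof (rule bump_average_le[OF _ elim(1)])
        have "continuous_on \<TT> (\<lambda>\<omega>. (\<lambda>(\<omega>, \<zeta>). F \<omega> \<zeta>) (\<omega>, \<zeta>))"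
          by (rule continuous_on_compose2[OF F]) (use \<zeta> in \<open>auto intro!: continuous_intros\<close>)
        then show "continuous_on \<TT> (\<lambda>\<omega>. F \<omega> \<zeta>)" by simp
        fix \<omega> assume \<omega>: "\<omega> \<in> \<TT>" "cmod (\<omega> - 1) \<le> 1 / (t + 1)"
        have "dist (\<omega>, \<zeta>) (1, \<zeta>) < d" using \<omega>(2) elim by (simp add: dist_Pair_Pair dist_norm)
        then have "dist (F \<omega> \<zeta>) (F 1 \<zeta>) < e"
          using d(2)[of "(1, \<zeta>)" "(\<omega>, \<zeta>)"] \<omega>(1) \<zeta> by simp
        then show "norm (F \<omega> \<zeta> - F 1 \<zeta>) \<le> e" by (simp add: dist_norm)
      qed
    qed
  qed
qed

section \<open>The dual automorphism\<close>

context circle_system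
begin

abbreviation "CC \<equiv> completion (with_universal_norm D)"

abbreviation mulC (infixl "\<odot>" 70) where "X \<odot> Y \<equiv> mul CC X Y"
abbreviation minusC (infixl "\<ominus>" 65) where "X \<ominus> Y \<equiv> alg_minus CC X Y"

interpretation CC: cstar_normed CC
  by (rule U.cstar_normed_completion)

abbreviation dual :: "(complex \<Rightarrow> 'a) \<Rightarrow> complex \<Rightarrow> 'a" where
  "dual \<xi> \<equiv> \<lambda>\<zeta>. scaleC \<zeta> (\<xi> \<zeta>)"

lemma crossed_product_circle_eq: "crossed_product_circle \<alpha> = CC"
  by (simp add: crossed_product_circle_def enveloping_cstar_def)

lemma dual_automorphism_eq: "dual_automorphism \<alpha> = U.map_completion dual"
  by (simp add: dual_automorphism_def exp.enveloping_map_eq)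

lemma dual_carr: "\<xi> \<in> carr D \<Longrightarrow> dual \<xi> \<in> carr D"
  by (simp add: D_simps continuous_intros)

lemma dual_dominated:
  assumes p: "p \<in> exp.dominated"
  shows "(\<lambda>x. p (dual x)) \<in> exp.dominated"
proof -
  have s: "cstar_seminorm D p" using p by simp
  \<comment> \<open>\<open>dual\<close> respects products on the circle only, so both sides are
    compared through distance 0.\<close>
  have eq: "p x = p y" if "x \<in> carr D" "y \<in> carr D" "\<And>\<zeta>. \<zeta> \<in> \<TT> \<Longrightarrow> x \<zeta> = y \<zeta>" for x y
    by (rule exp.dominated_dist_zero[OF p that(1,2) nrm_minus_zero]) (rule that(3))
  have mul: "dual (mul D x y) \<zeta> = mul D (dual x) (dual y) \<zeta>"
    if x: "x \<in> carr D" and y: "y \<in> carr D" and \<zeta>: "\<zeta> \<in> \<TT>" for x y \<zeta>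
    unfolding mul_eq circle_integral_linear[OF mul_integrand[OF x y \<zeta>] bounded_linear_scaleC[of \<zeta>], symmetric]
  proof (rule circle_integral_cong)
    fix \<omega> assume \<omega>: "\<omega> \<in> \<TT>"
    have e: "inverse \<omega> * \<zeta> * \<omega> = \<zeta>" using circle_nonzero[OF \<omega>] by simp
    show "scaleC \<zeta> (x \<omega> * \<alpha> \<omega> (y (inverse \<omega> * \<zeta>)))
        = scaleC \<omega> (x \<omega>) * \<alpha> \<omega> (scaleC (inverse \<omega> * \<zeta>) (y (inverse \<omega> * \<zeta>)))"
      by (simp add: action_hom(3)[OF \<omega>] mult_scaleC_left mult_scaleC_right scaleC_scaleC e)
  qed
  have "cstar_seminorm D (\<lambda>x. p (dual x))"
    unfolding cstar_seminorm_def
  proof (intro conjI ballI allI)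
    fix x c assume x: "x \<in> carr D"
    show "0 \<le> p (dual x)" using cstar_seminormD(1)[OF s dual_carr[OF x]] .
    have "dual (scal D c x) = scal D c (dual x)" by (simp add: D_simps scaleC_scaleC mult.commute)
    then show "p (dual (scal D c x)) = cmod c * p (dual x)"
      using cstar_seminormD(3)[OF s dual_carr[OF x]] by simp
    have "p (dual (mul D (adj D x) x)) = p (mul D (adj D (dual x)) (dual x))"
    proof (rule eq)
      fix \<zeta> assume \<zeta>: "\<zeta> \<in> \<TT>"
      show "dual (mul D (adj D x) x) \<zeta> = mul D (adj D (dual x)) (dual x) \<zeta>"
        unfolding mul[OF adj_carr[OF x] x \<zeta>] unfolding mul_eq
      proof (rule circle_integral_cong)
        fix \<omega> assume \<omega>: "\<omega> \<in> \<TT>"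
        then have "dual (adj D x) \<omega> = adj D (dual x) \<omega>"
          by (simp add: D_simps star_scaleC action_hom(3)[OF \<omega>])
        then show "dual (adj D x) \<omega> * \<alpha> \<omega> (dual x (inverse \<omega> * \<zeta>))
            = adj D (dual x) \<omega> * \<alpha> \<omega> (dual x (inverse \<omega> * \<zeta>))" by simp
      qed
    qed (intro dual_carr mul_carr adj_carr x)+
    then show "p (dual (mul D (adj D x) x)) = (p (dual x))\<^sup>2"
      using cstar_seminormD(5)[OF s dual_carr[OF x]] by simp
    fix y assume y: "y \<in> carr D"
    have "dual (plu D x y) = plu D (dual x) (dual y)" by (simp add: D_simps scaleC_add_right)
    then show "p (dual (plu D x y)) \<le> p (dual x) + p (dual y)"
      using cstar_seminormD(2)[OF s dual_carr[OF x] dual_carr[OF y]] by simp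
    have "p (dual (mul D x y)) = p (mul D (dual x) (dual y))"
      by (rule eq[OF _ _ mul[OF x y]]) (intro dual_carr mul_carr x y)+
    then show "p (dual (mul D x y)) \<le> p (dual x) * p (dual y)"
      using cstar_seminormD(4)[OF s dual_carr[OF x] dual_carr[OF y]] by simp
  qed
  moreover have "p (dual x) \<le> nrm D x" if x: "x \<in> carr D" for x
  proof -
    have "p (dual x) \<le> nrm D (dual x)" using p dual_carr[OF x] by blast
    also have "\<dots> = nrm D x"
      unfolding D_simps by (rule circle_integral_cong) (simp add: norm_scaleC)
    finally show ?thesis .
  qed
  ultimately show ?thesis by simp
qed

lemma universal_dual_le: "x \<in> carr D \<Longrightarrow> universal_norm D (dual x) \<le> universal_norm D x"
  by (rule exp.universal_invariant[where \<phi>=dual, OF dual_carr dual_dominated])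

lemma dual_dist:
  "x \<in> carr D \<Longrightarrow> y \<in> carr D \<Longrightarrow>
    universal_norm D (alg_minus D (dual x) (dual y)) \<le> universal_norm D (alg_minus D x y)"
  using universal_dual_le[of "alg_minus D x y"] exp.minus_closed[of x y]
  by (simp add: D_simps(6) scaleC_diff_right)

lemma dual_automorphism_props:
  "x \<in> carr D \<Longrightarrow> dual_automorphism \<alpha> (U.const_cls x) = U.const_cls (dual x)"
  "X \<in> carr CC \<Longrightarrow> dual_automorphism \<alpha> X \<in> carr CC"
  "X \<in> carr CC \<Longrightarrow> Y \<in> carr CC \<Longrightarrow>
    nrm CC (dual_automorphism \<alpha> X \<ominus> dual_automorphism \<alpha> Y) \<le> nrm CC (X \<ominus> Y)"
  "f \<in> cauchy_seqs (with_universal_norm D) \<Longrightarrow> dual_automorphism \<alpha> (U.cls f) = U.cls (\<lambda>n. dual (f n))"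
  unfolding dual_automorphism_eq
  using U.map_completion_const_cls[of dual x] U.map_completion_closed[of dual X]
    U.map_completion_dist[of dual X Y] U.map_completion_cls[of dual f] dual_dist dual_carr by simp_all

lemma nrm_const_le:
  assumes "x \<in> carr D"
  shows "nrm CC (U.const_cls x) \<le> nrm D x"
  using U.nrm_const_cls[of x] exp.universal_le_nrm[of x] assms by simp

lemma dist_const_le_nrm:
  assumes "x \<in> carr D" "y \<in> carr D"
  shows "nrm CC (U.const_cls x \<ominus> U.const_cls y) \<le> circle_integral (\<lambda>\<zeta>. norm (x \<zeta> - y \<zeta>))"
  using nrm_const_le[of "alg_minus D x y"] exp.minus_closed[of x y] assms
  by (simp add: U.const_cls_ops[simplified]) (simp add: D_simps(6,7))

lemma dist_const_le:
  assumes "x \<in> carr D" "y \<in> carr D" "\<And>\<zeta>. \<zeta> \<in> \<TT> \<Longrightarrow> norm (x \<zeta> - y \<zeta>) \<le> r"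
  shows "nrm CC (U.const_cls x \<ominus> U.const_cls y) \<le> r"
proof -
  have "circle_integral (\<lambda>\<zeta>. norm (x \<zeta> - y \<zeta>)) \<le> circle_integral (\<lambda>_. r)"
    using assms by (intro circle_integral_mono continuous_intros carr_continuous) auto
  then show ?thesis using dist_const_le_nrm[OF assms(1,2)] by simp
qed

lemma const_carr: "x \<in> carr D \<Longrightarrow> U.const_cls x \<in> carr CC"
  by (rule U.const_cls_closed) simp

section \<open>From A to the crossed product by the circle\<close>

theorem asymptotically_representable_dual_if_rokhlin:
  assumes "continuous_rokhlin_property (cstar_univ :: 'a star_alg) \<alpha>"
  shows "asymptotically_representable (crossed_product_circle \<alpha>) (dual_automorphism \<alpha>)"
proof -
  obtain u :: "real \<Rightarrow> 'a" where uc: "continuous_on {0..} u"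
    and uu: "\<And>t. 0 \<le> t \<Longrightarrow> star (u t) * u t = 1 \<and> u t * star (u t) = 1"
    and sup: "((\<lambda>t. SUP \<zeta>\<in>\<TT>. norm (\<alpha> \<zeta> (u t) - scaleC \<zeta> (u t))) \<longlongrightarrow> 0) at_top"
    and comm: "\<And>a. ((\<lambda>t. u t * a - a * u t) \<longlongrightarrow> 0) at_top"
    using assms unfolding continuous_rokhlin_property_cstar_univ by blast
  define r where "r t = (SUP \<zeta>\<in>\<TT>. norm (\<alpha> \<zeta> (u t) - scaleC \<zeta> (u t)))" for t
  have r0: "(r \<longlongrightarrow> 0) at_top" using sup by (simp add: r_def[abs_def])
  have nu: "norm (u t) \<le> 1" if "0 \<le> t" for t
    using norm_le_one_if_isometry[of "u t"] uu[OF that] by simp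
  have r: "norm (\<alpha> \<zeta> (u t) - scaleC \<zeta> (u t)) \<le> r t" if \<zeta>: "\<zeta> \<in> \<TT>" for \<zeta> t
    unfolding r_def
  proof (rule cSUP_circle_le[OF _ \<zeta>, where K="2 * norm (u t)"])
    fix \<omega> assume \<omega>: "\<omega> \<in> \<TT>"
    show "norm (\<alpha> \<omega> (u t) - scaleC \<omega> (u t)) \<le> 2 * norm (u t)"
      using norm_triangle_ineq4[of "\<alpha> \<omega> (u t)" "scaleC \<omega> (u t)"] action_hom(6)[OF \<omega>] \<omega>
      by (simp add: norm_scaleC)
  qed
  define v where "v t \<zeta> = bump t \<zeta> *\<^sub>R star (u t)" for t \<zeta>
  have vc: "v t \<in> carr D" for t
    unfolding D_simps v_def[abs_def] by (auto intro!: continuous_intros continuous_on_bump)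
  define V where "V t = U.const_cls (v t)" for t
  have Vc: "V t \<in> carr CC" for t unfolding V_def by (rule const_carr[OF vc])
  \<comment> \<open>The normalisation of the bump bounds the L1 norm, which dominates the universal
    norm.\<close>
  have nV: "nrm CC (V t) \<le> 1" if t: "0 \<le> t" for t
  proof -
    have "nrm CC (V t) \<le> circle_integral (\<lambda>\<zeta>. norm (v t \<zeta>))"
      unfolding V_def using nrm_const_le[OF vc[of t]] by (simp add: D_simps(7))
    also have "\<dots> \<le> circle_integral (bump t)"
    proof (rule circle_integral_mono[OF _ continuous_on_bump])
      show "continuous_on \<TT> (\<lambda>\<zeta>. norm (v t \<zeta>))" by (intro continuous_intros carr_continuous vc)
      fix \<zeta>
      show "norm (v t \<zeta>) \<le> bump t \<zeta>"
        using bump_nonneg[of t \<zeta>] nu[OF t] by (simp add: v_def mult_left_le)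
    qed
    finally show ?thesis by (simp add: circle_integral_bump)
  qed
  have adjv: "adj D (v t) \<zeta> = bump t \<zeta> *\<^sub>R \<alpha> \<zeta> (u t)" if \<zeta>: "\<zeta> \<in> \<TT>" for t \<zeta>
    by (simp add: D_simps(5) v_def star_scaleR star_star bump_cnj action_hom(9)[OF \<zeta>])
  \<comment> \<open>Convolution of the scalar bump with x. On the circle, left multiplication by
    \<open>v t\<close> is \<open>star (u t)\<close> times this operator (\<open>vx\<close>), and the
    operator tends to the identity uniformly on each x (\<open>conv_unif\<close>).\<close>
  define conv where "conv t x \<zeta> = circle_integral (\<lambda>\<omega>. bump t \<omega> *\<^sub>R \<alpha> \<omega> (x (inverse \<omega> * \<zeta>)))" for t x \<zeta>
  have conv_int: "continuous_on \<TT> (\<lambda>\<omega>. bump t \<omega> *\<^sub>R \<alpha> \<omega> (x (inverse \<omega> * \<zeta>)))"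
    if "x \<in> carr D" "\<zeta> \<in> \<TT>" for t x \<zeta>
    by (intro continuous_intros continuous_on_bump carr_compose[OF that(1)])
      (use that(2) in \<open>auto simp: norm_mult norm_inverse\<close>)
  have conv_carr: "conv t x \<in> carr D" if "x \<in> carr D" for t x
  proof -
    have "continuous_on \<TT> (\<lambda>\<zeta>. circle_integral (\<lambda>\<omega>. bump t \<omega> *\<^sub>R \<alpha> \<omega> (x (inverse \<omega> * \<zeta>))))"
      by (rule continuous_on_circle_integral, unfold case_prod_beta',
        intro continuous_intros continuous_on_compose2[OF continuous_on_bump[of UNIV]] carr_compose[OF that])
        (auto simp: norm_mult norm_inverse)
    then show ?thesis by (simp add: D_simps conv_def[abs_def])
  qed
  have vx: "mul D (v t) x \<zeta> = star (u t) * conv t x \<zeta>" if x: "x \<in> carr D" and \<zeta>: "\<zeta> \<in> \<TT>" for t x \<zeta>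
    unfolding mul_eq conv_def v_def
    using circle_integral_linear[OF conv_int[OF x \<zeta>] bounded_linear_mult_right[of "star (u t)"]] by simp
  have conv_dist: "norm (conv t x \<zeta> - conv t y \<zeta>) \<le> s"
    if x: "x \<in> carr D" and y: "y \<in> carr D" and \<zeta>: "\<zeta> \<in> \<TT>" and t: "0 \<le> t"
      and s: "\<And>\<zeta>. \<zeta> \<in> \<TT> \<Longrightarrow> norm (x \<zeta> - y \<zeta>) \<le> s" for t x y \<zeta> s
  proof -
    have "conv t x \<zeta> - conv t y \<zeta> =
        circle_integral (\<lambda>\<omega>. bump t \<omega> *\<^sub>R (\<alpha> \<omega> (x (inverse \<omega> * \<zeta>)) - \<alpha> \<omega> (y (inverse \<omega> * \<zeta>)))) - 0"
      unfolding conv_def using circle_integral_diff[OF conv_int[OF x \<zeta>, of t] conv_int[OF y \<zeta>, of t]]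
      by (simp add: scaleR_diff_right)
    also have "norm \<dots> \<le> s"
    proof (rule bump_average_le[OF _ t])
      show "continuous_on \<TT> (\<lambda>\<omega>. \<alpha> \<omega> (x (inverse \<omega> * \<zeta>)) - \<alpha> \<omega> (y (inverse \<omega> * \<zeta>)))"
        by (intro continuous_intros carr_compose[OF x] carr_compose[OF y])
          (use \<zeta> in \<open>auto simp: norm_mult norm_inverse\<close>)
      fix \<omega> assume \<omega>: "\<omega> \<in> \<TT>"
      show "norm (\<alpha> \<omega> (x (inverse \<omega> * \<zeta>)) - \<alpha> \<omega> (y (inverse \<omega> * \<zeta>)) - 0) \<le> s"
        using s[OF circle_mult[OF circle_inverse[OF \<omega>] \<zeta>]]
        by (simp add: action_hom(6)[OF \<omega>] flip: action_hom(2)[OF \<omega>])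
    qed
    finally show ?thesis .
  qed
  have conv_unif: "\<forall>\<^sub>F t in at_top. \<forall>\<zeta>\<in>\<TT>. norm (conv t x \<zeta> - x \<zeta>) \<le> e"
    if x: "x \<in> carr D" and e: "0 < e" for x e
  proof -
    have "continuous_on (\<TT> \<times> \<TT>) (\<lambda>(\<omega>, \<zeta>). \<alpha> \<omega> (x (inverse \<omega> * \<zeta>)))"
      unfolding case_prod_beta'
      by (intro continuous_intros carr_compose[OF x]) (auto simp: norm_mult norm_inverse)
    from bump_average_uniform[OF this e] show ?thesis by (simp add: conv_def)
  qed
  have avg_unif: "\<forall>\<^sub>F t in at_top. \<forall>\<zeta>\<in>\<TT>. norm (circle_integral (\<lambda>\<omega>. bump t \<omega> *\<^sub>R x (\<zeta> * \<omega>)) - x \<zeta>) \<le> e"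
    if x: "x \<in> carr D" and e: "0 < e" for x e
  proof -
    have "continuous_on (\<TT> \<times> \<TT>) (\<lambda>(\<omega>, \<zeta>). x (\<zeta> * \<omega>))"
      unfolding case_prod_beta'
      by (intro continuous_intros carr_compose[OF x]) (auto simp: norm_mult)
    from bump_average_uniform[OF this e] show ?thesis by simp
  qed
  \<comment> \<open>In \<open>adj D (v t)\<close> the path occurs as \<alpha> \<omega> (u t) and
    meets \<alpha> \<omega> (star (u t)) coming from y, so the unitaries cancel inside the
    integral.\<close>
  have vstar: "mul D (adj D (v t)) y \<zeta> = conv t x \<zeta>"
    if x: "x \<in> carr D" and y: "\<And>\<zeta>. \<zeta> \<in> \<TT> \<Longrightarrow> y \<zeta> = star (u t) * x \<zeta>" and \<zeta>: "\<zeta> \<in> \<TT>" and t: "0 \<le> t" for t x y \<zeta>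
    unfolding mul_eq conv_def
  proof (rule circle_integral_cong)
    fix \<omega> assume \<omega>: "\<omega> \<in> \<TT>"
    have "\<alpha> \<omega> (u t) * \<alpha> \<omega> (star (u t)) = 1"
      using uu[OF t] action_hom(4,7)[OF \<omega>] by metis
    then show "adj D (v t) \<omega> * \<alpha> \<omega> (y (inverse \<omega> * \<zeta>)) = bump t \<omega> *\<^sub>R \<alpha> \<omega> (x (inverse \<omega> * \<zeta>))"
      unfolding adjv[OF \<omega>] y[OF circle_mult[OF circle_inverse[OF \<omega>] \<zeta>]] action_hom(4)[OF \<omega>]
      by (simp flip: mult.assoc)
  qed
  \<comment> \<open>On the right the adjoint contributes \<alpha> \<zeta> (u t) at the outer
    variable \<zeta>. The Rokhlin condition compares this with \<zeta> u t, and that is the source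
    of the factor \<zeta> of the dual automorphism.\<close>
  have mulstar: "mul D y (adj D (v t)) \<zeta> = circle_integral (\<lambda>\<omega>. bump t \<omega> *\<^sub>R y (\<zeta> * \<omega>)) * \<alpha> \<zeta> (u t)"
    if y: "y \<in> carr D" and \<zeta>: "\<zeta> \<in> \<TT>" for t y \<zeta>
  proof -
    have c: "continuous_on \<TT> (\<lambda>\<omega>. bump t (inverse \<zeta> * \<omega>) *\<^sub>R y \<omega>)"
      by (intro continuous_intros continuous_on_compose2[OF continuous_on_bump[of UNIV]] carr_continuous y) auto
    have "mul D y (adj D (v t)) \<zeta> = circle_integral (\<lambda>\<omega>. (bump t (inverse \<zeta> * \<omega>) *\<^sub>R y \<omega>) * \<alpha> \<zeta> (u t))"
      unfolding mul_eq
    proof (rule circle_integral_cong)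
      fix \<omega> assume \<omega>: "\<omega> \<in> \<TT>"
      have i: "inverse \<omega> * \<zeta> \<in> \<TT>" by (rule circle_mult[OF circle_inverse[OF \<omega>] \<zeta>])
      have e: "\<omega> * (inverse \<omega> * \<zeta>) = \<zeta>" using circle_nonzero[OF \<omega>] by simp
      have b: "bump t (inverse \<omega> * \<zeta>) = bump t (inverse \<zeta> * \<omega>)"
        using bump_cnj[of t "inverse \<omega> * \<zeta>"] cnj_circle[OF i] by (simp add: mult.commute)
      show "y \<omega> * \<alpha> \<omega> (adj D (v t) (inverse \<omega> * \<zeta>)) = bump t (inverse \<zeta> * \<omega>) *\<^sub>R y \<omega> * \<alpha> \<zeta> (u t)"
        unfolding adjv[OF i] action_hom(9)[OF \<omega>] action_mult[OF \<omega> i, symmetric] e b by simp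
    qed
    also have "\<dots> = circle_integral (\<lambda>\<omega>. bump t (inverse \<zeta> * \<omega>) *\<^sub>R y \<omega>) * \<alpha> \<zeta> (u t)"
      by (rule circle_integral_linear[OF c bounded_linear_mult_left])
    also have "circle_integral (\<lambda>\<omega>. bump t (inverse \<zeta> * \<omega>) *\<^sub>R y \<omega>) = circle_integral (\<lambda>\<omega>. bump t \<omega> *\<^sub>R y (\<zeta> * \<omega>))"
      using circle_integral_rotate[OF c \<zeta>] circle_nonzero[OF \<zeta>] by (simp flip: mult.assoc)
    finally show ?thesis .
  qed
  have nsu: "norm (star (u t) * a) \<le> norm a" "norm (a * \<alpha> \<zeta> (u t)) \<le> norm a"
    if "0 \<le> t" "\<zeta> \<in> \<TT>" for t a \<zeta>
    using norm_mult_ineq[of "star (u t)" a] norm_mult_ineq[of a "\<alpha> \<zeta> (u t)"] nu[OF that(1)] action_hom(6)[OF that(2)]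
      mult_right_mono[of "norm (u t)" 1 "norm a"] mult_left_mono[of "norm (u t)" 1 "norm a"] by simp_all
  note ops = U.const_cls_ops[simplified]
  show ?thesis
    unfolding asymptotically_representable_def crossed_product_circle_eq
  proof (intro exI[of _ V] conjI allI impI ballI nV)
    show "norm_continuous_path CC V"
      unfolding norm_continuous_path_def
    proof (intro conjI allI impI Vc)
      fix t :: real assume t: "0 \<le> t"
      let ?g = "\<lambda>s. circle_integral (\<lambda>\<zeta>. norm (v s \<zeta> - v t \<zeta>))"
      have "continuous_on {0..} ?g"
      proof (rule continuous_on_circle_integral, unfold case_prod_beta' v_def, intro continuous_intros)
        show "continuous_on ({0..} \<times> \<TT>) (\<lambda>p. bump (fst p) (snd p))"
          using continuous_on_bump_pair[of "{0..}"] by (simp add: case_prod_beta')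
        show "continuous_on ({0..} \<times> \<TT>) (\<lambda>p. bump t (snd p))"
          by (rule continuous_on_compose2[OF continuous_on_bump[of UNIV]]) (auto intro!: continuous_intros)
        show "continuous_on ({0..} \<times> \<TT>) (\<lambda>p. u (fst p))"
          by (rule continuous_on_compose2[OF uc]) (auto intro!: continuous_intros)
      qed
      then have "(?g \<longlongrightarrow> ?g t) (at t within {0..})" using t unfolding continuous_on_def by blast
      moreover have "?g t = 0" by simp
      ultimately have g: "(?g \<longlongrightarrow> 0) (at t within {0..})" by (simp only:)
      show "((\<lambda>s. nrm CC (V s \<ominus> V t)) \<longlongrightarrow> 0) (at t within {0..})"
        by (rule tendsto_sandwich[OF _ _ tendsto_const g])
          (use Vc CC.nrm_nonneg CC.minus_closed dist_const_le_nrm[OF vc vc] in \<open>auto simp: V_def\<close>)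
    qed
    \<comment> \<open>The dual automorphism multiplies by \<zeta>, and \<open>v t\<close> lives
      where \<zeta> is within 1 / (t + 1) of 1.\<close>
    show "((\<lambda>t. nrm CC (dual_automorphism \<alpha> (V t) \<ominus> V t)) \<longlongrightarrow> 0) at_top"
    proof (rule CC.asymptotic_tendsto, rule CC.asymptoticI[OF _ Vc _ tendsto_inverse_at_top])
      fix t :: real assume t: "0 \<le> t"
      show "dual_automorphism \<alpha> (V t) \<in> carr CC" by (rule dual_automorphism_props(2)[OF Vc])
      have "nrm CC (dual_automorphism \<alpha> (V t) \<ominus> V t) \<le> circle_integral (\<lambda>\<zeta>. norm (dual (v t) \<zeta> - v t \<zeta>))"
        unfolding V_def dual_automorphism_props(1)[OF vc] by (rule dist_const_le_nrm[OF dual_carr[OF vc] vc])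
      also have "\<dots> \<le> circle_integral (\<lambda>\<zeta>. bump t \<zeta> * (1 / (t + 1)))"
      proof (rule circle_integral_mono)
        show "continuous_on \<TT> (\<lambda>\<zeta>. norm (dual (v t) \<zeta> - v t \<zeta>))"
          by (intro continuous_on_norm continuous_on_diff carr_continuous dual_carr vc)
        show "continuous_on \<TT> (\<lambda>\<zeta>. bump t \<zeta> * (1 / (t + 1)))" by (intro continuous_on_mult continuous_on_bump continuous_on_const)
        fix \<zeta> assume \<zeta>: "\<zeta> \<in> \<TT>"
        have "dual (v t) \<zeta> - v t \<zeta> = scaleC (\<zeta> - 1) (v t \<zeta>)" by (simp add: scaleC_diff_left)
        then have "norm (dual (v t) \<zeta> - v t \<zeta>) = bump t \<zeta> * (cmod (\<zeta> - 1) * norm (u t))"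
          using bump_nonneg[of t \<zeta>] by (simp add: norm_scaleC v_def mult_ac)
        also have "\<dots> \<le> bump t \<zeta> * (1 / (t + 1))"
        proof (cases "bump t \<zeta> = 0")
          case False
          from bump_support[OF t this] have "cmod (\<zeta> - 1) * norm (u t) \<le> 1 / (t + 1) * 1"
            using nu[OF t] t by (intro mult_mono) auto
          then show ?thesis using bump_nonneg[of t \<zeta>] by (intro mult_left_mono) simp_all
        qed simp
        finally show "norm (dual (v t) \<zeta> - v t \<zeta>) \<le> bump t \<zeta> * (1 / (t + 1))" .
      qed
      also have "\<dots> = 1 / (t + 1)"
        using circle_integral_linear[OF continuous_on_bump[of _ t] bounded_linear_mult_left[of "1 / (t + 1)"]]
        by (simp add: circle_integral_bump)
      finally show "nrm CC (dual_automorphism \<alpha> (V t) \<ominus> V t) \<le> 1 / (t + 1)" .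
    qed
    show "((\<lambda>t. nrm CC (adj CC (V t) \<odot> V t \<ominus> V t \<odot> adj CC (V t))) \<longlongrightarrow> 0) at_top"
    \<comment> \<open>Both products have the same scalar kernel, times 1 and times
      \<open>star (u t) * \<alpha> \<zeta> (u t)\<close>. The two bumps overlap only for \<zeta>
      within 2 * (1 / (t + 1)) of 1, and \<alpha> \<zeta> (u t) is within r t of \<zeta> u
      t.\<close>
    proof (rule CC.asymptotic_tendsto, rule CC.asymptoticI[where r="\<lambda>t. r t + 2 * (1 / (t + 1))"])
      show "((\<lambda>t. r t + 2 * (1 / (t + 1))) \<longlongrightarrow> 0) at_top"
        by (intro tendsto_add_zero r0 tendsto_mult_right_zero tendsto_inverse_at_top)
      fix t :: real assume t: "0 \<le> t"
      show "adj CC (V t) \<odot> V t \<in> carr CC" "V t \<odot> adj CC (V t) \<in> carr CC" using Vc by auto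
      let ?x = "mul D (adj D (v t)) (v t)" and ?y = "mul D (v t) (adj D (v t))" and ?r = "r t + 2 * (1 / (t + 1))"
      let ?k = "\<lambda>\<zeta> \<omega>. bump t \<omega> * bump t (inverse \<omega> * \<zeta>)"
      have kc2: "continuous_on (\<TT> \<times> \<TT>) (\<lambda>(\<zeta>, \<omega>). ?k \<zeta> \<omega>)"
        unfolding case_prod_beta'
        by (intro continuous_intros continuous_on_compose2[OF continuous_on_bump[of UNIV]]) auto
      have kc: "continuous_on \<TT> (?k \<zeta>)" for \<zeta>
        by (intro continuous_intros continuous_on_compose2[OF continuous_on_bump[of UNIV]]) auto
      have xk: "?x \<zeta> = circle_integral (?k \<zeta>) *\<^sub>R 1" if \<zeta>: "\<zeta> \<in> \<TT>" for \<zeta>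
      proof -
        have "?x \<zeta> = circle_integral (\<lambda>\<omega>. ?k \<zeta> \<omega> *\<^sub>R 1)"
          unfolding mul_eq
        proof (rule circle_integral_cong)
          fix \<omega> assume \<omega>: "\<omega> \<in> \<TT>"
          have "\<alpha> \<omega> (u t) * \<alpha> \<omega> (star (u t)) = 1"
            using uu[OF t] action_hom(4,7)[OF \<omega>] by metis
          then show "adj D (v t) \<omega> * \<alpha> \<omega> (v t (inverse \<omega> * \<zeta>)) = ?k \<zeta> \<omega> *\<^sub>R 1"
            by (simp add: adjv[OF \<omega>] v_def action_hom(9)[OF \<omega>])
        qed
        then show ?thesis using circle_integral_linear[OF kc bounded_linear_scaleR_left[of "1::'a"], of \<zeta>] by simp
      qed
      have yk: "?y \<zeta> = circle_integral (?k \<zeta>) *\<^sub>R (star (u t) * \<alpha> \<zeta> (u t))" if \<zeta>: "\<zeta> \<in> \<TT>" for \<zeta>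
      proof -
        have "?y \<zeta> = circle_integral (\<lambda>\<omega>. ?k \<zeta> \<omega> *\<^sub>R (star (u t) * \<alpha> \<zeta> (u t)))"
          unfolding mul_eq
        proof (rule circle_integral_cong)
          fix \<omega> assume \<omega>: "\<omega> \<in> \<TT>"
          have i: "inverse \<omega> * \<zeta> \<in> \<TT>" by (rule circle_mult[OF circle_inverse[OF \<omega>] \<zeta>])
          have e: "\<omega> * (inverse \<omega> * \<zeta>) = \<zeta>" using circle_nonzero[OF \<omega>] by simp
          show "v t \<omega> * \<alpha> \<omega> (adj D (v t) (inverse \<omega> * \<zeta>)) = ?k \<zeta> \<omega> *\<^sub>R (star (u t) * \<alpha> \<zeta> (u t))"
            unfolding adjv[OF i] action_hom(9)[OF \<omega>] action_mult[OF \<omega> i, symmetric] e v_def by simp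
        qed
        then show ?thesis using circle_integral_linear[OF kc bounded_linear_scaleR_left, of \<zeta> "star (u t) * \<alpha> \<zeta> (u t)"] by simp
      qed
      have ns: "norm (1 - star (u t) * \<alpha> \<zeta> (u t)) \<le> r t + cmod (\<zeta> - 1)" if \<zeta>: "\<zeta> \<in> \<TT>" for \<zeta>
      proof -
        have "star (u t) * (\<alpha> \<zeta> (u t) - scaleC \<zeta> (u t)) = star (u t) * \<alpha> \<zeta> (u t) - scaleC \<zeta> 1"
          using uu[OF t] by (simp add: right_diff_distrib mult_scaleC_right)
        then have "1 - star (u t) * \<alpha> \<zeta> (u t) = - (star (u t) * (\<alpha> \<zeta> (u t) - scaleC \<zeta> (u t))) - scaleC (\<zeta> - 1) 1"
          by (simp add: scaleC_diff_left)
        also have "norm \<dots> \<le> norm (star (u t) * (\<alpha> \<zeta> (u t) - scaleC \<zeta> (u t))) + norm (scaleC (\<zeta> - 1) (1::'a))"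
          by (rule order_trans[OF norm_triangle_ineq4]) simp
        also have "\<dots> \<le> r t + cmod (\<zeta> - 1) * 1"
          unfolding norm_scaleC
          by (intro add_mono order_trans[OF nsu(1)[OF t \<zeta>] r[OF \<zeta>]] mult_left_mono norm_one_le) simp
        finally show ?thesis by simp
      qed
      have "nrm CC (U.const_cls ?x \<ominus> U.const_cls ?y) \<le> circle_integral (\<lambda>\<zeta>. norm (?x \<zeta> - ?y \<zeta>))"
        by (intro dist_const_le_nrm mul_carr adj_carr vc)
      also have "\<dots> \<le> circle_integral (\<lambda>\<zeta>. circle_integral (?k \<zeta>) * ?r)"
      proof (rule circle_integral_mono)
        show "continuous_on \<TT> (\<lambda>\<zeta>. norm (?x \<zeta> - ?y \<zeta>))"
          by (intro continuous_on_norm continuous_on_diff carr_continuous mul_carr adj_carr vc)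
        show "continuous_on \<TT> (\<lambda>\<zeta>. circle_integral (?k \<zeta>) * ?r)"
          by (intro continuous_on_mult continuous_on_const continuous_on_circle_integral kc2)
        fix \<zeta> assume \<zeta>: "\<zeta> \<in> \<TT>"
        have nn: "0 \<le> ?k \<zeta> \<omega>" for \<omega> by (simp add: bump_nonneg)
        have "?x \<zeta> - ?y \<zeta> = circle_integral (?k \<zeta>) *\<^sub>R (1 - star (u t) * \<alpha> \<zeta> (u t))"
          by (simp add: xk[OF \<zeta>] yk[OF \<zeta>] scaleR_diff_right)
        then have "norm (?x \<zeta> - ?y \<zeta>) = circle_integral (?k \<zeta>) * norm (1 - star (u t) * \<alpha> \<zeta> (u t))"
          using circle_integral_nonneg[OF kc, of \<zeta>] nn by simp
        also have "\<dots> = circle_integral (\<lambda>\<omega>. ?k \<zeta> \<omega> * norm (1 - star (u t) * \<alpha> \<zeta> (u t)))"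
          by (rule circle_integral_linear[OF kc bounded_linear_mult_left, symmetric])
        also have "\<dots> \<le> circle_integral (\<lambda>\<omega>. ?k \<zeta> \<omega> * ?r)"
        proof (rule circle_integral_mono)
          fix \<omega> assume \<omega>: "\<omega> \<in> \<TT>"
          show "?k \<zeta> \<omega> * norm (1 - star (u t) * \<alpha> \<zeta> (u t)) \<le> ?k \<zeta> \<omega> * ?r"
          proof (cases "?k \<zeta> \<omega> = 0")
            case False
            then have "cmod (\<omega> - 1) \<le> 1 / (t + 1)" "cmod (inverse \<omega> * \<zeta> - 1) \<le> 1 / (t + 1)"
              using bump_support[OF t] by auto
            moreover have "cmod (\<zeta> - 1) \<le> cmod (\<zeta> - \<omega>) + cmod (\<omega> - 1)"
              using norm_triangle_ineq[of "\<zeta> - \<omega>" "\<omega> - 1"] by simp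
            moreover have "\<omega> * (inverse \<omega> * \<zeta> - 1) = \<zeta> - \<omega>"
              using circle_nonzero[OF \<omega>] by (simp add: right_diff_distrib)
            then have "cmod (\<zeta> - \<omega>) = cmod (\<omega> * (inverse \<omega> * \<zeta> - 1))" by simp
            then have "cmod (\<zeta> - \<omega>) = cmod (inverse \<omega> * \<zeta> - 1)" using \<omega> by (simp add: norm_mult)
            ultimately have "norm (1 - star (u t) * \<alpha> \<zeta> (u t)) \<le> ?r" using ns[OF \<zeta>] by linarith
            then show ?thesis using nn by (rule mult_left_mono)
          qed auto
        qed (intro continuous_on_mult continuous_on_const kc)+
        also have "\<dots> = circle_integral (?k \<zeta>) * ?r"
          by (rule circle_integral_linear[OF kc bounded_linear_mult_left])
        finally show "norm (?x \<zeta> - ?y \<zeta>) \<le> circle_integral (?k \<zeta>) * ?r" .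
      qed
      also have "\<dots> = circle_integral (\<lambda>\<zeta>. circle_integral (?k \<zeta>)) * ?r"
        by (rule circle_integral_linear[OF continuous_on_circle_integral[OF kc2] bounded_linear_mult_left])
      also have "circle_integral (\<lambda>\<zeta>. circle_integral (?k \<zeta>)) = circle_integral (\<lambda>\<omega>. circle_integral (\<lambda>\<zeta>. ?k \<zeta> \<omega>))"
        by (rule circle_integral_swap[OF kc2])
      also have "\<dots> = circle_integral (bump t)"
      proof (rule circle_integral_cong)
        fix \<omega> assume \<omega>: "\<omega> \<in> \<TT>"
        have "continuous_on \<TT> (\<lambda>\<zeta>. bump t (inverse \<omega> * \<zeta>))"
          by (intro continuous_intros continuous_on_compose2[OF continuous_on_bump[of UNIV]]) auto
        then have "circle_integral (\<lambda>\<zeta>. ?k \<zeta> \<omega>) = bump t \<omega> * circle_integral (\<lambda>\<zeta>. bump t (inverse \<omega> * \<zeta>))"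
          by (rule circle_integral_linear[OF _ bounded_linear_mult_right])
        also have "\<dots> = bump t \<omega>"
          using circle_integral_rotate[OF continuous_on_bump circle_inverse[OF \<omega>], of t] by (simp add: circle_integral_bump)
        finally show "circle_integral (\<lambda>\<zeta>. ?k \<zeta> \<omega>) = bump t \<omega>" .
      qed
      finally show "nrm CC (adj CC (V t) \<odot> V t \<ominus> V t \<odot> adj CC (V t)) \<le> ?r"
        by (simp add: V_def ops vc adj_carr circle_integral_bump)
    qed
    have lipV: "nrm CC ((V t \<odot> X) \<ominus> (V t \<odot> Y)) \<le> nrm CC (X \<ominus> Y)"
      "nrm CC ((adj CC (V t) \<odot> X) \<ominus> (adj CC (V t) \<odot> Y)) \<le> nrm CC (X \<ominus> Y)"
      "nrm CC ((X \<odot> adj CC (V t)) \<ominus> (Y \<odot> adj CC (V t))) \<le> nrm CC (X \<ominus> Y)"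
      if t: "0 \<le> t" and X: "X \<in> carr CC" and Y: "Y \<in> carr CC" for t X Y
    proof -
      have le: "nrm CC (V t) * nrm CC (X \<ominus> Y) \<le> 1 * nrm CC (X \<ominus> Y)"
        using X Y nV[OF t] by (intro mult_right_mono) auto
      have Va: "adj CC (V t) \<in> carr CC" "nrm CC (adj CC (V t)) = nrm CC (V t)" using Vc[of t] by auto
      show "nrm CC ((V t \<odot> X) \<ominus> (V t \<odot> Y)) \<le> nrm CC (X \<ominus> Y)"
        using CC.dist_mul_left[OF Vc X Y, of t] le by simp
      show "nrm CC ((adj CC (V t) \<odot> X) \<ominus> (adj CC (V t) \<odot> Y)) \<le> nrm CC (X \<ominus> Y)"
        using CC.dist_mul_left[OF Va(1) X Y] Va(2) le by simp
      show "nrm CC ((X \<odot> adj CC (V t)) \<ominus> (Y \<odot> adj CC (V t))) \<le> nrm CC (X \<ominus> Y)"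
        using CC.dist_mul_right[OF Va(1) X Y] Va(2) le by (simp add: mult.commute)
    qed
    have triangle4: "nrm CC (P \<ominus> Q) \<le> 2 * s + nrm CC (P' \<ominus> Q')"
      if "P \<in> carr CC" "P' \<in> carr CC" "Q \<in> carr CC" "Q' \<in> carr CC"
        "nrm CC (P \<ominus> P') \<le> s" "nrm CC (Q \<ominus> Q') \<le> s" for P Q P' Q' s
      using CC.dist_triangle[of P P' Q] CC.dist_triangle[of P' Q' Q] CC.dist_commute[of Q Q'] that by simp
    fix X assume X: "X \<in> carr CC"
    show "((\<lambda>t. nrm CC (adj CC (V t) \<odot> V t \<odot> X \<ominus> X)) \<longlongrightarrow> 0) at_top"
    proof (rule U.asymptotic_dense[where K=2 and F="\<lambda>t X. adj CC (V t) \<odot> V t \<odot> X" and G="\<lambda>t X. X", OF _ _ _ _ X])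
      fix t :: real and X Y assume t: "0 \<le> t" and X: "X \<in> carr CC" and Y: "Y \<in> carr CC"
      show "nrm CC (adj CC (V t) \<odot> V t \<odot> X \<ominus> X) \<le> 2 * nrm CC (X \<ominus> Y) +
          nrm CC (adj CC (V t) \<odot> V t \<odot> Y \<ominus> Y)"
      proof (rule triangle4)
        show "nrm CC (adj CC (V t) \<odot> V t \<odot> X \<ominus> adj CC (V t) \<odot> V t \<odot> Y) \<le> nrm CC (X \<ominus> Y)"
          using lipV(1)[OF t X Y] lipV(2)[OF t, of "V t \<odot> X" "V t \<odot> Y"] Vc X Y
          by (simp add: CC.mul_assoc_eq)
      qed (use X Y Vc in auto)
    next
      fix x assume "x \<in> carr (with_universal_norm D)"
      then have x: "x \<in> carr D" by simp
      show "((\<lambda>t. nrm CC (adj CC (V t) \<odot> V t \<odot> U.const_cls x \<ominus> U.const_cls x)) \<longlongrightarrow> 0) at_top"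
      proof (rule tendstoI)
        fix e :: real assume e: "0 < e"
        have "\<forall>\<^sub>F t in at_top. \<forall>\<zeta>\<in>\<TT>. norm (conv t x \<zeta> - x \<zeta>) \<le> e / 3" using e by (intro conv_unif x) simp
        with eventually_ge_at_top[of "0::real"]
        show "\<forall>\<^sub>F t in at_top. dist (nrm CC (adj CC (V t) \<odot> V t \<odot> U.const_cls x \<ominus> U.const_cls x)) 0 < e"
        proof eventually_elim
          case (elim t)
          let ?y = "mul D (adj D (v t)) (mul D (v t) x)"
          have yc: "?y \<in> carr D" by (intro mul_carr adj_carr vc x)
          have "adj CC (V t) \<odot> V t \<odot> U.const_cls x = U.const_cls ?y"
            unfolding CC.mul_assoc_eq[OF CC.adj_closed[OF Vc] Vc const_carr[OF x]]
            by (simp add: V_def ops vc adj_carr mul_carr x)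
          moreover have "nrm CC (U.const_cls ?y \<ominus> U.const_cls x) \<le> e / 3 + e / 3"
          proof (rule dist_const_le[OF yc x])
            fix \<zeta> assume \<zeta>: "\<zeta> \<in> \<TT>"
            \<comment> \<open>The product acts as \<open>conv\<close> applied twice. Since
              \<open>conv\<close> does not increase uniform distances, the error e / 3 occurs
              twice.\<close>
            have "?y \<zeta> = conv t (conv t x) \<zeta>" by (rule vstar[OF conv_carr[OF x] vx[OF x] \<zeta> elim(1)])
            moreover have "norm (conv t (conv t x) \<zeta> - conv t x \<zeta>) \<le> e / 3"
              by (rule conv_dist[OF conv_carr[OF x] x \<zeta> elim(1)]) (use elim(2) in blast)
            moreover have "norm (conv t x \<zeta> - x \<zeta>) \<le> e / 3" using elim(2) \<zeta> by blast
            ultimately show "norm (?y \<zeta> - x \<zeta>) \<le> e / 3 + e / 3"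
              using norm_triangle_mono[of "conv t (conv t x) \<zeta> - conv t x \<zeta>" "e / 3" "conv t x \<zeta> - x \<zeta>" "e / 3"] by simp
          qed
          ultimately show ?case
            using e CC.nrm_nonneg[OF CC.minus_closed[OF const_carr[OF yc] const_carr[OF x]]]
            by (simp add: dist_real_def)
        qed
      qed
    qed (use X Vc in auto)
    show "((\<lambda>t. nrm CC (dual_automorphism \<alpha> X \<ominus> V t \<odot> X \<odot> adj CC (V t))) \<longlongrightarrow> 0) at_top"
    proof (rule U.asymptotic_dense[where K=2 and F="\<lambda>t X. dual_automorphism \<alpha> X" and G="\<lambda>t X. V t \<odot> X \<odot> adj CC (V t)", OF _ _ _ _ X])
      fix t :: real and X Y assume t: "0 \<le> t" and X: "X \<in> carr CC" and Y: "Y \<in> carr CC"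
      show "nrm CC (dual_automorphism \<alpha> X \<ominus> V t \<odot> X \<odot> adj CC (V t)) \<le> 2 * nrm CC (X \<ominus> Y) +
          nrm CC (dual_automorphism \<alpha> Y \<ominus> V t \<odot> Y \<odot> adj CC (V t))"
      proof (rule triangle4)
        show "nrm CC (V t \<odot> X \<odot> adj CC (V t) \<ominus> V t \<odot> Y \<odot> adj CC (V t)) \<le> nrm CC (X \<ominus> Y)"
          using lipV(1)[OF t X Y] lipV(3)[OF t, of "V t \<odot> X" "V t \<odot> Y"] Vc X Y by simp
      qed (use X Y Vc dual_automorphism_props in auto)
    next
      fix x assume "x \<in> carr (with_universal_norm D)"
      then have x: "x \<in> carr D" by simp
      obtain M where M: "0 < M" "\<And>\<zeta>. \<zeta> \<in> \<TT> \<Longrightarrow> norm (x \<zeta>) \<le> M" using circle_bounded[OF carr_continuous[OF x]] by blast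
      show "((\<lambda>t. nrm CC (dual_automorphism \<alpha> (U.const_cls x) \<ominus> V t \<odot> U.const_cls x \<odot> adj CC (V t))) \<longlongrightarrow> 0) at_top"
      proof (rule tendstoI)
        fix e :: real assume e: "0 < e"
        have "\<forall>\<^sub>F t in at_top. \<forall>\<zeta>\<in>\<TT>. norm (conv t x \<zeta> - x \<zeta>) \<le> e / 5" using e by (intro conv_unif x) simp
        moreover have "\<forall>\<^sub>F t in at_top. \<forall>\<zeta>\<in>\<TT>. norm (circle_integral (\<lambda>\<omega>. bump t \<omega> *\<^sub>R x (\<zeta> * \<omega>)) - x \<zeta>) \<le> e / 5"
          using e by (intro avg_unif x) simp
        moreover have "\<forall>\<^sub>F t in at_top. \<forall>a\<in>x ` \<TT>. norm (u t * a - a * u t) \<le> e / 5"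
          using e by (intro compact_asymptotic_commute[OF _ nu comm] compact_continuous_image carr_continuous x compact_circle) auto
        moreover have "\<forall>\<^sub>F t in at_top. dist (r t) 0 < e / (5 * M)"
          using e M by (intro tendstoD[OF r0]) simp
        ultimately show "\<forall>\<^sub>F t in at_top. dist (nrm CC (dual_automorphism \<alpha> (U.const_cls x) \<ominus> V t \<odot> U.const_cls x \<odot> adj CC (V t))) 0 < e"
          using eventually_ge_at_top[of "0::real"]
        proof eventually_elim
          case (elim t)
          note t = elim(5)
          let ?y = "mul D (mul D (v t) x) (adj D (v t))"
          have yc: "?y \<in> carr D" by (intro mul_carr adj_carr vc x)
          have "V t \<odot> U.const_cls x \<odot> adj CC (V t) = U.const_cls ?y"
            by (simp add: V_def ops vc adj_carr mul_carr x)
          moreover have "nrm CC (U.const_cls (dual x) \<ominus> U.const_cls ?y) \<le> 4 * (e / 5)"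
          proof (rule dist_const_le[OF dual_carr[OF x] yc])
            fix \<zeta> assume \<zeta>: "\<zeta> \<in> \<TT>"
            define h where "h = circle_integral (\<lambda>\<omega>. bump t \<omega> *\<^sub>R conv t x (\<zeta> * \<omega>))"
            define h' where "h' = circle_integral (\<lambda>\<omega>. bump t \<omega> *\<^sub>R x (\<zeta> * \<omega>))"
            define a where "a = x \<zeta>"
            have cx: "continuous_on \<TT> (\<lambda>\<omega>. conv t x (\<zeta> * \<omega>))" "continuous_on \<TT> (\<lambda>\<omega>. x (\<zeta> * \<omega>))"
              by (intro carr_compose[OF conv_carr[OF x]] carr_compose[OF x] continuous_intros circle_mult \<zeta>; assumption)+
            have "h - h' = circle_integral (\<lambda>\<omega>. bump t \<omega> *\<^sub>R (conv t x (\<zeta> * \<omega>) - x (\<zeta> * \<omega>))) - 0"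
              unfolding h_def h'_def using cx
              by (subst circle_integral_diff[symmetric]) (auto intro!: continuous_on_scaleR continuous_on_bump simp: scaleR_diff_right)
            also have "norm \<dots> \<le> e / 5"
              by (rule bump_average_le[OF _ t]) (use cx elim(1) circle_mult[OF \<zeta>] in \<open>auto intro!: continuous_on_diff\<close>)
            finally have 1: "norm (h - h') \<le> e / 5" .
            have 2: "norm (h' - a) \<le> e / 5" unfolding h'_def a_def using elim(2) \<zeta> by blast
            have yh: "?y \<zeta> = star (u t) * h * \<alpha> \<zeta> (u t)"
            proof -
              have "circle_integral (\<lambda>\<omega>. bump t \<omega> *\<^sub>R mul D (v t) x (\<zeta> * \<omega>)) = circle_integral (\<lambda>\<omega>. star (u t) * (bump t \<omega> *\<^sub>R conv t x (\<zeta> * \<omega>)))"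
                by (rule circle_integral_cong) (simp only: vx[OF x circle_mult[OF \<zeta>]] mult_scaleR_right)
              also have "\<dots> = star (u t) * h"
                unfolding h_def using cx(1)
                by (intro circle_integral_linear[OF _ bounded_linear_mult_right] continuous_on_scaleR continuous_on_bump)
              finally show ?thesis using mulstar[OF mul_carr[OF vc x] \<zeta>] by simp
            qed
            \<comment> \<open>Four errors of at most e / 5 each: the inner convolution (h to h'),
              the outer average (h' to a), \<alpha> \<zeta> (u t) against \<zeta> u t, and the
              commutator of u t with a.\<close>
            have "dual x \<zeta> - ?y \<zeta> = - (star (u t) * (h - h') * \<alpha> \<zeta> (u t)) - star (u t) * (h' - a) * \<alpha> \<zeta> (u t)
                - star (u t) * (a * (\<alpha> \<zeta> (u t) - scaleC \<zeta> (u t))) + scaleC \<zeta> (star (u t) * (u t * a - a * u t))"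
              unfolding yh a_def
              using uu[OF t] by (simp add: algebra_simps mult_scaleC_right scaleC_diff_right flip: mult.assoc)
            also have "norm \<dots> \<le> e / 5 + e / 5 + e / 5 + e / 5"
            proof (rule order_trans[OF norm_four_terms_le], intro add_mono)
              have b2: "norm (star (u t) * c * \<alpha> \<zeta> (u t)) \<le> norm c" for c
                by (rule order_trans[OF nsu(2)[OF t \<zeta>] nsu(1)[OF t \<zeta>]])
              show "norm (star (u t) * (h - h') * \<alpha> \<zeta> (u t)) \<le> e / 5"
                by (rule order_trans[OF b2 1])
              show "norm (star (u t) * (h' - a) * \<alpha> \<zeta> (u t)) \<le> e / 5"
                by (rule order_trans[OF b2 2])
              have "norm (a * (\<alpha> \<zeta> (u t) - scaleC \<zeta> (u t))) \<le> M * (e / (5 * M))"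
                using M r[OF \<zeta>, of t] elim(4) \<zeta>
                by (intro order_trans[OF norm_mult_ineq] mult_mono) (auto simp: a_def dist_real_def)
              also have "\<dots> = e / 5" using M by simp
              finally show "norm (star (u t) * (a * (\<alpha> \<zeta> (u t) - scaleC \<zeta> (u t)))) \<le> e / 5"
                by (rule order_trans[OF nsu(1)[OF t \<zeta>]])
              have "norm (u t * a - a * u t) \<le> e / 5" using elim(3) \<zeta> by (auto simp: a_def)
              then have "norm (star (u t) * (u t * a - a * u t)) \<le> e / 5"
                by (rule order_trans[OF nsu(1)[OF t \<zeta>]])
              then show "norm (scaleC \<zeta> (star (u t) * (u t * a - a * u t))) \<le> e / 5"
                using \<zeta> by (simp add: norm_scaleC)
            qed
            finally show "norm (dual x \<zeta> - ?y \<zeta>) \<le> 4 * (e / 5)" by simp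
          qed
          ultimately show ?case
            using e CC.nrm_nonneg[OF CC.minus_closed[OF const_carr[OF dual_carr[OF x]] const_carr[OF yc]]]
            by (simp add: dist_real_def dual_automorphism_props(1)[OF x])
        qed
      qed
    qed (use X Vc dual_automorphism_props in auto)
  qed
qed

end

section \<open>Spectral subspaces\<close>

context circle_system
begin

interpretation CC: cstar_normed CC
  by (rule U.cstar_normed_completion)

definition spectral :: "int \<Rightarrow> 'a set" where
  "spectral m = {a. \<forall>\<zeta>\<in>\<TT>. \<alpha> \<zeta> a = scaleC (\<zeta> powi m) a}"

text \<open>The Fourier coefficient of the orbit map of a, which is the projection onto the spectral
  subspace of degree m.\<close>

definition fourier :: "int \<Rightarrow> 'a \<Rightarrow> 'a" where
  "fourier m a = circle_integral (\<lambda>\<omega>. scaleC (\<omega> powi (- m)) (\<alpha> \<omega> a))"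

lemma continuous_on_powi: "continuous_on \<TT> (\<lambda>\<omega>. \<omega> powi m)"
  by (intro continuous_intros) auto

lemma fourier_integrand: "continuous_on \<TT> (\<lambda>\<omega>. scaleC (\<omega> powi m) (\<alpha> \<omega> a))"
  by (intro continuous_intros continuous_on_powi) auto

lemma powi_cancel: "\<zeta> \<in> \<TT> \<Longrightarrow> \<zeta> powi k * \<zeta> powi l = \<zeta> powi (k + l)"
  using circle_nonzero[of \<zeta>] by (simp add: power_int_add)

lemma fourier_spectral: "fourier m a \<in> spectral m"
  unfolding spectral_def
proof (intro CollectI ballI)
  fix \<zeta> assume \<zeta>: "\<zeta> \<in> \<TT>"
  have "\<alpha> \<zeta> (fourier m a) = circle_integral (\<lambda>\<omega>. \<alpha> \<zeta> (scaleC (\<omega> powi (- m)) (\<alpha> \<omega> a)))"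
    unfolding fourier_def
    by (rule circle_integral_linear[OF fourier_integrand bounded_linear_action[OF \<zeta>], symmetric])
  also have "\<dots> = circle_integral (\<lambda>\<omega>. scaleC (\<zeta> powi m) (scaleC ((\<zeta> * \<omega>) powi (- m)) (\<alpha> (\<zeta> * \<omega>) a)))"
  proof (rule circle_integral_cong)
    fix \<omega> assume \<omega>: "\<omega> \<in> \<TT>"
    have "\<zeta> powi m * ((\<zeta> * \<omega>) powi (- m)) = \<omega> powi (- m)"
      using circle_nonzero[OF \<zeta>] by (simp add: power_int_mult_distrib power_int_minus)
    then show "\<alpha> \<zeta> (scaleC (\<omega> powi (- m)) (\<alpha> \<omega> a))
        = scaleC (\<zeta> powi m) (scaleC ((\<zeta> * \<omega>) powi (- m)) (\<alpha> (\<zeta> * \<omega>) a))"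
      by (simp add: action_hom(3)[OF \<zeta>] action_mult[OF \<zeta> \<omega>] scaleC_scaleC)
  qed
  also have "\<dots> = circle_integral (\<lambda>\<omega>. scaleC (\<zeta> powi m) (scaleC (\<omega> powi (- m)) (\<alpha> \<omega> a)))"
    by (rule circle_integral_rotate[OF _ \<zeta>, where f="\<lambda>\<omega>. scaleC (\<zeta> powi m) (scaleC (\<omega> powi (- m)) (\<alpha> \<omega> a))"])
      (intro continuous_intros fourier_integrand)
  also have "\<dots> = scaleC (\<zeta> powi m) (fourier m a)"
    unfolding fourier_def by (rule circle_integral_linear[OF fourier_integrand bounded_linear_scaleC])
  finally show "\<alpha> \<zeta> (fourier m a) = scaleC (\<zeta> powi m) (fourier m a)" .
qed

lemma fourier_eq: "a \<in> spectral m \<Longrightarrow> fourier m a = a"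
proof -
  assume a: "a \<in> spectral m"
  have "fourier m a = circle_integral (\<lambda>_. a)"
    unfolding fourier_def
  proof (rule circle_integral_cong)
    fix \<omega> assume \<omega>: "\<omega> \<in> \<TT>"
    then have "\<alpha> \<omega> a = scaleC (\<omega> powi m) a" using a by (simp add: spectral_def)
    then show "scaleC (\<omega> powi (- m)) (\<alpha> \<omega> a) = a" by (simp add: scaleC_scaleC powi_cancel[OF \<omega>])
  qed
  then show ?thesis by simp
qed

lemma fourier_diff: "fourier m (a - b) = fourier m a - fourier m b"
proof -
  have "fourier m (a - b) = circle_integral (\<lambda>\<omega>. scaleC (\<omega> powi (- m)) (\<alpha> \<omega> a) - scaleC (\<omega> powi (- m)) (\<alpha> \<omega> b))"
    unfolding fourier_def by (rule circle_integral_cong) (simp only: action_hom(2) scaleC_diff_right)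
  also have "\<dots> = fourier m a - fourier m b"
    unfolding fourier_def by (rule circle_integral_diff[OF fourier_integrand fourier_integrand])
  finally show ?thesis .
qed

lemma spectral_mult: "a \<in> spectral m \<Longrightarrow> b \<in> spectral n \<Longrightarrow> a * b \<in> spectral (m + n)"
  unfolding spectral_def
  by (auto simp: mult_scaleC_left mult_scaleC_right scaleC_scaleC action_hom(4) power_int_add circle_nonzero mult.commute)

lemma spectral_star: "a \<in> spectral m \<Longrightarrow> star a \<in> spectral (- m)"
  unfolding spectral_def
proof (intro CollectI ballI)
  fix \<zeta> assume a: "a \<in> {a. \<forall>\<zeta>\<in>\<TT>. \<alpha> \<zeta> a = scaleC (\<zeta> powi m) a}" and \<zeta>: "\<zeta> \<in> \<TT>"
  then have "star (\<alpha> \<zeta> a) = star (scaleC (\<zeta> powi m) a)" by simp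
  then show "\<alpha> \<zeta> (star a) = scaleC (\<zeta> powi (- m)) (star a)"
    by (simp add: action_hom(5)[OF \<zeta>] star_scaleC cnj_circle_powi[OF \<zeta>])
qed

lemma spectral_diff: "a \<in> spectral m \<Longrightarrow> b \<in> spectral m \<Longrightarrow> a - b \<in> spectral m"
  unfolding spectral_def by (auto simp: action_hom(2) scaleC_diff_right)

lemma one_spectral: "1 \<in> spectral 0"
  unfolding spectral_def by (auto simp: action_hom(7))

text \<open>Represents a p_k, where p_k = \<open>elem 1 k\<close> is the spectral projection of the
  canonical unitaries for the character \<omega>^k.\<close>

definition elem :: "'a \<Rightarrow> int \<Rightarrow> complex \<Rightarrow> 'a" where
  "elem a k = (\<lambda>\<zeta>. scaleC (\<zeta> powi (- k)) a)"

lemma elem_carr: "elem a k \<in> carr D"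
  unfolding D_simps elem_def by (auto intro!: continuous_on_scaleC continuous_on_const continuous_on_powi)

lemma elem_minus: "alg_minus D (elem a k) (elem b k) = elem (a - b) k"
  by (simp add: D_simps elem_def scaleC_diff_right)

lemma dual_elem: "\<zeta> \<in> \<TT> \<Longrightarrow> dual (elem a k) \<zeta> = elem a (k - 1) \<zeta>"
  using circle_nonzero[of \<zeta>] by (simp add: elem_def scaleC_scaleC power_int_diff power_int_minus field_simps)

text \<open>The element c of A with x * b p_k = c p_k (\<open>mul_elem\<close>): right
  multiplication by p_k collapses a function x to one element of A.\<close>

definition twisted_integral :: "int \<Rightarrow> 'a \<Rightarrow> (complex \<Rightarrow> 'a) \<Rightarrow> 'a" where
  "twisted_integral k b x = circle_integral (\<lambda>\<omega>. scaleC (\<omega> powi k) (x \<omega> * \<alpha> \<omega> b))"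

lemma twisted_integrand: "x \<in> carr D \<Longrightarrow> continuous_on \<TT> (\<lambda>\<omega>. scaleC (\<omega> powi k) (x \<omega> * \<alpha> \<omega> b))"
  by (intro continuous_intros continuous_on_powi carr_continuous) auto

lemma mul_elem:
  assumes x: "x \<in> carr D" and \<zeta>: "\<zeta> \<in> \<TT>"
  shows "mul D x (elem b k) \<zeta> = elem (twisted_integral k b x) k \<zeta>"
  unfolding mul_eq elem_def twisted_integral_def
    circle_integral_linear[OF twisted_integrand[OF x] bounded_linear_scaleC, symmetric]
proof (rule circle_integral_cong)
  fix \<omega> assume \<omega>: "\<omega> \<in> \<TT>"
  have "(inverse \<omega> * \<zeta>) powi (- k) = \<zeta> powi (- k) * \<omega> powi k"
    by (simp add: power_int_mult_distrib power_int_minus power_int_inverse mult.commute)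
  then show "x \<omega> * \<alpha> \<omega> (scaleC ((inverse \<omega> * \<zeta>) powi (- k)) b)
      = scaleC (\<zeta> powi (- k)) (scaleC (\<omega> powi k) (x \<omega> * \<alpha> \<omega> b))"
    by (simp add: action_hom(3)[OF \<omega>] mult_scaleC_right scaleC_scaleC)
qed

lemma twisted_integral_elem: "twisted_integral k b (elem a l) = a * fourier (l - k) b"
  unfolding twisted_integral_def fourier_def
    circle_integral_linear[OF fourier_integrand bounded_linear_mult_right, symmetric]
proof (rule circle_integral_cong)
  fix \<omega> assume \<omega>: "\<omega> \<in> \<TT>"
  show "scaleC (\<omega> powi k) (elem a l \<omega> * \<alpha> \<omega> b) = a * scaleC (\<omega> powi (- (l - k))) (\<alpha> \<omega> b)"
    by (simp add: elem_def mult_scaleC_left mult_scaleC_right scaleC_scaleC powi_cancel[OF \<omega>])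
qed

text \<open>p_l b p_k sees only the part of b of degree l - k: an element of degree d carries p_k to
  p_(k + d).\<close>

lemma mul_elem_elem:
  "\<zeta> \<in> \<TT> \<Longrightarrow> mul D (elem a l) (elem b k) \<zeta> = elem (a * fourier (l - k) b) k \<zeta>"
  by (simp add: mul_elem[OF elem_carr] twisted_integral_elem del: mem_sphere mem_sphere_0)

text \<open>The adjoint of a p_k is p_k \<open>star a\<close>, and \<open>star a\<close>, having
  degree - m, carries p_(k + m) to p_k.\<close>

lemma adj_elem:
  assumes "a \<in> spectral m" "\<zeta> \<in> \<TT>"
  shows "adj D (elem a k) \<zeta> = elem (star a) (k + m) \<zeta>"
proof -
  have "\<alpha> \<zeta> (star a) = scaleC (\<zeta> powi (- m)) (star a)"
    using spectral_star[OF assms(1)] assms(2) by (simp add: spectral_def)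
  moreover have "cnj (cnj \<zeta> powi (- k)) = \<zeta> powi (- k)" by simp
  ultimately show ?thesis
    by (simp add: D_simps(5) elem_def star_scaleC action_hom(3)[OF assms(2)] scaleC_scaleC powi_cancel[OF assms(2)]
        del: complex_cnj_power_int)
qed

text \<open>The L1 norm gives the upper bound. For the lower one a p_k acts on the vector p_k;
  homogeneity of a makes \<open>star a * a\<close> invariant, so the inner product of a p_k with
  itself is \<open>star a * a\<close>.\<close>

lemma universal_elem:
  assumes "a \<in> spectral m"
  shows "universal_norm D (elem a k) = norm a"
proof (rule antisym)
  have "nrm D (elem a k) = circle_integral (\<lambda>_. norm a)"
    unfolding D_simps(7) by (rule circle_integral_cong) (simp add: elem_def norm_scaleC norm_circle_powi)
  then show "universal_norm D (elem a k) \<le> norm a"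
    using exp.universal_le_nrm[OF elem_carr[of a k]] by simp
  have ip: "exp.ip (elem b k) (elem b k) = star b * b" if b: "b \<in> spectral n" for b n
  proof -
    have bb: "star b * b \<in> spectral 0" using spectral_mult[OF spectral_star[OF b] b] by simp
    have "exp.ip (elem b k) (elem b k) = circle_integral (\<lambda>_. star b * b)"
      unfolding exp.ip_def E_ip[OF elem_carr elem_carr]
    proof (rule circle_integral_cong)
      fix \<omega> assume \<omega>: "\<omega> \<in> \<TT>"
      have "\<alpha> (inverse \<omega>) (star b * b) = star b * b"
        using bb circle_inverse[OF \<omega>] by (simp add: spectral_def)
      then show "\<alpha> (inverse \<omega>) (star (elem b k \<omega>) * elem b k \<omega>) = star b * b"
        by (simp add: elem_def star_scaleC mult_scaleC_left mult_scaleC_right scaleC_scaleC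
            cnj_circle_powi[OF \<omega>] powi_cancel[OF \<omega>])
    qed
    then show ?thesis by simp
  qed
  then have m: "exp.mnorm (elem b k) = norm b" if "b \<in> spectral n" for b n
    using that by (simp add: exp.mnorm_def norm_star_mult)
  have "exp.mnorm (mul D (elem a k) (elem 1 k)) = exp.mnorm (elem a k)"
    by (rule exp.mnorm_cong[OF mul_carr[OF elem_carr elem_carr] elem_carr nrm_minus_zero])
      (simp add: mul_elem_elem fourier_eq[OF one_spectral] del: mem_sphere mem_sphere_0)
  then have "norm a \<le> universal_norm D (elem a k) * norm (1::'a)"
    using reg.mnorm_le_universal[OF elem_carr[of a k] elem_carr[of 1 k]] m[OF assms] m[OF one_spectral] by simp
  also have "\<dots> \<le> universal_norm D (elem a k) * 1"
    by (intro mult_left_mono norm_one_le exp.universal_nonneg elem_carr)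
  finally show "norm a \<le> universal_norm D (elem a k)" by simp
qed

section \<open>Compressions of the crossed product\<close>

abbreviation EE :: "'a \<Rightarrow> int \<Rightarrow> (nat \<Rightarrow> complex \<Rightarrow> 'a) set" where
  "EE a k \<equiv> U.const_cls (elem a k)"

lemma EE_carr: "EE a k \<in> carr CC"
  by (rule const_carr[OF elem_carr])

lemma const_cong:
  assumes "x \<in> carr D" "y \<in> carr D" "\<And>\<zeta>. \<zeta> \<in> \<TT> \<Longrightarrow> x \<zeta> = y \<zeta>"
  shows "U.const_cls x = U.const_cls y"
proof (rule U.const_cls_eqI)
  have "nrm D (alg_minus D x y) = 0" by (rule nrm_minus_zero) (rule assms(3))
  then show "nrm (with_universal_norm D) (alg_minus (with_universal_norm D) x y) = 0"
    using exp.universal_zero_if[of "alg_minus D x y"] exp.minus_closed[OF assms(1,2)] by simp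
qed (use assms in auto)

lemma EE_mul: "EE a l \<odot> EE b k = EE (a * fourier (l - k) b) k"
  using const_cong[OF mul_carr[OF elem_carr elem_carr] elem_carr mul_elem_elem, of a l b k]
    U.const_cls_ops(4)[of "elem a l" "elem b k"] elem_carr by simp

lemma EE_adj: "a \<in> spectral m \<Longrightarrow> adj CC (EE a k) = EE (star a) (k + m)"
  using const_cong[OF adj_carr[OF elem_carr] elem_carr adj_elem, of a m k]
    U.const_cls_ops(2)[of "elem a k"] elem_carr by simp

lemma EE_minus: "EE a k \<ominus> EE b k = EE (a - b) k"
  using U.const_cls_ops(5)[of "elem a k" "elem b k"] elem_carr by (simp add: elem_minus)

lemma nrm_EE: "a \<in> spectral m \<Longrightarrow> nrm CC (EE a k) = norm a"
  using U.nrm_const_cls[of "elem a k"] elem_carr by (simp add: universal_elem)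

lemma dual_EE: "dual_automorphism \<alpha> (EE a k) = EE a (k - 1)"
  using const_cong[OF dual_carr[OF elem_carr] elem_carr dual_elem, of a k]
  by (simp add: dual_automorphism_props(1)[OF elem_carr])

text \<open>The element y of degree -1 with p_(k - 1) x p_k = y p_k
  (\<open>EE_compress\<close>).\<close>

definition compress :: "int \<Rightarrow> (complex \<Rightarrow> 'a) \<Rightarrow> 'a" where
  "compress k x = fourier (- 1) (twisted_integral k 1 x)"

lemma compress_spectral: "compress k x \<in> spectral (- 1)"
  unfolding compress_def by (rule fourier_spectral)

lemma compress_minus:
  "x \<in> carr D \<Longrightarrow> y \<in> carr D \<Longrightarrow> compress k (alg_minus D x y) = compress k x - compress k y"
  unfolding compress_def twisted_integral_def
  using circle_integral_diff[OF twisted_integrand[of x k 1] twisted_integrand[of y k 1]]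
  by (simp add: D_simps(6) left_diff_distrib scaleC_diff_right flip: fourier_diff)

text \<open>The factor \<zeta> of the dual automorphism raises by one the frequency at which x is
  integrated.\<close>

lemma compress_dual: "x \<in> carr D \<Longrightarrow> compress k (dual x) = compress (k + 1) x"
proof -
  have "twisted_integral k 1 (dual x) = twisted_integral (k + 1) 1 x"
    unfolding twisted_integral_def
  proof (rule circle_integral_cong)
    fix \<omega> assume \<omega>: "\<omega> \<in> \<TT>"
    have "\<omega> powi k * \<omega> = \<omega> powi (k + 1)" using circle_nonzero[OF \<omega>] by (simp add: power_int_add)
    then show "scaleC (\<omega> powi k) (dual x \<omega> * \<alpha> \<omega> 1) = scaleC (\<omega> powi (k + 1)) (x \<omega> * \<alpha> \<omega> 1)"
      by (simp add: mult_scaleC_left scaleC_scaleC)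
  qed
  then show ?thesis by (simp add: compress_def)
qed

lemma EE_compress:
  assumes x: "x \<in> carr D"
  shows "EE 1 (k - 1) \<odot> (U.const_cls x \<odot> EE 1 k) = EE (compress k x) k"
proof -
  have "U.const_cls x \<odot> EE 1 k = EE (twisted_integral k 1 x) k"
    using const_cong[OF mul_carr[OF x elem_carr] elem_carr mul_elem[OF x], of 1 k]
      U.const_cls_ops(4)[of x "elem 1 k"] elem_carr x by simp
  then show ?thesis by (simp add: EE_mul compress_def)
qed

text \<open>The corner between p_(k - 1) and p_k is cut out by contractions, and
  \<open>nrm_EE\<close> identifies its norm with that of the compression.\<close>

lemma norm_compress_le: "x \<in> carr D \<Longrightarrow> norm (compress k x) \<le> universal_norm D x"
proof -
  assume x: "x \<in> carr D"
  have n1: "nrm CC (EE 1 l) \<le> 1" for l using nrm_EE[OF one_spectral] norm_one_le by simp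
  have "norm (compress k x) = nrm CC (EE 1 (k - 1) \<odot> (U.const_cls x \<odot> EE 1 k))"
    by (simp add: EE_compress[OF x] nrm_EE[OF compress_spectral])
  also have "\<dots> \<le> nrm CC (EE 1 (k - 1)) * nrm CC (U.const_cls x \<odot> EE 1 k)"
    by (intro CC.nrm_mul CC.mul_closed EE_carr const_carr x)
  also have "\<dots> \<le> 1 * (nrm CC (U.const_cls x) * nrm CC (EE 1 k))"
    by (intro mult_mono n1 CC.nrm_mul CC.nrm_nonneg CC.mul_closed EE_carr const_carr x) simp
  also have "\<dots> \<le> 1 * (nrm CC (U.const_cls x) * 1)"
    by (intro mult_left_mono n1 CC.nrm_nonneg const_carr x) simp
  also have "\<dots> = universal_norm D x" using U.nrm_const_cls[of x] x by simp
  finally show ?thesis .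
qed

abbreviation Compress :: "int \<Rightarrow> (nat \<Rightarrow> complex \<Rightarrow> 'a) set \<Rightarrow> 'a" where
  "Compress k \<equiv> U.extend (compress k)"

lemma Compress_props:
  "X \<in> carr CC \<Longrightarrow> norm (Compress k X) \<le> nrm CC X"
  "X \<in> carr CC \<Longrightarrow> Y \<in> carr CC \<Longrightarrow> Compress k (X \<ominus> Y) = Compress k X - Compress k Y"
  "x \<in> carr D \<Longrightarrow> Compress k (U.const_cls x) = compress k x"
  "norm_continuous_path CC v \<Longrightarrow> continuous_on {0..} (\<lambda>t. Compress k (v t))"
  "f \<in> cauchy_seqs (with_universal_norm D) \<Longrightarrow> (\<lambda>n. compress k (f n)) \<longlonglongrightarrow> Compress k (U.cls f)"
proof -
  have a: "\<And>x y. x \<in> carr (with_universal_norm D) \<Longrightarrow> y \<in> carr (with_universal_norm D) \<Longrightarrow>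
      compress k (alg_minus (with_universal_norm D) x y) = compress k x - compress k y"
    using compress_minus by simp
  have b: "\<And>x. x \<in> carr (with_universal_norm D) \<Longrightarrow> norm (compress k x) \<le> nrm (with_universal_norm D) x"
    using norm_compress_le by simp
  show "X \<in> carr CC \<Longrightarrow> norm (Compress k X) \<le> nrm CC X" by (rule U.norm_extend_le[OF a b])
  show "X \<in> carr CC \<Longrightarrow> Y \<in> carr CC \<Longrightarrow> Compress k (X \<ominus> Y) = Compress k X - Compress k Y"
    by (rule U.extend_minus[OF a b])
  show "x \<in> carr D \<Longrightarrow> Compress k (U.const_cls x) = compress k x"
    by (rule U.extend_const_cls[OF a b]) simp_all
  show "norm_continuous_path CC v \<Longrightarrow> continuous_on {0..} (\<lambda>t. Compress k (v t))"
    by (rule U.extend_path_continuous[OF a b])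
  show "f \<in> cauchy_seqs (with_universal_norm D) \<Longrightarrow> (\<lambda>n. compress k (f n)) \<longlonglongrightarrow> Compress k (U.cls f)"
    by (rule U.extend_tendsto[OF a b])
qed

lemma Compress_spectral:
  assumes "X \<in> carr CC" shows "Compress k X \<in> spectral (- 1)"
  unfolding spectral_def
proof (intro CollectI ballI)
  fix \<zeta> assume \<zeta>: "\<zeta> \<in> \<TT>"
  obtain f where f: "f \<in> cauchy_seqs (with_universal_norm D)" "X = U.cls f"
    using assms by (auto simp: U.carr_completion)
  note l = Compress_props(5)[OF f(1), of k]
  have "(\<lambda>n. \<alpha> \<zeta> (compress k (f n))) \<longlonglongrightarrow> \<alpha> \<zeta> (Compress k X)"
    unfolding f(2) by (rule bounded_linear.tendsto[OF bounded_linear_action[OF \<zeta>] l])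
  moreover have "(\<lambda>n. \<alpha> \<zeta> (compress k (f n))) = (\<lambda>n. scaleC (\<zeta> powi (- 1)) (compress k (f n)))"
    using compress_spectral \<zeta> by (simp add: spectral_def)
  moreover have "(\<lambda>n. scaleC (\<zeta> powi (- 1)) (compress k (f n))) \<longlonglongrightarrow> scaleC (\<zeta> powi (- 1)) (Compress k X)"
    unfolding f(2) by (rule bounded_linear.tendsto[OF bounded_linear_scaleC l])
  ultimately show "\<alpha> \<zeta> (Compress k X) = scaleC (\<zeta> powi (- 1)) (Compress k X)"
    using LIMSEQ_unique by metis
qed

lemma Compress_dual:
  assumes "X \<in> carr CC" shows "Compress k (dual_automorphism \<alpha> X) = Compress (k + 1) X"
proof -
  obtain f where f: "f \<in> cauchy_seqs (with_universal_norm D)" "X = U.cls f"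
    using assms by (auto simp: U.carr_completion)
  have fc: "f n \<in> carr D" for n using U.cauchy_carr[OF f(1), of n] by simp
  have "(\<lambda>n. dual (f n)) \<in> cauchy_seqs (with_universal_norm D)"
    by (rule U.cauchy_map[OF _ _ f(1)]) (use dual_carr dual_dist in auto)
  from Compress_props(5)[OF this, of k]
  have "(\<lambda>n. compress k (dual (f n))) \<longlonglongrightarrow> Compress k (dual_automorphism \<alpha> X)"
    unfolding f(2) dual_automorphism_props(4)[OF f(1)] .
  moreover have "(\<lambda>n. compress k (dual (f n))) \<longlonglongrightarrow> Compress (k + 1) X"
    unfolding f(2) using Compress_props(5)[OF f(1), of "k + 1"] by (simp add: compress_dual[OF fc])
  ultimately show ?thesis by (rule LIMSEQ_unique)
qed

text \<open>Both sides are contractive in X and agree on the dense image of the convolution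
  algebra.\<close>

lemma EE_Compress:
  assumes X: "X \<in> carr CC"
  shows "EE 1 (k - 1) \<odot> (X \<odot> EE 1 k) = EE (Compress k X) k"
proof -
  have n1: "nrm CC (EE 1 l) \<le> 1" for l using nrm_EE[OF one_spectral] norm_one_le by simp
  let ?L = "\<lambda>X. EE 1 (k - 1) \<odot> (X \<odot> EE 1 k)"
  have Lc: "?L X \<in> carr CC" if "X \<in> carr CC" for X by (intro CC.mul_closed EE_carr that)
  have "nrm CC (?L X \<ominus> EE (Compress k X) k) \<le> 0"
  proof (rule field_le_epsilon)
    fix e :: real assume "0 < e"
    then obtain x where "x \<in> carr (with_universal_norm D)" and d: "nrm CC (X \<ominus> U.const_cls x) < e / 2"
      using U.const_cls_dense[OF X, of "e / 2"] by auto
    then have x: "x \<in> carr D" by simp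
    have xc: "U.const_cls x \<in> carr CC" by (rule const_carr[OF x])
    have "nrm CC (?L X \<ominus> ?L (U.const_cls x)) \<le> nrm CC (EE 1 (k - 1)) * nrm CC (X \<odot> EE 1 k \<ominus> U.const_cls x \<odot> EE 1 k)"
      by (intro CC.dist_mul_left CC.mul_closed EE_carr X xc)
    also have "\<dots> \<le> 1 * (nrm CC (X \<ominus> U.const_cls x) * nrm CC (EE 1 k))"
      by (intro mult_mono n1 CC.dist_mul_right CC.nrm_nonneg CC.minus_closed CC.mul_closed EE_carr X xc) simp
    also have "\<dots> \<le> 1 * (nrm CC (X \<ominus> U.const_cls x) * 1)"
      by (intro mult_left_mono n1 CC.nrm_nonneg CC.minus_closed X xc) simp
    finally have 1: "nrm CC (?L X \<ominus> ?L (U.const_cls x)) \<le> e / 2" using d by simp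
    have "nrm CC (?L (U.const_cls x) \<ominus> EE (Compress k X) k) = norm (Compress k (U.const_cls x) - Compress k X)"
      unfolding EE_compress[OF x] EE_minus Compress_props(3)[OF x]
      by (rule nrm_EE[OF spectral_diff[OF compress_spectral Compress_spectral[OF X]]])
    also have "\<dots> = norm (Compress k (X \<ominus> U.const_cls x))"
      by (simp add: Compress_props(2)[OF X xc] norm_minus_commute)
    also have "\<dots> \<le> e / 2" using Compress_props(1)[OF CC.minus_closed[OF X xc], of k] d by simp
    finally have 2: "nrm CC (?L (U.const_cls x) \<ominus> EE (Compress k X) k) \<le> e / 2" .
    show "nrm CC (?L X \<ominus> EE (Compress k X) k) \<le> 0 + e"
      using 1 2 CC.dist_triangle[OF Lc[OF X] Lc[OF xc] EE_carr, of "Compress k X" k] by simp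
  qed
  then have "nrm CC (?L X \<ominus> EE (Compress k X) k) = 0"
    using CC.nrm_nonneg[OF CC.minus_closed[OF Lc[OF X] EE_carr], of "Compress k X" k] by (rule antisym)
  then show ?thesis by (rule CC.separated[OF Lc[OF X] EE_carr])
qed

section \<open>Density of the spectral subspaces\<close>

text \<open>The trigonometric polynomials \<open>h\<close> for which all \<open>\<integral> \<omega>\<^sup>m h(\<omega>) \<alpha>\<^sub>\<omega>(a) d\<omega>\<close> lie in \<open>G\<close> are stable under
  multiplication by \<open>\<omega>\<close> and its inverse, hence by \<open>Re \<omega>\<close> and \<open>Im \<omega>\<close>; so Stone-Weierstrass applies.\<close>

lemma spectral_dense:
  assumes G: "\<And>m. spectral m \<subseteq> G" and add: "\<And>a b. a \<in> G \<Longrightarrow> b \<in> G \<Longrightarrow> a + b \<in> G"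
    and scal: "\<And>c a. a \<in> G \<Longrightarrow> scaleC c a \<in> G" and closed: "closed G"
  shows "a \<in> G"
proof -
  define J where "J m h = circle_integral (\<lambda>\<omega>. scaleC (\<omega> powi m * h \<omega>) (\<alpha> \<omega> a))" for m h
  define T where "T = {h. continuous_on \<TT> h \<and> (\<forall>m. J m h \<in> G)}"
  have int: "continuous_on \<TT> (\<lambda>\<omega>. scaleC (\<omega> powi m * h \<omega>) (\<alpha> \<omega> a))" if "continuous_on \<TT> h" for m h
    by (intro continuous_intros continuous_on_powi that) auto
  have T_cong: "h' \<in> T" if "h \<in> T" "\<And>\<omega>. \<omega> \<in> \<TT> \<Longrightarrow> h' \<omega> = h \<omega>" for h h'
  proof -
    have "J m h' = J m h" for m unfolding J_def by (rule circle_integral_cong) (simp only: that(2))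
    then show ?thesis using that continuous_on_cong[of \<TT> \<TT> h' h] by (auto simp: T_def)
  qed
  have T_add: "(\<lambda>\<omega>. h \<omega> + g \<omega>) \<in> T" if "h \<in> T" "g \<in> T" for h g
  proof -
    have c: "continuous_on \<TT> h" "continuous_on \<TT> g" using that by (auto simp: T_def)
    have "J m (\<lambda>\<omega>. h \<omega> + g \<omega>) = J m h + J m g" for m
      unfolding J_def using circle_integral_add[OF int[OF c(1)] int[OF c(2)]]
      by (simp add: distrib_left scaleC_add_left)
    then show ?thesis using that add by (auto simp: T_def intro!: continuous_intros)
  qed
  have T_scal: "(\<lambda>\<omega>. c * h \<omega>) \<in> T" if "h \<in> T" for c h
  proof -
    have ch: "continuous_on \<TT> h" using that by (auto simp: T_def)
    have "J m (\<lambda>\<omega>. c * h \<omega>) = scaleC c (J m h)" for m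
      unfolding J_def circle_integral_linear[OF int[OF ch] bounded_linear_scaleC, symmetric]
      by (simp add: scaleC_scaleC mult_ac)
    then show ?thesis using that scal by (auto simp: T_def intro!: continuous_intros)
  qed
  have T_powi: "(\<lambda>\<omega>. \<omega> powi n * h \<omega>) \<in> T" if "h \<in> T" for n h
  proof -
    have "J m (\<lambda>\<omega>. \<omega> powi n * h \<omega>) = J (m + n) h" for m
      unfolding J_def by (rule circle_integral_cong) (simp only: powi_cancel[symmetric] mult.assoc)
    then show ?thesis using that by (auto simp: T_def intro!: continuous_on_mult continuous_on_powi)
  qed
  have T_poly: "\<forall>h\<in>T. (\<lambda>\<omega>. complex_of_real (g \<omega>) * h \<omega>) \<in> T"
    if "real_polynomial_function g" for g :: "complex \<Rightarrow> real"
    using that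
  proof induction
    case (linear f)
    show ?case
    proof
      fix h assume h: "h \<in> T"
      \<comment> \<open>A real-linear f satisfies f \<omega> = Re \<omega> * f 1 + Im \<omega> * f
        \<i>, which is twice the real part of c \<omega> for this c; on the circle the conjugate of
        \<omega> is its inverse.\<close>
      let ?c = "(complex_of_real (f 1) - \<i> * complex_of_real (f \<i>)) / 2"
      have "(\<lambda>\<omega>. ?c * (\<omega> powi 1 * h \<omega>) + cnj ?c * (\<omega> powi (- 1) * h \<omega>)) \<in> T"
        by (intro T_add T_scal T_powi h)
      then show "(\<lambda>\<omega>. complex_of_real (f \<omega>) * h \<omega>) \<in> T"
      proof (rule T_cong)
        fix \<omega> assume \<omega>: "\<omega> \<in> \<TT>"
        have "\<omega> = Re \<omega> *\<^sub>R 1 + Im \<omega> *\<^sub>R \<i>" by (simp add: complex_eq_iff)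
        then have "f \<omega> = f (Re \<omega> *\<^sub>R 1 + Im \<omega> *\<^sub>R \<i>)" by (rule arg_cong)
        also have "\<dots> = Re \<omega> * f 1 + Im \<omega> * f \<i>"
          using linear by (simp add: linear_add linear_scale bounded_linear.linear)
        finally have "complex_of_real (f \<omega>) = ?c * \<omega> + cnj ?c * cnj \<omega>"
          by (simp add: complex_eq_iff field_simps)
        then show "complex_of_real (f \<omega>) * h \<omega> = ?c * (\<omega> powi 1 * h \<omega>) + cnj ?c * (\<omega> powi (- 1) * h \<omega>)"
          by (simp add: cnj_circle[OF \<omega>] power_int_minus algebra_simps)
      qed
    qed
  next
    case (const c)
    then show ?case using T_scal by blast
  next
    case (add f g)
    then show ?case using T_add by (auto simp: distrib_right)
  next
    case (mult f g)
    then show ?case by (auto simp: mult.assoc)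
  qed
  have one: "(\<lambda>_. 1) \<in> T"
  proof -
    have "J m (\<lambda>_. 1) = fourier (- m) a" for m by (simp add: J_def fourier_def)
    moreover have "fourier (- m) a \<in> G" for m using G fourier_spectral by blast
    ultimately show ?thesis by (simp add: T_def)
  qed
  have "a \<in> closure G"
  proof (subst closure_approachable, intro allI impI)
    fix e :: real assume e: "0 < e"
    \<comment> \<open>The integrand is constant in the second variable, so the uniform statement is
      used at a single point.\<close>
    have "continuous_on (\<TT> \<times> \<TT>) (\<lambda>(\<omega>, \<zeta>). \<alpha> \<omega> a)"
      unfolding case_prod_beta' by (intro continuous_intros) auto
    from bump_average_uniform[OF this, of "e / 3"] e
    have "\<forall>\<^sub>F t in at_top. \<forall>\<zeta>\<in>\<TT>. norm (circle_integral (\<lambda>\<omega>. bump t \<omega> *\<^sub>R \<alpha> \<omega> a) - a) \<le> e / 3" by simp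
    then obtain t where t: "norm (circle_integral (\<lambda>\<omega>. bump t \<omega> *\<^sub>R \<alpha> \<omega> a) - a) \<le> e / 3"
      unfolding eventually_at_top_linorder using circle_one by blast
    \<comment> \<open>norm a + 1 instead of norm a, so that the divisor is positive also for a =
      0.\<close>
    have d: "0 < e / (3 * (norm a + 1))" using e by (simp add: add_nonneg_pos)
    obtain g where g: "real_polynomial_function g" "\<And>\<omega>. \<omega> \<in> \<TT> \<Longrightarrow> \<bar>bump t \<omega> - g \<omega>\<bar> < e / (3 * (norm a + 1))"
      using Stone_Weierstrass_real_polynomial_function[OF compact_circle continuous_on_bump[of \<TT> t] d] by blast
    define b where "b = J 0 (\<lambda>\<omega>. complex_of_real (g \<omega>))"
    have gT: "(\<lambda>\<omega>. complex_of_real (g \<omega>)) \<in> T" using T_poly[OF g(1)] one by fastforce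
    then have bG: "b \<in> G" by (simp add: T_def b_def)
    have b: "b = circle_integral (\<lambda>\<omega>. g \<omega> *\<^sub>R \<alpha> \<omega> a)" by (simp add: b_def J_def scaleR_scaleC)
    have gc: "continuous_on \<TT> g" using continuous_real_polymonial_function[OF g(1)] by (intro continuous_at_imp_continuous_on) simp
    have c: "continuous_on \<TT> (\<lambda>\<omega>. bump t \<omega> *\<^sub>R \<alpha> \<omega> a)" "continuous_on \<TT> (\<lambda>\<omega>. g \<omega> *\<^sub>R \<alpha> \<omega> a)"
      by (intro continuous_intros continuous_on_bump gc; simp)+
    have "norm (circle_integral (\<lambda>\<omega>. bump t \<omega> *\<^sub>R \<alpha> \<omega> a - g \<omega> *\<^sub>R \<alpha> \<omega> a)) \<le> e / 3"
    proof (rule circle_integral_bound)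
      fix \<omega> assume \<omega>: "\<omega> \<in> \<TT>"
      have "norm (bump t \<omega> *\<^sub>R \<alpha> \<omega> a - g \<omega> *\<^sub>R \<alpha> \<omega> a) = \<bar>bump t \<omega> - g \<omega>\<bar> * norm a"
        by (simp add: action_hom(6)[OF \<omega>] flip: scaleR_diff_left)
      also have "\<dots> \<le> e / (3 * (norm a + 1)) * (norm a + 1)"
        using g(2)[OF \<omega>] by (intro mult_mono) auto
      also have "\<dots> = e / 3"
      proof -
        have "e / (3 * c) * c = e / 3" if "c \<noteq> 0" for c :: real using that by simp
        moreover have "norm a + 1 \<noteq> 0" using norm_ge_zero[of a] by linarith
        ultimately show ?thesis by blast
      qed
      finally show "norm (bump t \<omega> *\<^sub>R \<alpha> \<omega> a - g \<omega> *\<^sub>R \<alpha> \<omega> a) \<le> e / 3" .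
    qed (intro continuous_on_diff c)
    then have "norm (circle_integral (\<lambda>\<omega>. bump t \<omega> *\<^sub>R \<alpha> \<omega> a) - b) \<le> e / 3"
      unfolding b circle_integral_diff[OF c] .
    then have "dist b a < e"
      using t e norm_triangle_ineq4[of "circle_integral (\<lambda>\<omega>. bump t \<omega> *\<^sub>R \<alpha> \<omega> a) - a" "circle_integral (\<lambda>\<omega>. bump t \<omega> *\<^sub>R \<alpha> \<omega> a) - b"]
      by (simp add: dist_norm)
    then show "\<exists>y\<in>G. dist y a < e" using bG by blast
  qed
  then show ?thesis using closed by simp
qed

text \<open>\<open>star x * x\<close> has degree 0, hence is fixed by the action together with its
  inverse root; so the polar part transforms like x.\<close>

lemma polar_spectral:
  assumes x: "x \<in> spectral m" and n: "norm (1 - star x * x) \<le> 1/2"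
  shows "polar x \<in> spectral m"
  unfolding spectral_def
proof (intro CollectI ballI)
  fix \<zeta> assume \<zeta>: "\<zeta> \<in> \<TT>"
  interpret star_aut "\<alpha> \<zeta>" by (rule star_aut_action[OF \<zeta>])
  have "\<alpha> \<zeta> (star x * x) = star x * x"
    using spectral_mult[OF spectral_star[OF x] x] \<zeta> by (simp add: spectral_def)
  moreover have "\<alpha> \<zeta> x = scaleC (\<zeta> powi m) x" using x \<zeta> by (simp add: spectral_def)
  ultimately show "\<alpha> \<zeta> (polar x) = scaleC (\<zeta> powi m) (polar x)"
    unfolding polar_def by (simp only: mult[of x] inv_sqrt[OF n] mult_scaleC_left)
qed

section \<open>From the crossed product by the circle to A\<close>

theorem rokhlin_if_asymptotically_representable_dual:
  assumes "asymptotically_representable (crossed_product_circle \<alpha>) (dual_automorphism \<alpha>)"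
  shows "continuous_rokhlin_property (cstar_univ :: 'a star_alg) \<alpha>"
proof -
  obtain v where v: "norm_continuous_path CC v" "\<And>t. 0 \<le> t \<Longrightarrow> nrm CC (v t) \<le> 1"
    and v1: "\<And>b. b \<in> carr CC \<Longrightarrow> ((\<lambda>t. nrm CC (adj CC (v t) \<odot> v t \<odot> b \<ominus> b)) \<longlongrightarrow> 0) at_top"
    and v3: "((\<lambda>t. nrm CC (dual_automorphism \<alpha> (v t) \<ominus> v t)) \<longlongrightarrow> 0) at_top"
    and v4: "\<And>b. b \<in> carr CC \<Longrightarrow> ((\<lambda>t. nrm CC (dual_automorphism \<alpha> b \<ominus> v t \<odot> b \<odot> adj CC (v t))) \<longlongrightarrow> 0) at_top"
    using assms unfolding asymptotically_representable_def crossed_product_circle_eq by blast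
  have vc: "v t \<in> carr CC" if "0 \<le> t" for t using v(1) that by (simp add: norm_continuous_path_def)
  have bv: "CC.bounded_path v" by (rule CC.bounded_pathI[of _ 1]) (auto intro: vc v(2))
  note bc = CC.bounded_path_const[OF EE_carr]
  note b_intros = CC.bounded_path_mul CC.bounded_path_adj bv bc
  have av1: "CC.asymptotic (\<lambda>t. adj CC (v t) \<odot> v t \<odot> b) (\<lambda>t. b)" if "b \<in> carr CC" for b
    unfolding CC.asymptotic_def using v1[OF that] vc that by auto
  \<comment> \<open>The condition is given with b on the right; its adjoint form has b on the
    left.\<close>
  have av1': "CC.asymptotic (\<lambda>t. b \<odot> (adj CC (v t) \<odot> v t)) (\<lambda>t. b)" if b: "b \<in> carr CC" for b
    by (rule CC.asymptotic_cong[OF CC.asymptotic_adj[OF av1[OF CC.adj_closed[OF b]]]])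
      (use vc b in \<open>auto simp: CC.adj_mul_eq CC.mul_assoc_eq\<close>)
  have av4: "CC.asymptotic (\<lambda>t. EE a (k - 1)) (\<lambda>t. v t \<odot> EE a k \<odot> adj CC (v t))" for a k
    unfolding CC.asymptotic_def using v4[OF EE_carr[of a k]] vc EE_carr by (auto simp: dual_EE)
  \<comment> \<open>Multiplying the relation \<open>dual_automorphism \<alpha> b\<close> \<approx> v
    b \<open>adj CC v\<close> by v on the right turns it into an intertwining relation, since
    \<open>adj CC v \<odot> v\<close> acts asymptotically as the identity on b.\<close>
  have vE: "CC.asymptotic (\<lambda>t. EE a (k - 1) \<odot> v t) (\<lambda>t. v t \<odot> EE a k)" for a k
  proof -
    have "CC.asymptotic (\<lambda>t. EE a (k - 1) \<odot> v t) (\<lambda>t. v t \<odot> EE a k \<odot> adj CC (v t) \<odot> v t)"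
      by (intro CC.asymptotic_mul_right av4 bv)
    also have "CC.asymptotic (\<lambda>t. v t \<odot> EE a k \<odot> adj CC (v t) \<odot> v t) (\<lambda>t. v t \<odot> EE a k)"
      by (rule CC.asymptotic_cong[OF CC.asymptotic_mul_left[OF av1'[OF EE_carr] bv]])
        (use vc EE_carr in \<open>auto simp: CC.mul_assoc_eq\<close>)
    finally show ?thesis .
  qed
  have id_right: "EE a k \<odot> EE 1 k = EE a k" for a k
    by (simp add: EE_mul fourier_eq[OF one_spectral])
  define x where "x t = Compress 0 (v t)" for t
  have xs: "x t \<in> spectral (- 1)" if "0 \<le> t" for t unfolding x_def by (rule Compress_spectral[OF vc[OF that]])
  have nx: "norm (x t) \<le> 1" if "0 \<le> t" for t
    unfolding x_def using Compress_props(1)[OF vc[OF that], of 0] v(2)[OF that] by simp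
  \<comment> \<open>The compression at k + 1 is the compression at k of the dual image
    (\<open>Compress_dual\<close>), and \<open>v t\<close> is almost fixed by the dual
    automorphism.\<close>
  have shift: "((\<lambda>t. Compress (k + 1) (v t) - Compress k (v t)) \<longlongrightarrow> 0) at_top" for k
  proof (rule Lim_null_comparison[OF CC.eventually_at_top_nonneg v3])
    fix t :: real assume t: "0 \<le> t"
    show "norm (Compress (k + 1) (v t) - Compress k (v t)) \<le> nrm CC (dual_automorphism \<alpha> (v t) \<ominus> v t)"
      using Compress_props(1)[OF CC.minus_closed[OF dual_automorphism_props(2)[OF vc[OF t]] vc[OF t]], of k]
      by (simp add: Compress_props(2)[OF dual_automorphism_props(2)[OF vc[OF t]] vc[OF t]] Compress_dual[OF vc[OF t]])
  qed
  have Cx: "((\<lambda>t. Compress k (v t) - x t) \<longlongrightarrow> 0) at_top" for k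
  proof (induction k rule: int_induct[of _ 0])
    case base
    show ?case by (simp add: x_def)
  next
    case (step1 i)
    show ?case using tendsto_add[OF shift[of i] step1(2)] by simp
  next
    case (step2 i)
    show ?case using tendsto_diff[OF step2(2) shift[of "i - 1"]] by simp
  qed
  have EEx: "CC.asymptotic (\<lambda>t. v t \<odot> EE 1 k) (\<lambda>t. EE (x t) k)" for k
  proof -
    have "CC.asymptotic (\<lambda>t. v t \<odot> EE 1 k) (\<lambda>t. EE 1 (k - 1) \<odot> (v t \<odot> EE 1 k))"
      by (rule CC.asymptotic_cong[OF CC.asymptotic_sym[OF CC.asymptotic_mul_right[OF vE bc]], of 1 k 1 k])
        (use vc EE_carr in \<open>auto simp: CC.mul_assoc_eq id_right\<close>)
    also have "CC.asymptotic (\<lambda>t. EE 1 (k - 1) \<odot> (v t \<odot> EE 1 k)) (\<lambda>t. EE (x t) k)"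
    proof (rule CC.asymptoticI[OF _ EE_carr _ tendsto_norm_zero[OF Cx[of k]]])
      fix t :: real assume t: "0 \<le> t"
      show "EE 1 (k - 1) \<odot> (v t \<odot> EE 1 k) \<in> carr CC" by (intro CC.mul_closed EE_carr vc t)
      show "nrm CC (EE 1 (k - 1) \<odot> (v t \<odot> EE 1 k) \<ominus> EE (x t) k) \<le> norm (Compress k (v t) - x t)"
        unfolding EE_Compress[OF vc[OF t]] EE_minus
          nrm_EE[OF spectral_diff[OF Compress_spectral[OF vc[OF t]] xs[OF t]]] ..
    qed
    finally show ?thesis .
  qed
  have bEx: "CC.bounded_path (\<lambda>t. EE (x t) k)" for k
    by (rule CC.bounded_pathI[of _ 1]) (auto intro: EE_carr simp: nrm_EE[OF xs] nx)
  have bvE: "CC.bounded_path (\<lambda>t. v t \<odot> EE a k)" for a k by (intro b_intros)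
  \<comment> \<open>On a spectral subspace \<open>EE\<close> is isometric; homogeneity of f - g is
    what lets limits descend to A.\<close>
  have lim: "((\<lambda>t. f t - g t) \<longlongrightarrow> 0) at_top"
    if "CC.asymptotic (\<lambda>t. EE (f t) k) (\<lambda>t. EE (g t) k)" "\<And>t. 0 \<le> t \<Longrightarrow> f t - g t \<in> spectral m" for f g k m
  proof (rule tendsto_norm_zero_cancel, rule Lim_transform_eventually[OF CC.asymptotic_tendsto[OF that(1)]])
    show "\<forall>\<^sub>F t in at_top. nrm CC (EE (f t) k \<ominus> EE (g t) k) = norm (f t - g t)"
      by (rule CC.eventually_at_top_nonneg) (simp add: EE_minus nrm_EE[OF that(2)])
  qed
  have xx: "((\<lambda>t. star (x t) * x t - 1) \<longlongrightarrow> 0) at_top"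
  proof (rule lim)
    have "CC.asymptotic (\<lambda>t. adj CC (EE (x t) 0) \<odot> EE (x t) 0) (\<lambda>t. adj CC (v t \<odot> EE 1 0) \<odot> (v t \<odot> EE 1 0))"
      by (intro CC.asymptotic_mul CC.asymptotic_adj CC.asymptotic_sym[OF EEx] CC.bounded_path_adj bEx bvE)
    also have "CC.asymptotic (\<lambda>t. adj CC (v t \<odot> EE 1 0) \<odot> (v t \<odot> EE 1 0)) (\<lambda>t. EE 1 0)"
      by (rule CC.asymptotic_cong[OF CC.asymptotic_mul_left[OF av1[OF EE_carr] bc], of 1 0 1 0])
        (use vc EE_carr in \<open>auto simp: CC.mul_assoc_eq CC.adj_mul_eq EE_adj[OF one_spectral] id_right\<close>)
    finally show "CC.asymptotic (\<lambda>t. EE (star (x t) * x t) 0) (\<lambda>t. EE 1 0)"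
      by (rule CC.asymptotic_cong) (simp_all add: EE_adj[OF xs] EE_mul fourier_eq[OF xs])
    fix t :: real assume "0 \<le> t"
    from xs[OF this] show "star (x t) * x t - 1 \<in> spectral 0"
      using spectral_mult[OF spectral_star] by (intro spectral_diff one_spectral) fastforce
  qed
  have xx': "((\<lambda>t. x t * star (x t) - 1) \<longlongrightarrow> 0) at_top"
  proof (rule lim)
    have "CC.asymptotic (\<lambda>t. EE (x t) 0 \<odot> adj CC (EE (x t) 0)) (\<lambda>t. (v t \<odot> EE 1 0) \<odot> adj CC (v t \<odot> EE 1 0))"
      by (intro CC.asymptotic_mul CC.asymptotic_adj CC.asymptotic_sym[OF EEx] CC.bounded_path_adj bEx bvE)
    \<comment> \<open>The range of x p_0 lies under p_(-1), matching the image p_(-1) of p_0 under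
      the dual automorphism.\<close>
    also have "CC.asymptotic (\<lambda>t. (v t \<odot> EE 1 0) \<odot> adj CC (v t \<odot> EE 1 0)) (\<lambda>t. EE 1 (- 1))"
    proof (rule CC.asymptotic_cong[OF CC.asymptotic_sym[OF av4[of 1 0]]])
      fix t :: real assume t: "0 \<le> t"
      have "(v t \<odot> EE 1 0) \<odot> adj CC (v t \<odot> EE 1 0)
          = v t \<odot> (EE 1 0 \<odot> EE 1 0) \<odot> adj CC (v t)"
        using vc[OF t] EE_carr by (simp add: CC.mul_assoc_eq CC.adj_mul_eq EE_adj[OF one_spectral])
      then show "v t \<odot> EE 1 0 \<odot> adj CC (v t) = (v t \<odot> EE 1 0) \<odot> adj CC (v t \<odot> EE 1 0)"
        unfolding id_right by simp
    qed simp
    finally show "CC.asymptotic (\<lambda>t. EE (x t * star (x t)) (- 1)) (\<lambda>t. EE 1 (- 1))"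
      by (rule CC.asymptotic_cong)
        (use fourier_eq[OF spectral_star[OF xs]] in \<open>simp_all add: EE_adj[OF xs] EE_mul\<close>)
    fix t :: real assume "0 \<le> t"
    from xs[OF this] show "x t * star (x t) - 1 \<in> spectral 0"
      using spectral_mult[OF _ spectral_star] by (intro spectral_diff one_spectral) fastforce
  qed
  \<comment> \<open>a x p_0 is close to a p_(-1) v p_0, hence to v a p_0 = v p_m a p_0, hence to x
    p_m a p_0 = x a p_0. The last approximation uses the same x at k = m as at k = 0.\<close>
  have comm_spectral: "((\<lambda>t. a * x t - x t * a) \<longlongrightarrow> 0) at_top" if a: "a \<in> spectral m" for a m
  proof (rule lim)
    have "CC.asymptotic (\<lambda>t. EE a (- 1) \<odot> EE (x t) 0) (\<lambda>t. EE a (- 1) \<odot> (v t \<odot> EE 1 0))"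
      by (intro CC.asymptotic_mul_left CC.asymptotic_sym[OF EEx] bc)
    also have "CC.asymptotic (\<lambda>t. EE a (- 1) \<odot> (v t \<odot> EE 1 0)) (\<lambda>t. v t \<odot> EE a 0)"
      by (rule CC.asymptotic_cong[OF CC.asymptotic_mul_right[OF vE bc], of a 0 1 0])
        (use vc EE_carr in \<open>auto simp: CC.mul_assoc_eq id_right\<close>)
    also have "CC.asymptotic (\<lambda>t. v t \<odot> EE a 0) (\<lambda>t. EE (x t) m \<odot> EE a 0)"
    proof (rule CC.asymptotic_cong[OF CC.asymptotic_mul_right[OF EEx bc]])
      fix t :: real assume t: "0 \<le> t"
      have "EE 1 m \<odot> EE a 0 = EE a 0" using fourier_eq[OF a] by (simp add: EE_mul)
      then show "v t \<odot> EE 1 m \<odot> EE a 0 = v t \<odot> EE a 0"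
        using CC.mul_assoc_eq[OF vc[OF t] EE_carr EE_carr, of 1 m a 0] by simp
    qed simp
    finally show "CC.asymptotic (\<lambda>t. EE (a * x t) 0) (\<lambda>t. EE (x t * a) 0)"
      by (rule CC.asymptotic_cong) (use fourier_eq[OF a] in \<open>simp_all add: EE_mul fourier_eq[OF xs]\<close>)
    fix t :: real assume t: "0 \<le> t"
    show "a * x t - x t * a \<in> spectral (m + - 1)"
      using spectral_mult[OF a xs[OF t]] spectral_mult[OF xs[OF t] a]
      by (intro spectral_diff) (simp_all add: add.commute)
  qed
  define G where "G = {a. ((\<lambda>t. a * x t - x t * a) \<longlongrightarrow> 0) at_top}"
  have comm_x: "((\<lambda>t. a * x t - x t * a) \<longlongrightarrow> 0) at_top" for a
  proof -
    have "a \<in> G"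
    proof (rule spectral_dense)
      show "spectral m \<subseteq> G" for m using comm_spectral by (auto simp: G_def)
      show "a + b \<in> G" if "a \<in> G" "b \<in> G" for a b
        using tendsto_add[of "\<lambda>t. a * x t - x t * a" 0 at_top "\<lambda>t. b * x t - x t * b" 0] that
        by (simp add: G_def algebra_simps)
      show "scaleC c a \<in> G" if "a \<in> G" for c a
        using bounded_linear.tendsto_zero[OF bounded_linear_scaleC[of c], of "\<lambda>t. a * x t - x t * a" at_top] that
        by (simp add: G_def mult_scaleC_left mult_scaleC_right scaleC_diff_right)
      show "closed G"
        unfolding closed_sequential_limits
      proof (intro allI impI)
        fix f l assume fl: "(\<forall>n. f n \<in> G) \<and> f \<longlonglongrightarrow> l"
        have "((\<lambda>t. l * x t - x t * l) \<longlongrightarrow> 0) at_top"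
        proof (rule tendstoI)
          fix e :: real assume e: "0 < e"
          have "\<forall>\<^sub>F n in sequentially. dist (f n) l < e / 4" using fl e by (intro tendstoD) auto
          then obtain n where n: "dist (f n) l < e / 4" by (auto simp: eventually_sequentially)
          have "\<forall>\<^sub>F t in at_top. dist (f n * x t - x t * f n) 0 < e / 2"
            using fl e by (intro tendstoD) (auto simp: G_def)
          with eventually_ge_at_top[of "0::real"]
          show "\<forall>\<^sub>F t in at_top. dist (l * x t - x t * l) 0 < e"
          proof eventually_elim
            case (elim t)
            have 1: "norm ((l - f n) * x t) \<le> e / 4 * 1" "norm (x t * (l - f n)) \<le> 1 * (e / 4)"
              using n nx[OF elim(1)] e
              by (intro order_trans[OF norm_mult_ineq] mult_mono; simp add: dist_norm norm_minus_commute)+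
            have "l * x t - x t * l = (f n * x t - x t * f n) + ((l - f n) * x t - x t * (l - f n))"
              by (simp add: algebra_simps)
            also have "norm \<dots> \<le> norm (f n * x t - x t * f n) + (norm ((l - f n) * x t) + norm (x t * (l - f n)))"
              by (intro norm_triangle_mono order_refl norm_triangle_ineq4)
            also have "\<dots> < e" using 1 elim(2) by (simp add: dist_norm)
            finally show ?case by (simp add: dist_norm)
          qed
        qed
        then show "l \<in> G" by (simp add: G_def)
      qed
    qed
    then show ?thesis by (simp add: G_def)
  qed
  have xc: "continuous_on {0..} x" unfolding x_def[abs_def] by (rule Compress_props(4)[OF v(1)])
  obtain s where s: "0 \<le> s" "continuous_on {0..} (\<lambda>t. polar (x (t + s)))"
    "\<And>t. 0 \<le> t \<Longrightarrow> norm (1 - star (x (t + s)) * x (t + s)) \<le> 1/2"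
    "\<And>t. 0 \<le> t \<Longrightarrow> star (polar (x (t + s))) * polar (x (t + s)) = 1"
    "\<And>t. 0 \<le> t \<Longrightarrow> polar (x (t + s)) * star (polar (x (t + s))) = 1"
    "((\<lambda>t. polar (x (t + s)) - x (t + s)) \<longlongrightarrow> 0) at_top"
    by (rule unitary_path_near[OF xc LIM_zero_cancel[OF xx] LIM_zero_cancel[OF xx']]) blast
  define w where "w t = polar (x (t + s))" for t
  have ws: "w t \<in> spectral (- 1)" if "0 \<le> t" for t
    unfolding w_def using that s(1) by (intro polar_spectral xs s(3)) auto
  have filt: "filterlim (\<lambda>t. t + s) at_top at_top"
    using filterlim_tendsto_add_at_top[OF tendsto_const filterlim_ident, of s] by (simp add: add.commute)
  have comm_w: "((\<lambda>t. a * w t - w t * a) \<longlongrightarrow> 0) at_top" for a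
  proof -
    have "((\<lambda>t. a * x (t + s) - x (t + s) * a) \<longlongrightarrow> 0) at_top"
      by (rule filterlim_compose[OF comm_x filt])
    moreover have "((\<lambda>t. a * (w t - x (t + s)) - (w t - x (t + s)) * a) \<longlongrightarrow> 0 - 0) at_top"
      using s(6) unfolding w_def[symmetric]
      by (intro tendsto_diff tendsto_mult_left_zero tendsto_mult_right_zero)
    ultimately have "((\<lambda>t. (a * x (t + s) - x (t + s) * a) + (a * (w t - x (t + s)) - (w t - x (t + s)) * a)) \<longlongrightarrow> 0 + (0 - 0)) at_top"
      by (rule tendsto_add)
    then show ?thesis by (simp add: algebra_simps)
  qed
  show ?thesis
    unfolding continuous_rokhlin_property_cstar_univ
  \<comment> \<open>\<open>w t\<close> has degree -1, so its adjoint has the degree 1 demanded of a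
    Rokhlin path.\<close>
  proof (intro exI[of _ "\<lambda>t. star (w t)"] conjI allI impI)
    show "continuous_on {0..} (\<lambda>t. star (w t))"
      unfolding w_def by (intro continuous_on_star s(2))
    show "star (star (w t)) * star (w t) = 1" "star (w t) * star (star (w t)) = 1" if "0 \<le> t" for t
      using s(4,5)[OF that] by (simp_all add: w_def star_star)
    \<comment> \<open>The polar part is exactly homogeneous, so the defect is 0 for every t \<ge> 0
      and not only in the limit.\<close>
    have "norm (\<alpha> \<zeta> (star (w t)) - scaleC \<zeta> (star (w t))) = 0" if "0 \<le> t" "\<zeta> \<in> \<TT>" for t \<zeta>
      using spectral_star[OF ws[OF that(1)]] that(2) by (simp add: spectral_def)
    then have "(SUP \<zeta>\<in>\<TT>. norm (\<alpha> \<zeta> (star (w t)) - scaleC \<zeta> (star (w t)))) = (SUP \<zeta>\<in>\<TT>. 0)" if "0 \<le> t" for t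
      using that by (intro SUP_cong) auto
    then have "(SUP \<zeta>\<in>\<TT>. norm (\<alpha> \<zeta> (star (w t)) - scaleC \<zeta> (star (w t)))) = 0" if "0 \<le> t" for t
      using that by simp
    then show "((\<lambda>t. SUP \<zeta>\<in>\<TT>. norm (\<alpha> \<zeta> (star (w t)) - scaleC \<zeta> (star (w t)))) \<longlongrightarrow> 0) at_top"
      by (intro Lim_transform_eventually[OF tendsto_const] CC.eventually_at_top_nonneg) simp
    show "((\<lambda>t. star (w t) * a - a * star (w t)) \<longlongrightarrow> 0) at_top" for a
      using bounded_linear.tendsto_zero[OF bounded_linear_star comm_w[of "star a"]]
      by (simp add: star_diff star_mult star_star)
  qed
qed

end

theorem theorem2p6:
  fixes \<alpha> :: "complex \<Rightarrow> 'a::unital_cstar_algebra \<Rightarrow> 'a"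
    and \<beta> :: "'a \<Rightarrow> 'a"
  assumes "circle_action (cstar_univ :: 'a star_alg) \<alpha>"
    and "star_automorphism (cstar_univ :: 'a star_alg) \<beta>"
  shows "(continuous_rokhlin_property (cstar_univ :: 'a star_alg) \<alpha> \<longleftrightarrow>
            asymptotically_representable (crossed_product_circle \<alpha>) (dual_automorphism \<alpha>)) \<and>
         (asymptotically_representable (cstar_univ :: 'a star_alg) \<beta> \<longleftrightarrow>
            continuous_rokhlin_property (crossed_product_int \<beta>) (dual_action \<beta>))"
proof -
  interpret c: circle_system \<alpha> by standard (rule assms(1))
  interpret z: int_system \<beta> by standard (simp add: star_auto_def assms(2))
  show ?thesis
    using c.asymptotically_representable_dual_if_rokhlin c.rokhlin_if_asymptotically_representable_dual
      z.asymptotically_representable_if_dual_rokhlin z.dual_rokhlin_if_asymptotically_representable by blast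
qed

end
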